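(* Let $T\in\mathbb R_+$ and let $G_t(x)$ be a real-valued function and $H_t(x)=(H^k_t(x),k=1,2,\dots)$ be an $\ell_2$-valued function, both defined on $\Omega\times(0,T]\times\Gamma$ and possessing the following properties: (i) $G_t(x)$ and $H_t(x)$ are $\mathcal P_T\otimes\mathcal B(\Gamma)$-measurable, where $\mathcal P_T$ is the restriction of $\mathcal P$ to $\Omega\times(0,T]$; (ii) there is an event $\Omega'$ of full probability such that for each $\omega\in\Omega'$ and $x\in\Gamma$ $$\int_0^T\big(|G_t(x)|+|H_t(x)|^2_{\ell_2}\big)\,dt<\infty;$$ (iii) almost surely $$\int_0^T\int_\Gamma|G_t(x)|\,dx\,dt+\int_\Gamma\Big(\int_0^T|H_t(x)|^2_{\ell_2}\,dt\Big)^{1/2}dx<\infty.$$ Then: (a) There is a function $F_t(x)$ on $\Omega\times[0,T]\times\Gamma$ which is $\mathcal F\otimes\mathcal B([0,T])\otimes\mathcal B(\Gamma)$-measurable, continuous in $t$, and such that for any $x\in\Gamma$ with probability one $$F_t(x)=\int_0^tG_s(x)\,ds+\sum_{k=1}^\infty\int_0^tH^k_s(x)\,dw^k_s\qquad( * )$$ for all $t\in[0,T]$, where the series converges uniformly on $[0,T]$ in probability. (b) For any $k=1,2,\dots$ the stochastic integrals $\int_0^t\int_\Gamma H^k_s(x)\,dx\,dw^k_s$ (no summation in $k$) are well defined for $t\in[0,T]$. (c) Suppose we are given a function $F_t(x)$ on $\Omega\times[0,T]\times\Gamma$ such that (iv) for each $t\in[0,T]$ the function $F_t(x)$ is measurable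 in $(\omega,x)$ with respect to the completion $\overline{\mathcal F\otimes\mathcal B(\Gamma)}$ of $\mathcal F\otimes\mathcal B(\Gamma)$ with respect to the product measure; (v) for each $t\in[0,T]$ and $x\in\Gamma$ equation $( * )$ holds almost surely. Then for any countable subset $\rho$ of $[0,T]$ $$\int_\Gamma\sup_{t\in\rho}|F_t(x)|\,dx<\infty\quad\text{(a.s.)},$$ and for each $t\in[0,T]$ almost surely $$\int_\Gamma F_t(x)\,dx=\int_0^t\int_\Gamma G_s(x)\,dx\,ds+\sum_{k=1}^\infty\int_0^t\int_\Gamma H^k_s(x)\,dx\,dw^k_s,\qquad( ** )$$ where the series converges uniformly on $[0,T]$ in probability. (d) If for a function $F_t(x)$ satisfying (iv) and (v), for almost all $(\omega,x)$, $F_t(x)$ is continuous in $t$ on $[0,T]$, then with probability one $( ** )$ holds for all $t\in[0,T]$.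
   Context: $(\Omega,\mathcal F,P)$ is a complete probability space with an increasing filtration $\{\mathcal F_t,t\ge0\}$ of $\sigma$-fields $\mathcal F_t\subset\mathcal F$ complete with respect to $(\mathcal F,P)$; $\mathcal P$ is the predictable $\sigma$-field in $\Omega\times(0,\infty)$ associated with $\{\mathcal F_t\}$; $w^k_t$, $k=1,2,\dots$, are independent one-dimensional Wiener processes with respect to $\{\mathcal F_t\}$. $\mathbb R_+=[0,\infty)$. $\Gamma$ is a Borel subset of $\mathbb R^d$ with nonzero finite Lebesgue measure. $\mathcal B(E)$ denotes the Borel $\sigma$-field of $E$. The product measure on $\Omega\times\Gamma$ is $P$ times Lebesgue measure. *)

theory Defs
  imports "HOL-Probability.Probability"
begin

text \<open>
  Processes are written with the time first: \<open>X t \<omega>\<close>, \<open>G t \<omega> x\<close>, and \<open>w k t \<omega>\<close>, \<open>H k t \<omega> x\<close> for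
  sequences of them. Sequences with indices \<open>k = 1, 2, \<dots>\<close> are indexed by all of \<^typ>\<open>nat\<close>, starting
  from 0. A filtration is a family \<open>\<F>\<close> of measures indexed by \<^typ>\<open>real\<close>, of
  which only the \<open>\<sigma>\<close>-fields \<open>sets (\<F> t)\<close> with \<open>t \<ge> 0\<close> are ever used.
\<close>

section \<open>Filtrations, Wiener processes, predictability\<close>

definition complete_filtration :: "'a measure \<Rightarrow> (real \<Rightarrow> 'a measure) \<Rightarrow> bool" where
  "complete_filtration M \<F> \<longleftrightarrow>
     (\<forall>t\<ge>0. subalgebra M (\<F> t) \<and> null_sets M \<subseteq> sets (\<F> t)) \<and>
     (\<forall>s t. 0 \<le> s \<longrightarrow> s \<le> t \<longrightarrow> sets (\<F> s) \<subseteq> sets (\<F> t))"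

definition wiener_process ::
    "'a measure \<Rightarrow> (real \<Rightarrow> 'a measure) \<Rightarrow> (real \<Rightarrow> 'a \<Rightarrow> real) \<Rightarrow> bool" where
  "wiener_process M \<F> w \<longleftrightarrow>
     (\<forall>t\<ge>0. w t \<in> borel_measurable (\<F> t)) \<and>
     (AE \<omega> in M. w 0 \<omega> = 0) \<and>
     (AE \<omega> in M. continuous_on {0..} (\<lambda>t. w t \<omega>)) \<and>
     (\<forall>s t. 0 \<le> s \<longrightarrow> s < t \<longrightarrow>
        distributed M lborel (\<lambda>\<omega>. w t \<omega> - w s \<omega>) (normal_density 0 (sqrt (t - s))) \<and>
        prob_space.indep_set M (sets (\<F> s))
          {(\<lambda>\<omega>. w t \<omega> - w s \<omega>) -` B \<inter> space M | B. B \<in> sets borel})"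

text \<open>Mutual independence of the processes as random elements of the path space.\<close>

definition independent_processes :: "'a measure \<Rightarrow> (nat \<Rightarrow> real \<Rightarrow> 'a \<Rightarrow> real) \<Rightarrow> bool" where
  "independent_processes M w \<longleftrightarrow>
     prob_space.indep_vars M (\<lambda>_. \<Pi>\<^sub>M t\<in>{0..}. borel) (\<lambda>k \<omega>. \<lambda>t\<in>{0..}. w k t \<omega>) UNIV"

definition predictable :: "'a measure \<Rightarrow> (real \<Rightarrow> 'a measure) \<Rightarrow> ('a \<times> real) measure" where
  "predictable M \<F> = sigma (space M \<times> {0<..})
     {A \<times> {s<..t} | A s t. 0 \<le> s \<and> s \<le> t \<and> A \<in> sets (\<F> s)}"

definition predictable_upto ::
    "'a measure \<Rightarrow> (real \<Rightarrow> 'a measure) \<Rightarrow> real \<Rightarrow> ('a \<times> real) measure" where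
  "predictable_upto M \<F> T = restrict_space (predictable M \<F>) (space M \<times> {0<..T})"

section \<open>The sequence space \<open>\<ell>\<^sub>2\<close> and its Borel \<open>\<sigma>\<close>-field\<close>

definition ell2 :: "(nat \<Rightarrow> real) set" where
  "ell2 = {a. summable (\<lambda>k. (a k)\<^sup>2)}"

definition ell2_norm :: "(nat \<Rightarrow> real) \<Rightarrow> real" where
  "ell2_norm a = sqrt (\<Sum>k. (a k)\<^sup>2)"

definition ell2_open :: "(nat \<Rightarrow> real) set \<Rightarrow> bool" where
  "ell2_open U \<longleftrightarrow> U \<subseteq> ell2 \<and>
     (\<forall>a\<in>U. \<exists>e>0. \<forall>b\<in>ell2. ell2_norm (\<lambda>k. b k - a k) < e \<longrightarrow> b \<in> U)"

definition ell2_borel :: "(nat \<Rightarrow> real) measure" where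
  "ell2_borel = sigma ell2 {U. ell2_open U}"

section \<open>Convergence in probability, uniformly on \<open>[0, T]\<close>\<close>

text \<open>
  The measurability requirement is there because \<^const>\<open>measure\<close> gives non-measurable sets the value 0.
\<close>

definition tendsto_zero_in_prob :: "'a measure \<Rightarrow> (nat \<Rightarrow> 'a \<Rightarrow> ennreal) \<Rightarrow> bool" where
  "tendsto_zero_in_prob M Z \<longleftrightarrow>
     (\<forall>n. Z n \<in> borel_measurable M) \<and>
     (\<forall>\<epsilon>>0. (\<lambda>n. measure M {\<omega> \<in> space M. Z n \<omega> > ennreal \<epsilon>}) \<longlonglongrightarrow> 0)"

definition ucp_tendsto ::
    "'a measure \<Rightarrow> real \<Rightarrow> (nat \<Rightarrow> real \<Rightarrow> 'a \<Rightarrow> real) \<Rightarrow> (real \<Rightarrow> 'a \<Rightarrow> real) \<Rightarrow> bool" where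
  "ucp_tendsto M T X Y \<longleftrightarrow>
     tendsto_zero_in_prob M (\<lambda>n \<omega>. \<Squnion>t\<in>{0..T}. ennreal \<bar>X n t \<omega> - Y t \<omega>\<bar>)"

definition ucp_sums ::
    "'a measure \<Rightarrow> real \<Rightarrow> (nat \<Rightarrow> real \<Rightarrow> 'a \<Rightarrow> real) \<Rightarrow> (real \<Rightarrow> 'a \<Rightarrow> real) \<Rightarrow> bool" where
  "ucp_sums M T X S \<longleftrightarrow> ucp_tendsto M T (\<lambda>n t \<omega>. \<Sum>k<n. X k t \<omega>) S"

definition ucp_summable :: "'a measure \<Rightarrow> real \<Rightarrow> (nat \<Rightarrow> real \<Rightarrow> 'a \<Rightarrow> real) \<Rightarrow> bool" where
  "ucp_summable M T X \<longleftrightarrow> (\<exists>S. ucp_sums M T X S)"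

text \<open>
  The sum of a series converging in this sense is unique only up to indistinguishability on
  \<open>[0, T]\<close>; \<open>ucp_suminf\<close> is some version of it.
\<close>

definition ucp_suminf ::
    "'a measure \<Rightarrow> real \<Rightarrow> (nat \<Rightarrow> real \<Rightarrow> 'a \<Rightarrow> real) \<Rightarrow> real \<Rightarrow> 'a \<Rightarrow> real" where
  "ucp_suminf M T X = (SOME S. ucp_sums M T X S)"

section \<open>The Ito integral\<close>

text \<open>
  A triple \<open>(n, \<tau>, \<xi>)\<close> represents the elementary integrand equal to \<open>\<xi> i\<close> on \<open>(\<tau> i, \<tau> (i + 1)]\<close> for
  \<open>i < n\<close>, and to 0 elsewhere.
\<close>

definition simple_integrand ::
    "(real \<Rightarrow> 'a measure) \<Rightarrow> real \<Rightarrow> nat \<Rightarrow> (nat \<Rightarrow> real) \<Rightarrow> (nat \<Rightarrow> 'a \<Rightarrow> real) \<Rightarrow> bool" where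
  "simple_integrand \<F> T n \<tau> \<xi> \<longleftrightarrow>
     0 \<le> \<tau> 0 \<and> (\<forall>i<n. \<tau> i \<le> \<tau> (Suc i)) \<and> \<tau> n \<le> T \<and>
     (\<forall>i<n. \<xi> i \<in> borel_measurable (\<F> (\<tau> i)) \<and> (\<exists>C. \<forall>\<omega>\<in>space (\<F> (\<tau> i)). \<bar>\<xi> i \<omega>\<bar> \<le> C))"

definition simple_process ::
    "nat \<Rightarrow> (nat \<Rightarrow> real) \<Rightarrow> (nat \<Rightarrow> 'a \<Rightarrow> real) \<Rightarrow> real \<Rightarrow> 'a \<Rightarrow> real" where
  "simple_process n \<tau> \<xi> s \<omega> = (\<Sum>i<n. \<xi> i \<omega> * indicator {\<tau> i<..\<tau> (Suc i)} s)"

definition simple_ito ::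
    "(real \<Rightarrow> 'a \<Rightarrow> real) \<Rightarrow> nat \<Rightarrow> (nat \<Rightarrow> real) \<Rightarrow> (nat \<Rightarrow> 'a \<Rightarrow> real) \<Rightarrow> real \<Rightarrow> 'a \<Rightarrow> real" where
  "simple_ito w n \<tau> \<xi> t \<omega> = (\<Sum>i<n. \<xi> i \<omega> * (w (min t (\<tau> (Suc i))) \<omega> - w (min t (\<tau> i)) \<omega>))"

text \<open>
  \<open>has_ito_integral M \<F> w T h I\<close>: \<open>h\<close> is a predictable process on \<open>(0, T]\<close> with
  \<open>\<integral>\<^sub>0\<^sup>T h\<^sub>s\<^sup>2 ds < \<infinity>\<close> almost surely, and \<open>I\<close> is a continuous adapted version, on \<open>[0, T]\<close>, of
  \<open>\<integral>\<^sub>0\<^sup>t h\<^sub>s dw\<^sub>s\<close>: the limit, uniform on \<open>[0, T]\<close> in probability, of the integrals of elementary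
  integrands \<open>h\<^sup>j\<close> such that \<open>\<integral>\<^sub>0\<^sup>T (h\<^sup>j\<^sub>s - h\<^sub>s)\<^sup>2 ds\<close> tends to 0 in probability.
\<close>

definition has_ito_integral ::
    "'a measure \<Rightarrow> (real \<Rightarrow> 'a measure) \<Rightarrow> (real \<Rightarrow> 'a \<Rightarrow> real) \<Rightarrow> real \<Rightarrow>
     (real \<Rightarrow> 'a \<Rightarrow> real) \<Rightarrow> (real \<Rightarrow> 'a \<Rightarrow> real) \<Rightarrow> bool" where
  "has_ito_integral M \<F> w T h I \<longleftrightarrow>
     (\<lambda>(\<omega>, s). h s \<omega>) \<in> borel_measurable (predictable_upto M \<F> T) \<and>
     (AE \<omega> in M. (\<integral>\<^sup>+s\<in>{0<..T}. ennreal ((h s \<omega>)\<^sup>2) \<partial>lborel) < \<infinity>) \<and>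
     (\<forall>t\<in>{0..T}. I t \<in> borel_measurable (\<F> t)) \<and>
     (\<forall>\<omega>\<in>space M. continuous_on {0..T} (\<lambda>t. I t \<omega>)) \<and>
     (\<exists>n \<tau> \<xi>.
        (\<forall>j. simple_integrand \<F> T (n j) (\<tau> j) (\<xi> j)) \<and>
        tendsto_zero_in_prob M
          (\<lambda>j \<omega>. \<integral>\<^sup>+s\<in>{0<..T}. ennreal ((simple_process (n j) (\<tau> j) (\<xi> j) s \<omega> - h s \<omega>)\<^sup>2) \<partial>lborel) \<and>
        ucp_tendsto M T (\<lambda>j. simple_ito w (n j) (\<tau> j) (\<xi> j)) I)"

definition ito_integrable ::
    "'a measure \<Rightarrow> (real \<Rightarrow> 'a measure) \<Rightarrow> (real \<Rightarrow> 'a \<Rightarrow> real) \<Rightarrow> real \<Rightarrow>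
     (real \<Rightarrow> 'a \<Rightarrow> real) \<Rightarrow> bool" where
  "ito_integrable M \<F> w T h \<longleftrightarrow> (\<exists>I. has_ito_integral M \<F> w T h I)"

text \<open>Again some version, unique up to indistinguishability on \<open>[0, T]\<close>.\<close>

definition ito_integral ::
    "'a measure \<Rightarrow> (real \<Rightarrow> 'a measure) \<Rightarrow> (real \<Rightarrow> 'a \<Rightarrow> real) \<Rightarrow> real \<Rightarrow>
     (real \<Rightarrow> 'a \<Rightarrow> real) \<Rightarrow> real \<Rightarrow> 'a \<Rightarrow> real" where
  "ito_integral M \<F> w T h = (SOME I. has_ito_integral M \<F> w T h I)"

text \<open>
  For a sequence of integrands: \<open>ito_series\<close> is the process \<open>\<Sum>\<^sub>k \<integral>\<^sub>0\<^sup>t h\<^sup>k\<^sub>s dw\<^sup>k\<^sub>s\<close>, and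
  \<open>ito_series_converges\<close> says that its terms are well defined and that the series converges
  uniformly on \<open>[0, T]\<close> in probability.
\<close>

definition ito_series_converges ::
    "'a measure \<Rightarrow> (real \<Rightarrow> 'a measure) \<Rightarrow> (nat \<Rightarrow> real \<Rightarrow> 'a \<Rightarrow> real) \<Rightarrow> real \<Rightarrow>
     (nat \<Rightarrow> real \<Rightarrow> 'a \<Rightarrow> real) \<Rightarrow> bool" where
  "ito_series_converges M \<F> w T h \<longleftrightarrow>
     (\<forall>k. ito_integrable M \<F> (w k) T (h k)) \<and>
     ucp_summable M T (\<lambda>k. ito_integral M \<F> (w k) T (h k))"

definition ito_series ::
    "'a measure \<Rightarrow> (real \<Rightarrow> 'a measure) \<Rightarrow> (nat \<Rightarrow> real \<Rightarrow> 'a \<Rightarrow> real) \<Rightarrow> real \<Rightarrow>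
     (nat \<Rightarrow> real \<Rightarrow> 'a \<Rightarrow> real) \<Rightarrow> real \<Rightarrow> 'a \<Rightarrow> real" where
  "ito_series M \<F> w T h = ucp_suminf M T (\<lambda>k. ito_integral M \<F> (w k) T (h k))"

text \<open>
  For a function \<open>F\<close> on \<open>\<Omega> \<times> [0, T] \<times> \<Gamma>\<close>: joint measurability in \<open>(\<omega>, x)\<close> with respect to the completed product, and
  the pointwise representation for each fixed \<open>t\<close> and \<open>x\<close>, almost surely. Since sections of
  \<open>F\<close> are in general only Lebesgue (not Borel) measurable in \<open>x\<close>, integrals over \<open>\<Gamma>\<close> are taken
  with respect to \<^const>\<open>lebesgue\<close>; for Borel integrands this makes no difference.
\<close>

definition solves_pointwise ::
    "'a measure \<Rightarrow> (real \<Rightarrow> 'a measure) \<Rightarrow> (nat \<Rightarrow> real \<Rightarrow> 'a \<Rightarrow> real) \<Rightarrow> real \<Rightarrow>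
     (real ^ 'd) set \<Rightarrow> (real \<Rightarrow> 'a \<Rightarrow> real ^ 'd \<Rightarrow> real) \<Rightarrow>
     (nat \<Rightarrow> real \<Rightarrow> 'a \<Rightarrow> real ^ 'd \<Rightarrow> real) \<Rightarrow> (real \<Rightarrow> 'a \<Rightarrow> real ^ 'd \<Rightarrow> real) \<Rightarrow> bool" where
  "solves_pointwise M \<F> w T \<Gamma> G H F \<longleftrightarrow>
     (\<forall>t\<in>{0..T}. (\<lambda>(\<omega>, x). F t \<omega> x)
        \<in> borel_measurable (completion (M \<Otimes>\<^sub>M restrict_space lborel \<Gamma>))) \<and>
     (\<forall>t\<in>{0..T}. \<forall>x\<in>\<Gamma>. AE \<omega> in M.
        F t \<omega> x = (LINT s:{0<..t}|lborel. G s \<omega> x)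
          + ito_series M \<F> w T (\<lambda>k s \<omega>. H k s \<omega> x) t \<omega>)"

end

theory Submission
  imports Defs "HOL-Real_Asymp.Real_Asymp"
begin

text \<open>
  Let \<open>qv\<^sub>t = \<Sum>\<^sub>k \<integral>\<^sub>0\<^sup>t |f\<^sup>k|\<^sup>2 ds\<close> be the bracket of the integral \<open>I = \<Sum>\<^sub>k \<integral> f\<^sup>k dw\<^sup>k\<close>. The increments of
  distinct \<open>w\<^sup>k\<close> are orthogonal given the past, so the isometry and the maximal inequality control
  \<open>sup |I|\<close> in probability by \<open>qv\<^sub>T\<close>, and \<open>E sup |I| \<le> 10 E qv\<^sub>T\<^sup>1\<^sup>/\<^sup>2\<close>. The integrand is approximated by step
  functions whose value on a cell is the truncated average over the preceding cell; these depend
  measurably on \<open>x\<close>, and choosing the mesh as a measurable function of \<open>x\<close> so that Borel-Cantelli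
  applies gives a version of the integral that is measurable in \<open>(\<omega>, t, x)\<close> and continuous in \<open>t\<close>.

  Put \<open>\<phi>\<^sub>t = \<integral> qv\<^sub>t(x)\<^sup>1\<^sup>/\<^sup>2 dx\<close>. Truncating \<open>H\<close> at the predictable event \<open>\<phi>\<^sub>t \<le> \<delta>\<close> and integrating the bound
  for \<open>E sup |I|\<close> over \<open>x\<close> shows that \<open>\<integral> sup\<^sub>t |I\<^sub>t(x)| dx\<close> is small in probability when \<open>\<phi>\<^sub>T\<close> is. By
  Minkowski's inequality \<open>\<phi>\<^sub>T\<close> also dominates the bracket of the integral of \<open>\<integral> H dx\<close>. Hence both
  sides of the stochastic Fubini identity are continuous under the approximation by step functions,
  for which the identity is a finite sum. An arbitrary solution agrees with the constructed one for
  almost all \<open>(\<omega>, x)\<close>, simultaneously on a countable set of times.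
\<close>

section \<open>Convergence in probability\<close>

text \<open>Hypothesis (iii) controls only the integral over x of the square root of the bracket,
  almost surely and without moments. Estimates must therefore be linear in that root, which is why a
  first moment bound for the supremum is extracted from the maximal inequality. Localisation must be
  common to all x, since a bound on the bracket at one x says nothing about the others: the
  integrand is truncated according to the integrated root \<open>phi\<close>, and a predictable
  truncation together with locality (\<open>vito_local\<close>) plays the part of stopping.

  The sequence over k is treated as one integrand with one bracket \<open>qv\<close>, so the
  infinite series obeys the same estimates as a single integral; the versions chosen by
  \<open>ito_integral\<close> and \<open>ucp_suminf\<close> are identified in
  \<open>ito_series_eq\<close>.

  Orthogonality of distinct Wiener processes given the past is not immediate. Each increment alone
  is independent of the past, and the paths are independent of each other, but this does not make a
  pair of increments jointly independent of the past. The covariation on a fine grid settles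
  it.\<close>

lemma ennreal_tendsto_0_iff:
  fixes f :: "'b \<Rightarrow> ennreal"
  shows "(f \<longlongrightarrow> 0) F \<longleftrightarrow> (\<forall>e>0. eventually (\<lambda>x. f x \<le> ennreal e) F)"
proof safe
  fix e :: real assume "(f \<longlongrightarrow> 0) F" "0 < e"
  then show "eventually (\<lambda>x. f x \<le> ennreal e) F"
    by (auto dest!: order_tendstoD(2)[where a = "ennreal e"] elim!: eventually_mono)
next
  assume *: "\<forall>e>0. eventually (\<lambda>x. f x \<le> ennreal e) F"
  show "(f \<longlongrightarrow> 0) F"
  proof (rule order_tendstoI)
    fix a :: ennreal assume "0 < a"
    then obtain z where z: "0 < z" "z < a" using dense by blast
    then have "z < top" using less_le_trans top_greatest by blast
    then obtain e where e: "z = ennreal e" "0 \<le> e" by (cases z) auto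
    with z have "0 < e" by auto
    with * have "eventually (\<lambda>x. f x \<le> ennreal e) F" by blast
    then show "eventually (\<lambda>x. f x < a) F" using z e by (auto elim!: eventually_mono)
  qed (auto)
qed

text \<open>The two preimages differ by subsets of a null set, which completeness makes measurable.
  It serves where almost everywhere equality with a measurable function is all that is known:
  sections of an arbitrary solution, and suprema after a change of the Wiener paths on a null
  event.\<close>

lemma (in complete_measure) borel_measurable_AE_cong:
  assumes f: "f \<in> borel_measurable M" and eq: "AE x in M. g x = (f x :: 'b :: topological_space)"
  shows "g \<in> borel_measurable M"
proof (rule measurableI)
  fix A :: "'b set" assume A: "A \<in> sets borel"
  from eq obtain N where N: "N \<in> null_sets M" "{x \<in> space M. g x \<noteq> f x} \<subseteq> N"
    by (auto elim!: AE_E)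
  let ?A = "f -` A \<inter> space M" and ?B = "g -` A \<inter> space M"
  have "?B - ?A \<subseteq> N" "?A - ?B \<subseteq> N" using N by auto
  then have "?B - ?A \<in> sets M" "?A - ?B \<in> sets M" using N(1) by (blast intro: complete)+
  moreover have "?A \<in> sets M" using f A by (rule measurable_sets)
  moreover have "?B = (?A - (?A - ?B)) \<union> (?B - ?A)" by auto
  ultimately show "?B \<in> sets M" by (metis sets.Diff sets.Un)
qed simp

lemma tendsto_0_double_add:
  fixes a b c :: "nat \<Rightarrow> ennreal"
  assumes "\<And>n. c n \<le> 2 * a n + 2 * b n" "a \<longlonglongrightarrow> 0" "b \<longlonglongrightarrow> 0"
  shows "c \<longlonglongrightarrow> 0"
proof (rule tendsto_sandwich[OF _ _ tendsto_const])
  have "(\<lambda>n. 2 * a n + 2 * b n) \<longlonglongrightarrow> 2 * 0 + 2 * 0"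
    using assms(2,3) by (intro tendsto_add ennreal_tendsto_cmult) simp_all
  then show "(\<lambda>n. 2 * a n + 2 * b n) \<longlonglongrightarrow> 0" by simp
qed (use assms(1) in simp_all)

section \<open>Truncated means as a gauge of smallness in probability\<close>

context prob_space
begin

text \<open>A single subadditive number that tends to 0 exactly when \<open>Z\<close> tends to 0 in
  probability (\<open>tendsto_zero_in_prob_iff\<close>). Errors can be added without splitting a
  level \<epsilon> each time.\<close>

definition psize :: "('a \<Rightarrow> ennreal) \<Rightarrow> ennreal" where
  "psize Z = (\<integral>\<^sup>+\<omega>. min 1 (Z \<omega>) \<partial>M)"

lemma psize_mono_AE: "AE \<omega> in M. Z \<omega> \<le> Z' \<omega> \<Longrightarrow> psize Z \<le> psize Z'"
  unfolding psize_def by (rule nn_integral_mono_AE) (auto simp: min_le_iff_disj)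

lemma min_1_add_le: "min 1 (x + y) \<le> min 1 x + min 1 (y :: ennreal)"
proof (cases "1 \<le> x \<or> 1 \<le> y")
  case True
  then show ?thesis by (auto simp: min_def intro: add_increasing add_increasing2)
next
  case False
  then show ?thesis by (auto simp: min_def)
qed

lemma psize_add:
  assumes [measurable]: "X \<in> borel_measurable M" "Y \<in> borel_measurable M"
  shows "psize (\<lambda>\<omega>. X \<omega> + Y \<omega>) \<le> psize X + psize Y"
proof -
  have "psize (\<lambda>\<omega>. X \<omega> + Y \<omega>) \<le> (\<integral>\<^sup>+\<omega>. min 1 (X \<omega>) + min 1 (Y \<omega>) \<partial>M)"
    unfolding psize_def by (rule nn_integral_mono) (rule min_1_add_le)
  also have "\<dots> = psize X + psize Y" unfolding psize_def by (rule nn_integral_add) auto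
  finally show ?thesis .
qed

lemma psize_double:
  assumes [measurable]: "X \<in> borel_measurable M"
  shows "psize (\<lambda>\<omega>. 2 * X \<omega>) \<le> 2 * psize X"
  using psize_add[of X X] by (simp add: mult_2)

lemma psize_le_prob:
  assumes [measurable]: "Z \<in> borel_measurable M" and e: "0 \<le> e"
  shows "psize Z \<le> e + emeasure M {\<omega> \<in> space M. e < Z \<omega>}"
proof -
  have "psize Z \<le> (\<integral>\<^sup>+\<omega>. e + indicator {\<omega> \<in> space M. e < Z \<omega>} \<omega> \<partial>M)"
    unfolding psize_def
    by (rule nn_integral_mono) (auto simp: indicator_def min_def not_less intro: add_increasing)
  also have "\<dots> = e + emeasure M {\<omega> \<in> space M. e < Z \<omega>}"
    by (subst nn_integral_add) (auto simp: emeasure_space_1)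
  finally show ?thesis .
qed

text \<open>Markov's inequality for the truncated variable; the truncation at 1 is the reason for
  \<open>e \<le> 1\<close>.\<close>

lemma prob_le_psize:
  assumes [measurable]: "Z \<in> borel_measurable M" and e: "0 \<le> e" "e \<le> 1"
  shows "e * emeasure M {\<omega> \<in> space M. e < Z \<omega>} \<le> psize Z"
proof -
  have "e * emeasure M {\<omega> \<in> space M. e < Z \<omega>} =
      (\<integral>\<^sup>+\<omega>. e * indicator {\<omega> \<in> space M. e < Z \<omega>} \<omega> \<partial>M)"
    by (subst nn_integral_cmult) auto
  also have "\<dots> \<le> psize Z"
    unfolding psize_def using e
    by (intro nn_integral_mono) (auto simp: indicator_def less_imp_le)
  finally show ?thesis .
qed

lemma psize_eq_0_iff:
  assumes [measurable]: "Z \<in> borel_measurable M"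
  shows "psize Z = 0 \<longleftrightarrow> (AE \<omega> in M. Z \<omega> = 0)"
  unfolding psize_def
  by (subst nn_integral_0_iff_AE) (auto simp: min_def elim!: AE_mp)

lemma psize_tendsto_0_AE:
  assumes [measurable]: "\<And>n. Z n \<in> borel_measurable M"
    and lim: "AE \<omega> in M. (\<lambda>n. Z n \<omega>) \<longlonglongrightarrow> 0"
  shows "(\<lambda>n. psize (Z n)) \<longlonglongrightarrow> 0"
proof -
  have "(\<lambda>n. \<integral>\<^sup>+\<omega>. min 1 (Z n \<omega>) \<partial>M) \<longlonglongrightarrow> (\<integral>\<^sup>+\<omega>. 0 \<partial>M)"
  proof (rule nn_integral_dominated_convergence[where w = "\<lambda>_. 1"])
    show "AE \<omega> in M. (\<lambda>n. min 1 (Z n \<omega>)) \<longlonglongrightarrow> 0"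
      using lim
    proof eventually_elim
      case (elim \<omega>)
      then have "(\<lambda>n. min 1 (Z n \<omega>)) \<longlonglongrightarrow> min 1 0" by (intro tendsto_min tendsto_const)
      then show ?case by simp
    qed
  qed (auto simp: emeasure_space_1)
  then show ?thesis unfolding psize_def by simp
qed

lemma tendsto_zero_in_prob_iff:
  "tendsto_zero_in_prob M Z \<longleftrightarrow> (\<forall>n. Z n \<in> borel_measurable M) \<and> (\<lambda>n. psize (Z n)) \<longlonglongrightarrow> 0"
proof (cases "\<forall>n. Z n \<in> borel_measurable M")
  case True
  then have [measurable]: "\<And>n. Z n \<in> borel_measurable M" by auto
  have "(\<forall>e>0. (\<lambda>n. measure M {\<omega> \<in> space M. Z n \<omega> > ennreal e}) \<longlonglongrightarrow> 0) \<longleftrightarrow>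
      (\<lambda>n. psize (Z n)) \<longlonglongrightarrow> 0" (is "?L \<longleftrightarrow> ?R")
  proof
    assume L: ?L
    show ?R unfolding ennreal_tendsto_0_iff
    proof safe
      fix e :: real assume e: "0 < e"
      with L have "(\<lambda>n. measure M {\<omega> \<in> space M. Z n \<omega> > ennreal (e/2)}) \<longlonglongrightarrow> 0" by auto
      then have "eventually (\<lambda>n. measure M {\<omega> \<in> space M. Z n \<omega> > ennreal (e/2)} < e/2) sequentially"
        using e by (auto dest: order_tendstoD(2)[where a = "e/2"])
      then show "eventually (\<lambda>n. psize (Z n) \<le> ennreal e) sequentially"
      proof eventually_elim
        case (elim n)
        have "psize (Z n) \<le> ennreal (e/2) + emeasure M {\<omega> \<in> space M. Z n \<omega> > ennreal (e/2)}"
          by (rule psize_le_prob) auto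
        also have "\<dots> \<le> ennreal (e/2) + ennreal (e/2)"
          using elim by (intro add_left_mono) (auto simp: emeasure_eq_measure intro!: ennreal_leI)
        also have "\<dots> = ennreal e" using e by (subst ennreal_plus[symmetric]) auto
        finally show ?case .
      qed
    qed
  next
    assume R: ?R
    show ?L
    proof safe
      fix e :: real assume e: "0 < e"
      \<comment> \<open>Markov's inequality for \<open>psize\<close> needs a level of at most 1;
        lowering the level from \<open>e\<close> to \<open>d\<close> only enlarges the
        event.\<close>
      define d where "d = min 1 e"
      have d: "0 < d" "d \<le> 1" "d \<le> e" using e by (auto simp: d_def)
      have "(\<lambda>n. ennreal (1/d) * psize (Z n)) \<longlonglongrightarrow> ennreal (1/d) * 0"
        using R by (intro ennreal_tendsto_cmult) auto
      then have lim: "(\<lambda>n. ennreal (1/d) * psize (Z n)) \<longlonglongrightarrow> ennreal 0" by simp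
      have le: "ennreal (measure M {\<omega> \<in> space M. Z n \<omega> > ennreal e}) \<le> ennreal (1/d) * psize (Z n)" for n
      proof -
        have "emeasure M {\<omega> \<in> space M. Z n \<omega> > ennreal e}
            \<le> emeasure M {\<omega> \<in> space M. Z n \<omega> > ennreal d}"
          using d by (intro emeasure_mono) (auto intro: le_less_trans ennreal_leI)
        also have "\<dots> = ennreal (1/d) * (ennreal d * emeasure M {\<omega> \<in> space M. Z n \<omega> > ennreal d})"
          using d by (simp add: mult.assoc[symmetric] ennreal_mult[symmetric])
        also have "\<dots> \<le> ennreal (1/d) * psize (Z n)"
          using d by (intro mult_left_mono prob_le_psize) auto
        finally show ?thesis by (simp add: emeasure_eq_measure)
      qed
      have "(\<lambda>n. ennreal (measure M {\<omega> \<in> space M. Z n \<omega> > ennreal e})) \<longlonglongrightarrow> ennreal 0"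
        by (rule tendsto_sandwich[OF _ _ tendsto_const lim]) (auto simp: le)
      then show "(\<lambda>n. measure M {\<omega> \<in> space M. Z n \<omega> > ennreal e}) \<longlonglongrightarrow> 0"
        by (subst (asm) tendsto_ennreal_iff) auto
    qed
  qed
  then show ?thesis using True by (simp add: tendsto_zero_in_prob_def)
qed (auto simp: tendsto_zero_in_prob_def)

end

section \<open>Martingale transforms on a partition\<close>

locale filtered_space = prob_space M for M :: "'a measure" +
  fixes \<F> :: "real \<Rightarrow> 'a measure"
  assumes complete_M: "complete_measure M"
    and filtration: "complete_filtration M \<F>"
begin

lemma subalg: "0 \<le> t \<Longrightarrow> subalgebra M (\<F> t)"
  using filtration by (auto simp: complete_filtration_def)

lemma space_F: "0 \<le> t \<Longrightarrow> space (\<F> t) = space M"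
  using subalg by (auto simp: subalgebra_def)

lemma sets_F_mono: "0 \<le> s \<Longrightarrow> s \<le> t \<Longrightarrow> sets (\<F> s) \<subseteq> sets (\<F> t)"
  using filtration by (auto simp: complete_filtration_def)

lemma measurable_F_mono:
  assumes "f \<in> measurable (\<F> s) N" "0 \<le> s" "s \<le> t"
  shows "f \<in> measurable (\<F> t) N"
  by (rule measurable_from_subalg[OF _ assms(1)])
     (use assms sets_F_mono[of s t] space_F in \<open>auto simp: subalgebra_def\<close>)

lemma measurable_F_M: "f \<in> measurable (\<F> s) N \<Longrightarrow> 0 \<le> s \<Longrightarrow> f \<in> measurable M N"
  using measurable_from_subalg subalg by blast

end

text \<open>
  Only these moment identities of the Wiener processes are used. That \<open>W\<close> is continuous for every
  \<open>\<omega>\<close> is achieved by a modification, see \<open>modification\<close> below.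
\<close>

locale wiener_system = filtered_space M \<F> for M :: "'a measure" and \<F> :: "real \<Rightarrow> 'a measure" +
  fixes W :: "nat \<Rightarrow> real \<Rightarrow> 'a \<Rightarrow> real" and T :: real
  assumes T_nonneg: "0 \<le> T"
    and W_cont: "\<And>k \<omega>. \<omega> \<in> space M \<Longrightarrow> continuous_on {0..} (\<lambda>t. W k t \<omega>)"
    and W_adapted: "\<And>k t. 0 \<le> t \<Longrightarrow> W k t \<in> borel_measurable (\<F> t)"
    and W_mean: "\<And>k s t X. 0 \<le> s \<Longrightarrow> s \<le> t \<Longrightarrow> X \<in> borel_measurable (\<F> s) \<Longrightarrow> integrable M X \<Longrightarrow>
      has_bochner_integral M (\<lambda>\<omega>. X \<omega> * (W k t \<omega> - W k s \<omega>)) 0"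
    and W_var: "\<And>k s t X. 0 \<le> s \<Longrightarrow> s \<le> t \<Longrightarrow> X \<in> borel_measurable (\<F> s) \<Longrightarrow> integrable M X \<Longrightarrow>
      has_bochner_integral M (\<lambda>\<omega>. X \<omega> * (W k t \<omega> - W k s \<omega>)\<^sup>2) (expectation X * (t - s))"
    and W_cov: "\<And>k l s t X C. k \<noteq> l \<Longrightarrow> 0 \<le> s \<Longrightarrow> s \<le> t \<Longrightarrow> X \<in> borel_measurable (\<F> s) \<Longrightarrow>
      (\<And>\<omega>. \<omega> \<in> space M \<Longrightarrow> \<bar>X \<omega>\<bar> \<le> C) \<Longrightarrow>
      has_bochner_integral M (\<lambda>\<omega>. X \<omega> * (W k t \<omega> - W k s \<omega>) * (W l t \<omega> - W l s \<omega>)) 0"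
begin

lemma W_measurable [measurable]: "0 \<le> t \<Longrightarrow> W k t \<in> borel_measurable M"
  using W_adapted measurable_F_M by blast

end

context wiener_system
begin

definition mart :: "(nat \<Rightarrow> real) \<Rightarrow> nat \<Rightarrow> (nat \<Rightarrow> nat \<Rightarrow> 'a \<Rightarrow> real) \<Rightarrow> nat \<Rightarrow> 'a \<Rightarrow> real" where
  "mart p K \<eta> l \<omega> = (\<Sum>j<l. \<Sum>k<K. \<eta> k j \<omega> * (W k (p (Suc j)) \<omega> - W k (p j) \<omega>))"

definition brk :: "(nat \<Rightarrow> real) \<Rightarrow> nat \<Rightarrow> (nat \<Rightarrow> nat \<Rightarrow> 'a \<Rightarrow> real) \<Rightarrow> nat \<Rightarrow> 'a \<Rightarrow> real" where
  "brk p K \<eta> l \<omega> = (\<Sum>j<l. \<Sum>k<K. (\<eta> k j \<omega>)\<^sup>2 * (p (Suc j) - p j))"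

context
  fixes p :: "nat \<Rightarrow> real" and K m :: nat
  assumes p_0: "0 \<le> p 0" and p_mono: "\<And>j. j < m \<Longrightarrow> p j \<le> p (Suc j)"
begin

lemma p_le: "i \<le> j \<Longrightarrow> j \<le> m \<Longrightarrow> p i \<le> p j"
proof (induction j)
  case (Suc j)
  then show ?case using p_mono[of j] by (cases "i = Suc j") (auto intro: order_trans)
qed simp

lemma p_nonneg: "j \<le> m \<Longrightarrow> 0 \<le> p j"
  using p_le[of 0 j] p_0 by auto

context
  fixes \<eta> :: "nat \<Rightarrow> nat \<Rightarrow> 'a \<Rightarrow> real" and C :: real
  assumes \<eta>_meas: "\<And>k j. k < K \<Longrightarrow> j < m \<Longrightarrow> \<eta> k j \<in> borel_measurable (\<F> (p j))"
    and \<eta>_bdd: "\<And>k j \<omega>. k < K \<Longrightarrow> j < m \<Longrightarrow> \<omega> \<in> space M \<Longrightarrow> \<bar>\<eta> k j \<omega>\<bar> \<le> C"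
begin

lemma mart_adapted: "l \<le> m \<Longrightarrow> mart p K \<eta> l \<in> borel_measurable (\<F> (p l))"
proof -
  assume l: "l \<le> m"
  have "(\<lambda>\<omega>. \<eta> k j \<omega> * (W k (p (Suc j)) \<omega> - W k (p j) \<omega>)) \<in> borel_measurable (\<F> (p l))"
    if "k < K" "j < l" for k j
  proof -
    have "\<eta> k j \<in> borel_measurable (\<F> (p l))"
      using \<eta>_meas[of k j] that l p_le[of j l] p_nonneg[of j] by (auto elim!: measurable_F_mono)
    moreover have "W k (p (Suc j)) \<in> borel_measurable (\<F> (p l))"
      using W_adapted[of "p (Suc j)" k] that l p_le[of "Suc j" l] p_nonneg[of "Suc j"]
      by (auto elim!: measurable_F_mono)
    moreover have "W k (p j) \<in> borel_measurable (\<F> (p l))"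
      using W_adapted[of "p j" k] that l p_le[of j l] p_nonneg[of j] by (auto elim!: measurable_F_mono)
    ultimately show ?thesis by measurable
  qed
  then show ?thesis unfolding mart_def[abs_def] by (intro borel_measurable_sum) auto
qed

text \<open>The bracket of a Wiener process is deterministic, so the part accumulated up to
  \<open>p (Suc j)\<close> is already known at \<open>p j\<close>. Thus the integrand can be
  switched off before the bracket exceeds a given level.\<close>

lemma brk_adapted: "j < m \<Longrightarrow> brk p K \<eta> (Suc j) \<in> borel_measurable (\<F> (p j))"
proof -
  assume j: "j < m"
  have "(\<lambda>\<omega>. (\<eta> k i \<omega>)\<^sup>2 * (p (Suc i) - p i)) \<in> borel_measurable (\<F> (p j))"
    if "k < K" "i < Suc j" for k i
  proof -
    have "\<eta> k i \<in> borel_measurable (\<F> (p j))"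
      using \<eta>_meas[of k i] that j p_le[of i j] p_nonneg[of i] by (auto elim!: measurable_F_mono)
    then show ?thesis by measurable
  qed
  then show ?thesis unfolding brk_def[abs_def] by (intro borel_measurable_sum) auto
qed

text \<open>Expand the square of the last step. Products of the past with a new increment vanish by
  \<open>W_mean\<close>, products of increments with different k by \<open>W_cov\<close>, and the
  squares give the new part of the bracket by \<open>W_var\<close>. The bound \<open>C\<close> makes
  these products integrable.\<close>

lemma mart_isometry:
  "l \<le> m \<Longrightarrow> has_bochner_integral M (\<lambda>\<omega>. (mart p K \<eta> l \<omega>)\<^sup>2) (expectation (brk p K \<eta> l))
     \<and> integrable M (brk p K \<eta> l)"
proof (induction l)
  case 0
  then show ?case by (simp add: mart_def brk_def[abs_def] has_bochner_integral_zero)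
next
  case (Suc l)
  let ?N = "mart p K \<eta>"
  let ?D = "\<lambda>k \<omega>. W k (p (Suc l)) \<omega> - W k (p l) \<omega>"
  have l: "l < m" using Suc by auto
  have p: "0 \<le> p l" "p l \<le> p (Suc l)" using p_nonneg[of l] p_mono[of l] l by auto
  have \<eta>m: "\<eta> k l \<in> borel_measurable (\<F> (p l))" if "k < K" for k using \<eta>_meas l that by auto
  have \<eta>M [measurable]: "\<eta> k l \<in> borel_measurable M" if "k < K" for k
    using \<eta>m[OF that] p(1) by (rule measurable_F_M)
  have Nm: "?N l \<in> borel_measurable (\<F> (p l))" using mart_adapted l by auto
  have NM [measurable]: "?N l \<in> borel_measurable M" using Nm p(1) by (rule measurable_F_M)
  have N2: "integrable M (\<lambda>\<omega>. (?N l \<omega>)\<^sup>2)"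
    using Suc by (auto simp: has_bochner_integral_iff)
  have Ni: "integrable M (?N l)" using N2 by (rule square_integrable_imp_integrable[rotated]) simp
  have eq: "?N (Suc l) \<omega> ^ 2 = (?N l \<omega>)\<^sup>2 + 2 * (\<Sum>k<K. ?N l \<omega> * \<eta> k l \<omega> * ?D k \<omega>) +
      (\<Sum>k<K. \<Sum>i<K. \<eta> k l \<omega> * \<eta> i l \<omega> * ?D k \<omega> * ?D i \<omega>)" for \<omega>
  proof -
    have *: "?N (Suc l) \<omega> = ?N l \<omega> + (\<Sum>k<K. \<eta> k l \<omega> * ?D k \<omega>)" by (simp add: mart_def)
    have "(\<Sum>k<K. \<eta> k l \<omega> * ?D k \<omega>)\<^sup>2 = (\<Sum>k<K. \<Sum>i<K. \<eta> k l \<omega> * \<eta> i l \<omega> * ?D k \<omega> * ?D i \<omega>)"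
      by (simp add: power2_eq_square sum_product mult_ac)
    then show ?thesis unfolding * by (simp add: power2_sum sum_distrib_left mult_ac)
  qed
  have i1: "has_bochner_integral M (\<lambda>\<omega>. ?N l \<omega> * \<eta> k l \<omega> * ?D k \<omega>) 0" if k: "k < K" for k
  proof (rule W_mean[OF p])
    show "(\<lambda>\<omega>. ?N l \<omega> * \<eta> k l \<omega>) \<in> borel_measurable (\<F> (p l))"
      using Nm \<eta>m[OF k] by measurable
    show "integrable M (\<lambda>\<omega>. ?N l \<omega> * \<eta> k l \<omega>)"
    proof (rule Bochner_Integration.integrable_bound[where f = "\<lambda>\<omega>. C * ?N l \<omega>"])
      show "AE \<omega> in M. norm (?N l \<omega> * \<eta> k l \<omega>) \<le> norm (C * ?N l \<omega>)"
      proof (rule AE_I2)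
        fix \<omega> assume "\<omega> \<in> space M"
        then have "\<bar>\<eta> k l \<omega>\<bar> \<le> \<bar>C\<bar>" using \<eta>_bdd[OF k l] by fastforce
        then show "norm (?N l \<omega> * \<eta> k l \<omega>) \<le> norm (C * ?N l \<omega>)"
          by (simp add: abs_mult mult.commute mult_right_mono)
      qed
    qed (use Ni k in auto)
  qed
  have bdd2: "\<bar>\<eta> k l \<omega> * \<eta> i l \<omega>\<bar> \<le> C * C" if "k < K" "i < K" "\<omega> \<in> space M" for k i \<omega>
  proof -
    have "\<bar>\<eta> k l \<omega>\<bar> \<le> C" "\<bar>\<eta> i l \<omega>\<bar> \<le> C" using \<eta>_bdd that l by auto
    then show ?thesis unfolding abs_mult by (intro mult_mono) auto
  qed
  have int2: "integrable M (\<lambda>\<omega>. \<eta> k l \<omega> * \<eta> i l \<omega>)" if "k < K" "i < K" for k i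
    using that bdd2[OF that] by (intro integrable_const_bound[where B = "C * C"]) auto
  have i2: "has_bochner_integral M (\<lambda>\<omega>. \<eta> k l \<omega> * \<eta> i l \<omega> * ?D k \<omega> * ?D i \<omega>)
      (if i = k then expectation (\<lambda>\<omega>. (\<eta> k l \<omega>)\<^sup>2) * (p (Suc l) - p l) else 0)" if "k < K" "i < K" for k i
  proof (cases "i = k")
    case True
    have "has_bochner_integral M (\<lambda>\<omega>. (\<eta> k l \<omega> * \<eta> k l \<omega>) * (?D k \<omega>)\<^sup>2)
      (expectation (\<lambda>\<omega>. \<eta> k l \<omega> * \<eta> k l \<omega>) * (p (Suc l) - p l))"
    proof (rule W_var[OF p _ int2[OF that(1) that(1)]])
      show "(\<lambda>\<omega>. \<eta> k l \<omega> * \<eta> k l \<omega>) \<in> borel_measurable (\<F> (p l))"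
        using \<eta>m[OF that(1)] by measurable
    qed
    then show ?thesis using True by (simp add: power2_eq_square mult_ac)
  next
    case False
    have "(\<lambda>\<omega>. \<eta> k l \<omega> * \<eta> i l \<omega>) \<in> borel_measurable (\<F> (p l))"
      using \<eta>m[OF that(1)] \<eta>m[OF that(2)] by measurable
    from W_cov[OF _ p this, of k i "C * C"] False bdd2[OF that] show ?thesis by auto
  qed
  have bi: "integrable M (\<lambda>\<omega>. (\<eta> k l \<omega>)\<^sup>2)" if "k < K" for k
    using int2[of k k] that by (auto simp: power2_eq_square)
  have "brk p K \<eta> (Suc l) = (\<lambda>\<omega>. brk p K \<eta> l \<omega> + (\<Sum>k<K. (\<eta> k l \<omega>)\<^sup>2 * (p (Suc l) - p l)))"
    by (auto simp: brk_def)
  moreover have "integrable M (brk p K \<eta> l)" using Suc by auto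
  ultimately have "has_bochner_integral M (brk p K \<eta> (Suc l)) (expectation (brk p K \<eta> l) +
        (\<Sum>k<K. expectation (\<lambda>\<omega>. (\<eta> k l \<omega>)\<^sup>2) * (p (Suc l) - p l)))"
    using bi by (auto intro!: has_bochner_integral_add has_bochner_integral_sum
      has_bochner_integral_mult_left has_bochner_integral_integrable)
  then have b: "integrable M (brk p K \<eta> (Suc l))"
      "expectation (brk p K \<eta> (Suc l)) = expectation (brk p K \<eta> l) +
        (\<Sum>k<K. expectation (\<lambda>\<omega>. (\<eta> k l \<omega>)\<^sup>2) * (p (Suc l) - p l))"
    by (auto simp: has_bochner_integral_iff)
  have "has_bochner_integral M (\<lambda>\<omega>. ?N (Suc l) \<omega> ^ 2) (expectation (brk p K \<eta> l) + 2 * (\<Sum>k<K. 0) +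
      (\<Sum>k<K. \<Sum>i<K. (if i = k then expectation (\<lambda>\<omega>. (\<eta> k l \<omega>)\<^sup>2) * (p (Suc l) - p l) else 0)))"
    unfolding eq using Suc i1 i2
    by (intro has_bochner_integral_add has_bochner_integral_mult_right has_bochner_integral_sum) auto
  then show ?case using b by simp
qed

end

lemma mart_maximal:
  fixes \<eta> :: "nat \<Rightarrow> nat \<Rightarrow> 'a \<Rightarrow> real" and C e d :: real
  assumes \<eta>_meas: "\<And>k j. k < K \<Longrightarrow> j < m \<Longrightarrow> \<eta> k j \<in> borel_measurable (\<F> (p j))"
    and \<eta>_bdd: "\<And>k j \<omega>. k < K \<Longrightarrow> j < m \<Longrightarrow> \<omega> \<in> space M \<Longrightarrow> \<bar>\<eta> k j \<omega>\<bar> \<le> C"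
    and e: "0 < e" and d: "0 \<le> d"
  shows "ennreal (e\<^sup>2) * emeasure M {\<omega> \<in> space M. (\<exists>l\<le>m. e < \<bar>mart p K \<eta> l \<omega>\<bar>) \<and> brk p K \<eta> m \<omega> \<le> d}
      \<le> (\<integral>\<^sup>+\<omega>. min (ennreal (brk p K \<eta> m \<omega>)) (ennreal d) \<partial>M)"
proof -
  \<comment> \<open>\<open>\<theta> j\<close> is 1 as long as the sum has not passed
    \<open>e\<close> up to \<open>p j\<close> and the bracket at \<open>p (Suc j)\<close> is within
    \<open>d\<close>. Both conditions are decided at time \<open>p j\<close>, so
    \<open>\<eta>'\<close> is again an admissible integrand.\<close>
  define \<theta> where "\<theta> j \<omega> = (if brk p K \<eta> (Suc j) \<omega> \<le> d \<and> (\<forall>l\<in>{..j}. \<bar>mart p K \<eta> l \<omega>\<bar> \<le> e) then 1 else 0 :: real)" for j \<omega>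
  define \<eta>' where "\<eta>' k j \<omega> = \<eta> k j \<omega> * \<theta> j \<omega>" for k j \<omega>
  have \<theta>_meas: "\<theta> j \<in> borel_measurable (\<F> (p j))" if j: "j < m" for j
  proof -
    have [measurable]: "brk p K \<eta> (Suc j) \<in> borel_measurable (\<F> (p j))"
      using brk_adapted[where \<eta> = \<eta>, OF \<eta>_meas \<eta>_bdd j] by auto
    have 1: "mart p K \<eta> l \<in> borel_measurable (\<F> (p j))" if "l \<in> {..j}" for l
      using mart_adapted[where \<eta> = \<eta> and l = l, OF \<eta>_meas \<eta>_bdd] that j p_le[of l j] p_nonneg[of l]
      by (auto elim!: measurable_F_mono)
    have 2: "Measurable.pred (\<F> (p j)) (\<lambda>\<omega>. \<forall>l\<in>{..j}. \<bar>mart p K \<eta> l \<omega>\<bar> \<le> e)"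
    proof (rule pred_intros_finite)
      fix l assume "l \<in> {..j}"
      from 1[OF this] show "Measurable.pred (\<F> (p j)) (\<lambda>\<omega>. \<bar>mart p K \<eta> l \<omega>\<bar> \<le> e)" by measurable
    qed simp
    show ?thesis unfolding \<theta>_def[abs_def] using 2 by measurable
  qed
  have m': "\<eta>' k j \<in> borel_measurable (\<F> (p j))" if "k < K" "j < m" for k j
    unfolding \<eta>'_def[abs_def] using \<eta>_meas[OF that] \<theta>_meas[OF that(2)] by measurable
  have b': "\<bar>\<eta>' k j \<omega>\<bar> \<le> C" if "k < K" "j < m" "\<omega> \<in> space M" for k j \<omega>
    using \<eta>_bdd[OF that] by (auto simp: \<eta>'_def \<theta>_def)
  let ?N = "mart p K \<eta>" and ?N' = "mart p K \<eta>'" and ?B = "brk p K \<eta>" and ?B' = "brk p K \<eta>'"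
  let ?A = "{\<omega> \<in> space M. (\<exists>l\<le>m. e < \<bar>?N l \<omega>\<bar>) \<and> ?B m \<omega> \<le> d}"
  have iso: "has_bochner_integral M (\<lambda>\<omega>. (?N' m \<omega>)\<^sup>2) (expectation (?B' m))" "integrable M (?B' m)"
    using mart_isometry[where \<eta> = \<eta>' and l = m, OF m' b'] by auto
  have B'_nonneg: "0 \<le> ?B' l \<omega>" if "l \<le> m" for l \<omega>
    unfolding brk_def using that p_mono by (auto intro!: sum_nonneg mult_nonneg_nonneg)
  have B_mono: "?B i \<omega> \<le> ?B j \<omega>" if "i \<le> j" "j \<le> m" for i j \<omega>
    unfolding brk_def using that p_mono
    by (intro sum_mono2) (auto intro!: sum_nonneg mult_nonneg_nonneg)
  have B'_le: "?B' l \<omega> \<le> ?B l \<omega> \<and> ?B' l \<omega> \<le> d" if "l \<le> m" for l \<omega>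
    using that
  proof (induction l)
    case 0 then show ?case using d by (simp add: brk_def)
  next
    case (Suc l)
    have S: "?B' (Suc l) \<omega> = ?B' l \<omega> + (\<Sum>k<K. (\<eta>' k l \<omega>)\<^sup>2 * (p (Suc l) - p l))"
        "?B (Suc l) \<omega> = ?B l \<omega> + (\<Sum>k<K. (\<eta> k l \<omega>)\<^sup>2 * (p (Suc l) - p l))"
      by (auto simp: brk_def)
    show ?case
    proof (cases "\<theta> l \<omega> = 0")
      case True
      then have "\<eta>' k l \<omega> = 0" for k by (simp add: \<eta>'_def)
      then show ?thesis using Suc S B_mono[of l "Suc l" \<omega>] by auto
    next
      case False
      then have "\<theta> l \<omega> = 1" "?B (Suc l) \<omega> \<le> d" by (auto simp: \<theta>_def split: if_splits)
      moreover from this have "\<eta>' k l \<omega> = \<eta> k l \<omega>" for k by (simp add: \<eta>'_def)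
      ultimately show ?thesis using Suc S by auto
    qed
  qed
  have NA: "e < \<bar>?N' m \<omega>\<bar>" if "\<omega> \<in> ?A" for \<omega>
  proof -
    define l where "l = (LEAST l. e < \<bar>?N l \<omega>\<bar>)"
    from that obtain l' where l': "l' \<le> m" "e < \<bar>?N l' \<omega>\<bar>" and d: "?B m \<omega> \<le> d" by auto
    have l: "e < \<bar>?N l \<omega>\<bar>" "l \<le> m"
      unfolding l_def using LeastI[of "\<lambda>l. e < \<bar>?N l \<omega>\<bar>", OF l'(2)] Least_le[of "\<lambda>l. e < \<bar>?N l \<omega>\<bar>", OF l'(2)] l'
      by auto
    have less: "\<bar>?N i \<omega>\<bar> \<le> e" if "i < l" for i
      using not_less_Least[of i "\<lambda>l. e < \<bar>?N l \<omega>\<bar>"] that by (auto simp: l_def)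
    have \<theta>: "\<theta> j \<omega> = (if j < l then 1 else 0)" if "j < m" for j
    proof (cases "j < l")
      case True
      have "?B (Suc j) \<omega> \<le> d" using B_mono[of "Suc j" m \<omega>] that d by auto
      then show ?thesis using True less by (auto simp: \<theta>_def)
    next
      case False
      then have "\<exists>i\<in>{..j}. \<not> \<bar>?N i \<omega>\<bar> \<le> e" using l(1) by (intro bexI[of _ l]) auto
      then show ?thesis using False by (auto simp: \<theta>_def)
    qed
    have "?N' m \<omega> = (\<Sum>j<m. if j < l then \<Sum>k<K. \<eta> k j \<omega> * (W k (p (Suc j)) \<omega> - W k (p j) \<omega>) else 0)"
      unfolding mart_def \<eta>'_def by (intro sum.cong) (auto simp: \<theta>)
    also have "\<dots> = (\<Sum>j\<in>{..<m} \<inter> {j. j < l}. \<Sum>k<K. \<eta> k j \<omega> * (W k (p (Suc j)) \<omega> - W k (p j) \<omega>))"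
      by (simp add: sum.If_cases)
    also have "{..<m} \<inter> {j. j < l} = {..<l}" using l by auto
    finally show ?thesis using l by (simp add: mart_def)
  qed
  have NM [measurable]: "?N' m \<in> borel_measurable M"
    using mart_adapted[where \<eta> = \<eta>' and l = m, OF m' b'] p_nonneg[of m] by (auto intro: measurable_F_M)
  have "ennreal (e\<^sup>2) * emeasure M ?A \<le> ennreal (e\<^sup>2) * emeasure M {\<omega> \<in> space M. e < \<bar>?N' m \<omega>\<bar>}"
    using NA by (intro mult_left_mono emeasure_mono) auto
  also have "\<dots> = (\<integral>\<^sup>+\<omega>. ennreal (e\<^sup>2) * indicator {\<omega> \<in> space M. e < \<bar>?N' m \<omega>\<bar>} \<omega> \<partial>M)"
    by (subst nn_integral_cmult) auto
  also have "\<dots> \<le> (\<integral>\<^sup>+\<omega>. ennreal ((?N' m \<omega>)\<^sup>2) \<partial>M)"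
    using e by (intro nn_integral_mono) (auto simp: indicator_def abs_le_square_iff[symmetric] intro!: ennreal_leI)
  also have "\<dots> = ennreal (expectation (?B' m))"
    using iso(1) by (subst nn_integral_eq_integral) (auto simp: has_bochner_integral_iff)
  also have "\<dots> = (\<integral>\<^sup>+\<omega>. ennreal (?B' m \<omega>) \<partial>M)"
    using iso(2) B'_nonneg by (subst nn_integral_eq_integral) auto
  also have "\<dots> \<le> (\<integral>\<^sup>+\<omega>. min (ennreal (?B m \<omega>)) (ennreal d) \<partial>M)"
    using B'_le[of m] by (intro nn_integral_mono) (auto intro!: ennreal_leI)
  finally show ?thesis .
qed

end

end

section \<open>Elementary integrals\<close>

definition qv :: "real \<Rightarrow> (nat \<Rightarrow> real \<Rightarrow> real) \<Rightarrow> ennreal" where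
  "qv r p = (\<Sum>k. \<integral>\<^sup>+s. ennreal ((p k s)\<^sup>2) * indicator {0<..r} s \<partial>lborel)"

definition supn :: "real \<Rightarrow> (real \<Rightarrow> real) \<Rightarrow> ennreal" where
  "supn T X = (\<Squnion>t\<in>{0..T}. ennreal \<bar>X t\<bar>)"

text \<open>By continuity, each value is a limit of values at times in the dense set. With a
  countable dense set this makes the supremum measurable and lets \<open>elem_maximal\<close> work
  with finitely many times.\<close>

lemma supn_dense:
  assumes X: "continuous_on {0..T} X" and S: "S \<subseteq> {0..T}" "{0..T} \<subseteq> closure S"
  shows "supn T X = (\<Squnion>t\<in>S. ennreal \<bar>X t\<bar>)"
  unfolding supn_def
proof (rule antisym)
  show "(\<Squnion>t\<in>{0..T}. ennreal \<bar>X t\<bar>) \<le> (\<Squnion>t\<in>S. ennreal \<bar>X t\<bar>)"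
  proof (rule SUP_least)
    fix t assume t: "t \<in> {0..T}"
    then have "t \<in> closure S" using S by auto
    then obtain s where s: "\<And>n. s n \<in> S" "s \<longlonglongrightarrow> t" by (auto simp: closure_sequential)
    have "(\<lambda>n. X (s n)) \<longlonglongrightarrow> X t"
      using X s t S by (auto simp: continuous_on_sequentially o_def subset_eq)
    then have "(\<lambda>n. ennreal \<bar>X (s n)\<bar>) \<longlonglongrightarrow> ennreal \<bar>X t\<bar>"
      by (intro tendsto_ennrealI tendsto_rabs)
    then show "ennreal \<bar>X t\<bar> \<le> (\<Squnion>t\<in>S. ennreal \<bar>X t\<bar>)"
      by (rule LIMSEQ_le_const2) (use s in \<open>auto intro!: SUP_upper\<close>)
  qed
  show "(\<Squnion>t\<in>S. ennreal \<bar>X t\<bar>) \<le> (\<Squnion>t\<in>{0..T}. ennreal \<bar>X t\<bar>)"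
    using S by (intro SUP_subset_mono) auto
qed

lemma supn_measurable:
  assumes X: "\<And>\<omega>. \<omega> \<in> space N \<Longrightarrow> continuous_on {0..T} (\<lambda>t. X t \<omega>)"
    and m: "\<And>t. t \<in> {0..T} \<Longrightarrow> X t \<in> borel_measurable N"
  shows "(\<lambda>\<omega>. supn T (\<lambda>t. X t \<omega>)) \<in> borel_measurable N"
proof -
  obtain S where S: "countable S" "S \<subseteq> {0..T}" "{0..T} \<subseteq> closure S" by (rule separable)
  have "(\<lambda>\<omega>. \<Squnion>t\<in>S. ennreal \<bar>X t \<omega>\<bar>) \<in> borel_measurable N"
    using S m by (intro borel_measurable_SUP) (auto intro!: measurable_compose[OF _ measurable_ennreal] borel_measurable_abs)
  then show ?thesis
    by (rule subst[OF measurable_cong, of N, rotated, where P = "\<lambda>x. x"]) (use X S supn_dense in auto)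
qed

lemma supn_add_le: "supn T (\<lambda>t. X t + Y t) \<le> supn T X + supn T Y"
  unfolding supn_def
proof (rule SUP_least)
  fix t assume t: "t \<in> {0..T}"
  have "ennreal \<bar>X t + Y t\<bar> \<le> ennreal \<bar>X t\<bar> + ennreal \<bar>Y t\<bar>"
    by (subst ennreal_plus[symmetric]) (auto intro!: ennreal_leI simp del: ennreal_plus)
  also have "\<dots> \<le> (\<Squnion>t\<in>{0..T}. ennreal \<bar>X t\<bar>) + (\<Squnion>t\<in>{0..T}. ennreal \<bar>Y t\<bar>)"
    using t by (intro add_mono SUP_upper) auto
  finally show "ennreal \<bar>X t + Y t\<bar> \<le> \<dots>" .
qed

lemma supn_minus: "supn T (\<lambda>t. - X t) = supn T X"
  by (simp add: supn_def)

lemma supn_diff_le: "supn T (\<lambda>t. X t - Y t) \<le> supn T X + supn T Y"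
  using supn_add_le[of T X "\<lambda>t. - Y t"] by (simp add: supn_minus)

lemma supn_cong: "(\<And>t. 0 \<le> t \<Longrightarrow> t \<le> T \<Longrightarrow> X t = Y t) \<Longrightarrow> supn T X = supn T Y"
  unfolding supn_def by (intro SUP_cong) auto

lemma supn_zero [simp]: "0 \<le> T \<Longrightarrow> supn T (\<lambda>_. 0) = 0"
  by (simp add: supn_def)

lemma supn_upper: "0 \<le> t \<Longrightarrow> t \<le> T \<Longrightarrow> ennreal \<bar>X t\<bar> \<le> supn T X"
  unfolding supn_def by (intro SUP_upper) auto

lemma supn_eq_0: "0 \<le> T \<Longrightarrow> supn T X = 0 \<longleftrightarrow> (\<forall>t\<in>{0..T}. X t = 0)"
  unfolding supn_def by (auto simp: SUP_eq_iff bot_ennreal)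

lemma qv_measurable:
  assumes "\<And>k. (\<lambda>(\<omega>, s). f k s \<omega>) \<in> borel_measurable (N \<Otimes>\<^sub>M borel)"
  shows "(\<lambda>\<omega>. qv r (\<lambda>k s. f k s \<omega>)) \<in> borel_measurable N"
proof -
  have [measurable]: "(\<lambda>x. f k (snd x) (fst x)) \<in> borel_measurable (N \<Otimes>\<^sub>M lborel)" for k
    using assms[of k] by (simp add: case_prod_beta' cong: measurable_cong_sets)
  have "(\<lambda>\<omega>. \<integral>\<^sup>+s. ennreal ((f k s \<omega>)\<^sup>2) * indicator {0<..r} s \<partial>lborel) \<in> borel_measurable N" for k
    by (rule lborel.borel_measurable_nn_integral) (simp add: case_prod_beta')
  then show ?thesis unfolding qv_def by measurable
qed

lemma qv_mono_r: "r \<le> r' \<Longrightarrow> qv r p \<le> qv r' p"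
  unfolding qv_def by (intro suminf_le nn_integral_mono) (auto simp: indicator_def)

lemma qv_mono:
  "(\<And>k s. 0 < s \<Longrightarrow> s \<le> r \<Longrightarrow> \<bar>p k s\<bar> \<le> \<bar>q k s\<bar>) \<Longrightarrow> qv r p \<le> qv r q"
  unfolding qv_def
  by (intro suminf_le nn_integral_mono) (auto simp: indicator_def abs_le_square_iff intro!: ennreal_leI)

lemma qv_cong:
  "(\<And>k s. 0 < s \<Longrightarrow> s \<le> r \<Longrightarrow> p k s = q k s) \<Longrightarrow> qv r p = qv r q"
  by (intro antisym qv_mono) auto

lemma qv_zero [simp]: "qv r (\<lambda>_ _. 0) = 0"
  by (simp add: qv_def)

lemma sum_square_le: "(a + b)\<^sup>2 \<le> 2 * a\<^sup>2 + 2 * (b::real)\<^sup>2"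
  using sum_squares_bound[of a b] by (simp add: power2_sum)

text \<open>From (a + b)^2 \<le> 2 a^2 + 2 b^2 at every k and s. This weak triangle inequality acts
  directly on squares in \<open>ennreal\<close>; its factor reappears on the right of
  \<open>vito_maximal\<close>.\<close>

lemma qv_add_le:
  assumes [measurable]: "\<And>k. p k \<in> borel_measurable borel" "\<And>k. q k \<in> borel_measurable borel"
  shows "qv r (\<lambda>k s. p k s + q k s) \<le> 2 * qv r p + 2 * qv r q"
proof -
  let ?I = "\<lambda>p k. \<integral>\<^sup>+s. ennreal ((p k s)\<^sup>2) * indicator {0<..r} s \<partial>lborel"
  have "qv r (\<lambda>k s. p k s + q k s) \<le> (\<Sum>k. 2 * ?I p k + 2 * ?I q k)"
    unfolding qv_def
  proof (intro suminf_le)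
    fix k
    have "ennreal ((p k s + q k s)\<^sup>2) \<le> 2 * ennreal ((p k s)\<^sup>2) + 2 * ennreal ((q k s)\<^sup>2)" for s
    proof -
      have "ennreal ((p k s + q k s)\<^sup>2) \<le> ennreal (2 * (p k s)\<^sup>2 + 2 * (q k s)\<^sup>2)"
        by (intro ennreal_leI sum_square_le)
      also have "\<dots> = 2 * ennreal ((p k s)\<^sup>2) + 2 * ennreal ((q k s)\<^sup>2)"
        by (subst ennreal_plus) (auto simp: ennreal_mult)
      finally show ?thesis .
    qed
    then have "?I (\<lambda>k s. p k s + q k s) k \<le> (\<integral>\<^sup>+s. 2 * (ennreal ((p k s)\<^sup>2) * indicator {0<..r} s)
        + 2 * (ennreal ((q k s)\<^sup>2) * indicator {0<..r} s) \<partial>lborel)"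
      by (intro nn_integral_mono) (auto simp: indicator_def)
    also have "\<dots> = 2 * ?I p k + 2 * ?I q k"
      by (subst nn_integral_add) (auto simp: nn_integral_cmult)
    finally show "?I (\<lambda>k s. p k s + q k s) k \<le> 2 * ?I p k + 2 * ?I q k" .
  qed auto
  also have "\<dots> = 2 * qv r p + 2 * qv r q"
    unfolding qv_def by (subst suminf_add[symmetric]) (auto simp: ennreal_suminf_cmult)
  finally show ?thesis .
qed

lemma qv_minus: "qv r (\<lambda>k s. - p k s) = qv r p"
  by (simp add: qv_def)

lemma qv_diff_le:
  assumes "\<And>k. p k \<in> borel_measurable borel" "\<And>k. q k \<in> borel_measurable borel"
  shows "qv r (\<lambda>k s. p k s - q k s) \<le> 2 * qv r p + 2 * qv r q"
  using qv_add_le[of p "\<lambda>k s. - q k s" r] assms by (simp add: qv_minus)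

section \<open>Continuous adapted processes and elementary integrands\<close>

context wiener_system
begin

text \<open>Joint measurability makes \<open>qv\<close> a random variable; adaptedness enters
  through the elementary integrands that approximate \<open>f\<close>.\<close>

definition fmeas :: "(nat \<Rightarrow> real \<Rightarrow> 'a \<Rightarrow> real) \<Rightarrow> bool" where
  "fmeas f \<longleftrightarrow> (\<forall>k. (\<lambda>(\<omega>, s). f k s \<omega>) \<in> borel_measurable (M \<Otimes>\<^sub>M borel))"

lemma fmeas_path: "fmeas f \<Longrightarrow> \<omega> \<in> space M \<Longrightarrow> (\<lambda>s. f k s \<omega>) \<in> borel_measurable borel"
  unfolding fmeas_def using measurable_Pair2[of "\<lambda>(\<omega>, s). f k s \<omega>" M borel borel \<omega>] by auto

lemma fmeas_add:
  assumes "fmeas f" "fmeas g" shows "fmeas (\<lambda>k s \<omega>. f k s \<omega> + g k s \<omega>)"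
  unfolding fmeas_def
proof
  fix k
  have [measurable]: "(\<lambda>(\<omega>, s). f k s \<omega>) \<in> borel_measurable (M \<Otimes>\<^sub>M borel)"
    "(\<lambda>(\<omega>, s). g k s \<omega>) \<in> borel_measurable (M \<Otimes>\<^sub>M borel)"
    using assms by (simp_all add: fmeas_def)
  show "(\<lambda>(\<omega>, s). f k s \<omega> + g k s \<omega>) \<in> borel_measurable (M \<Otimes>\<^sub>M borel)" by measurable
qed

lemma fmeas_scale:
  assumes "fmeas f" shows "fmeas (\<lambda>k s \<omega>. c * f k s \<omega>)"
  unfolding fmeas_def
proof
  fix k
  have [measurable]: "(\<lambda>(\<omega>, s). f k s \<omega>) \<in> borel_measurable (M \<Otimes>\<^sub>M borel)"
    using assms by (simp add: fmeas_def)
  show "(\<lambda>(\<omega>, s). c * f k s \<omega>) \<in> borel_measurable (M \<Otimes>\<^sub>M borel)" by measurable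
qed

lemma fmeas_diff:
  assumes "fmeas f" "fmeas g" shows "fmeas (\<lambda>k s \<omega>. f k s \<omega> - g k s \<omega>)"
  using fmeas_add[OF assms(1) fmeas_scale[OF assms(2), of "-1"]] by simp

lemma fmeas_qv [measurable]: "fmeas f \<Longrightarrow> (\<lambda>\<omega>. qv r (\<lambda>k s. f k s \<omega>)) \<in> borel_measurable M"
  unfolding fmeas_def by (rule qv_measurable) auto

definition cadapted :: "(real \<Rightarrow> 'a \<Rightarrow> real) \<Rightarrow> bool" where
  "cadapted X \<longleftrightarrow> (\<forall>\<omega>\<in>space M. continuous_on {0..T} (\<lambda>t. X t \<omega>)) \<and>
    (\<forall>t\<in>{0..T}. X t \<in> borel_measurable (\<F> t))"

lemma cadapted_measurable: "cadapted X \<Longrightarrow> 0 \<le> t \<Longrightarrow> t \<le> T \<Longrightarrow> X t \<in> borel_measurable M"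
  unfolding cadapted_def using measurable_F_M[of "X t" t] by simp

lemma cadapted_supn [measurable]: "cadapted X \<Longrightarrow> (\<lambda>\<omega>. supn T (\<lambda>t. X t \<omega>)) \<in> borel_measurable M"
  by (rule supn_measurable) (simp add: cadapted_def, simp add: cadapted_measurable)

lemma cadaptedI:
  assumes "\<And>\<omega>. \<omega> \<in> space M \<Longrightarrow> continuous_on {0..T} (\<lambda>t. X t \<omega>)"
    and "\<And>t. 0 \<le> t \<Longrightarrow> t \<le> T \<Longrightarrow> X t \<in> borel_measurable (\<F> t)"
  shows "cadapted X"
  using assms by (simp add: cadapted_def)

lemma cadaptedD:
  assumes "cadapted X"
  shows "\<omega> \<in> space M \<Longrightarrow> continuous_on {0..T} (\<lambda>t. X t \<omega>)"
    and "0 \<le> t \<Longrightarrow> t \<le> T \<Longrightarrow> X t \<in> borel_measurable (\<F> t)"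
  using assms by (simp_all add: cadapted_def)

lemma cadapted_add:
  assumes X: "cadapted X" and Y: "cadapted Y" shows "cadapted (\<lambda>t \<omega>. X t \<omega> + Y t \<omega>)"
proof (rule cadaptedI)
  show "continuous_on {0..T} (\<lambda>t. X t \<omega> + Y t \<omega>)" if "\<omega> \<in> space M" for \<omega>
    using cadaptedD(1)[OF X that] cadaptedD(1)[OF Y that] by (rule continuous_on_add)
  show "(\<lambda>\<omega>. X t \<omega> + Y t \<omega>) \<in> borel_measurable (\<F> t)" if "0 \<le> t" "t \<le> T" for t
    using cadaptedD(2)[OF X that] cadaptedD(2)[OF Y that] by (rule borel_measurable_add)
qed

lemma cadapted_scale:
  assumes X: "cadapted X" shows "cadapted (\<lambda>t \<omega>. c * X t \<omega>)"
proof (rule cadaptedI)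
  show "continuous_on {0..T} (\<lambda>t. c * X t \<omega>)" if "\<omega> \<in> space M" for \<omega>
    using cadaptedD(1)[OF X that] by (rule continuous_on_mult_left)
  show "(\<lambda>\<omega>. c * X t \<omega>) \<in> borel_measurable (\<F> t)" if "0 \<le> t" "t \<le> T" for t
    using cadaptedD(2)[OF X that] by measurable
qed

lemma cadapted_diff:
  assumes "cadapted X" "cadapted Y" shows "cadapted (\<lambda>t \<omega>. X t \<omega> - Y t \<omega>)"
  using cadapted_add[OF assms(1) cadapted_scale[OF assms(2), of "-1"]] by simp

text \<open>
  An elementary integrand is described by its behaviour on intervals that avoid a finite set \<open>E\<close>,
  instead of by a partition: sums of elementary integrands then need no common refinement.
\<close>

definition elem_on :: "nat \<Rightarrow> real set \<Rightarrow> (nat \<Rightarrow> real \<Rightarrow> 'a \<Rightarrow> real) \<Rightarrow> (real \<Rightarrow> 'a \<Rightarrow> real) \<Rightarrow> bool" where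
  "elem_on K E f I \<longleftrightarrow>
     (\<forall>k\<ge>K. \<forall>s \<omega>. f k s \<omega> = 0) \<and>
     (\<forall>p q. 0 \<le> p \<longrightarrow> p < q \<longrightarrow> q \<le> T \<longrightarrow> E \<inter> {p<..<q} = {} \<longrightarrow>
       (\<forall>k. f k q \<in> borel_measurable (\<F> p)) \<and>
       (\<forall>k. \<forall>s\<in>{p<..q}. \<forall>\<omega>. f k s \<omega> = f k q \<omega>) \<and>
       (\<forall>\<omega>. I q \<omega> - I p \<omega> = (\<Sum>k<K. f k q \<omega> * (W k q \<omega> - W k p \<omega>))))"

definition elem :: "(nat \<Rightarrow> real \<Rightarrow> 'a \<Rightarrow> real) \<Rightarrow> (real \<Rightarrow> 'a \<Rightarrow> real) \<Rightarrow> bool" where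
  "elem f I \<longleftrightarrow> fmeas f \<and> cadapted I \<and> (\<forall>\<omega>. I 0 \<omega> = 0) \<and>
     (\<exists>C. \<forall>k s. \<forall>\<omega>\<in>space M. \<bar>f k s \<omega>\<bar> \<le> C) \<and>
     (\<exists>K E. finite E \<and> E \<subseteq> {0..T} \<and> elem_on K E f I)"

lemma elem_onD:
  assumes f: "elem_on K E f I"
  shows "K \<le> k \<Longrightarrow> f k s \<omega> = 0"
    and "0 \<le> p \<Longrightarrow> p < q \<Longrightarrow> q \<le> T \<Longrightarrow> E \<inter> {p<..<q} = {} \<Longrightarrow> f k q \<in> borel_measurable (\<F> p)"
    and "0 \<le> p \<Longrightarrow> p < q \<Longrightarrow> q \<le> T \<Longrightarrow> E \<inter> {p<..<q} = {} \<Longrightarrow> s \<in> {p<..q} \<Longrightarrow> f k s \<omega> = f k q \<omega>"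
    and "0 \<le> p \<Longrightarrow> p < q \<Longrightarrow> q \<le> T \<Longrightarrow> E \<inter> {p<..<q} = {} \<Longrightarrow>
      I q \<omega> - I p \<omega> = (\<Sum>k<K. f k q \<omega> * (W k q \<omega> - W k p \<omega>))"
proof -
  note D = f[unfolded elem_on_def]
  show "K \<le> k \<Longrightarrow> f k s \<omega> = 0" by (rule D[THEN conjunct1, rule_format])
  show "0 \<le> p \<Longrightarrow> p < q \<Longrightarrow> q \<le> T \<Longrightarrow> E \<inter> {p<..<q} = {} \<Longrightarrow> f k q \<in> borel_measurable (\<F> p)"
    by (rule D[THEN conjunct2, rule_format, THEN conjunct1, rule_format])
  show "0 \<le> p \<Longrightarrow> p < q \<Longrightarrow> q \<le> T \<Longrightarrow> E \<inter> {p<..<q} = {} \<Longrightarrow> s \<in> {p<..q} \<Longrightarrow> f k s \<omega> = f k q \<omega>"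
    by (rule D[THEN conjunct2, rule_format, THEN conjunct2, THEN conjunct1, rule_format])
  show "0 \<le> p \<Longrightarrow> p < q \<Longrightarrow> q \<le> T \<Longrightarrow> E \<inter> {p<..<q} = {} \<Longrightarrow>
      I q \<omega> - I p \<omega> = (\<Sum>k<K. f k q \<omega> * (W k q \<omega> - W k p \<omega>))"
    by (rule D[THEN conjunct2, rule_format, THEN conjunct2, THEN conjunct2, rule_format])
qed

lemma elem_onI:
  assumes "\<And>k s \<omega>. K \<le> k \<Longrightarrow> f k s \<omega> = 0"
    and "\<And>p q k. 0 \<le> p \<Longrightarrow> p < q \<Longrightarrow> q \<le> T \<Longrightarrow> E \<inter> {p<..<q} = {} \<Longrightarrow> f k q \<in> borel_measurable (\<F> p)"
    and "\<And>p q k s \<omega>. 0 \<le> p \<Longrightarrow> p < q \<Longrightarrow> q \<le> T \<Longrightarrow> E \<inter> {p<..<q} = {} \<Longrightarrow> s \<in> {p<..q} \<Longrightarrow> f k s \<omega> = f k q \<omega>"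
    and "\<And>p q \<omega>. 0 \<le> p \<Longrightarrow> p < q \<Longrightarrow> q \<le> T \<Longrightarrow> E \<inter> {p<..<q} = {} \<Longrightarrow>
      I q \<omega> - I p \<omega> = (\<Sum>k<K. f k q \<omega> * (W k q \<omega> - W k p \<omega>))"
  shows "elem_on K E f I"
  unfolding elem_on_def by (intro conjI allI impI ballI) (rule assms; assumption)+

lemma elemI:
  assumes "fmeas f" "cadapted I" "\<And>\<omega>. I 0 \<omega> = 0" "\<And>k s \<omega>. \<omega> \<in> space M \<Longrightarrow> \<bar>f k s \<omega>\<bar> \<le> C"
    "finite E" "E \<subseteq> {0..T}" "elem_on K E f I"
  shows "elem f I"
  unfolding elem_def using assms(1,2,3) by (intro conjI exI[of _ C] exI[of _ K] exI[of _ E]) (use assms in auto)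

lemma elemE:
  assumes "elem f I"
  obtains C K E where "fmeas f" "cadapted I" "\<And>\<omega>. I 0 \<omega> = 0"
    "\<And>k s \<omega>. \<omega> \<in> space M \<Longrightarrow> \<bar>f k s \<omega>\<bar> \<le> C"
    "finite E" "E \<subseteq> {0..T}" "elem_on K E f I"
proof -
  from assms obtain C K E where "fmeas f" "cadapted I" "\<forall>\<omega>. I 0 \<omega> = 0"
    "\<forall>k s. \<forall>\<omega>\<in>space M. \<bar>f k s \<omega>\<bar> \<le> C" "finite E" "E \<subseteq> {0..T}" "elem_on K E f I"
    unfolding elem_def by (elim conjE exE)
  then show ?thesis by (intro that[of C E K]) simp_all
qed

text \<open>A larger \<open>K\<close> adds zero terms and a larger \<open>E\<close> leaves fewer
  intervals to test, so two integrands can be given the same parameters before they are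
  added.\<close>

lemma elem_on_mono:
  assumes f: "elem_on K E f I" and "K \<le> K'" and "E \<subseteq> E'"
  shows "elem_on K' E' f I"
proof (rule elem_onI)
  fix p q :: real assume pq: "0 \<le> p" "p < q" "q \<le> T" "E' \<inter> {p<..<q} = {}"
  then have E: "E \<inter> {p<..<q} = {}" using assms by auto
  note D = elem_onD[OF f]
  show "f k q \<in> borel_measurable (\<F> p)" for k using D(2)[OF pq(1-3) E] .
  show "f k s \<omega> = f k q \<omega>" if "s \<in> {p<..q}" for k s \<omega> using D(3)[OF pq(1-3) E that] .
  have "(\<Sum>k<K'. f k q \<omega> * (W k q \<omega> - W k p \<omega>)) = (\<Sum>k<K. f k q \<omega> * (W k q \<omega> - W k p \<omega>))" for \<omega>
    using assms D(1) by (intro sum.mono_neutral_right) auto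
  then show "I q \<omega> - I p \<omega> = (\<Sum>k<K'. f k q \<omega> * (W k q \<omega> - W k p \<omega>))" for \<omega>
    using D(4)[OF pq(1-3) E, of \<omega>] by simp
qed (use assms elem_onD(1)[OF f] in auto)

lemma elem_zero: "elem (\<lambda>k s \<omega>. 0) (\<lambda>t \<omega>. 0)"
  by (rule elemI[of _ _ 0 "{}" 0]) (simp_all add: fmeas_def cadapted_def elem_on_def)

lemma elem_scale:
  assumes "elem f I"
  shows "elem (\<lambda>k s \<omega>. c * f k s \<omega>) (\<lambda>t \<omega>. c * I t \<omega>)"
  using assms
proof (rule elemE)
  fix C K E assume f: "fmeas f" "cadapted I" "\<And>\<omega>. I 0 \<omega> = 0"
    "\<And>k s \<omega>. \<omega> \<in> space M \<Longrightarrow> \<bar>f k s \<omega>\<bar> \<le> C" "finite E" "E \<subseteq> {0..T}" "elem_on K E f I"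
  note D = elem_onD[OF f(7)]
  show ?thesis
  proof (rule elemI[OF fmeas_scale[OF f(1)] cadapted_scale[OF f(2)] _ _ f(5,6), where C = "\<bar>c\<bar> * C" and K = K])
    show "\<bar>c * f k s \<omega>\<bar> \<le> \<bar>c\<bar> * C" if "\<omega> \<in> space M" for k s \<omega>
      using f(4)[OF that] by (simp add: abs_mult mult_left_mono)
    show "elem_on K E (\<lambda>k s \<omega>. c * f k s \<omega>) (\<lambda>t \<omega>. c * I t \<omega>)"
    proof (rule elem_onI)
      fix p q :: real assume pq: "0 \<le> p" "p < q" "q \<le> T" "E \<inter> {p<..<q} = {}"
      show "(\<lambda>\<omega>. c * f k q \<omega>) \<in> borel_measurable (\<F> p)" for k
        using D(2)[OF pq, of k] by measurable
      show "c * f k s \<omega> = c * f k q \<omega>" if "s \<in> {p<..q}" for k s \<omega> using D(3)[OF pq that] by simp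
      show "c * I q \<omega> - c * I p \<omega> = (\<Sum>k<K. c * f k q \<omega> * (W k q \<omega> - W k p \<omega>))" for \<omega>
        using arg_cong[OF D(4)[OF pq, of \<omega>], of "\<lambda>x. c * x"]
        by (simp only: right_diff_distrib sum_distrib_left mult.assoc)
    qed (simp add: D(1))
  qed (simp add: f(3))
qed

lemma elem_add:
  assumes "elem f I" "elem g J"
  shows "elem (\<lambda>k s \<omega>. f k s \<omega> + g k s \<omega>) (\<lambda>t \<omega>. I t \<omega> + J t \<omega>)"
  using assms(1)
proof (rule elemE)
  fix C K E assume f: "fmeas f" "cadapted I" "\<And>\<omega>. I 0 \<omega> = 0"
    "\<And>k s \<omega>. \<omega> \<in> space M \<Longrightarrow> \<bar>f k s \<omega>\<bar> \<le> C" "finite E" "E \<subseteq> {0..T}" "elem_on K E f I"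
  show ?thesis
    using assms(2)
  proof (rule elemE)
    fix C' K' E' assume g: "fmeas g" "cadapted J" "\<And>\<omega>. J 0 \<omega> = 0"
      "\<And>k s \<omega>. \<omega> \<in> space M \<Longrightarrow> \<bar>g k s \<omega>\<bar> \<le> C'" "finite E'" "E' \<subseteq> {0..T}" "elem_on K' E' g J"
    let ?K = "max K K'" and ?E = "E \<union> E'"
    have F: "elem_on ?K ?E f I" using f(7) by (rule elem_on_mono) auto
    have G: "elem_on ?K ?E g J" using g(7) by (rule elem_on_mono) auto
    show ?thesis
    proof (rule elemI[OF fmeas_add[OF f(1) g(1)] cadapted_add[OF f(2) g(2)], where C = "C + C'" and K = ?K and E = ?E])
      show "\<bar>f k s \<omega> + g k s \<omega>\<bar> \<le> C + C'" if "\<omega> \<in> space M" for k s \<omega>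
        using f(4)[OF that, of k s] g(4)[OF that, of k s] by simp
      show "elem_on ?K ?E (\<lambda>k s \<omega>. f k s \<omega> + g k s \<omega>) (\<lambda>t \<omega>. I t \<omega> + J t \<omega>)"
      proof (rule elem_onI)
        fix p q :: real assume pq: "0 \<le> p" "p < q" "q \<le> T" "?E \<inter> {p<..<q} = {}"
        show "(\<lambda>\<omega>. f k q \<omega> + g k q \<omega>) \<in> borel_measurable (\<F> p)" for k
          using elem_onD(2)[OF F pq, of k] elem_onD(2)[OF G pq, of k] by measurable
        show "f k s \<omega> + g k s \<omega> = f k q \<omega> + g k q \<omega>" if "s \<in> {p<..q}" for k s \<omega>
          using elem_onD(3)[OF F pq that] elem_onD(3)[OF G pq that] by simp
        show "I q \<omega> + J q \<omega> - (I p \<omega> + J p \<omega>) =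
            (\<Sum>k<?K. (f k q \<omega> + g k q \<omega>) * (W k q \<omega> - W k p \<omega>))" for \<omega>
        proof -
          have "I q \<omega> + J q \<omega> - (I p \<omega> + J p \<omega>) = (I q \<omega> - I p \<omega>) + (J q \<omega> - J p \<omega>)" by simp
          then show ?thesis
            by (simp only: elem_onD(4)[OF F pq] elem_onD(4)[OF G pq] distrib_right sum.distrib)
        qed
      qed (simp add: elem_onD(1)[OF F] elem_onD(1)[OF G])
      show "E \<union> E' \<subseteq> {0..T}" using f(6) g(6) by (rule Un_least)
    qed (simp_all add: f(3,5) g(3,5))
  qed
qed

lemma elem_diff:
  assumes "elem f I" "elem g J"
  shows "elem (\<lambda>k s \<omega>. f k s \<omega> - g k s \<omega>) (\<lambda>t \<omega>. I t \<omega> - J t \<omega>)"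
  using elem_add[OF assms(1) elem_scale[OF assms(2), of "-1"]] by simp

lemma elem_sum:
  assumes "finite A" "\<And>i. i \<in> A \<Longrightarrow> elem (f i) (I i)"
  shows "elem (\<lambda>k s \<omega>. \<Sum>i\<in>A. f i k s \<omega>) (\<lambda>t \<omega>. \<Sum>i\<in>A. I i t \<omega>)"
  using assms
proof (induction A rule: finite_induct)
  case empty
  then show ?case using elem_zero by simp
next
  case (insert i A)
  then show ?case using elem_add[of "f i" "I i"] by simp
qed

text \<open>The building block: the grid approximations, their means over the parameter and the
  elementary integrands of the Ito integral are all finite sums of these.\<close>

lemma elem_single:
  assumes ab: "0 \<le> a" "a \<le> b" "b \<le> T" and \<xi>: "\<xi> \<in> borel_measurable (\<F> a)"
    and bdd: "\<And>\<omega>. \<omega> \<in> space M \<Longrightarrow> \<bar>\<xi> \<omega>\<bar> \<le> C"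
  shows "elem (\<lambda>k s \<omega>. if k = k0 then \<xi> \<omega> * indicator {a<..b} s else 0)
    (\<lambda>t \<omega>. \<xi> \<omega> * (W k0 (min t b) \<omega> - W k0 (min t a) \<omega>))" (is "elem ?f ?I")
proof -
  have \<xi>M [measurable]: "\<xi> \<in> borel_measurable M" using \<xi> ab(1) by (rule measurable_F_M)
  have "fmeas ?f" unfolding fmeas_def case_prod_beta' by measurable
  moreover have "cadapted ?I" unfolding cadapted_def
  proof (intro conjI ballI)
    fix \<omega> assume \<omega>: "\<omega> \<in> space M"
    have "continuous_on {0..T} (\<lambda>t. W k0 (min t c) \<omega>)" if "0 \<le> c" for c
      by (rule continuous_on_compose2[OF W_cont[OF \<omega>]]) (use that in \<open>auto intro!: continuous_intros\<close>)
    then show "continuous_on {0..T} (\<lambda>t. \<xi> \<omega> * (W k0 (min t b) \<omega> - W k0 (min t a) \<omega>))"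
      using ab by (intro continuous_intros) auto
  next
    fix t assume t: "t \<in> {0..T}"
    show "(\<lambda>\<omega>. \<xi> \<omega> * (W k0 (min t b) \<omega> - W k0 (min t a) \<omega>)) \<in> borel_measurable (\<F> t)"
    proof (cases "t \<le> a")
      case True
      then have "min t b = t" "min t a = t" using ab by auto
      then show ?thesis by simp
    next
      case False
      have 1: "\<xi> \<in> borel_measurable (\<F> t)" using \<xi> ab False by (auto elim!: measurable_F_mono)
      have 2: "W k0 (min t c) \<in> borel_measurable (\<F> t)" if "0 \<le> c" for c
        using W_adapted[of "min t c" k0] that t by (auto elim!: measurable_F_mono)
      show ?thesis using 1 2[of a] 2[of b] ab by (intro borel_measurable_times borel_measurable_diff) auto
    qed
  qed
  moreover have "\<bar>?f k s \<omega>\<bar> \<le> max C 0" if "\<omega> \<in> space M" for k s \<omega>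
    using bdd[OF that] by (auto simp: indicator_def)
  moreover have "elem_on (Suc k0) {a, b} ?f ?I"
  proof (rule elem_onI)
    fix p q :: real assume pq: "0 \<le> p" "p < q" "q \<le> T" "{a, b} \<inter> {p<..<q} = {}"
    have a: "a \<le> p \<or> q \<le> a" and b: "b \<le> p \<or> q \<le> b" using pq by auto
    show "?f k q \<in> borel_measurable (\<F> p)" for k
    proof (cases "a < q \<and> q \<le> b")
      case True
      then have "\<xi> \<in> borel_measurable (\<F> p)" using a \<xi> ab by (auto elim!: measurable_F_mono)
      then show ?thesis by measurable
    next
      case False
      then have "?f k q = (\<lambda>\<omega>. 0)" by (auto simp: indicator_def)
      then show ?thesis by simp
    qed
    show "?f k s \<omega> = ?f k q \<omega>" if "s \<in> {p<..q}" for k s \<omega> using a b that by (auto simp: indicator_def)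
    show "?I q \<omega> - ?I p \<omega> = (\<Sum>k<Suc k0. ?f k q \<omega> * (W k q \<omega> - W k p \<omega>))" for \<omega>
    proof -
      have "(\<Sum>k<Suc k0. ?f k q \<omega> * (W k q \<omega> - W k p \<omega>)) =
          \<xi> \<omega> * indicator {a<..b} q * (W k0 q \<omega> - W k0 p \<omega>)"
        by simp
      moreover have "?I q \<omega> - ?I p \<omega> = \<xi> \<omega> * indicator {a<..b} q * (W k0 q \<omega> - W k0 p \<omega>)"
      proof -
        \<comment> \<open>An interval from \<open>p\<close> to \<open>q\<close> whose interior
          avoids \<open>a\<close> and \<open>b\<close> lies before \<open>a\<close>, between the
          two, or after \<open>b\<close>.\<close>
        consider "q \<le> a" | "a \<le> p" "q \<le> b" | "b \<le> p" using a b pq ab by fastforce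
        then show ?thesis
        proof cases
          case 1
          then have "min q b = q" "min p b = p" "min q a = q" "min p a = p" using pq ab by auto
          then show ?thesis using 1 by (simp add: indicator_def)
        next
          case 2
          then have "min q b = q" "min p b = p" "min q a = a" "min p a = a" using pq ab by auto
          then show ?thesis using 2 pq by (simp add: indicator_def algebra_simps)
        next
          case 3
          then have "min q b = b" "min p b = b" "min q a = a" "min p a = a" using pq ab by auto
          then show ?thesis using 3 pq by (simp add: indicator_def)
        qed
      qed
      ultimately show ?thesis by simp
    qed
  qed auto
  moreover have "{a, b} \<subseteq> {0..T}" using ab by auto
  moreover have "?I 0 \<omega> = 0" for \<omega> using ab by simp
  ultimately show ?thesis by (intro elemI[where C = "max C 0" and K = "Suc k0" and E = "{a, b}"]) auto
qed

text \<open>Carries \<open>mart_maximal\<close> over to elementary integrands: along a partition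
  whose open cells avoid \<open>E\<close>, integral and bracket are exactly the discrete ones. The
  coefficient of a cell is the value at its right end, which by \<open>elem_on\<close> holds on the
  whole half-open cell and is known at its left end.\<close>

lemma elem_partition:
  assumes p0: "p 0 = 0" and pm: "p m = T" and mono: "\<And>j. j < m \<Longrightarrow> p j < p (Suc j)"
    and E: "\<And>j. j < m \<Longrightarrow> E \<inter> {p j<..<p (Suc j)} = {}"
    and I0: "\<And>\<omega>. I 0 \<omega> = 0" and f: "elem_on K E f I" "fmeas f"
  shows "l \<le> m \<Longrightarrow> I (p l) \<omega> = mart p K (\<lambda>k j. f k (p (Suc j))) l \<omega>"
    and "\<omega> \<in> space M \<Longrightarrow> qv T (\<lambda>k s. f k s \<omega>) = ennreal (brk p K (\<lambda>k j. f k (p (Suc j))) m \<omega>)"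
proof -
  have le: "j \<le> m \<Longrightarrow> 0 \<le> p j \<and> p j \<le> T" for j
  proof -
    have "i \<le> j \<Longrightarrow> j \<le> m \<Longrightarrow> p i \<le> p j" for i j
    proof (induction j)
      case (Suc j)
      show ?case
      proof (cases "i = Suc j")
        case False
        then have "p i \<le> p j" "p j < p (Suc j)" using Suc mono[of j] by simp_all
        then show ?thesis by simp
      qed simp
    qed simp
    from this[of 0 j] this[of j m] show "j \<le> m \<Longrightarrow> 0 \<le> p j \<and> p j \<le> T" using p0 pm by simp
  qed
  have C: "\<forall>s\<in>{p j<..p (Suc j)}. f k s \<omega> = f k (p (Suc j)) \<omega>"
    "I (p (Suc j)) \<omega> - I (p j) \<omega> = (\<Sum>k<K. f k (p (Suc j)) \<omega> * (W k (p (Suc j)) \<omega> - W k (p j) \<omega>))"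
    if "j < m" for j k \<omega>
  proof -
    have j: "0 \<le> p j" "p (Suc j) \<le> T" using le[of j] le[of "Suc j"] that by simp_all
    show "\<forall>s\<in>{p j<..p (Suc j)}. f k s \<omega> = f k (p (Suc j)) \<omega>"
      by (intro ballI elem_onD(3)[OF f(1) j(1) mono[OF that] j(2) E[OF that]])
    show "I (p (Suc j)) \<omega> - I (p j) \<omega> = (\<Sum>k<K. f k (p (Suc j)) \<omega> * (W k (p (Suc j)) \<omega> - W k (p j) \<omega>))"
      by (rule elem_onD(4)[OF f(1) j(1) mono[OF that] j(2) E[OF that]])
  qed
  show "l \<le> m \<Longrightarrow> I (p l) \<omega> = mart p K (\<lambda>k j. f k (p (Suc j))) l \<omega>"
  proof (induction l)
    case 0
    then show ?case using I0 p0 by (simp add: mart_def)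
  next
    case (Suc l)
    then have "I (p (Suc l)) \<omega> = I (p l) \<omega> + (\<Sum>k<K. f k (p (Suc l)) \<omega> * (W k (p (Suc l)) \<omega> - W k (p l) \<omega>))"
      using C(2)[of l \<omega>] by (simp add: algebra_simps)
    then show ?case using Suc by (simp add: mart_def)
  qed
  assume \<omega>: "\<omega> \<in> space M"
  have [measurable]: "(\<lambda>s. f k s \<omega>) \<in> borel_measurable borel" for k
    using fmeas_path[OF f(2) \<omega>] .
  have pos: "0 \<le> (f k (p (Suc j)) \<omega>)\<^sup>2 * (p (Suc j) - p j)" if "j < m" for k j
    using mono[OF that] by simp
  have int: "(\<integral>\<^sup>+s. ennreal ((f k s \<omega>)\<^sup>2) * indicator {0<..p l} s \<partial>lborel) =
      ennreal (\<Sum>j<l. (f k (p (Suc j)) \<omega>)\<^sup>2 * (p (Suc j) - p j))" if "l \<le> m" for k l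
    using that
  proof (induction l)
    case 0
    then show ?case by (simp add: p0)
  next
    case (Suc l)
    have l: "l < m" "l \<le> m" using Suc.prems by simp_all
    have pl: "0 \<le> p l" "p l < p (Suc l)" using le[OF l(2)] mono[OF l(1)] by simp_all
    have "(\<integral>\<^sup>+s. ennreal ((f k s \<omega>)\<^sup>2) * indicator {0<..p (Suc l)} s \<partial>lborel) =
      (\<integral>\<^sup>+s. ennreal ((f k s \<omega>)\<^sup>2) * indicator {0<..p l} s +
        ennreal ((f k (p (Suc l)) \<omega>)\<^sup>2) * indicator {p l<..p (Suc l)} s \<partial>lborel)"
    proof (rule nn_integral_cong)
      fix s
      have "f k s \<omega> = f k (p (Suc l)) \<omega>" if "s \<in> {p l<..p (Suc l)}" using C(1)[OF l(1)] that by blast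
      then show "ennreal ((f k s \<omega>)\<^sup>2) * indicator {0<..p (Suc l)} s = ennreal ((f k s \<omega>)\<^sup>2) * indicator {0<..p l} s +
        ennreal ((f k (p (Suc l)) \<omega>)\<^sup>2) * indicator {p l<..p (Suc l)} s"
        using pl by (cases "s \<in> {p l<..p (Suc l)}") (simp_all add: indicator_def)
    qed
    also have "\<dots> = (\<integral>\<^sup>+s. ennreal ((f k s \<omega>)\<^sup>2) * indicator {0<..p l} s \<partial>lborel) +
        (\<integral>\<^sup>+s. ennreal ((f k (p (Suc l)) \<omega>)\<^sup>2) * indicator {p l<..p (Suc l)} s \<partial>lborel)"
      by (rule nn_integral_add) measurable
    also have "(\<integral>\<^sup>+s. ennreal ((f k (p (Suc l)) \<omega>)\<^sup>2) * indicator {p l<..p (Suc l)} s \<partial>lborel) =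
        ennreal ((f k (p (Suc l)) \<omega>)\<^sup>2 * (p (Suc l) - p l))"
      using pl by (subst nn_integral_cmult) (simp_all add: ennreal_mult'[symmetric])
    also have "(\<integral>\<^sup>+s. ennreal ((f k s \<omega>)\<^sup>2) * indicator {0<..p l} s \<partial>lborel) =
        ennreal (\<Sum>j<l. (f k (p (Suc j)) \<omega>)\<^sup>2 * (p (Suc j) - p j))"
      by (rule Suc.IH[OF l(2)])
    also have "ennreal (\<Sum>j<l. (f k (p (Suc j)) \<omega>)\<^sup>2 * (p (Suc j) - p j)) +
        ennreal ((f k (p (Suc l)) \<omega>)\<^sup>2 * (p (Suc l) - p l)) =
        ennreal ((\<Sum>j<l. (f k (p (Suc j)) \<omega>)\<^sup>2 * (p (Suc j) - p j)) +
          (f k (p (Suc l)) \<omega>)\<^sup>2 * (p (Suc l) - p l))"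
      using pl l by (intro ennreal_plus[symmetric] sum_nonneg pos) simp_all
    finally show ?case by simp
  qed
  have "qv T (\<lambda>k s. f k s \<omega>) = (\<Sum>k<K. \<integral>\<^sup>+s. ennreal ((f k s \<omega>)\<^sup>2) * indicator {0<..T} s \<partial>lborel)"
    unfolding qv_def by (rule suminf_finite) (simp_all add: elem_onD(1)[OF f(1)])
  also have "\<dots> = (\<Sum>k<K. ennreal (\<Sum>j<m. (f k (p (Suc j)) \<omega>)\<^sup>2 * (p (Suc j) - p j)))"
    using int[OF order_refl] unfolding pm by simp
  also have "\<dots> = ennreal (\<Sum>k<K. (\<Sum>j<m. (f k (p (Suc j)) \<omega>)\<^sup>2 * (p (Suc j) - p j)))"
    by (intro sum_ennreal sum_nonneg pos) simp
  also have "\<dots> = ennreal (brk p K (\<lambda>k j. f k (p (Suc j))) m \<omega>)"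
    unfolding brk_def by (subst sum.swap) (rule refl)
  finally show "qv T (\<lambda>k s. f k s \<omega>) = ennreal (brk p K (\<lambda>k j. f k (p (Suc j))) m \<omega>)" .
qed

text \<open>For finitely many times this is \<open>mart_maximal\<close> on a suitable partition,
  with a bound that does not depend on the times. A countable dense set of times is exhausted by an
  increasing sequence of finite ones, and the probabilities converge by continuity from
  below.\<close>

lemma elem_maximal:
  assumes f: "elem f I" and e: "0 < e" and d: "0 \<le> d"
  shows "ennreal (e\<^sup>2) * emeasure M {\<omega> \<in> space M. ennreal e < supn T (\<lambda>t. I t \<omega>) \<and> qv T (\<lambda>k s. f k s \<omega>) \<le> ennreal d}
    \<le> (\<integral>\<^sup>+\<omega>. min (qv T (\<lambda>k s. f k s \<omega>)) (ennreal d) \<partial>M)" (is "_ \<le> ?R")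
proof -
  obtain C K E where *: "fmeas f" "cadapted I" "\<And>\<omega>. I 0 \<omega> = 0"
    "\<And>k s \<omega>. \<omega> \<in> space M \<Longrightarrow> \<bar>f k s \<omega>\<bar> \<le> C" "finite E" "E \<subseteq> {0..T}" "elem_on K E f I"
    by (rule elemE[OF f]) (rule that; assumption)
  let ?Q = "\<lambda>\<omega>. qv T (\<lambda>k s. f k s \<omega>)"
  have [measurable]: "?Q \<in> borel_measurable M" using *(1) by (rule fmeas_qv)
  have fin: "ennreal (e\<^sup>2) * emeasure M {\<omega> \<in> space M. (\<exists>t\<in>D. e < \<bar>I t \<omega>\<bar>) \<and> ?Q \<omega> \<le> ennreal d} \<le> ?R"
    if D: "finite D" "D \<subseteq> {0..T}" for D
  proof -
    \<comment> \<open>Observation times, exceptional points of the integrand and both endpoints are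
      merged, so that the open cells between consecutive points avoid \<open>E\<close>.\<close>
    define P where "P = insert 0 (insert T (D \<union> E))"
    have P: "finite P" "P \<subseteq> {0..T}" "0 \<in> P" "T \<in> P" using D *(5,6) T_nonneg by (auto simp: P_def)
    define xs where "xs = sorted_list_of_set P"
    define m where "m = length xs - 1"
    define p where "p j = xs ! j" for j
    have xs: "set xs = P" "sorted_wrt (<) xs" using P by (auto simp: xs_def)
    have len: "length xs = Suc m" using xs P by (cases xs) (auto simp: m_def)
    have less: "p i < p j" if "i < j" "j \<le> m" for i j
      using xs(2) that len by (auto simp: p_def sorted_wrt_iff_nth_less)
    have le: "p i \<le> p j" if "i \<le> j" "j \<le> m" for i j
      using less[of i j] that by (cases "i = j") auto
    have surj: "\<exists>l\<le>m. x = p l" if "x \<in> P" for x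
      using that len unfolding xs(1)[symmetric] in_set_conv_nth by (auto simp: p_def less_Suc_eq_le)
    have inP: "p l \<in> P" if "l \<le> m" for l
      using that len xs(1) unfolding p_def by (auto intro!: nth_mem)
    have p0: "p 0 = 0"
    proof -
      obtain l where "l \<le> m" "0 = p l" using surj[OF P(3)] by auto
      then have "p 0 \<le> 0" using le[of 0 l] by auto
      then show ?thesis using inP[of 0] P(2) by auto
    qed
    have pm: "p m = T"
    proof -
      obtain l where "l \<le> m" "T = p l" using surj[OF P(4)] by auto
      then have "T \<le> p m" using le[of l m] by auto
      then show ?thesis using inP[of m] P(2) by auto
    qed
    have E: "E \<inter> {p j<..<p (Suc j)} = {}" if j: "j < m" for j
    proof (rule ccontr)
      assume "\<not> ?thesis"
      then obtain x where x: "x \<in> E" "p j < x" "x < p (Suc j)" by auto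
      obtain l where l: "l \<le> m" "x = p l" using surj[of x] x by (auto simp: P_def)
      have "j < l" using x l le[of l j] j by (meson not_less less_imp_le)
      moreover have "l < Suc j" using x l le[of "Suc j" l] j by (meson not_less)
      ultimately show False by simp
    qed
    have mono: "p j < p (Suc j)" if "j < m" for j using less that by auto
    define \<eta> where "\<eta> = (\<lambda>k j. f k (p (Suc j)))"
    have mart: "I (p l) \<omega> = mart p K \<eta> l \<omega>" if "l \<le> m" for l \<omega>
      unfolding \<eta>_def by (rule elem_partition(1)[OF p0 pm mono E *(3) *(7) *(1)]) (use that in auto)
    have brk: "?Q \<omega> = ennreal (brk p K \<eta> m \<omega>)" if "\<omega> \<in> space M" for \<omega>
      unfolding \<eta>_def by (rule elem_partition(2)[OF p0 pm mono E *(3) *(7) *(1)]) (use that in auto)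
    have "ennreal (e\<^sup>2) * emeasure M {\<omega> \<in> space M. (\<exists>l\<le>m. e < \<bar>mart p K \<eta> l \<omega>\<bar>) \<and> brk p K \<eta> m \<omega> \<le> d}
      \<le> (\<integral>\<^sup>+\<omega>. min (ennreal (brk p K \<eta> m \<omega>)) (ennreal d) \<partial>M)"
    proof (rule mart_maximal[where C = C])
      show "\<eta> k j \<in> borel_measurable (\<F> (p j))" if "k < K" "j < m" for k j
        unfolding \<eta>_def using le[of 0 j] le[of "Suc j" m] that p0 pm
        by (intro elem_onD(2)[OF *(7) _ mono[OF that(2)] _ E[OF that(2)]]) auto
    qed (use p0 mono *(4) e d in \<open>auto simp: \<eta>_def less_imp_le\<close>)
    also have "\<dots> = ?R" by (intro nn_integral_cong) (simp add: brk)
    finally have R: "ennreal (e\<^sup>2) * emeasure M {\<omega> \<in> space M. (\<exists>l\<le>m. e < \<bar>mart p K \<eta> l \<omega>\<bar>) \<and> brk p K \<eta> m \<omega> \<le> d} \<le> ?R" .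
    have ex: "\<exists>l\<le>m. e < \<bar>I (p l) \<omega>\<bar>" if "\<exists>t\<in>D. e < \<bar>I t \<omega>\<bar>" for \<omega>
    proof -
      from that obtain t where t: "t \<in> D" "e < \<bar>I t \<omega>\<bar>" by (rule bexE)
      then have "t \<in> P" by (simp add: P_def)
      from surj[OF this] obtain l where "l \<le> m" "t = p l" by (elim exE conjE)
      then show ?thesis using t by (intro exI[of _ l]) simp
    qed
    have sub: "{\<omega> \<in> space M. (\<exists>t\<in>D. e < \<bar>I t \<omega>\<bar>) \<and> ?Q \<omega> \<le> ennreal d} \<subseteq>
      {\<omega> \<in> space M. (\<exists>l\<le>m. e < \<bar>I (p l) \<omega>\<bar>) \<and> ?Q \<omega> \<le> ennreal d}"
      using ex by (intro Collect_mono) simp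
    have eq: "{\<omega> \<in> space M. (\<exists>l\<le>m. e < \<bar>I (p l) \<omega>\<bar>) \<and> ?Q \<omega> \<le> ennreal d} =
      {\<omega> \<in> space M. (\<exists>l\<le>m. e < \<bar>mart p K \<eta> l \<omega>\<bar>) \<and> brk p K \<eta> m \<omega> \<le> d}"
      using d by (intro Collect_cong conj_cong refl ex_cong1) (simp_all add: mart brk ennreal_le_iff)
    have [measurable]: "I (p l) \<in> borel_measurable M" if "l \<in> {..m}" for l
      using inP[of l] P(2) that by (intro cadapted_measurable[OF *(2)]) auto
    have "Measurable.pred M (\<lambda>\<omega>. \<exists>l\<in>{..m}. e < \<bar>I (p l) \<omega>\<bar>)"
      by (rule pred_intros_finite) auto
    then have "{\<omega> \<in> space M. (\<exists>l\<le>m. e < \<bar>I (p l) \<omega>\<bar>) \<and> ?Q \<omega> \<le> ennreal d} \<in> sets M"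
      unfolding Bex_def atMost_iff by measurable
    with sub have "ennreal (e\<^sup>2) * emeasure M {\<omega> \<in> space M. (\<exists>t\<in>D. e < \<bar>I t \<omega>\<bar>) \<and> ?Q \<omega> \<le> ennreal d} \<le>
      ennreal (e\<^sup>2) * emeasure M {\<omega> \<in> space M. (\<exists>l\<le>m. e < \<bar>I (p l) \<omega>\<bar>) \<and> ?Q \<omega> \<le> ennreal d}"
      by (intro mult_left_mono emeasure_mono) auto
    then show ?thesis using R unfolding eq by (rule order_trans)
  qed
  obtain S where S: "countable S" "S \<subseteq> {0..T}" "{0..T} \<subseteq> closure S" by (rule separable)
  have "S \<noteq> {}" using S(3) T_nonneg by auto
  define D where "D n = from_nat_into S ` {..n}" for n
  have DS: "(\<Union>n. D n) = S"
  proof -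
    have "(\<Union>n. D n) = range (from_nat_into S)" unfolding D_def by blast
    then show ?thesis using range_from_nat_into[OF \<open>S \<noteq> {}\<close> S(1)] by simp
  qed
  define A where "A n = {\<omega> \<in> space M. (\<exists>t\<in>D n. e < \<bar>I t \<omega>\<bar>) \<and> ?Q \<omega> \<le> ennreal d}" for n
  have Dn: "finite (D n)" "D n \<subseteq> {0..T}" for n using DS S(2) by (auto simp: D_def)
  have [measurable]: "A n \<in> sets M" for n
  proof -
    have [measurable]: "I t \<in> borel_measurable M" if "t \<in> D n" for t
      using Dn(2)[of n] that by (intro cadapted_measurable[OF *(2)]) auto
    have "Measurable.pred M (\<lambda>\<omega>. \<exists>t\<in>D n. e < \<bar>I t \<omega>\<bar>)"
      using Dn by (intro pred_intros_finite) auto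
    then show ?thesis unfolding A_def by measurable
  qed
  have eqA: "{\<omega> \<in> space M. ennreal e < supn T (\<lambda>t. I t \<omega>) \<and> ?Q \<omega> \<le> ennreal d} = (\<Union>n. A n)"
  proof -
    have "ennreal e < supn T (\<lambda>t. I t \<omega>) \<longleftrightarrow> (\<exists>n. \<exists>t\<in>D n. e < \<bar>I t \<omega>\<bar>)" if "\<omega> \<in> space M" for \<omega>
    proof -
      have "supn T (\<lambda>t. I t \<omega>) = (\<Squnion>t\<in>S. ennreal \<bar>I t \<omega>\<bar>)"
        using *(2) that S by (intro supn_dense) (auto simp: cadapted_def)
      then show ?thesis using e DS by (auto simp: less_SUP_iff ennreal_less_iff)
    qed
    then show ?thesis by (auto simp: A_def)
  qed
  have "incseq A" unfolding A_def D_def by (rule incseq_SucI) auto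
  then have "emeasure M (\<Union>n. A n) = (SUP n. emeasure M (A n))"
    by (intro SUP_emeasure_incseq[symmetric]) auto
  then have "ennreal (e\<^sup>2) * emeasure M (\<Union>n. A n) = (SUP n. ennreal (e\<^sup>2) * emeasure M (A n))"
    by (simp add: SUP_mult_left_ennreal)
  also have "\<dots> \<le> ?R"
    using fin[OF Dn] unfolding A_def by (intro SUP_least) auto
  finally show ?thesis unfolding eqA .
qed

end

section \<open>The integral of a sequence of integrands\<close>

lemma numeral_mult_ennreal: "numeral n * ennreal x = ennreal (numeral n * x)"
  by (simp add: ennreal_mult')

context wiener_system
begin

lemma psize_tendsto_prob:
  assumes m: "\<And>n. Z n \<in> borel_measurable M" and lim: "(\<lambda>n. psize (Z n)) \<longlonglongrightarrow> 0" and e: "0 < e"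
  shows "(\<lambda>n. emeasure M {\<omega> \<in> space M. ennreal e < Z n \<omega>}) \<longlonglongrightarrow> 0"
proof -
  have "tendsto_zero_in_prob M Z" using m lim by (simp add: tendsto_zero_in_prob_iff)
  then have "(\<lambda>n. measure M {\<omega> \<in> space M. Z n \<omega> > ennreal e}) \<longlonglongrightarrow> 0"
    using e by (simp add: tendsto_zero_in_prob_def)
  from tendsto_ennrealI[OF this] show ?thesis by (simp add: emeasure_eq_measure)
qed

text \<open>
  \<open>I\<close> is a version of \<open>\<Sum>\<^sub>k \<integral> f\<^sup>k dW\<^sup>k\<close>.
\<close>

definition vito :: "(nat \<Rightarrow> real \<Rightarrow> 'a \<Rightarrow> real) \<Rightarrow> (real \<Rightarrow> 'a \<Rightarrow> real) \<Rightarrow> bool" where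
  "vito f I \<longleftrightarrow> fmeas f \<and> cadapted I \<and> (\<exists>g J. (\<forall>j. elem (g j) (J j)) \<and>
     (\<lambda>j. psize (\<lambda>\<omega>. qv T (\<lambda>k s. g j k s \<omega> - f k s \<omega>))) \<longlonglongrightarrow> 0 \<and>
     (\<lambda>j. psize (\<lambda>\<omega>. supn T (\<lambda>t. J j t \<omega> - I t \<omega>))) \<longlonglongrightarrow> 0)"

lemma vitoI:
  assumes "fmeas f" "cadapted I" "\<And>j. elem (g j) (J j)"
    "(\<lambda>j. psize (\<lambda>\<omega>. qv T (\<lambda>k s. g j k s \<omega> - f k s \<omega>))) \<longlonglongrightarrow> 0"
    "(\<lambda>j. psize (\<lambda>\<omega>. supn T (\<lambda>t. J j t \<omega> - I t \<omega>))) \<longlonglongrightarrow> 0"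
  shows "vito f I"
  unfolding vito_def
  by (rule conjI[OF assms(1)], rule conjI[OF assms(2)], rule exI[of _ g], rule exI[of _ J], intro conjI allI assms)

lemma vitoE:
  assumes "vito f I"
  obtains g J where "fmeas f" "cadapted I" "\<And>j. elem (g j) (J j)"
    "(\<lambda>j. psize (\<lambda>\<omega>. qv T (\<lambda>k s. g j k s \<omega> - f k s \<omega>))) \<longlonglongrightarrow> 0"
    "(\<lambda>j. psize (\<lambda>\<omega>. supn T (\<lambda>t. J j t \<omega> - I t \<omega>))) \<longlonglongrightarrow> 0"
proof -
  from assms[unfolded vito_def] show ?thesis
  proof (elim conjE exE)
    fix g J assume "fmeas f" "cadapted I" "\<forall>j. elem (g j) (J j)"
    "(\<lambda>j. psize (\<lambda>\<omega>. qv T (\<lambda>k s. g j k s \<omega> - f k s \<omega>))) \<longlonglongrightarrow> 0"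
    "(\<lambda>j. psize (\<lambda>\<omega>. supn T (\<lambda>t. J j t \<omega> - I t \<omega>))) \<longlonglongrightarrow> 0"
    then show ?thesis by (intro that[of g J]) simp_all
  qed
qed

lemma vito_fmeas: "vito f I \<Longrightarrow> fmeas f" and vito_cadapted: "vito f I \<Longrightarrow> cadapted I"
  by (simp_all add: vito_def)

lemma elem_fmeas: "elem f I \<Longrightarrow> fmeas f" and elem_cadapted: "elem f I \<Longrightarrow> cadapted I"
  by (simp_all add: elem_def)

lemma psize_zero [simp]: "psize (\<lambda>_. 0) = 0"
  by (simp add: psize_def)

lemma elem_vito: "elem f I \<Longrightarrow> vito f I"
  by (rule vitoI[of f I "\<lambda>_. f" "\<lambda>_. I"]) (simp_all add: elem_fmeas elem_cadapted T_nonneg)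

lemma psize_double_add:
  assumes [measurable]: "X \<in> borel_measurable M" "Y \<in> borel_measurable M"
    and le: "AE \<omega> in M. Z \<omega> \<le> 2 * X \<omega> + 2 * Y \<omega>"
  shows "psize Z \<le> 2 * psize X + 2 * psize Y"
proof -
  have "psize Z \<le> psize (\<lambda>\<omega>. 2 * X \<omega> + 2 * Y \<omega>)" using le by (rule psize_mono_AE)
  also have "\<dots> \<le> psize (\<lambda>\<omega>. 2 * X \<omega>) + psize (\<lambda>\<omega>. 2 * Y \<omega>)" by (rule psize_add) measurable
  also have "\<dots> \<le> 2 * psize X + 2 * psize Y" by (intro add_mono psize_double) measurable
  finally show ?thesis .
qed

lemma fmeas_diff_qv_le:
  assumes "fmeas f" "fmeas g" "\<omega> \<in> space M"
  shows "qv r (\<lambda>k s. f k s \<omega> - g k s \<omega>) \<le> 2 * qv r (\<lambda>k s. f k s \<omega>) + 2 * qv r (\<lambda>k s. g k s \<omega>)"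
  using assms by (intro qv_diff_le fmeas_path)

lemma vito_diff:
  assumes "vito f I" "vito f' I'"
  shows "vito (\<lambda>k s \<omega>. f k s \<omega> - f' k s \<omega>) (\<lambda>t \<omega>. I t \<omega> - I' t \<omega>)"
  using assms(1)
proof (rule vitoE)
  fix g J assume f: "fmeas f" "cadapted I" "\<And>j. elem (g j) (J j)"
    "(\<lambda>j. psize (\<lambda>\<omega>. qv T (\<lambda>k s. g j k s \<omega> - f k s \<omega>))) \<longlonglongrightarrow> 0"
    "(\<lambda>j. psize (\<lambda>\<omega>. supn T (\<lambda>t. J j t \<omega> - I t \<omega>))) \<longlonglongrightarrow> 0"
  show ?thesis
    using assms(2)
  proof (rule vitoE)
    fix g' J' assume f': "fmeas f'" "cadapted I'" "\<And>j. elem (g' j) (J' j)"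
      "(\<lambda>j. psize (\<lambda>\<omega>. qv T (\<lambda>k s. g' j k s \<omega> - f' k s \<omega>))) \<longlonglongrightarrow> 0"
      "(\<lambda>j. psize (\<lambda>\<omega>. supn T (\<lambda>t. J' j t \<omega> - I' t \<omega>))) \<longlonglongrightarrow> 0"
    note g = elem_fmeas[OF f(3)] and g' = elem_fmeas[OF f'(3)]
    note J = elem_cadapted[OF f(3)] and J' = elem_cadapted[OF f'(3)]
    show ?thesis
    proof (rule vitoI[OF fmeas_diff[OF f(1) f'(1)] cadapted_diff[OF f(2) f'(2)] elem_diff[OF f(3) f'(3)]])
      show "(\<lambda>j. psize (\<lambda>\<omega>. qv T (\<lambda>k s. g j k s \<omega> - g' j k s \<omega> - (f k s \<omega> - f' k s \<omega>)))) \<longlonglongrightarrow> 0"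
      proof (rule tendsto_0_double_add[OF _ f(4) f'(4)], rule psize_double_add)
        fix j
        show "AE \<omega> in M. qv T (\<lambda>k s. g j k s \<omega> - g' j k s \<omega> - (f k s \<omega> - f' k s \<omega>)) \<le>
          2 * qv T (\<lambda>k s. g j k s \<omega> - f k s \<omega>) + 2 * qv T (\<lambda>k s. g' j k s \<omega> - f' k s \<omega>)"
        proof (rule AE_I2)
          fix \<omega> assume \<omega>: "\<omega> \<in> space M"
          have eq: "(\<lambda>k s. g j k s \<omega> - g' j k s \<omega> - (f k s \<omega> - f' k s \<omega>)) =
              (\<lambda>k s. (g j k s \<omega> - f k s \<omega>) - (g' j k s \<omega> - f' k s \<omega>))"
            by (intro ext) simp
          show "qv T (\<lambda>k s. g j k s \<omega> - g' j k s \<omega> - (f k s \<omega> - f' k s \<omega>)) \<le>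
            2 * qv T (\<lambda>k s. g j k s \<omega> - f k s \<omega>) + 2 * qv T (\<lambda>k s. g' j k s \<omega> - f' k s \<omega>)"
            unfolding eq by (rule fmeas_diff_qv_le[OF fmeas_diff[OF g f(1)] fmeas_diff[OF g' f'(1)] \<omega>])
        qed
      qed (rule fmeas_qv[OF fmeas_diff[OF g f(1)]] fmeas_qv[OF fmeas_diff[OF g' f'(1)]])+
      show "(\<lambda>j. psize (\<lambda>\<omega>. supn T (\<lambda>t. J j t \<omega> - J' j t \<omega> - (I t \<omega> - I' t \<omega>)))) \<longlonglongrightarrow> 0"
      proof (rule tendsto_0_double_add[OF _ f(5) f'(5)], rule psize_double_add)
        fix j
        show "AE \<omega> in M. supn T (\<lambda>t. J j t \<omega> - J' j t \<omega> - (I t \<omega> - I' t \<omega>)) \<le>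
          2 * supn T (\<lambda>t. J j t \<omega> - I t \<omega>) + 2 * supn T (\<lambda>t. J' j t \<omega> - I' t \<omega>)"
        proof (rule AE_I2)
          fix \<omega>
          have eq: "(\<lambda>t. J j t \<omega> - J' j t \<omega> - (I t \<omega> - I' t \<omega>)) =
              (\<lambda>t. (J j t \<omega> - I t \<omega>) - (J' j t \<omega> - I' t \<omega>))"
            by (intro ext) simp
          have "supn T (\<lambda>t. J j t \<omega> - J' j t \<omega> - (I t \<omega> - I' t \<omega>)) \<le>
            supn T (\<lambda>t. J j t \<omega> - I t \<omega>) + supn T (\<lambda>t. J' j t \<omega> - I' t \<omega>)"
            unfolding eq by (rule supn_diff_le)
          also have "\<dots> \<le> 2 * supn T (\<lambda>t. J j t \<omega> - I t \<omega>) + 2 * supn T (\<lambda>t. J' j t \<omega> - I' t \<omega>)"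
            by (intro add_mono) (simp_all add: mult_2)
          finally show "supn T (\<lambda>t. J j t \<omega> - J' j t \<omega> - (I t \<omega> - I' t \<omega>)) \<le> \<dots>" .
        qed
      qed (rule cadapted_supn[OF cadapted_diff[OF J f(2)]] cadapted_supn[OF cadapted_diff[OF J' f'(2)]])+
    qed
  qed
qed

lemma vito_zero: "vito (\<lambda>k s \<omega>. 0) (\<lambda>t \<omega>. 0)"
  by (rule elem_vito[OF elem_zero])

lemma vito_add:
  assumes "vito f I" "vito f' I'"
  shows "vito (\<lambda>k s \<omega>. f k s \<omega> + f' k s \<omega>) (\<lambda>t \<omega>. I t \<omega> + I' t \<omega>)"
  using vito_diff[OF assms(1) vito_diff[OF vito_zero assms(2)]] by simp

lemma vito_sum:
  assumes "finite A" "\<And>i. i \<in> A \<Longrightarrow> vito (f i) (I i)"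
  shows "vito (\<lambda>k s \<omega>. \<Sum>i\<in>A. f i k s \<omega>) (\<lambda>t \<omega>. \<Sum>i\<in>A. I i t \<omega>)"
  using assms
proof (induction A rule: finite_induct)
  case empty
  then show ?case using vito_zero by simp
next
  case (insert i A)
  then show ?case using vito_add[of "f i" "I i"] by simp
qed

text \<open>The integrand enters \<open>vito\<close> only through its \<open>qv\<close> distance to
  the approximants. The lemma allows a change of integrand on a null event or on a null set of
  times, in particular the passage between the given integrands and their cut-offs.\<close>

lemma vito_AE_cong:
  assumes "vito f I" and f': "fmeas f'" and eq: "AE \<omega> in M. qv T (\<lambda>k s. f' k s \<omega> - f k s \<omega>) = 0"
  shows "vito f' I"
  using assms(1)
proof (rule vitoE)
  fix g J assume f: "fmeas f" "cadapted I" "\<And>j. elem (g j) (J j)"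
    "(\<lambda>j. psize (\<lambda>\<omega>. qv T (\<lambda>k s. g j k s \<omega> - f k s \<omega>))) \<longlonglongrightarrow> 0"
    "(\<lambda>j. psize (\<lambda>\<omega>. supn T (\<lambda>t. J j t \<omega> - I t \<omega>))) \<longlonglongrightarrow> 0"
  note g = elem_fmeas[OF f(3)]
  show ?thesis
  proof (rule vitoI[OF f' f(2,3) _ f(5)])
    have "(\<lambda>j. 0::ennreal) \<longlonglongrightarrow> 0" by simp
    from f(4) this show "(\<lambda>j. psize (\<lambda>\<omega>. qv T (\<lambda>k s. g j k s \<omega> - f' k s \<omega>))) \<longlonglongrightarrow> 0"
    proof (rule tendsto_0_double_add[rotated])
      fix j
      have "psize (\<lambda>\<omega>. qv T (\<lambda>k s. g j k s \<omega> - f' k s \<omega>)) \<le>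
        2 * psize (\<lambda>\<omega>. qv T (\<lambda>k s. g j k s \<omega> - f k s \<omega>)) + 2 * psize (\<lambda>\<omega>. 0)"
      proof (rule psize_double_add[OF fmeas_qv[OF fmeas_diff[OF g f(1)]]])
        show "AE \<omega> in M. qv T (\<lambda>k s. g j k s \<omega> - f' k s \<omega>) \<le> 2 * qv T (\<lambda>k s. g j k s \<omega> - f k s \<omega>) + 2 * 0"
          using eq AE_space
        proof eventually_elim
          case (elim \<omega>)
          have eq: "(\<lambda>k s. g j k s \<omega> - f' k s \<omega>) = (\<lambda>k s. (g j k s \<omega> - f k s \<omega>) - (f' k s \<omega> - f k s \<omega>))"
            by (intro ext) simp
          have "qv T (\<lambda>k s. g j k s \<omega> - f' k s \<omega>) \<le>
            2 * qv T (\<lambda>k s. g j k s \<omega> - f k s \<omega>) + 2 * qv T (\<lambda>k s. f' k s \<omega> - f k s \<omega>)"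
            unfolding eq by (rule fmeas_diff_qv_le[OF fmeas_diff[OF g f(1)] fmeas_diff[OF f' f(1)] elim(2)])
          then show ?case using elim(1) by simp
        qed
      qed simp
      then show "psize (\<lambda>\<omega>. qv T (\<lambda>k s. g j k s \<omega> - f' k s \<omega>)) \<le>
        2 * psize (\<lambda>\<omega>. qv T (\<lambda>k s. g j k s \<omega> - f k s \<omega>)) + 2 * 0" by simp
    qed
  qed
qed

text \<open>A limit of \<open>elem_maximal\<close>. The level \<open>2 * e\<close> is shared equally
  between the approximating integral and its distance to \<open>I\<close>; the factor 2 on the right
  comes from estimating the bracket of the approximant by twice that of \<open>f\<close> plus twice
  the error.\<close>

lemma vito_maximal:
  assumes v: "vito f I" and e: "0 < e" and d: "0 \<le> d"
  shows "ennreal (e\<^sup>2) * emeasure M {\<omega> \<in> space M. ennreal (2 * e) < supn T (\<lambda>t. I t \<omega>) \<and> qv T (\<lambda>k s. f k s \<omega>) \<le> ennreal d}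
    \<le> 2 * (\<integral>\<^sup>+\<omega>. min (qv T (\<lambda>k s. f k s \<omega>)) (ennreal d) \<partial>M)"
  using v
proof (rule vitoE)
  fix g J assume f: "fmeas f" "cadapted I" "\<And>j. elem (g j) (J j)"
    "(\<lambda>j. psize (\<lambda>\<omega>. qv T (\<lambda>k s. g j k s \<omega> - f k s \<omega>))) \<longlonglongrightarrow> 0"
    "(\<lambda>j. psize (\<lambda>\<omega>. supn T (\<lambda>t. J j t \<omega> - I t \<omega>))) \<longlonglongrightarrow> 0"
  note g = elem_fmeas[OF f(3)] and J = elem_cadapted[OF f(3)]
  define Q where "Q \<omega> = qv T (\<lambda>k s. f k s \<omega>)" for \<omega>
  define Qj where "Qj j \<omega> = qv T (\<lambda>k s. g j k s \<omega>)" for j \<omega>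
  define Rj where "Rj j \<omega> = qv T (\<lambda>k s. g j k s \<omega> - f k s \<omega>)" for j \<omega>
  define U where "U \<omega> = supn T (\<lambda>t. I t \<omega>)" for \<omega>
  define Uj where "Uj j \<omega> = supn T (\<lambda>t. J j t \<omega>)" for j \<omega>
  define Vj where "Vj j \<omega> = supn T (\<lambda>t. J j t \<omega> - I t \<omega>)" for j \<omega>
  have [measurable]: "Q \<in> borel_measurable M" "Qj j \<in> borel_measurable M" "Rj j \<in> borel_measurable M"
    "U \<in> borel_measurable M" "Uj j \<in> borel_measurable M" "Vj j \<in> borel_measurable M" for j
    unfolding Q_def[abs_def] Qj_def[abs_def] Rj_def[abs_def] U_def[abs_def] Uj_def[abs_def] Vj_def[abs_def]
    by (rule fmeas_qv cadapted_supn f g J fmeas_diff cadapted_diff)+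
  have Qle: "Qj j \<omega> \<le> 2 * Q \<omega> + 2 * Rj j \<omega>" if "\<omega> \<in> space M" for j \<omega>
    using qv_add_le[of "\<lambda>k s. f k s \<omega>" "\<lambda>k s. g j k s \<omega> - f k s \<omega>" T] fmeas_path[OF f(1) that] fmeas_path[OF fmeas_diff[OF g f(1)] that]
    by (simp add: Q_def Qj_def Rj_def)
  have Ule: "U \<omega> \<le> Uj j \<omega> + Vj j \<omega>" for j \<omega>
    using supn_diff_le[of T "\<lambda>t. J j t \<omega>" "\<lambda>t. J j t \<omega> - I t \<omega>"] by (simp add: U_def Uj_def Vj_def)
  let ?P = "emeasure M"
  let ?A = "{\<omega> \<in> space M. ennreal (2 * e) < U \<omega> \<and> Q \<omega> \<le> ennreal d}"
  let ?E = "\<integral>\<^sup>+\<omega>. min (Q \<omega>) (ennreal d) \<partial>M"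
  have "ennreal (e\<^sup>2) * ?P ?A \<le> 2 * ?E"
  proof (rule ennreal_le_epsilon)
    fix \<epsilon> :: real assume \<epsilon>: "0 < \<epsilon>"
    \<comment> \<open>Off the event \<open>?B j\<close> the bracket of the approximant exceeds
      \<open>2 * Q\<close> by at most \<open>2 * h\<close>, and this surplus integrates to
      \<epsilon>.\<close>
    define h where "h = \<epsilon> / 2"
    have h: "0 < h" using \<epsilon> by (simp add: h_def)
    let ?B = "\<lambda>j. {\<omega> \<in> space M. ennreal h < Rj j \<omega>}"
    let ?C = "\<lambda>j. {\<omega> \<in> space M. ennreal e < Vj j \<omega>}"
    let ?D = "\<lambda>j. {\<omega> \<in> space M. ennreal e < Uj j \<omega> \<and> Qj j \<omega> \<le> ennreal (2 * d + 2 * h)}"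
    have sub: "?A \<subseteq> ?D j \<union> (?B j \<union> ?C j)" for j
    proof
      fix \<omega> assume \<omega>: "\<omega> \<in> ?A"
      show "\<omega> \<in> ?D j \<union> (?B j \<union> ?C j)"
      proof (rule ccontr)
        assume n: "\<omega> \<notin> ?D j \<union> (?B j \<union> ?C j)"
        have \<omega>': "\<omega> \<in> space M" "ennreal (2 * e) < U \<omega>" "Q \<omega> \<le> ennreal d" using \<omega> by simp_all
        have R: "Rj j \<omega> \<le> ennreal h" and V: "Vj j \<omega> \<le> ennreal e" using n \<omega>' by (simp_all add: not_less)
        have "Qj j \<omega> \<le> 2 * ennreal d + 2 * ennreal h"
          by (rule order_trans[OF Qle[OF \<omega>'(1)]]) (intro add_mono mult_left_mono R \<omega>' order_refl, simp_all)
        also have "\<dots> = ennreal (2 * d + 2 * h)" using d h by (simp add: ennreal_mult')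
        finally have "Uj j \<omega> \<le> ennreal e" using n \<omega>' by (simp add: not_less)
        then have "U \<omega> \<le> ennreal e + ennreal e"
          by (intro order_trans[OF Ule[of \<omega> j]] add_mono V)
        also have "\<dots> = ennreal (2 * e)" using e by (simp flip: ennreal_plus)
        finally show False using \<omega>'(2) by simp
      qed
    qed
    have main: "ennreal (e\<^sup>2) * ?P ?A \<le> 2 * ?E + ennreal \<epsilon> +
        (ennreal (2 * d + 2 * h + e\<^sup>2) * ?P (?B j) + ennreal (e\<^sup>2) * ?P (?C j))" for j
    proof -
      have "?P ?A \<le> ?P (?D j \<union> (?B j \<union> ?C j))" using sub by (intro emeasure_mono) measurable
      also have "\<dots> \<le> ?P (?D j) + ?P (?B j \<union> ?C j)" by (rule emeasure_subadditive) measurable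
      also have "\<dots> \<le> ?P (?D j) + (?P (?B j) + ?P (?C j))" by (intro add_left_mono emeasure_subadditive) measurable
      finally have "ennreal (e\<^sup>2) * ?P ?A \<le> ennreal (e\<^sup>2) * (?P (?D j) + (?P (?B j) + ?P (?C j)))"
        by (rule mult_left_mono) simp
      also have "\<dots> = ennreal (e\<^sup>2) * ?P (?D j) + (ennreal (e\<^sup>2) * ?P (?B j) + ennreal (e\<^sup>2) * ?P (?C j))"
        by (simp only: distrib_left)
      also have "ennreal (e\<^sup>2) * ?P (?D j) \<le> (\<integral>\<^sup>+\<omega>. min (Qj j \<omega>) (ennreal (2 * d + 2 * h)) \<partial>M)"
        unfolding Qj_def Uj_def using d h by (intro elem_maximal f(3) e) simp
      also have "\<dots> \<le> (\<integral>\<^sup>+\<omega>. 2 * min (Q \<omega>) (ennreal d) + (ennreal (2 * h) + ennreal (2 * d + 2 * h) * indicator (?B j) \<omega>) \<partial>M)"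
      proof (rule nn_integral_mono)
        fix \<omega> assume \<omega>: "\<omega> \<in> space M"
        show "min (Qj j \<omega>) (ennreal (2 * d + 2 * h)) \<le> 2 * min (Q \<omega>) (ennreal d) + (ennreal (2 * h) + ennreal (2 * d + 2 * h) * indicator (?B j) \<omega>)"
        proof (cases "\<omega> \<in> ?B j")
          case True
          have "min (Qj j \<omega>) (ennreal (2 * d + 2 * h)) \<le> ennreal (2 * d + 2 * h) * indicator (?B j) \<omega>"
            using True by simp
          also have "\<dots> \<le> 2 * min (Q \<omega>) (ennreal d) + (ennreal (2 * h) + ennreal (2 * d + 2 * h) * indicator (?B j) \<omega>)"
            by (intro add_increasing) simp_all
          finally show ?thesis .
        next
          case False
          then have R: "Rj j \<omega> \<le> ennreal h" using \<omega> by (simp add: not_less)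
          have h2: "ennreal (2 * h) = 2 * ennreal h" using h by (simp add: ennreal_mult')
          have "ennreal (2 * d + 2 * h) = 2 * ennreal d + ennreal (2 * h)" using d h by (simp add: ennreal_mult')
          moreover have "Qj j \<omega> \<le> 2 * Q \<omega> + ennreal (2 * h)"
            unfolding h2 by (rule order_trans[OF Qle[OF \<omega>]]) (intro add_mono mult_left_mono R order_refl, simp_all)
          ultimately have "min (Qj j \<omega>) (ennreal (2 * d + 2 * h)) \<le> 2 * min (Q \<omega>) (ennreal d) + ennreal (2 * h)"
            by (cases "Q \<omega> \<le> ennreal d") (simp_all add: min.coboundedI1 min.absorb1 min.absorb2)
          also have "\<dots> \<le> 2 * min (Q \<omega>) (ennreal d) + (ennreal (2 * h) + ennreal (2 * d + 2 * h) * indicator (?B j) \<omega>)"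
            by (intro add_left_mono) simp
          finally show ?thesis .
        qed
      qed
      also have "\<dots> = 2 * ?E + (ennreal \<epsilon> + ennreal (2 * d + 2 * h) * ?P (?B j))"
        by (simp add: nn_integral_add nn_integral_cmult emeasure_space_1 h_def)
      finally have "ennreal (e\<^sup>2) * ?P ?A \<le> 2 * ?E + (ennreal \<epsilon> + ennreal (2 * d + 2 * h) * ?P (?B j)) +
          (ennreal (e\<^sup>2) * ?P (?B j) + ennreal (e\<^sup>2) * ?P (?C j))" by (simp add: add_right_mono)
      moreover have "ennreal (2 * d + 2 * h + e\<^sup>2) * ?P (?B j) = ennreal (2 * d + 2 * h) * ?P (?B j) + ennreal (e\<^sup>2) * ?P (?B j)"
        using d h by (subst ennreal_plus) (simp_all add: distrib_right)
      ultimately show ?thesis by (simp add: add_ac)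
    qed
    \<comment> \<open>Only the probabilities of \<open>?B j\<close> and \<open>?C j\<close> depend
      on \<open>j\<close>; they vanish in the limit by the two convergences in the definition of
      \<open>vito\<close>.\<close>
    have "(\<lambda>j. 2 * ?E + ennreal \<epsilon> + (ennreal (2 * d + 2 * h + e\<^sup>2) * ?P (?B j) + ennreal (e\<^sup>2) * ?P (?C j)))
        \<longlonglongrightarrow> 2 * ?E + ennreal \<epsilon> + (ennreal (2 * d + 2 * h + e\<^sup>2) * 0 + ennreal (e\<^sup>2) * 0)"
    proof (intro tendsto_add tendsto_const ennreal_tendsto_cmult)
      show "(\<lambda>j. ?P (?B j)) \<longlonglongrightarrow> 0"
        using f(4) h by (intro psize_tendsto_prob) (simp_all add: Rj_def[abs_def] fmeas_qv[OF fmeas_diff[OF g f(1)]])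
      show "(\<lambda>j. ?P (?C j)) \<longlonglongrightarrow> 0"
        using f(5) e by (intro psize_tendsto_prob) (simp_all add: Vj_def[abs_def] cadapted_supn[OF cadapted_diff[OF J f(2)]])
    qed simp_all
    then show "ennreal (e\<^sup>2) * ?P ?A \<le> 2 * ?E + ennreal \<epsilon>"
      using main by (intro LIMSEQ_le_const) auto
  qed
  then show ?thesis by (simp add: Q_def U_def)
qed

text \<open>On the event of zero bracket let \<open>d\<close> tend to 0 in
  \<open>vito_maximal\<close>, whose right side is at most \<open>2 * d\<close>. Applied to
  differences this gives uniqueness of the integral, and equality of two integrals on the event
  where their integrands agree.\<close>

lemma vito_local:
  assumes v: "vito f I"
  shows "AE \<omega> in M. qv T (\<lambda>k s. f k s \<omega>) = 0 \<longrightarrow> supn T (\<lambda>t. I t \<omega>) = 0"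
proof -
  define Q where "Q \<omega> = qv T (\<lambda>k s. f k s \<omega>)" for \<omega>
  define U where "U \<omega> = supn T (\<lambda>t. I t \<omega>)" for \<omega>
  have [measurable]: "Q \<in> borel_measurable M" "U \<in> borel_measurable M"
    unfolding Q_def[abs_def] U_def[abs_def]
    using fmeas_qv[OF vito_fmeas[OF v]] cadapted_supn[OF vito_cadapted[OF v]] by simp_all
  have zero: "emeasure M {\<omega> \<in> space M. ennreal (2 * e) < U \<omega> \<and> Q \<omega> = 0} = 0" (is "?m = 0") if e: "0 < e" for e
  proof -
    have key: "ennreal (e\<^sup>2) * ?m \<le> 0 + ennreal d" if d: "0 < d" for d
    proof -
      have "ennreal (e\<^sup>2) * ?m \<le> ennreal (e\<^sup>2) * emeasure M {\<omega> \<in> space M. ennreal (2 * e) < U \<omega> \<and> Q \<omega> \<le> ennreal (d/2)}"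
        by (intro mult_left_mono emeasure_mono) auto
      also have "\<dots> \<le> 2 * (\<integral>\<^sup>+\<omega>. min (Q \<omega>) (ennreal (d/2)) \<partial>M)"
        unfolding Q_def U_def using d by (intro vito_maximal[OF v e]) simp
      also have "\<dots> \<le> 2 * (\<integral>\<^sup>+\<omega>. ennreal (d/2) \<partial>M)" by (intro mult_left_mono nn_integral_mono) simp_all
      also have "\<dots> = ennreal d" using d by (simp add: emeasure_space_1 numeral_mult_ennreal)
      finally show ?thesis by simp
    qed
    have "ennreal (e\<^sup>2) * ?m \<le> 0" by (rule ennreal_le_epsilon[OF key])
    then show ?thesis using e by simp
  qed
  have "AE \<omega> in M. \<forall>n. \<not> (ennreal (2 * (1 / Suc n)) < U \<omega> \<and> Q \<omega> = 0)"
  proof (subst AE_all_countable, rule allI)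
    fix n
    have "AE \<omega> in M. \<omega> \<notin> {\<omega> \<in> space M. ennreal (2 * (1 / Suc n)) < U \<omega> \<and> Q \<omega> = 0}"
      using zero[of "1 / Suc n"] by (intro AE_not_in) (simp add: null_sets_def)
    then show "AE \<omega> in M. \<not> (ennreal (2 * (1 / Suc n)) < U \<omega> \<and> Q \<omega> = 0)"
      using AE_space by eventually_elim simp
  qed
  then have "AE \<omega> in M. Q \<omega> = 0 \<longrightarrow> U \<omega> = 0"
  proof eventually_elim
    case (elim \<omega>)
    show ?case
    proof
      assume "Q \<omega> = 0"
      with elim have le: "U \<omega> \<le> ennreal (2 * (1 / Suc n))" for n by (simp add: not_less)
      have "(\<lambda>n. ennreal (2 * (1 / Suc n))) \<longlonglongrightarrow> ennreal (2 * 0)"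
        by (intro tendsto_ennrealI tendsto_mult tendsto_const LIMSEQ_Suc[OF lim_1_over_n])
      then have "U \<omega> \<le> ennreal (2 * 0)" by (rule LIMSEQ_le_const) (use le in auto)
      then show "U \<omega> = 0" by simp
    qed
  qed
  then show ?thesis by (simp add: Q_def U_def)
qed

lemma vito_local_diff:
  assumes "vito f I" "vito g J"
  shows "AE \<omega> in M. qv T (\<lambda>k s. f k s \<omega> - g k s \<omega>) = 0 \<longrightarrow> supn T (\<lambda>t. I t \<omega> - J t \<omega>) = 0"
  using vito_local[OF vito_diff[OF assms]] .

lemma vito_tendsto_0:
  assumes v: "\<And>j. vito (f j) (I j)" and lim: "(\<lambda>j. psize (\<lambda>\<omega>. qv T (\<lambda>k s. f j k s \<omega>))) \<longlonglongrightarrow> 0"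
  shows "(\<lambda>j. psize (\<lambda>\<omega>. supn T (\<lambda>t. I j t \<omega>))) \<longlonglongrightarrow> 0"
proof -
  define Q where "Q j \<omega> = qv T (\<lambda>k s. f j k s \<omega>)" for j \<omega>
  define U where "U j \<omega> = supn T (\<lambda>t. I j t \<omega>)" for j \<omega>
  have [measurable]: "Q j \<in> borel_measurable M" "U j \<in> borel_measurable M" for j
    unfolding Q_def[abs_def] U_def[abs_def]
    using fmeas_qv[OF vito_fmeas[OF v]] cadapted_supn[OF vito_cadapted[OF v]] by simp_all
  have "(\<lambda>j. psize (U j)) \<longlonglongrightarrow> 0"
    unfolding ennreal_tendsto_0_iff
  proof safe
    fix e' :: real assume "0 < e'"
    \<comment> \<open>Five shares: the level \<open>2 * e\<close> in \<open>psize_le_prob\<close>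
      costs two of them, the event of a large bracket one, and \<open>?D\<close> the remaining two,
      because \<open>d = e ^ 3\<close> makes the quotient \<open>2 * d / e\<^sup>2\<close> equal to
      \<open>2 * e\<close>.\<close>
    define e where "e = e' / 5"
    have e: "0 < e" using \<open>0 < e'\<close> by (simp add: e_def)
    define d where "d = e ^ 3"
    have d: "0 < d" using e by (simp add: d_def)
    have "(\<lambda>n. emeasure M {\<omega> \<in> space M. ennreal d < Q n \<omega>}) \<longlonglongrightarrow> 0"
      using lim d by (intro psize_tendsto_prob) (simp_all add: Q_def[abs_def] fmeas_qv[OF vito_fmeas[OF v]])
    then have "eventually (\<lambda>n. emeasure M {\<omega> \<in> space M. ennreal d < Q n \<omega>} \<le> ennreal e) sequentially"
      using e by (simp add: ennreal_tendsto_0_iff)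
    then show "eventually (\<lambda>n. psize (U n) \<le> ennreal e') sequentially"
    proof eventually_elim
      case (elim n)
      let ?D = "{\<omega> \<in> space M. ennreal (2 * e) < U n \<omega> \<and> Q n \<omega> \<le> ennreal d}"
      have "ennreal (e\<^sup>2) * emeasure M ?D \<le> 2 * (\<integral>\<^sup>+\<omega>. min (Q n \<omega>) (ennreal d) \<partial>M)"
        unfolding Q_def U_def using d by (intro vito_maximal[OF v e]) simp
      also have "\<dots> \<le> 2 * (\<integral>\<^sup>+\<omega>. ennreal d \<partial>M)" by (intro mult_left_mono nn_integral_mono) simp_all
      also have "\<dots> = ennreal (e\<^sup>2) * ennreal (2 * e)"
        using e by (simp add: emeasure_space_1 d_def ennreal_mult'[symmetric] numeral_mult_ennreal power3_eq_cube power2_eq_square mult_ac)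
      finally have D: "emeasure M ?D \<le> ennreal (2 * e)"
        using e by (subst (asm) ennreal_mult_le_mult_iff) simp_all
      have "psize (U n) \<le> ennreal (2 * e) + emeasure M {\<omega> \<in> space M. ennreal (2 * e) < U n \<omega>}"
        by (rule psize_le_prob) simp_all
      also have "emeasure M {\<omega> \<in> space M. ennreal (2 * e) < U n \<omega>} \<le>
          emeasure M (?D \<union> {\<omega> \<in> space M. ennreal d < Q n \<omega>})"
        by (intro emeasure_mono) (auto simp: not_less)
      also have "\<dots> \<le> emeasure M ?D + emeasure M {\<omega> \<in> space M. ennreal d < Q n \<omega>}"
        by (rule emeasure_subadditive) measurable
      also have "\<dots> \<le> ennreal (2 * e) + ennreal e" by (rule add_mono[OF D elim])
      also have "ennreal (2 * e) + (ennreal (2 * e) + ennreal e) = ennreal e'"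
        using e by (simp add: e_def flip: ennreal_plus)
      finally show ?case by (simp add: add_left_mono)
    qed
  qed
  then show ?thesis by (simp add: U_def[abs_def])
qed

text \<open>The layer cake formula, written for the levels \<open>2 * e\<close> at which
  \<open>vito_maximal\<close> gives its bound; the factor in front undoes the rescaling.\<close>

lemma layer_cake_half: "2 * (\<integral>\<^sup>+e. indicator {0<..} e * indicator {e. ennreal (2 * e) < u} e \<partial>lborel) = u"
proof (cases u)
  case (real r)
  have "(\<integral>\<^sup>+e. indicator {0<..} e * indicator {e. ennreal (2 * e) < u} e \<partial>lborel) =
      (\<integral>\<^sup>+e. indicator {0<..<r/2} e \<partial>lborel)"
    using real by (intro nn_integral_cong) (auto simp: indicator_def ennreal_less_iff)
  also have "\<dots> = ennreal (r / 2)" using real by simp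
  finally show ?thesis using real by (simp add: numeral_mult_ennreal)
next
  case top
  have "(\<integral>\<^sup>+e. indicator {0<..} e * indicator {e. ennreal (2 * e) < u} e \<partial>lborel) =
      (\<integral>\<^sup>+e. indicator {0<..} e \<partial>(lborel :: real measure))"
    using top by (intro nn_integral_cong) (auto simp: indicator_def)
  also have "\<dots> = emeasure lborel {0::real<..}" by simp
  also have "\<dots> = \<infinity>"
  proof (rule ccontr)
    assume "emeasure lborel {0::real<..} \<noteq> \<infinity>"
    then obtain n where "emeasure lborel {0::real<..} < of_nat n"
      using ennreal_Ex_less_of_nat[of "emeasure lborel {0::real<..}"] by (auto simp: less_top)
    moreover have "emeasure lborel {0<..<real n} \<le> emeasure lborel {0::real<..}"
      by (intro emeasure_mono) auto
    ultimately show False by (simp add: ennreal_of_nat_eq_real_of_nat)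
  qed
  finally show ?thesis using top by simp
qed

lemma layer_cake: "0 \<le> q \<Longrightarrow> (\<integral>\<^sup>+e. indicator {0<..} e * indicator {e. e < q} e \<partial>lborel) = ennreal q"
proof -
  assume q: "0 \<le> q"
  have "(\<integral>\<^sup>+e. indicator {0<..} e * indicator {e. e < q} e \<partial>lborel) = (\<integral>\<^sup>+e. indicator {0<..<q} e \<partial>lborel)"
    by (intro nn_integral_cong) (auto simp: indicator_def)
  then show ?thesis using q by simp
qed

text \<open>The integrand is 1 up to \<open>e = q\<close>, contributing q, and q^2 / e^2 from there
  on, contributing another q by the antiderivative -q^2 / e.\<close>

lemma truncated_square_integral:
  assumes q: "0 \<le> q"
  shows "(\<integral>\<^sup>+e. indicator {0<..} e * ennreal (min (q\<^sup>2) (e\<^sup>2) / e\<^sup>2) \<partial>lborel) \<le> 2 * ennreal q"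
proof (cases "q = 0")
  case True
  then show ?thesis by simp
next
  case False
  with q have q: "0 < q" by simp
  have "(\<integral>\<^sup>+e. indicator {0<..} e * ennreal (min (q\<^sup>2) (e\<^sup>2) / e\<^sup>2) \<partial>lborel) \<le>
      (\<integral>\<^sup>+e. indicator {0<..q} e + ennreal (q\<^sup>2 / e\<^sup>2) * indicator {q..} e \<partial>lborel)"
  proof (rule nn_integral_mono)
    fix e :: real
    show "indicator {0<..} e * ennreal (min (q\<^sup>2) (e\<^sup>2) / e\<^sup>2) \<le> indicator {0<..q} e + ennreal (q\<^sup>2 / e\<^sup>2) * indicator {q..} e"
    proof (cases "0 < e")
      case e: True
      show ?thesis
      proof (cases "e \<le> q")
        case True
        have "ennreal (min (q\<^sup>2) (e\<^sup>2) / e\<^sup>2) \<le> ennreal 1"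
          using e by (intro ennreal_leI) (simp add: divide_le_eq)
        then show ?thesis using e True by (simp add: add_increasing2)
      next
        case False
        then show ?thesis using e by (simp add: divide_right_mono ennreal_leI)
      qed
    qed simp
  qed
  also have "\<dots> = (\<integral>\<^sup>+e. indicator {0<..q} e \<partial>lborel) + (\<integral>\<^sup>+e. ennreal (q\<^sup>2 / e\<^sup>2) * indicator {q..} e \<partial>lborel)"
    by (rule nn_integral_add) measurable
  also have "(\<integral>\<^sup>+e. ennreal (q\<^sup>2 / e\<^sup>2) * indicator {q..} e \<partial>lborel) = 0 - (- q\<^sup>2 / q)"
  proof (rule nn_integral_FTC_atLeast[where F = "\<lambda>e. - q\<^sup>2 / e"])
    show "((\<lambda>e. - q\<^sup>2 / e) \<longlongrightarrow> 0) at_top" by real_asymp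
    show "((\<lambda>e. - q\<^sup>2 / e) has_real_derivative q\<^sup>2 / e\<^sup>2) (at e)" if "q \<le> e" for e
      using that q by (auto intro!: derivative_eq_intros simp: power2_eq_square)
  qed simp_all
  also have "(\<integral>\<^sup>+e. indicator {0<..q} e \<partial>lborel) = ennreal q" using q by simp
  also have "ennreal q + ennreal (0 - (- q\<^sup>2 / q)) = 2 * ennreal q"
    using q by (simp add: power2_eq_square mult_2)
  finally show ?thesis .
qed

text \<open>
  The maximal inequality is used with \<open>\<delta> = e\<^sup>2\<close> and integrated over \<open>e\<close>.
\<close>

lemma vito_L1:
  assumes v: "vito f I" and q: "q \<in> borel_measurable M" "\<And>\<omega>. \<omega> \<in> space M \<Longrightarrow> 0 \<le> q \<omega>"
    and Q: "\<And>\<omega>. \<omega> \<in> space M \<Longrightarrow> qv T (\<lambda>k s. f k s \<omega>) = ennreal ((q \<omega>)\<^sup>2)"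
  shows "(\<integral>\<^sup>+\<omega>. supn T (\<lambda>t. I t \<omega>) \<partial>M) \<le> 10 * (\<integral>\<^sup>+\<omega>. ennreal (q \<omega>) \<partial>M)"
proof -
  define U where "U \<omega> = supn T (\<lambda>t. I t \<omega>)" for \<omega>
  have [measurable]: "U \<in> borel_measurable M" "q \<in> borel_measurable M"
    unfolding U_def[abs_def] using cadapted_supn[OF vito_cadapted[OF v]] q by simp_all
  interpret pair_sigma_finite M lborel ..
  have le: "emeasure M {\<omega> \<in> space M. ennreal (2 * e) < U \<omega>} \<le>
    (\<integral>\<^sup>+\<omega>. indicator {\<omega> \<in> space M. e < q \<omega>} \<omega> + 2 * ennreal (min ((q \<omega>)\<^sup>2) (e\<^sup>2) / e\<^sup>2) \<partial>M)" if e: "0 < e" for e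
  proof -
    let ?D = "{\<omega> \<in> space M. ennreal (2 * e) < U \<omega> \<and> qv T (\<lambda>k s. f k s \<omega>) \<le> ennreal (e\<^sup>2)}"
    \<comment> \<open>Where \<open>q \<omega> \<le> e\<close> the bracket is at most
      \<open>e\<^sup>2\<close> and the maximal inequality applies; everything else is charged to the
      event \<open>e < q \<omega>\<close>.\<close>
    have sub: "{\<omega> \<in> space M. ennreal (2 * e) < U \<omega>} \<subseteq> ?D \<union> {\<omega> \<in> space M. e < q \<omega>}"
    proof
      fix \<omega> assume \<omega>: "\<omega> \<in> {\<omega> \<in> space M. ennreal (2 * e) < U \<omega>}"
      have m: "\<omega> \<in> space M" "ennreal (2 * e) < U \<omega>" using \<omega> by simp_all
      show "\<omega> \<in> ?D \<union> {\<omega> \<in> space M. e < q \<omega>}"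
      proof (cases "e < q \<omega>")
        case False
        then have "(q \<omega>)\<^sup>2 \<le> e\<^sup>2" using q(2)[OF m(1)] by (intro power_mono) simp_all
        then show ?thesis using m Q[OF m(1)] by (simp add: ennreal_leI)
      qed (use m in simp)
    qed
    have [measurable]: "?D \<in> sets M"
    proof -
      have [measurable]: "(\<lambda>\<omega>. qv T (\<lambda>k s. f k s \<omega>)) \<in> borel_measurable M" by (rule fmeas_qv[OF vito_fmeas[OF v]])
      show ?thesis by measurable
    qed
    have "emeasure M {\<omega> \<in> space M. ennreal (2 * e) < U \<omega>} \<le> emeasure M (?D \<union> {\<omega> \<in> space M. e < q \<omega>})"
      by (rule emeasure_mono[OF sub]) measurable
    also have "\<dots> \<le> emeasure M ?D + emeasure M {\<omega> \<in> space M. e < q \<omega>}"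
      by (rule emeasure_subadditive) measurable
    also have "emeasure M ?D \<le> (\<integral>\<^sup>+\<omega>. 2 * ennreal (min ((q \<omega>)\<^sup>2) (e\<^sup>2) / e\<^sup>2) \<partial>M)"
    proof -
      have "ennreal (e\<^sup>2) * emeasure M ?D \<le> 2 * (\<integral>\<^sup>+\<omega>. min (qv T (\<lambda>k s. f k s \<omega>)) (ennreal (e\<^sup>2)) \<partial>M)"
        unfolding U_def by (intro vito_maximal[OF v e]) simp
      also have "\<dots> = 2 * (\<integral>\<^sup>+\<omega>. ennreal (e\<^sup>2) * ennreal (min ((q \<omega>)\<^sup>2) (e\<^sup>2) / e\<^sup>2) \<partial>M)"
        using e by (intro arg_cong2[of _ _ _ _ "(*)"] refl nn_integral_cong) (simp add: Q ennreal_mult'[symmetric] min_def ennreal_le_iff)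
      also have "\<dots> = ennreal (e\<^sup>2) * (\<integral>\<^sup>+\<omega>. 2 * ennreal (min ((q \<omega>)\<^sup>2) (e\<^sup>2) / e\<^sup>2) \<partial>M)"
        by (simp add: nn_integral_cmult mult_ac)
      finally show ?thesis using e by (subst (asm) ennreal_mult_le_mult_iff) simp_all
    qed
    also have "(\<integral>\<^sup>+\<omega>. 2 * ennreal (min ((q \<omega>)\<^sup>2) (e\<^sup>2) / e\<^sup>2) \<partial>M) + emeasure M {\<omega> \<in> space M. e < q \<omega>} =
      (\<integral>\<^sup>+\<omega>. indicator {\<omega> \<in> space M. e < q \<omega>} \<omega> + 2 * ennreal (min ((q \<omega>)\<^sup>2) (e\<^sup>2) / e\<^sup>2) \<partial>M)"
      by (subst nn_integral_add) (simp_all add: add.commute)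
    finally show ?thesis by (simp add: add_right_mono)
  qed
  have "(\<integral>\<^sup>+\<omega>. (\<integral>\<^sup>+e. indicator {0<..} e * indicator {e. ennreal (2 * e) < U \<omega>} e \<partial>lborel) \<partial>M) =
      (\<integral>\<^sup>+e. (\<integral>\<^sup>+\<omega>. indicator {0<..} e * indicator {e. ennreal (2 * e) < U \<omega>} e \<partial>M) \<partial>lborel)"
    by (rule Fubini'[symmetric]) measurable
  also have "\<dots> = (\<integral>\<^sup>+e. indicator {0<..} e * emeasure M {\<omega> \<in> space M. ennreal (2 * e) < U \<omega>} \<partial>lborel)"
  proof (rule nn_integral_cong)
    fix e :: real
    have "(\<integral>\<^sup>+\<omega>. indicator {0<..} e * indicator {e. ennreal (2 * e) < U \<omega>} e \<partial>M) =
        (\<integral>\<^sup>+\<omega>. indicator {0<..} e * indicator {\<omega> \<in> space M. ennreal (2 * e) < U \<omega>} \<omega> \<partial>M)"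
      by (intro nn_integral_cong) (simp add: indicator_def)
    then show "(\<integral>\<^sup>+\<omega>. indicator {0<..} e * indicator {e. ennreal (2 * e) < U \<omega>} e \<partial>M) =
        indicator {0<..} e * emeasure M {\<omega> \<in> space M. ennreal (2 * e) < U \<omega>}"
      by (simp add: nn_integral_cmult)
  qed
  also have "\<dots> \<le> (\<integral>\<^sup>+e. indicator {0<..} e *
      (\<integral>\<^sup>+\<omega>. indicator {\<omega> \<in> space M. e < q \<omega>} \<omega> + 2 * ennreal (min ((q \<omega>)\<^sup>2) (e\<^sup>2) / e\<^sup>2) \<partial>M) \<partial>lborel)"
    using le by (intro nn_integral_mono) (simp add: indicator_def)
  also have "\<dots> = (\<integral>\<^sup>+e. (\<integral>\<^sup>+\<omega>. indicator {0<..} e *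
      (indicator {e. e < q \<omega>} e + 2 * ennreal (min ((q \<omega>)\<^sup>2) (e\<^sup>2) / e\<^sup>2)) \<partial>M) \<partial>lborel)"
    by (intro nn_integral_cong, subst nn_integral_cmult[symmetric]) (auto intro!: nn_integral_cong simp: indicator_def)
  also have "\<dots> = (\<integral>\<^sup>+\<omega>. (\<integral>\<^sup>+e. indicator {0<..} e *
      (indicator {e. e < q \<omega>} e + 2 * ennreal (min ((q \<omega>)\<^sup>2) (e\<^sup>2) / e\<^sup>2)) \<partial>lborel) \<partial>M)"
    by (rule Fubini') measurable
  \<comment> \<open>\<open>layer_cake\<close> contributes q; the factor 2 of
    \<open>vito_maximal\<close> times the 2 q of \<open>truncated_square_integral\<close>
    contributes 4 q. The final constant 10 is twice this 5, because of the levels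
    \<open>2 * e\<close>.\<close>
  also have "\<dots> \<le> (\<integral>\<^sup>+\<omega>. 5 * ennreal (q \<omega>) \<partial>M)"
  proof (rule nn_integral_mono)
    fix \<omega> assume \<omega>: "\<omega> \<in> space M"
    have "(\<integral>\<^sup>+e. indicator {0<..} e * (indicator {e. e < q \<omega>} e + 2 * ennreal (min ((q \<omega>)\<^sup>2) (e\<^sup>2) / e\<^sup>2)) \<partial>lborel) =
      (\<integral>\<^sup>+e. indicator {0<..} e * indicator {e. e < q \<omega>} e +
        2 * (indicator {0<..} e * ennreal (min ((q \<omega>)\<^sup>2) (e\<^sup>2) / e\<^sup>2)) \<partial>lborel)"
      by (intro nn_integral_cong) (simp add: distrib_left mult_ac)
    also have "\<dots> = (\<integral>\<^sup>+e. indicator {0<..} e * indicator {e. e < q \<omega>} e \<partial>lborel) +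
        2 * (\<integral>\<^sup>+e. indicator {0<..} e * ennreal (min ((q \<omega>)\<^sup>2) (e\<^sup>2) / e\<^sup>2) \<partial>lborel)"
      by (subst nn_integral_add) (simp_all add: nn_integral_cmult)
    also have "\<dots> \<le> ennreal (q \<omega>) + 2 * (2 * ennreal (q \<omega>))"
      using layer_cake[OF q(2)[OF \<omega>]] truncated_square_integral[OF q(2)[OF \<omega>]]
      by (intro add_mono mult_left_mono) simp_all
    also have "\<dots> = 5 * ennreal (q \<omega>)"
      using q(2)[OF \<omega>] by (simp add: numeral_mult_ennreal del: ennreal_plus flip: ennreal_plus)
    finally show "(\<integral>\<^sup>+e. indicator {0<..} e * (indicator {e. e < q \<omega>} e + 2 * ennreal (min ((q \<omega>)\<^sup>2) (e\<^sup>2) / e\<^sup>2)) \<partial>lborel)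
        \<le> 5 * ennreal (q \<omega>)" .
  qed
  also have "\<dots> = 5 * (\<integral>\<^sup>+\<omega>. ennreal (q \<omega>) \<partial>M)" by (rule nn_integral_cmult) measurable
  finally have half: "(\<integral>\<^sup>+\<omega>. (\<integral>\<^sup>+e. indicator {0<..} e * indicator {e. ennreal (2 * e) < U \<omega>} e \<partial>lborel) \<partial>M)
      \<le> 5 * (\<integral>\<^sup>+\<omega>. ennreal (q \<omega>) \<partial>M)" .
  have "(\<integral>\<^sup>+\<omega>. U \<omega> \<partial>M) = (\<integral>\<^sup>+\<omega>. 2 * (\<integral>\<^sup>+e. indicator {0<..} e * indicator {e. ennreal (2 * e) < U \<omega>} e \<partial>lborel) \<partial>M)"
    by (simp only: layer_cake_half)
  also have "\<dots> = 2 * (\<integral>\<^sup>+\<omega>. (\<integral>\<^sup>+e. indicator {0<..} e * indicator {e. ennreal (2 * e) < U \<omega>} e \<partial>lborel) \<partial>M)"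
    by (rule nn_integral_cmult) measurable
  also have "\<dots> \<le> 2 * (5 * (\<integral>\<^sup>+\<omega>. ennreal (q \<omega>) \<partial>M))" by (intro mult_left_mono half) simp
  also have "\<dots> = 10 * (\<integral>\<^sup>+\<omega>. ennreal (q \<omega>) \<partial>M)" by (simp add: mult.assoc[symmetric])
  finally show ?thesis by (simp add: U_def)
qed

end

section \<open>Step functions approximating a path in the mean square\<close>

definition gcell :: "real \<Rightarrow> nat \<Rightarrow> nat \<Rightarrow> real set" where
  "gcell T n i = {T * real i / real n<..T * real (Suc i) / real n}"

text \<open>
  The average is taken over the cell preceding the cell \<open>i\<close>, so that \<open>stepf T n (avg T n p)\<close> is adapted when \<open>p\<close> is.
\<close>

definition avg :: "real \<Rightarrow> nat \<Rightarrow> (real \<Rightarrow> real) \<Rightarrow> nat \<Rightarrow> real" where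
  "avg T n p i = (if i = 0 then 0 else (real n / T) * (LINT s|lborel. p s * indicator (gcell T n (i - 1)) s))"

definition stepf :: "real \<Rightarrow> nat \<Rightarrow> (nat \<Rightarrow> real) \<Rightarrow> real \<Rightarrow> real" where
  "stepf T n a s = (\<Sum>i<n. a i * indicator (gcell T n i) s)"

definition sqn :: "real \<Rightarrow> (real \<Rightarrow> real) \<Rightarrow> ennreal" where
  "sqn T p = (\<integral>\<^sup>+s. ennreal ((p s)\<^sup>2) * indicator {0<..T} s \<partial>lborel)"

lemma qv_sqn: "qv T p = (\<Sum>k. sqn T (p k))"
  by (simp add: qv_def sqn_def)

lemma sqn_cong: "(\<And>s. 0 < s \<Longrightarrow> s \<le> T \<Longrightarrow> p s = q s) \<Longrightarrow> sqn T p = sqn T q"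
  unfolding sqn_def by (intro nn_integral_cong) (simp add: indicator_def)

lemma sqn_mono: "(\<And>s. 0 < s \<Longrightarrow> s \<le> T \<Longrightarrow> \<bar>p s\<bar> \<le> \<bar>q s\<bar>) \<Longrightarrow> sqn T p \<le> sqn T q"
  unfolding sqn_def
  by (intro nn_integral_mono) (simp add: indicator_def abs_le_square_iff ennreal_leI)

lemma sqn_zero [simp]: "sqn T (\<lambda>_. 0) = 0"
  by (simp add: sqn_def)

lemma qv_single: "qv T (\<lambda>k s. if k = k0 then p s else 0) = sqn T p"
proof -
  have "qv T (\<lambda>k s. if k = k0 then p s else 0) = (\<Sum>k\<in>{k0}. sqn T (\<lambda>s. if k = k0 then p s else 0))"
    unfolding qv_sqn by (rule suminf_finite) simp_all
  then show ?thesis by simp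
qed

lemma sqn_add_le:
  assumes "p \<in> borel_measurable borel" "q \<in> borel_measurable borel"
  shows "sqn T (\<lambda>s. p s + q s) \<le> 2 * sqn T p + 2 * sqn T q"
proof -
  have "qv T (\<lambda>k s. (if k = 0 then p s else 0) + (if k = 0 then q s else 0)) \<le>
    2 * qv T (\<lambda>k s. if k = 0 then p s else 0) + 2 * qv T (\<lambda>k s. if k = 0 then q s else 0)"
    using assms by (intro qv_add_le) simp_all
  moreover have "(\<lambda>k s. (if k = 0 then p s else 0) + (if k = 0 then q s else 0)) = (\<lambda>k::nat. \<lambda>s. if k = 0 then p s + q s else 0)"
    by (intro ext) simp
  ultimately show ?thesis by (simp add: qv_single)
qed

lemma sqn_minus: "sqn T (\<lambda>s. - p s) = sqn T p"
  by (simp add: sqn_def)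

lemma sqn_diff_le:
  assumes "p \<in> borel_measurable borel" "q \<in> borel_measurable borel"
  shows "sqn T (\<lambda>s. p s - q s) \<le> 2 * sqn T p + 2 * sqn T q"
  using sqn_add_le[of p "\<lambda>s. - q s" T] assms by (simp add: sqn_minus)

lemma sqn_scale: "sqn T (\<lambda>s. c * p s) = ennreal (c\<^sup>2) * sqn T p" if "p \<in> borel_measurable borel"
  unfolding sqn_def using that
  by (subst nn_integral_cmult[symmetric]) (simp_all add: power_mult_distrib ennreal_mult mult.assoc)

lemma stepf_measurable [measurable]: "stepf T n a \<in> borel_measurable borel"
  unfolding stepf_def[abs_def] gcell_def by measurable

text \<open>Elementary integrands must be bounded. Clamping fixes 0, shrinks absolute values and is
  1-Lipschitz, so it preserves both the mean square bound and the convergence of the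
  averages.\<close>

definition clamp :: "nat \<Rightarrow> real \<Rightarrow> real" where
  "clamp n y = max (- real n) (min (real n) y)"

lemma clamp_zero [simp]: "clamp n 0 = 0" and clamp_abs_le: "\<bar>clamp n y\<bar> \<le> \<bar>y\<bar>"
  and clamp_bdd: "\<bar>clamp n y\<bar> \<le> real n" and clamp_lipschitz: "\<bar>clamp n y - clamp n z\<bar> \<le> \<bar>y - z\<bar>"
  and clamp_eq: "\<bar>y\<bar> \<le> real n \<Longrightarrow> clamp n y = y"
  by (auto simp: clamp_def max_def min_def)

lemma clamp_measurable [measurable]: "clamp n \<in> borel_measurable borel"
  unfolding clamp_def[abs_def] by measurable

text \<open>One index governs the mesh, the truncation level and the number of components, so a
  single sequence approximates the whole integrand by bounded step functions with finitely many
  nonzero components.\<close>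

definition appr :: "real \<Rightarrow> nat \<Rightarrow> (nat \<Rightarrow> real \<Rightarrow> real) \<Rightarrow> nat \<Rightarrow> real \<Rightarrow> real" where
  "appr T n p k s = (if k < n then stepf T n (\<lambda>i. clamp n (avg T n (p k) i)) s else 0)"

lemma appr_measurable [measurable]: "appr T n p k \<in> borel_measurable borel"
  unfolding appr_def[abs_def] by measurable

context
  fixes T :: real
  assumes T: "0 < T"
begin

lemma gcell_ex:
  assumes "0 < s" "s \<le> T" "0 < n"
  shows "\<exists>i<n. s \<in> gcell T n i"
proof -
  define x where "x = s * n / T"
  have x: "0 < x" "x \<le> n" using assms T by (simp_all add: x_def divide_le_eq)
  \<comment> \<open>The ceiling minus one instead of the floor, because the cells are open on the
    left and closed on the right.\<close>
  define i where "i = nat (\<lceil>x\<rceil> - 1)"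
  have c: "1 \<le> \<lceil>x\<rceil>" using x by (simp add: one_le_ceiling)
  then have ri: "real i = of_int \<lceil>x\<rceil> - 1" by (simp add: i_def)
  have "real i < x" "x \<le> real i + 1" using ceiling_correct[of x] ri by linarith+
  moreover have "i < n" using \<open>real i < x\<close> x by linarith
  moreover have "s = T * x / n" using assms T by (simp add: x_def)
  ultimately have "s \<in> gcell T n i" "i < n"
    using T assms by (simp_all add: gcell_def divide_strict_right_mono divide_right_mono)
  then show ?thesis by blast
qed

lemma gcell_unique:
  assumes "s \<in> gcell T n i" "s \<in> gcell T n j" "0 < n"
  shows "i = j"
proof -
  have *: "False" if "i < j" "s \<in> gcell T n i" "s \<in> gcell T n j" for i j
  proof -
    have "real (Suc i) \<le> real j" using that(1) by simp
    then have "T * real (Suc i) / n \<le> T * real j / n" using T by (intro divide_right_mono mult_left_mono) simp_all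
    then show False using that(2,3) by (simp add: gcell_def)
  qed
  show ?thesis using *[of i j] *[of j i] assms by (meson linorder_neqE_nat)
qed

lemma gcell_subset: "i < n \<Longrightarrow> gcell T n i \<subseteq> {0<..T}"
proof
  fix s assume i: "i < n" and s: "s \<in> gcell T n i"
  have "real (Suc i) \<le> real n" using i by simp
  then have "T * real (Suc i) / n \<le> T * real n / n" using T by (intro divide_right_mono mult_left_mono) simp_all
  then have "s \<le> T" using s i by (simp add: gcell_def)
  moreover have "0 \<le> T * real i / n" using T by simp
  then have "0 < s" using s unfolding gcell_def greaterThanAtMost_iff by linarith
  ultimately show "s \<in> {0<..T}" by simp
qed

lemma gcell_sets [measurable]: "gcell T n i \<in> sets borel"
  by (simp add: gcell_def)

lemma emeasure_gcell: "0 < n \<Longrightarrow> emeasure lborel (gcell T n i) = ennreal (T / n)"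
proof -
  assume n: "0 < n"
  have "T * real i / n \<le> T * real (Suc i) / n" using T by (intro divide_right_mono mult_left_mono) simp_all
  then have "emeasure lborel (gcell T n i) = ennreal (T * real (Suc i) / n - T * real i / n)"
    unfolding gcell_def by (rule emeasure_lborel_Ioc)
  also have "T * real (Suc i) / n - T * real i / n = T / n"
    by (simp add: diff_divide_distrib[symmetric] algebra_simps)
  finally show ?thesis .
qed

lemma stepf_at: "s \<in> gcell T n i \<Longrightarrow> i < n \<Longrightarrow> stepf T n a s = a i"
proof -
  assume s: "s \<in> gcell T n i" and i: "i < n"
  have "stepf T n a s = (\<Sum>j<n. if j = i then a i else 0)"
    unfolding stepf_def
  proof (rule sum.cong)
    fix j
    show "a j * indicator (gcell T n j) s = (if j = i then a i else 0)"
      using s i gcell_unique[of s n i j] by (cases "j = i") (auto simp: indicator_def)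
  qed simp
  then show ?thesis using i by simp
qed

lemma sqn_gcells:
  assumes n: "0 < n" and [measurable]: "p \<in> borel_measurable borel"
  shows "sqn T p = (\<Sum>i<n. \<integral>\<^sup>+s. ennreal ((p s)\<^sup>2) * indicator (gcell T n i) s \<partial>lborel)"
proof -
  have "sqn T p = (\<integral>\<^sup>+s. (\<Sum>i<n. ennreal ((p s)\<^sup>2) * indicator (gcell T n i) s) \<partial>lborel)"
    unfolding sqn_def
  proof (rule nn_integral_cong)
    fix s
    show "ennreal ((p s)\<^sup>2) * indicator {0<..T} s = (\<Sum>i<n. ennreal ((p s)\<^sup>2) * indicator (gcell T n i) s)"
    proof (cases "s \<in> {0<..T}")
      case True
      then obtain i where i: "i < n" "s \<in> gcell T n i" using gcell_ex[of s n] n by auto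
      have "(\<Sum>j<n. ennreal ((p s)\<^sup>2) * indicator (gcell T n j) s) = (\<Sum>j<n. if j = i then ennreal ((p s)\<^sup>2) else 0)"
      proof (rule sum.cong)
        fix j
        show "ennreal ((p s)\<^sup>2) * indicator (gcell T n j) s = (if j = i then ennreal ((p s)\<^sup>2) else 0)"
          using i gcell_unique[of s n i j] n by (cases "j = i") (auto simp: indicator_def)
      qed simp
      then show ?thesis using True i by simp
    next
      case False
      then have "s \<notin> gcell T n i" if "i < n" for i using gcell_subset[OF that] by blast
      then show ?thesis using False by simp
    qed
  qed
  also have "\<dots> = (\<Sum>i<n. \<integral>\<^sup>+s. ennreal ((p s)\<^sup>2) * indicator (gcell T n i) s \<partial>lborel)"
    by (rule nn_integral_sum) measurable
  finally show ?thesis .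
qed

text \<open>Cauchy-Schwarz on one cell. Because of the delay, the value used on cell
  \<open>Suc i\<close> is paid for by the energy of \<open>p\<close> on cell \<open>i\<close>. If
  \<open>p\<close> is not integrable there, its Bochner integral is 0 by convention and the
  inequality is trivial.\<close>

lemma avg_square_le:
  assumes [measurable]: "p \<in> borel_measurable borel" and n: "0 < n"
  shows "ennreal ((avg T n p (Suc i))\<^sup>2) * ennreal (T / n) \<le> (\<integral>\<^sup>+s. ennreal ((p s)\<^sup>2) * indicator (gcell T n i) s \<partial>lborel)"
proof -
  let ?c = "gcell T n i"
  let ?L = "LINT s|lborel. p s * indicator ?c s"
  have "ennreal \<bar>?L\<bar> \<le> (\<integral>\<^sup>+s. ennreal \<bar>p s * indicator ?c s\<bar> \<partial>lborel)"
  proof (cases "integrable lborel (\<lambda>s. p s * indicator ?c s)")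
    case True
    have "\<bar>?L\<bar> \<le> (LINT s|lborel. \<bar>p s * indicator ?c s\<bar>)" by (rule integral_abs_bound)
    then have "ennreal \<bar>?L\<bar> \<le> ennreal (LINT s|lborel. \<bar>p s * indicator ?c s\<bar>)" by (rule ennreal_leI)
    also have "\<dots> = (\<integral>\<^sup>+s. ennreal \<bar>p s * indicator ?c s\<bar> \<partial>lborel)"
      using True by (intro nn_integral_eq_integral[symmetric]) simp_all
    finally show ?thesis .
  qed (simp add: not_integrable_integral_eq)
  also have "\<dots> = (\<integral>\<^sup>+s. (ennreal \<bar>p s\<bar> * indicator ?c s) * indicator ?c s \<partial>lborel)"
    by (intro nn_integral_cong) (simp add: indicator_def)
  finally have "(ennreal \<bar>?L\<bar>)\<^sup>2 \<le> (\<integral>\<^sup>+s. (ennreal \<bar>p s\<bar> * indicator ?c s) * indicator ?c s \<partial>lborel)\<^sup>2"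
    by (rule power_mono) simp
  also have "\<dots> \<le> (\<integral>\<^sup>+s. (ennreal \<bar>p s\<bar> * indicator ?c s)\<^sup>2 \<partial>lborel) * (\<integral>\<^sup>+s. (indicator ?c s)\<^sup>2 \<partial>lborel)"
    by (rule Cauchy_Schwarz_nn_integral) measurable
  also have "(\<integral>\<^sup>+s. (indicator ?c s)\<^sup>2 \<partial>lborel) = (\<integral>\<^sup>+s. indicator ?c s \<partial>lborel)"
    by (intro nn_integral_cong) (simp add: indicator_def)
  also have "\<dots> = ennreal (T / n)" using n by (simp add: emeasure_gcell)
  also have "(\<integral>\<^sup>+s. (ennreal \<bar>p s\<bar> * indicator ?c s)\<^sup>2 \<partial>lborel) = (\<integral>\<^sup>+s. ennreal ((p s)\<^sup>2) * indicator ?c s \<partial>lborel)"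
    by (intro nn_integral_cong) (simp add: indicator_def ennreal_power)
  finally have L: "ennreal (?L\<^sup>2) \<le> (\<integral>\<^sup>+s. ennreal ((p s)\<^sup>2) * indicator ?c s \<partial>lborel) * ennreal (T / n)"
    by (simp add: ennreal_power)
  have "ennreal ((avg T n p (Suc i))\<^sup>2) * ennreal (T / n) = ennreal (n / T) * ennreal (?L\<^sup>2)"
    using T n by (simp add: avg_def ennreal_mult[symmetric] power2_eq_square mult_ac)
  also have "\<dots> \<le> ennreal (n / T) * ((\<integral>\<^sup>+s. ennreal ((p s)\<^sup>2) * indicator ?c s \<partial>lborel) * ennreal (T / n))"
    by (intro mult_left_mono L) simp
  also have "\<dots> = (ennreal (n / T) * ennreal (T / n)) * (\<integral>\<^sup>+s. ennreal ((p s)\<^sup>2) * indicator ?c s \<partial>lborel)"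
    by (simp only: mult_ac)
  also have "ennreal (n / T) * ennreal (T / n) = 1"
    using T n by (simp add: ennreal_mult[symmetric])
  finally show ?thesis by simp
qed

text \<open>Sum \<open>avg_square_le\<close> over the cells: the first value is 0 and the energy of
  the last cell is not spent. This contraction, uniform in \<open>n\<close>, is what allows
  convergence to be checked on a dense class only (\<open>L2conv_approx\<close>).\<close>

lemma sqn_stepf_avg_le:
  assumes p [measurable]: "p \<in> borel_measurable borel" and n: "0 < n"
  shows "sqn T (stepf T n (avg T n p)) \<le> sqn T p"
proof -
  have "sqn T (stepf T n (avg T n p)) =
      (\<Sum>i<n. \<integral>\<^sup>+s. ennreal ((stepf T n (avg T n p) s)\<^sup>2) * indicator (gcell T n i) s \<partial>lborel)"
    by (rule sqn_gcells[OF n]) measurable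
  also have "\<dots> = (\<Sum>i<n. ennreal ((avg T n p i)\<^sup>2) * ennreal (T / n))"
  proof (rule sum.cong)
    fix i assume "i \<in> {..<n}"
    then have i: "i < n" by simp
    have "(\<integral>\<^sup>+s. ennreal ((stepf T n (avg T n p) s)\<^sup>2) * indicator (gcell T n i) s \<partial>lborel) =
      (\<integral>\<^sup>+s. ennreal ((avg T n p i)\<^sup>2) * indicator (gcell T n i) s \<partial>lborel)"
      by (intro nn_integral_cong) (simp add: indicator_def stepf_at[OF _ i])
    also have "\<dots> = ennreal ((avg T n p i)\<^sup>2) * ennreal (T / n)"
      using n by (simp add: nn_integral_cmult emeasure_gcell)
    finally show "(\<integral>\<^sup>+s. ennreal ((stepf T n (avg T n p) s)\<^sup>2) * indicator (gcell T n i) s \<partial>lborel) = \<dots>" .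
  qed simp
  also obtain m where m: "n = Suc m" using n by (cases n) simp_all
  have "(\<Sum>i<n. ennreal ((avg T n p i)\<^sup>2) * ennreal (T / n)) = (\<Sum>i<m. ennreal ((avg T n p (Suc i))\<^sup>2) * ennreal (T / n))"
    unfolding m sum.lessThan_Suc_shift by (simp add: avg_def)
  also have "\<dots> \<le> (\<Sum>i<m. \<integral>\<^sup>+s. ennreal ((p s)\<^sup>2) * indicator (gcell T n i) s \<partial>lborel)"
    by (intro sum_mono avg_square_le p n)
  also have "\<dots> \<le> (\<Sum>i<n. \<integral>\<^sup>+s. ennreal ((p s)\<^sup>2) * indicator (gcell T n i) s \<partial>lborel)"
    unfolding m by simp
  also have "\<dots> = sqn T p" by (rule sqn_gcells[OF n p, symmetric])
  finally show ?thesis .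
qed

section \<open>Mean square convergence of the delayed averages\<close>

definition L2 :: "(real \<Rightarrow> real) \<Rightarrow> bool" where
  "L2 p \<longleftrightarrow> p \<in> borel_measurable borel \<and> sqn T p < \<infinity>"

lemma L2_integrable:
  assumes "L2 p" and i: "i < n"
  shows "integrable lborel (\<lambda>s. p s * indicator (gcell T n i) s)"
proof -
  have [measurable]: "p \<in> borel_measurable borel" and fin: "sqn T p < \<infinity>" using assms by (simp_all add: L2_def)
  have "(\<integral>\<^sup>+s. ennreal (norm (p s * indicator (gcell T n i) s)) \<partial>lborel) \<le>
      (\<integral>\<^sup>+s. ennreal ((p s)\<^sup>2) * indicator {0<..T} s + indicator {0<..T} s \<partial>lborel)"
  proof (rule nn_integral_mono)
    fix s
    have "\<bar>p s\<bar> \<le> (p s)\<^sup>2 + 1"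
      using sum_squares_bound[of "\<bar>p s\<bar>" 1] by (simp add: power2_eq_square)
    then have "ennreal \<bar>p s\<bar> \<le> ennreal ((p s)\<^sup>2) + 1"
      using ennreal_leI[of "\<bar>p s\<bar>" "(p s)\<^sup>2 + 1"] by (simp add: ennreal_plus)
    moreover have "s \<in> gcell T n i \<Longrightarrow> s \<in> {0<..T}" using gcell_subset[OF i] by blast
    ultimately show "ennreal (norm (p s * indicator (gcell T n i) s)) \<le>
        ennreal ((p s)\<^sup>2) * indicator {0<..T} s + indicator {0<..T} s"
      by (cases "s \<in> gcell T n i") simp_all
  qed
  also have "\<dots> = sqn T p + ennreal T"
    unfolding sqn_def using T by (subst nn_integral_add) simp_all
  also have "\<dots> < \<infinity>" using fin by (simp add: less_top)
  finally show ?thesis by (intro integrableI_bounded) simp_all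
qed

lemma stepf_diff: "stepf T n a s - stepf T n b s = stepf T n (\<lambda>i. a i - b i) s"
  unfolding stepf_def by (simp add: sum_subtractf left_diff_distrib)

lemma stepf_scale: "stepf T n (\<lambda>i. c * a i) s = c * stepf T n a s"
  unfolding stepf_def by (simp only: sum_distrib_left mult.assoc)

lemma stepf_cong: "(\<And>i. i < n \<Longrightarrow> a i = b i) \<Longrightarrow> stepf T n a s = stepf T n b s"
  unfolding stepf_def by (intro sum.cong) simp_all

lemma avg_diff:
  assumes "L2 p" "L2 q" "i < n"
  shows "avg T n (\<lambda>s. p s - q s) i = avg T n p i - avg T n q i"
proof (cases i)
  case (Suc j)
  then have "integrable lborel (\<lambda>s. p s * indicator (gcell T n j) s)" "integrable lborel (\<lambda>s. q s * indicator (gcell T n j) s)"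
    using assms by (simp_all add: L2_integrable)
  then show ?thesis using Suc by (simp add: avg_def left_diff_distrib right_diff_distrib)
qed (simp add: avg_def)

lemma avg_scale: "avg T n (\<lambda>s. c * p s) i = c * avg T n p i"
  by (simp add: avg_def mult.assoc)

lemma L2_diff: "L2 p \<Longrightarrow> L2 q \<Longrightarrow> L2 (\<lambda>s. p s - q s)"
  unfolding L2_def using sqn_diff_le[of p q T]
  by (auto simp: ennreal_mult_less_top intro: le_less_trans)

lemma L2_scale: "L2 p \<Longrightarrow> L2 (\<lambda>s. c * p s)"
  unfolding L2_def by (auto simp: sqn_scale ennreal_mult_less_top)

definition L2conv :: "(real \<Rightarrow> real) \<Rightarrow> bool" where
  "L2conv p \<longleftrightarrow> (\<lambda>n. sqn T (\<lambda>s. stepf T (Suc n) (avg T (Suc n) p) s - p s)) \<longlonglongrightarrow> 0"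

lemma L2conv_diff:
  assumes p: "L2 p" "L2conv p" and q: "L2 q" "L2conv q"
  shows "L2conv (\<lambda>s. p s - q s)"
  unfolding L2conv_def
proof (rule tendsto_0_double_add[OF _ p(2)[unfolded L2conv_def] q(2)[unfolded L2conv_def]])
  fix n
  have "sqn T (\<lambda>s. stepf T (Suc n) (avg T (Suc n) (\<lambda>s. p s - q s)) s - (p s - q s)) =
    sqn T (\<lambda>s. (stepf T (Suc n) (avg T (Suc n) p) s - p s) - (stepf T (Suc n) (avg T (Suc n) q) s - q s))"
  proof (rule sqn_cong)
    fix s
    have "stepf T (Suc n) (avg T (Suc n) (\<lambda>s. p s - q s)) s = stepf T (Suc n) (avg T (Suc n) p) s - stepf T (Suc n) (avg T (Suc n) q) s"
      unfolding stepf_diff by (intro stepf_cong avg_diff p q)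
    then show "stepf T (Suc n) (avg T (Suc n) (\<lambda>s. p s - q s)) s - (p s - q s) =
      (stepf T (Suc n) (avg T (Suc n) p) s - p s) - (stepf T (Suc n) (avg T (Suc n) q) s - q s)" by simp
  qed
  also have "\<dots> \<le> 2 * sqn T (\<lambda>s. stepf T (Suc n) (avg T (Suc n) p) s - p s) + 2 * sqn T (\<lambda>s. stepf T (Suc n) (avg T (Suc n) q) s - q s)"
  proof (rule sqn_diff_le)
    have [measurable]: "p \<in> borel_measurable borel" "q \<in> borel_measurable borel" using p q by (simp_all add: L2_def)
    show "(\<lambda>s. stepf T (Suc n) (avg T (Suc n) p) s - p s) \<in> borel_measurable borel"
      "(\<lambda>s. stepf T (Suc n) (avg T (Suc n) q) s - q s) \<in> borel_measurable borel" by measurable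
  qed
  finally show "sqn T (\<lambda>s. stepf T (Suc n) (avg T (Suc n) (\<lambda>s. p s - q s)) s - (p s - q s)) \<le> \<dots>" .
qed

lemma L2conv_scale:
  assumes p: "L2 p" "L2conv p"
  shows "L2conv (\<lambda>s. c * p s)"
proof -
  have [measurable]: "p \<in> borel_measurable borel" using p by (simp add: L2_def)
  have "sqn T (\<lambda>s. stepf T (Suc n) (avg T (Suc n) (\<lambda>s. c * p s)) s - c * p s) =
    ennreal (c\<^sup>2) * sqn T (\<lambda>s. stepf T (Suc n) (avg T (Suc n) p) s - p s)" for n
    by (subst sqn_scale[symmetric]) (simp_all add: avg_scale[abs_def] stepf_scale right_diff_distrib)
  moreover have "(\<lambda>n. ennreal (c\<^sup>2) * sqn T (\<lambda>s. stepf T (Suc n) (avg T (Suc n) p) s - p s)) \<longlonglongrightarrow> ennreal (c\<^sup>2) * 0"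
    using p(2) unfolding L2conv_def by (intro ennreal_tendsto_cmult) simp_all
  ultimately show ?thesis unfolding L2conv_def by simp
qed

lemma L2conv_cong:
  assumes "\<And>s. 0 < s \<Longrightarrow> s \<le> T \<Longrightarrow> p s = q s"
  shows "L2conv p \<longleftrightarrow> L2conv q"
proof -
  have a: "avg T n p i = avg T n q i" if "i < n" for n i
  proof (cases i)
    case (Suc j)
    then have "(\<lambda>s. p s * indicator (gcell T n j) s) = (\<lambda>s. q s * indicator (gcell T n j) s)"
      using assms gcell_subset[of j n] that by (intro ext) (auto simp: indicator_def subset_eq)
    then show ?thesis by (simp add: avg_def Suc)
  qed (simp add: avg_def)
  have "stepf T n (avg T n p) s = stepf T n (avg T n q) s" for n s by (rule stepf_cong) (rule a)
  then have "sqn T (\<lambda>s. stepf T n (avg T n p) s - p s) = sqn T (\<lambda>s. stepf T n (avg T n q) s - q s)" for n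
    by (intro sqn_cong) (simp add: assms)
  then show ?thesis by (simp add: L2conv_def)
qed

lemma L2conv_approx:
  assumes p: "L2 p" and ap: "\<And>e. 0 < e \<Longrightarrow> \<exists>q. L2 q \<and> L2conv q \<and> sqn T (\<lambda>s. p s - q s) \<le> ennreal e"
  shows "L2conv p"
  unfolding L2conv_def ennreal_tendsto_0_iff
proof safe
  fix e :: real assume e: "0 < e"
  \<comment> \<open>Tenths, since the two uses of the weak triangle inequality below give the total
    factor 2 + 2 (2 + 2) = 10.\<close>
  obtain q where q: "L2 q" "L2conv q" "sqn T (\<lambda>s. p s - q s) \<le> ennreal (e / 10)" using ap[of "e/10"] e by auto
  have [measurable]: "p \<in> borel_measurable borel" "q \<in> borel_measurable borel" using p q by (simp_all add: L2_def)
  have "\<forall>\<^sub>F n in sequentially. sqn T (\<lambda>s. stepf T (Suc n) (avg T (Suc n) q) s - q s) \<le> ennreal (e / 10)"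
    using q(2) e unfolding L2conv_def ennreal_tendsto_0_iff by simp
  then show "\<forall>\<^sub>F n in sequentially. sqn T (\<lambda>s. stepf T (Suc n) (avg T (Suc n) p) s - p s) \<le> ennreal e"
  proof eventually_elim
    case (elim n)
    let ?S = "\<lambda>p. stepf T (Suc n) (avg T (Suc n) p)"
    have d: "?S p s - ?S q s = ?S (\<lambda>s. p s - q s) s" for s
      unfolding stepf_diff by (intro stepf_cong avg_diff[symmetric] p q)
    have "sqn T (\<lambda>s. ?S p s - p s) = sqn T (\<lambda>s. ?S (\<lambda>s. p s - q s) s + ((?S q s - q s) - (p s - q s)))"
      by (intro sqn_cong) (simp add: d[symmetric])
    also have "\<dots> \<le> 2 * sqn T (?S (\<lambda>s. p s - q s)) + 2 * sqn T (\<lambda>s. (?S q s - q s) - (p s - q s))"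
      by (rule sqn_add_le) measurable
    also have "\<dots> \<le> 2 * ennreal (e / 10) + 2 * (2 * ennreal (e / 10) + 2 * ennreal (e / 10))"
    proof (intro add_mono mult_left_mono)
      have "sqn T (?S (\<lambda>s. p s - q s)) \<le> sqn T (\<lambda>s. p s - q s)" by (rule sqn_stepf_avg_le) simp_all
      then show "sqn T (?S (\<lambda>s. p s - q s)) \<le> ennreal (e / 10)" using q(3) by (rule order_trans)
      have "sqn T (\<lambda>s. (?S q s - q s) - (p s - q s)) \<le> 2 * sqn T (\<lambda>s. ?S q s - q s) + 2 * sqn T (\<lambda>s. p s - q s)"
        by (rule sqn_diff_le) measurable
      also have "\<dots> \<le> 2 * ennreal (e / 10) + 2 * ennreal (e / 10)"
        by (intro add_mono mult_left_mono elim q(3)) simp_all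
      finally show "sqn T (\<lambda>s. (?S q s - q s) - (p s - q s)) \<le> 2 * ennreal (e / 10) + 2 * ennreal (e / 10)" .
    qed simp_all
    also have "\<dots> = ennreal e"
      using e by (simp add: numeral_mult_ennreal del: ennreal_plus flip: ennreal_plus)
    finally show ?case .
  qed
qed

lemma sqn_dominated:
  assumes [measurable]: "\<And>n. f n \<in> borel_measurable borel" "g \<in> borel_measurable borel"
    and b: "\<And>n s. 0 < s \<Longrightarrow> s \<le> T \<Longrightarrow> \<bar>f n s\<bar> \<le> \<bar>g s\<bar>" and g: "sqn T g < \<infinity>"
    and lim: "AE s in lborel. 0 < s \<longrightarrow> s \<le> T \<longrightarrow> (\<lambda>n. f n s) \<longlonglongrightarrow> 0"
  shows "(\<lambda>n. sqn T (f n)) \<longlonglongrightarrow> 0"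
proof -
  have "(\<lambda>n. sqn T (f n)) \<longlonglongrightarrow> (\<integral>\<^sup>+s. 0 \<partial>(lborel :: real measure))"
    unfolding sqn_def
  proof (rule nn_integral_dominated_convergence[where w = "\<lambda>s. ennreal ((g s)\<^sup>2) * indicator {0<..T} s"])
    show "AE s in lborel. ennreal ((f n s)\<^sup>2) * indicator {0<..T} s \<le> ennreal ((g s)\<^sup>2) * indicator {0<..T} s" for n
      using b by (intro AE_I2) (simp add: indicator_def abs_le_square_iff ennreal_leI)
    show "(\<integral>\<^sup>+s. ennreal ((g s)\<^sup>2) * indicator {0<..T} s \<partial>lborel) < \<infinity>" using g by (simp add: sqn_def)
    show "AE s in lborel. (\<lambda>n. ennreal ((f n s)\<^sup>2) * indicator {0<..T} s) \<longlonglongrightarrow> 0"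
      using lim
    proof eventually_elim
      case (elim s)
      show ?case
      proof (cases "0 < s \<and> s \<le> T")
        case True
        then have "(\<lambda>n. f n s) \<longlonglongrightarrow> 0" using elim by simp
        then have "(\<lambda>n. ennreal ((f n s)\<^sup>2)) \<longlonglongrightarrow> ennreal (0\<^sup>2)" by (intro tendsto_ennrealI tendsto_power)
        then show ?thesis using True by simp
      qed (auto simp: indicator_def)
    qed
  qed measurable
  then show ?thesis by simp
qed

lemma sqn_const: "sqn T (\<lambda>_. c) < \<infinity>"
proof -
  have "sqn T (\<lambda>_. c) = ennreal (c\<^sup>2) * ennreal T" unfolding sqn_def using T by (simp add: nn_integral_cmult)
  then show ?thesis by (simp add: ennreal_mult_less_top)
qed

lemma L2_indicator: "A \<in> sets borel \<Longrightarrow> L2 (indicator A)"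
proof -
  assume A: "A \<in> sets borel"
  have "sqn T (indicator A) \<le> sqn T (\<lambda>_. 1)" by (rule sqn_mono) (simp add: indicator_def)
  then show ?thesis using A sqn_const[of 1] by (auto simp: L2_def intro: le_less_trans)
qed

lemma avg_const_on:
  assumes "\<And>s. s \<in> gcell T n i \<Longrightarrow> p s = c" "0 < n"
  shows "avg T n p (Suc i) = c"
proof -
  have "(\<lambda>s. p s * indicator (gcell T n i) s) = (\<lambda>s. c * indicator (gcell T n i) s)"
    using assms(1) by (intro ext) (simp add: indicator_def)
  then have "avg T n p (Suc i) = (n / T) * (c * measure lborel (gcell T n i))"
    by (simp add: avg_def)
  also have "measure lborel (gcell T n i) = T / n"
    using emeasure_gcell[OF assms(2), of i] T by (simp add: measure_def)
  finally show ?thesis using T assms(2) by simp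
qed

text \<open>At any s other than the jump \<open>a\<close>, the cell preceding that of s finally lies
  on the same side of \<open>a\<close> as s, and there the average is exact. The errors are bounded
  by 1, so dominated convergence applies.\<close>

lemma L2conv_atMost: "L2conv (indicator {..a})"
  unfolding L2conv_def
proof (rule sqn_dominated[where g = "\<lambda>_. 1"])
  have bd: "\<bar>avg T (Suc n) (indicator {..a}) i\<bar> \<le> 1 \<and> 0 \<le> avg T (Suc n) (indicator {..a}) i" for n i
  proof (cases i)
    case (Suc j)
    have "(LINT s|lborel. indicator {..a} s * indicator (gcell T (Suc n) j) s) = measure lborel ({..a} \<inter> gcell T (Suc n) j)"
      by (simp add: indicator_inter_arith[symmetric])
    moreover have "measure lborel ({..a} \<inter> gcell T (Suc n) j) \<le> measure lborel (gcell T (Suc n) j)"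
      using emeasure_gcell[of "Suc n" j] by (intro measure_mono_fmeasurable) (simp_all add: fmeasurable_def)
    moreover have "measure lborel (gcell T (Suc n) j) = T / Suc n"
      using emeasure_gcell[of "Suc n" j] T by (simp add: measure_def)
    ultimately show ?thesis using Suc T by (simp add: avg_def divide_le_eq mult.commute le_divide_eq)
  qed (simp add: avg_def)
  show "\<bar>stepf T (Suc n) (avg T (Suc n) (indicator {..a})) s - indicator {..a} s\<bar> \<le> \<bar>1\<bar>" if s: "0 < s" "s \<le> T" for n s
  proof -
    obtain i where i: "i < Suc n" "s \<in> gcell T (Suc n) i" using gcell_ex[OF s, of "Suc n"] by auto
    show ?thesis using bd[of n i] unfolding stepf_at[OF i(2,1)] by (auto simp: indicator_def)
  qed
  show "AE s in lborel. 0 < s \<longrightarrow> s \<le> T \<longrightarrow>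
      (\<lambda>n. stepf T (Suc n) (avg T (Suc n) (indicator {..a})) s - indicator {..a} s) \<longlonglongrightarrow> 0"
    using AE_lborel_singleton[of a]
  proof eventually_elim
    case (elim s)
    show ?case
    proof (intro impI)
      assume s: "0 < s" "s \<le> T"
      \<comment> \<open>The part \<open>s\<close> of the minimum keeps s out of the first cell,
        whose value is 0 by definition; the part \<open>\<bar>s - a\<bar>\<close> keeps the
        preceding cell on the same side of \<open>a\<close>. Points of that cell are within two mesh
        widths of s, hence the condition on \<open>2 * T / Suc n\<close>.\<close>
      define \<delta> where "\<delta> = min s \<bar>s - a\<bar>"
      have \<delta>: "0 < \<delta>" using s elim by (simp add: \<delta>_def)
      have "(\<lambda>n. 2 * T / Suc n) \<longlonglongrightarrow> 0" by real_asymp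
      then have "\<forall>\<^sub>F n in sequentially. 2 * T / Suc n < \<delta>" using \<delta> by (rule order_tendstoD)
      then have "\<forall>\<^sub>F n in sequentially. stepf T (Suc n) (avg T (Suc n) (indicator {..a})) s - indicator {..a} s = 0"
      proof eventually_elim
        case (elim n)
        obtain i where i: "i < Suc n" "s \<in> gcell T (Suc n) i" using gcell_ex[OF s, of "Suc n"] by auto
        have si: "T * i / Suc n < s" "s \<le> T * (i + 1) / Suc n" using i(2) by (simp_all add: gcell_def add.commute)
        have "i \<noteq> 0"
        proof
          assume "i = 0"
          then have "s \<le> T / Suc n" using si by simp
          also have "\<dots> \<le> 2 * T / Suc n" using T by (simp add: divide_right_mono)
          finally show False using elim by (simp add: \<delta>_def)
        qed
        then obtain j where j: "i = Suc j" by (cases i) simp_all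
        have "avg T (Suc n) (indicator {..a}) (Suc j) = indicator {..a} s"
        proof (rule avg_const_on)
          fix r assume r: "r \<in> gcell T (Suc n) j"
          have r1: "T * j / Suc n < r" "r \<le> T * (j + 1) / Suc n" using r by (simp_all add: gcell_def add.commute)
          have "r < s" using r1 si j by (simp add: add.commute)
          have e: "T * (real j + 2) / Suc n = T * j / Suc n + 2 * T / Suc n"
            by (simp add: add_divide_distrib[symmetric] algebra_simps)
          have "s \<le> T * (real j + 2) / Suc n" using si(2) j by (simp add: add.commute add.left_commute)
          then have "s - r < \<delta>" using r1(1) elim unfolding e by linarith
          then show "indicator {..a} r = indicator {..a} s"
            using \<open>r < s\<close> by (auto simp: \<delta>_def indicator_def)
        qed simp
        then show ?case unfolding stepf_at[OF i(2,1)] j by simp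
      qed
      then show "(\<lambda>n. stepf T (Suc n) (avg T (Suc n) (indicator {..a})) s - indicator {..a} s) \<longlonglongrightarrow> 0"
        by (rule tendsto_eventually)
    qed
  qed
qed (use sqn_const in simp_all)

text \<open>Half lines generate the Borel sets and are stable under intersection, so Dynkin's
  theorem reduces the claim to complements and disjoint unions. Countable unions are mean square
  limits of finite ones, which \<open>L2conv_approx\<close> accepts.\<close>

lemma L2conv_indicator:
  assumes "A \<in> sets borel"
  shows "L2conv (indicator A)"
proof -
  have eq: "sets borel = sigma_sets UNIV (range (\<lambda>a::real. {..a}))"
    unfolding borel_eq_atMost by (rule sets_measure_of) simp
  have "Int_stable (range (\<lambda>a::real. {..a}))"
  proof (rule Int_stableI_image)
    fix i j :: real
    have "{..i} \<inter> {..j} = {..min i j}" by auto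
    then show "\<exists>k\<in>UNIV. {..i} \<inter> {..j} = {..k}" by blast
  qed
  moreover have "range (\<lambda>a::real. {..a}) \<subseteq> Pow UNIV" by simp
  moreover have "A \<in> sigma_sets UNIV (range (\<lambda>a::real. {..a}))" using assms eq by simp
  ultimately show ?thesis
  proof (induction rule: sigma_sets_induct_disjoint)
    case (basic A)
    then show ?case using L2conv_atMost by auto
  next
    case empty
    have "L2conv (\<lambda>s. 0 * indicator {..0} s)"
      by (rule L2conv_scale) (simp_all add: L2_indicator L2conv_atMost)
    then show ?case by (simp add: indicator_def)
  next
    case (compl A)
    then have A: "A \<in> sets borel" using eq by simp
    \<comment> \<open>The complement may be taken within \<open>{..T}\<close>, since
      \<open>L2conv\<close> depends only on values on (0, T].\<close>
    have "L2conv (\<lambda>s. indicator {..T} s - indicator A s)"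
      by (rule L2conv_diff) (simp_all add: L2_indicator L2conv_atMost A compl.IH)
    then show ?case by (rule L2conv_cong[THEN iffD1, rotated]) (simp add: indicator_def)
  next
    case (union A)
    then have [measurable]: "A i \<in> sets borel" for i using eq by auto
    define B where "B n = (\<Union>i<n. A i)" for n :: nat
    have [measurable]: "B n \<in> sets borel" for n by (simp add: B_def)
    have B: "L2conv (indicator (B n))" for n
    proof (induction n)
      case 0
      have "L2conv (\<lambda>s. 0 * indicator {..0} s)"
        by (rule L2conv_scale) (simp_all add: L2_indicator L2conv_atMost)
      then show ?case by (simp add: B_def indicator_def)
    next
      case (Suc n)
      have "L2conv (\<lambda>s. indicator (B n) s - (- 1) * indicator (A n) s)"
        by (rule L2conv_diff[OF L2_indicator Suc L2_scale[OF L2_indicator] L2conv_scale[OF L2_indicator union(3)]]) measurable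
      moreover have "indicator (B n) s - (- 1) * indicator (A n) s = (indicator (B (Suc n)) s :: real)" for s
      proof -
        have "s \<notin> B n" if "s \<in> A n"
        proof
          assume "s \<in> B n"
          then obtain i where "i < n" "s \<in> A i" by (auto simp: B_def)
          then show False using that disjoint_family_onD[OF union(1), of i n] by auto
        qed
        moreover have "s \<in> B (Suc n) \<longleftrightarrow> s \<in> B n \<or> s \<in> A n" by (auto simp: B_def less_Suc_eq)
        ultimately show ?thesis by (simp add: indicator_def)
      qed
      ultimately show ?case by simp
    qed
    show ?case
    proof (rule L2conv_approx)
      show "L2 (indicator (\<Union> (range A)))" by (rule L2_indicator) simp
      have "(\<lambda>n. sqn T (\<lambda>s. indicator (\<Union> (range A)) s - indicator (B n) s)) \<longlonglongrightarrow> 0"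
      proof (rule sqn_dominated[where g = "\<lambda>_. 1"])
        show "AE s in lborel. 0 < s \<longrightarrow> s \<le> T \<longrightarrow> (\<lambda>n. indicator (\<Union> (range A)) s - indicator (B n) s :: real) \<longlonglongrightarrow> 0"
        proof (intro AE_I2 impI)
          fix s
          have "incseq B" unfolding B_def by (rule incseq_SucI) (auto simp: less_Suc_eq)
          moreover have "(\<Union>n. B n) = \<Union> (range A)" by (auto simp: B_def)
          ultimately have "(\<lambda>n. indicator (B n) s :: real) \<longlonglongrightarrow> indicator (\<Union> (range A)) s"
            using LIMSEQ_indicator_incseq[of B s] by simp
          then have "(\<lambda>n. indicator (\<Union> (range A)) s - indicator (B n) s :: real) \<longlonglongrightarrow> indicator (\<Union> (range A)) s - indicator (\<Union> (range A)) s"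
            by (intro tendsto_diff tendsto_const)
          then show "(\<lambda>n. indicator (\<Union> (range A)) s - indicator (B n) s :: real) \<longlonglongrightarrow> 0" by simp
        qed
        show "\<bar>indicator (\<Union> (range A)) s - indicator (B n) s\<bar> \<le> \<bar>1 :: real\<bar>" for n s
          by (simp add: indicator_def)
      qed (use sqn_const in simp_all)
      then have ev: "\<forall>\<^sub>F n in sequentially. sqn T (\<lambda>s. indicator (\<Union> (range A)) s - indicator (B n) s) \<le> ennreal e" if "0 < e" for e
        using that unfolding ennreal_tendsto_0_iff by blast
      show "\<exists>q. L2 q \<and> L2conv q \<and> sqn T (\<lambda>s. indicator (\<Union> (range A)) s - q s) \<le> ennreal e" if e: "0 < e" for e
      proof -
        obtain n where "sqn T (\<lambda>s. indicator (\<Union> (range A)) s - indicator (B n) s) \<le> ennreal e"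
          using eventually_happens[OF ev[OF e]] by auto
        then show ?thesis using B[of n] L2_indicator[of "B n"] by (intro exI[of _ "indicator (B n)"]) simp
      qed
    qed
  qed
qed

lemma L2conv_sum_indicator:
  assumes "finite Y" "\<And>y. y \<in> Y \<Longrightarrow> A y \<in> sets borel"
  shows "L2 (\<lambda>s. \<Sum>y\<in>Y. y * indicator (A y) s) \<and> L2conv (\<lambda>s. \<Sum>y\<in>Y. y * indicator (A y) s)"
  using assms
proof (induction Y rule: finite_induct)
  case empty
  have e: "(\<lambda>s. 0) = (indicator {} :: real \<Rightarrow> real)" by (intro ext) simp
  show ?case unfolding sum.empty e by (simp only: L2_indicator L2conv_indicator sets.empty_sets)
next
  case (insert y Y)
  have A: "A y \<in> sets borel" using insert by simp
  let ?f = "\<lambda>s. \<Sum>y\<in>Y. y * indicator (A y) s"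
  have f: "L2 ?f" "L2conv ?f" using insert by simp_all
  have g: "L2 (\<lambda>s. (- y) * indicator (A y) s)" "L2conv (\<lambda>s. (- y) * indicator (A y) s)"
    by (intro L2_scale L2conv_scale L2_indicator L2conv_indicator A)+
  have "L2 (\<lambda>s. ?f s - (- y) * indicator (A y) s)" "L2conv (\<lambda>s. ?f s - (- y) * indicator (A y) s)"
    by (rule L2_diff[OF f(1) g(1)], rule L2conv_diff[OF f g])
  moreover have "(\<lambda>s. ?f s - (- y) * indicator (A y) s) = (\<lambda>s. \<Sum>y\<in>insert y Y. y * indicator (A y) s)"
    by (intro ext) (simp only: sum.insert[OF insert.hyps] diff_minus_eq_add mult_minus_left add.commute)
  ultimately show ?case by simp
qed

text \<open>Simple functions \<open>F i\<close> with \<open>\<bar>F i\<bar>\<close> at most twice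
  \<open>\<bar>p\<bar>\<close> converge to \<open>p\<close> everywhere, hence in mean square with
  \<open>3 * p\<close> as majorant. Each is a finite combination of indicators, already
  treated.\<close>

lemma L2_L2conv:
  assumes p: "L2 p"
  shows "L2conv p"
proof (rule L2conv_approx[OF p])
  fix e :: real assume e: "0 < e"
  have pm [measurable]: "p \<in> borel_measurable borel" using p by (simp add: L2_def)
  then have "p \<in> borel_measurable lborel" by simp
  from borel_measurable_implies_sequence_metric[OF this, of 0]
  obtain F where F: "\<And>i. simple_function lborel (F i)" "\<And>s. (\<lambda>i. F i s) \<longlonglongrightarrow> p s" "\<And>i s. \<bar>F i s\<bar> \<le> 2 * \<bar>p s\<bar>"
    by (auto simp: dist_real_def)
  have [measurable]: "F i \<in> borel_measurable borel" for i
    using borel_measurable_simple_function[OF F(1)[of i]] by simp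
  have "(\<lambda>i. sqn T (\<lambda>s. p s - F i s)) \<longlonglongrightarrow> 0"
  proof (rule sqn_dominated[where g = "\<lambda>s. 3 * p s"])
    show "\<bar>p s - F n s\<bar> \<le> \<bar>3 * p s\<bar>" for n s using F(3)[of n s] by (simp add: abs_mult)
    show "sqn T (\<lambda>s. 3 * p s) < \<infinity>" using L2_scale[OF p, of 3] by (simp add: L2_def)
    show "AE s in lborel. 0 < s \<longrightarrow> s \<le> T \<longrightarrow> (\<lambda>n. p s - F n s) \<longlonglongrightarrow> 0"
    proof (intro AE_I2 impI)
      fix s
      have "(\<lambda>n. p s - F n s) \<longlonglongrightarrow> p s - p s" by (intro tendsto_diff tendsto_const F(2))
      then show "(\<lambda>n. p s - F n s) \<longlonglongrightarrow> 0" by simp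
    qed
  qed measurable
  then obtain i where i: "sqn T (\<lambda>s. p s - F i s) \<le> ennreal e"
    using e unfolding ennreal_tendsto_0_iff eventually_sequentially by blast
  have rep: "F i = (\<lambda>s. \<Sum>y\<in>range (F i). y * indicator (F i -` {y}) s)"
  proof
    fix s
    have fin: "finite (range (F i))" using simple_functionD(1)[OF F(1)[of i]] by simp
    have "(\<Sum>y\<in>range (F i). y * indicator (F i -` {y}) s) = (\<Sum>y\<in>range (F i). if y = F i s then y else 0)"
      by (intro sum.cong) (simp_all add: indicator_def)
    also have "\<dots> = F i s" using fin by simp
    finally show "F i s = (\<Sum>y\<in>range (F i). y * indicator (F i -` {y}) s)" by simp
  qed
  have "L2 (F i) \<and> L2conv (F i)"
    unfolding rep[symmetric] using simple_functionD[OF F(1)[of i]]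
    by (subst (1 2) rep, intro L2conv_sum_indicator) simp_all
  then show "\<exists>q. L2 q \<and> L2conv q \<and> sqn T (\<lambda>s. p s - q s) \<le> ennreal e" using i by blast
qed

section \<open>Truncated approximation of the whole sequence of components\<close>

lemma stepf_clamp:
  assumes "0 < s" "s \<le> T" "0 < n"
  shows "stepf T n (\<lambda>i. clamp m (a i)) s = clamp m (stepf T n a s)"
proof -
  obtain i where i: "i < n" "s \<in> gcell T n i" using gcell_ex[OF assms] by auto
  show ?thesis unfolding stepf_at[OF i(2,1)] ..
qed

text \<open>A bound uniform in \<open>n\<close> and componentwise in \<open>k\<close>: it supplies
  the majorant for dominated convergence over k in \<open>qv_appr_tendsto\<close> and, through
  \<open>err_nrm_le\<close>, over x in \<open>err_phi_tendsto\<close>.\<close>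

lemma sqn_appr_le:
  assumes [measurable]: "p k \<in> borel_measurable borel" and n: "0 < n"
  shows "sqn T (\<lambda>s. appr T n p k s - p k s) \<le> 4 * sqn T (p k)"
proof -
  have "sqn T (appr T n p k) \<le> sqn T (stepf T n (avg T n (p k)))"
  proof (rule sqn_mono)
    fix s assume "0 < s" "s \<le> T"
    then show "\<bar>appr T n p k s\<bar> \<le> \<bar>stepf T n (avg T n (p k)) s\<bar>"
      using n by (simp add: appr_def stepf_clamp clamp_abs_le)
  qed
  also have "\<dots> \<le> sqn T (p k)" by (rule sqn_stepf_avg_le) (simp_all add: n)
  finally have 1: "sqn T (appr T n p k) \<le> sqn T (p k)" .
  have "sqn T (\<lambda>s. appr T n p k s - p k s) \<le> 2 * sqn T (appr T n p k) + 2 * sqn T (p k)"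
    by (rule sqn_diff_le) measurable
  also have "\<dots> \<le> 2 * sqn T (p k) + 2 * sqn T (p k)" by (intro add_mono mult_left_mono 1) simp_all
  also have "\<dots> = 4 * sqn T (p k)" by (simp add: distrib_right[symmetric])
  finally show ?thesis .
qed

lemma qv_appr_le:
  assumes "\<And>k. p k \<in> borel_measurable borel" and "0 < n"
  shows "qv T (\<lambda>k s. appr T n p k s - p k s) \<le> 4 * qv T p"
proof -
  have "qv T (\<lambda>k s. appr T n p k s - p k s) \<le> (\<Sum>k. 4 * sqn T (p k))"
    unfolding qv_sqn using assms by (intro suminf_le sqn_appr_le) simp_all
  then show ?thesis by (simp add: qv_sqn)
qed

lemma sqn_appr_tendsto:
  assumes p: "L2 (p k)"
  shows "(\<lambda>n. sqn T (\<lambda>s. appr T (Suc n) p k s - p k s)) \<longlonglongrightarrow> 0"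
proof -
  have pm [measurable]: "p k \<in> borel_measurable borel" using p by (simp add: L2_def)
  let ?S = "\<lambda>n. stepf T (Suc n) (avg T (Suc n) (p k))"
  let ?a = "\<lambda>n s. clamp (Suc n) (?S n s)"
  have 1: "(\<lambda>n. sqn T (\<lambda>s. ?S n s - p k s)) \<longlonglongrightarrow> 0" using L2_L2conv[OF p] by (simp add: L2conv_def)
  have 2: "(\<lambda>n. sqn T (\<lambda>s. p k s - clamp (Suc n) (p k s))) \<longlonglongrightarrow> 0"
  proof (rule sqn_dominated[where g = "\<lambda>s. 2 * p k s"])
    show "\<bar>p k s - clamp (Suc n) (p k s)\<bar> \<le> \<bar>2 * p k s\<bar>" for n s
      using clamp_abs_le[of "Suc n" "p k s"] by simp
    show "sqn T (\<lambda>s. 2 * p k s) < \<infinity>" using L2_scale[OF p, of 2] by (simp add: L2_def)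
    show "AE s in lborel. 0 < s \<longrightarrow> s \<le> T \<longrightarrow> (\<lambda>n. p k s - clamp (Suc n) (p k s)) \<longlonglongrightarrow> 0"
    proof (intro AE_I2 impI tendsto_eventually)
      fix s
      obtain N where "\<bar>p k s\<bar> \<le> real N" using real_arch_simple by blast
      then show "\<forall>\<^sub>F n in sequentially. p k s - clamp (Suc n) (p k s) = 0"
        by (intro eventually_sequentiallyI[of N]) (simp add: clamp_eq)
    qed
  qed measurable
  \<comment> \<open>Compare both the clamped step function and \<open>p k\<close> with the clamped
    path: the first distance is controlled by the Lipschitz property and \<open>1\<close>, the
    second by \<open>2\<close>.\<close>
  have 3: "(\<lambda>n. sqn T (\<lambda>s. ?a n s - p k s)) \<longlonglongrightarrow> 0"
  proof (rule tendsto_0_double_add[OF _ 1 2])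
    fix n
    have "sqn T (\<lambda>s. ?a n s - p k s) \<le> 2 * sqn T (\<lambda>s. ?a n s - clamp (Suc n) (p k s)) + 2 * sqn T (\<lambda>s. p k s - clamp (Suc n) (p k s))"
    proof -
      have "sqn T (\<lambda>s. (?a n s - clamp (Suc n) (p k s)) - (p k s - clamp (Suc n) (p k s))) \<le>
        2 * sqn T (\<lambda>s. ?a n s - clamp (Suc n) (p k s)) + 2 * sqn T (\<lambda>s. p k s - clamp (Suc n) (p k s))"
        by (rule sqn_diff_le) measurable
      then show ?thesis by simp
    qed
    also have "sqn T (\<lambda>s. ?a n s - clamp (Suc n) (p k s)) \<le> sqn T (\<lambda>s. ?S n s - p k s)"
      by (intro sqn_mono clamp_lipschitz)
    finally show "sqn T (\<lambda>s. ?a n s - p k s) \<le>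
        2 * sqn T (\<lambda>s. ?S n s - p k s) + 2 * sqn T (\<lambda>s. p k s - clamp (Suc n) (p k s))"
      by (simp add: mult_left_mono add_right_mono)
  qed
  have "\<forall>\<^sub>F n in sequentially. sqn T (\<lambda>s. ?a n s - p k s) = sqn T (\<lambda>s. appr T (Suc n) p k s - p k s)"
  proof (rule eventually_sequentiallyI)
    fix n assume "k \<le> n"
    then show "sqn T (\<lambda>s. ?a n s - p k s) = sqn T (\<lambda>s. appr T (Suc n) p k s - p k s)"
      by (intro sqn_cong) (simp add: appr_def stepf_clamp)
  qed
  then show ?thesis by (rule Lim_transform_eventually[OF 3])
qed

lemma qv_appr_tendsto:
  assumes p: "\<And>k. p k \<in> borel_measurable borel" and fin: "qv T p < \<infinity>"
  shows "(\<lambda>n. qv T (\<lambda>k s. appr T (Suc n) p k s - p k s)) \<longlonglongrightarrow> 0"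
proof -
  have fk: "sqn T (p k) < \<infinity>" for k
  proof -
    have "sqn T (p k) = (\<Sum>i\<in>{k}. sqn T (p i))" by simp
    also have "\<dots> \<le> qv T p" unfolding qv_sqn by (rule sum_le_suminf) simp_all
    finally show ?thesis using fin by (rule le_less_trans)
  qed
  \<comment> \<open>The series over k is read as an integral over counting measure, so that
    dominated convergence applies to it.\<close>
  have "(\<lambda>n. \<integral>\<^sup>+k. sqn T (\<lambda>s. appr T (Suc n) p k s - p k s) \<partial>count_space UNIV) \<longlonglongrightarrow> (\<integral>\<^sup>+k. 0 \<partial>count_space (UNIV :: nat set))"
  proof (rule nn_integral_dominated_convergence[where w = "\<lambda>k. 4 * sqn T (p k)"])
    show "AE k in count_space UNIV. sqn T (\<lambda>s. appr T (Suc n) p k s - p k s) \<le> 4 * sqn T (p k)" for n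
      using p by (intro AE_I2 sqn_appr_le) simp_all
    have "(\<integral>\<^sup>+k. 4 * sqn T (p k) \<partial>count_space UNIV) = 4 * qv T p"
      by (simp add: nn_integral_count_space_nat qv_sqn)
    then show "(\<integral>\<^sup>+k. 4 * sqn T (p k) \<partial>count_space UNIV) < \<infinity>"
      using fin by (simp add: ennreal_mult_less_top)
    show "AE k in count_space UNIV. (\<lambda>n. sqn T (\<lambda>s. appr T (Suc n) p k s - p k s)) \<longlonglongrightarrow> 0"
      using p fk by (intro AE_I2 sqn_appr_tendsto) (simp add: L2_def)
  qed simp_all
  then show ?thesis by (simp add: nn_integral_count_space_nat qv_sqn)
qed

end

section \<open>Integrands depending on a parameter\<close>

text \<open>Evaluation at the grid point just below the time involves countably many measurable
  sections and is jointly measurable; path continuity passes this on to the limit.\<close>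

lemma continuous_jointly_measurable:
  fixes X :: "real \<Rightarrow> 'b \<Rightarrow> real"
  assumes T: "0 \<le> T" and m: "\<And>t. 0 \<le> t \<Longrightarrow> t \<le> T \<Longrightarrow> X t \<in> borel_measurable N"
    and c: "\<And>\<omega>. \<omega> \<in> space N \<Longrightarrow> continuous_on {0..T} (\<lambda>t. X t \<omega>)"
  shows "(\<lambda>z. X (snd z) (fst z)) \<in> borel_measurable (N \<Otimes>\<^sub>M restrict_space borel {0..T})"
proof (rule borel_measurable_LIMSEQ_real)
  \<comment> \<open>\<open>min T\<close> keeps every grid value inside [0, T], so that each of the
    countably many pieces is measurable, including those whose index is too large to be
    attained.\<close>
  define g where "g n t = min T (real (nat \<lfloor>real (Suc n) * t\<rfloor>) / real (Suc n))" for n t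
  show "(\<lambda>z. X (g n (snd z)) (fst z)) \<in> borel_measurable (N \<Otimes>\<^sub>M restrict_space borel {0..T})" for n
    unfolding g_def
  proof (rule measurable_compose_countable[where f = "\<lambda>i z. X (min T (real i / real (Suc n))) (fst z)"
        and g = "\<lambda>z. nat \<lfloor>real (Suc n) * snd z\<rfloor>"])
    fix i :: nat
    have "X (min T (real i / real (Suc n))) \<in> borel_measurable N" using T by (intro m) simp_all
    then show "(\<lambda>z. X (min T (real i / real (Suc n))) (fst z)) \<in> borel_measurable (N \<Otimes>\<^sub>M restrict_space borel {0..T})"
      by (rule measurable_compose[OF measurable_fst])
    have [measurable]: "(\<lambda>t::real. t) \<in> restrict_space borel {0..T} \<rightarrow>\<^sub>M borel"
      by (rule measurable_restrict_space1) simp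
    have [measurable]: "snd \<in> N \<Otimes>\<^sub>M restrict_space borel {0..T} \<rightarrow>\<^sub>M (borel :: real measure)"
      using measurable_compose[OF measurable_snd \<open>(\<lambda>t::real. t) \<in> _\<close>] by simp
    show "(\<lambda>z. nat \<lfloor>real (Suc n) * snd z\<rfloor>) \<in> N \<Otimes>\<^sub>M restrict_space borel {0..T} \<rightarrow>\<^sub>M count_space UNIV"
      by measurable
  qed
  fix z assume "z \<in> space (N \<Otimes>\<^sub>M restrict_space borel {0..T})"
  then have z: "fst z \<in> space N" "snd z \<in> {0..T}" by (auto simp: space_pair_measure)
  have lim: "(\<lambda>n. g n (snd z)) \<longlonglongrightarrow> snd z"
  proof -
    have "(\<lambda>n. real (nat \<lfloor>real (Suc n) * snd z\<rfloor>) / real (Suc n)) \<longlonglongrightarrow> snd z"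
    proof (rule tendsto_sandwich)
      have fl: "real (nat \<lfloor>real (Suc n) * snd z\<rfloor>) = of_int \<lfloor>real (Suc n) * snd z\<rfloor>" for n
        using z by simp
      show "\<forall>\<^sub>F n in sequentially. snd z - 1 / real (Suc n) \<le> real (nat \<lfloor>real (Suc n) * snd z\<rfloor>) / real (Suc n)"
      proof (intro always_eventually allI)
        fix n
        have "real (Suc n) * snd z - 1 \<le> of_int \<lfloor>real (Suc n) * snd z\<rfloor>" by linarith
        then have "(real (Suc n) * snd z - 1) / real (Suc n) \<le> of_int \<lfloor>real (Suc n) * snd z\<rfloor> / real (Suc n)"
          by (intro divide_right_mono) simp_all
        then show "snd z - 1 / real (Suc n) \<le> real (nat \<lfloor>real (Suc n) * snd z\<rfloor>) / real (Suc n)"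
          unfolding fl by (simp add: diff_divide_distrib)
      qed
      show "\<forall>\<^sub>F n in sequentially. real (nat \<lfloor>real (Suc n) * snd z\<rfloor>) / real (Suc n) \<le> snd z"
      proof (intro always_eventually allI)
        fix n
        have "of_int \<lfloor>real (Suc n) * snd z\<rfloor> \<le> real (Suc n) * snd z" by simp
        then have "of_int \<lfloor>real (Suc n) * snd z\<rfloor> / real (Suc n) \<le> real (Suc n) * snd z / real (Suc n)"
          by (intro divide_right_mono) simp_all
        then show "real (nat \<lfloor>real (Suc n) * snd z\<rfloor>) / real (Suc n) \<le> snd z"
          unfolding fl by (simp del: of_nat_Suc)
      qed
      have "(\<lambda>n. 1 / real (Suc n)) \<longlonglongrightarrow> 0" by (rule LIMSEQ_Suc[OF lim_1_over_n])
      from tendsto_diff[OF tendsto_const[of "snd z"] this]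
      show "(\<lambda>n. snd z - 1 / real (Suc n)) \<longlonglongrightarrow> snd z" by simp
    qed simp
    from tendsto_min[OF tendsto_const[of T] this] show ?thesis using z by (simp add: g_def)
  qed
  have g: "\<forall>n. g n (snd z) \<in> {0..T}" using T by (simp add: g_def)
  have "((\<lambda>t. X t (fst z)) \<circ> (\<lambda>n. g n (snd z))) \<longlonglongrightarrow> X (snd z) (fst z)"
    using c[OF z(1), unfolded continuous_on_sequentially, rule_format, OF z(2), of "\<lambda>n. g n (snd z)"] g lim by simp
  then show "(\<lambda>n. X (g n (snd z)) (fst z)) \<longlonglongrightarrow> X (snd z) (fst z)" by (simp add: comp_def)
qed

section \<open>Predictable integrands with a parameter and their grid approximations\<close>

context wiener_system
begin

abbreviation predictable_T ("\<P>") where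
  "\<P> \<equiv> predictable_upto M \<F> T"

text \<open>The predictable \<sigma>-field lives on (0, T]; the convention that integrands vanish at
  other times turns predictability into joint measurability over all real times.\<close>

definition predX :: "'x measure \<Rightarrow> (nat \<Rightarrow> real \<Rightarrow> 'a \<Rightarrow> 'x \<Rightarrow> real) \<Rightarrow> bool" where
  "predX X K \<longleftrightarrow> (\<forall>k. (\<lambda>((\<omega>, s), x). K k s \<omega> x) \<in> borel_measurable (\<P> \<Otimes>\<^sub>M X)) \<and>
    (\<forall>k s \<omega> x. s \<notin> {0<..T} \<longrightarrow> K k s \<omega> x = 0)"

lemma space_predictable_upto: "space (\<P>) = space M \<times> {0<..T}"
proof -
  have "{A \<times> {s<..t} | A s t. 0 \<le> s \<and> s \<le> t \<and> A \<in> sets (\<F> s)} \<subseteq> Pow (space M \<times> {0<..})"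
    using sets.sets_into_space space_F by fastforce
  then have sp: "space (predictable M \<F>) = space M \<times> {0<..}"
    unfolding predictable_def by (rule space_measure_of)
  have "(space M \<times> {0<..T}) \<inter> (space M \<times> {0<..}) = space M \<times> {0<..T}" by auto
  then show ?thesis unfolding predictable_upto_def space_restrict_space sp .
qed

text \<open>Predictable sets are progressive: a generator starting at s < r has its base in
  \<open>\<F> s\<close>, hence in \<open>\<F> r\<close>, and one starting at r or later does not
  meet (0, r].\<close>

lemma predictable_upto_progressive:
  assumes r: "0 \<le> r" "r \<le> T"
  shows "(\<lambda>z. z) \<in> restrict_space (\<F> r \<Otimes>\<^sub>M borel) (space M \<times> {0<..r}) \<rightarrow>\<^sub>M \<P>"
  unfolding predictable_upto_def
proof (rule measurable_restrict_space2)
  let ?N = "restrict_space (\<F> r \<Otimes>\<^sub>M (borel :: real measure)) (space M \<times> {0<..r})"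
  have sp: "space ?N = space M \<times> {0<..r}"
    using space_F[OF r(1)] by (auto simp: space_restrict_space space_pair_measure)
  show "(\<lambda>z. z) \<in> space ?N \<rightarrow> space M \<times> {0<..T}" using r sp by auto
  show "(\<lambda>z. z) \<in> ?N \<rightarrow>\<^sub>M predictable M \<F>"
    unfolding predictable_def
  proof (rule measurable_measure_of)
    show "{A \<times> {s<..t} | A s t. 0 \<le> s \<and> s \<le> t \<and> A \<in> sets (\<F> s)} \<subseteq> Pow (space M \<times> {0<..})"
      using sets.sets_into_space space_F by fastforce
    show "(\<lambda>z. z) \<in> space ?N \<rightarrow> space M \<times> {0<..}" using sp by auto
    fix y assume "y \<in> {A \<times> {s<..t} | A s t. 0 \<le> s \<and> s \<le> t \<and> A \<in> sets (\<F> s)}"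
    then obtain A s t where y: "y = A \<times> {s<..t}" "0 \<le> s" "s \<le> t" "A \<in> sets (\<F> s)" by blast
    show "(\<lambda>z. z) -` y \<inter> space ?N \<in> sets ?N"
    proof (cases "s < r")
      case True
      then have "A \<in> sets (\<F> r)" using y sets_F_mono[of s r] by auto
      then have "y \<in> sets (\<F> r \<Otimes>\<^sub>M borel)" unfolding y by (intro pair_measureI) simp_all
      then show ?thesis unfolding sp by (auto simp: sets_restrict_space)
    next
      case False
      then have "(\<lambda>z. z) -` y \<inter> space ?N = {}" unfolding sp y by auto
      then show ?thesis by simp
    qed
  qed
qed

lemma predX_progressive:
  assumes K: "predX X K" and r: "0 \<le> r" "r \<le> T"
  shows "(\<lambda>z. indicator {0<..r} (snd z) * K k (snd z) (fst (fst z)) (snd (fst z))) \<in> borel_measurable ((\<F> r \<Otimes>\<^sub>M X) \<Otimes>\<^sub>M borel)"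
proof -
  let ?N = "(\<F> r \<Otimes>\<^sub>M X) \<Otimes>\<^sub>M (borel :: real measure)"
  let ?A = "(space M \<times> space X) \<times> {0<..r}"
  let ?R = "restrict_space (\<F> r \<Otimes>\<^sub>M (borel :: real measure)) (space M \<times> {0<..r})"
  have A: "?A \<inter> space ?N \<in> sets ?N"
  proof -
    have "space M \<times> space X \<in> sets (\<F> r \<Otimes>\<^sub>M X)"
      using sets.top[of "\<F> r"] sets.top[of X] unfolding space_F[OF r(1)] by (rule pair_measureI)
    then have "?A \<in> sets ?N" by (rule pair_measureI) simp
    then show ?thesis by simp
  qed
  have K': "(\<lambda>z. K k (snd (fst z)) (fst (fst z)) (snd z)) \<in> borel_measurable (\<P> \<Otimes>\<^sub>M X)"
    using K by (simp add: predX_def case_prod_beta')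
  have 1: "(\<lambda>z. (fst (fst z), snd z)) \<in> restrict_space ?N ?A \<rightarrow>\<^sub>M ?R"
  proof (rule measurable_restrict_space2)
    show "(\<lambda>z. (fst (fst z), snd z)) \<in> space (restrict_space ?N ?A) \<rightarrow> space M \<times> {0<..r}"
      by (auto simp: space_restrict_space)
    show "(\<lambda>z. (fst (fst z), snd z)) \<in> restrict_space ?N ?A \<rightarrow>\<^sub>M \<F> r \<Otimes>\<^sub>M borel"
      by (rule measurable_restrict_space1) measurable
  qed
  have 2: "(\<lambda>z. (fst (fst z), snd z)) \<in> restrict_space ?N ?A \<rightarrow>\<^sub>M \<P>"
    by (rule measurable_compose[OF 1 predictable_upto_progressive[OF r]])
  have 3: "(\<lambda>z. snd (fst z)) \<in> restrict_space ?N ?A \<rightarrow>\<^sub>M X"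
    by (rule measurable_restrict_space1) measurable
  have "(\<lambda>z. K k (snd z) (fst (fst z)) (snd (fst z))) \<in> borel_measurable (restrict_space ?N ?A)"
    using measurable_compose[OF measurable_Pair[OF 2 3] K'] by simp
  then have "(\<lambda>z. indicator ?A z *\<^sub>R K k (snd z) (fst (fst z)) (snd (fst z))) \<in> borel_measurable ?N"
    by (subst (asm) borel_measurable_restrict_space_iff[OF A])
  then show ?thesis
    by (rule measurable_cong[THEN iffD1, rotated])
      (auto simp: space_pair_measure space_F[OF r(1)] indicator_def)
qed

lemma sub_pair:
  assumes r: "0 \<le> r" and f: "f \<in> \<F> r \<Otimes>\<^sub>M X \<rightarrow>\<^sub>M N"
  shows "f \<in> M \<Otimes>\<^sub>M X \<rightarrow>\<^sub>M N"
proof -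
  have "(\<lambda>z. z) \<in> M \<Otimes>\<^sub>M X \<rightarrow>\<^sub>M \<F> r \<Otimes>\<^sub>M X"
  proof -
    have "(\<lambda>z. (fst z, snd z)) \<in> M \<Otimes>\<^sub>M X \<rightarrow>\<^sub>M \<F> r \<Otimes>\<^sub>M X"
    proof (rule measurable_Pair)
      have "(\<lambda>\<omega>. \<omega>) \<in> M \<rightarrow>\<^sub>M \<F> r" by (rule measurable_F_M[OF _ r]) simp
      from measurable_compose[OF measurable_fst[of M X] this] show "fst \<in> M \<Otimes>\<^sub>M X \<rightarrow>\<^sub>M \<F> r" by simp
    qed simp
    then show ?thesis by simp
  qed
  from measurable_compose[OF this f] show ?thesis by simp
qed

lemma predX_measurable:
  assumes K: "predX X K"
  shows "(\<lambda>z. K k (snd z) (fst (fst z)) (snd (fst z))) \<in> borel_measurable ((M \<Otimes>\<^sub>M X) \<Otimes>\<^sub>M borel)"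
proof -
  have zero: "K k s \<omega> x = 0" if "s \<notin> {0<..T}" for s \<omega> x using K that by (simp add: predX_def)
  have "(\<lambda>z. z) \<in> (M \<Otimes>\<^sub>M X) \<Otimes>\<^sub>M borel \<rightarrow>\<^sub>M (\<F> T \<Otimes>\<^sub>M X) \<Otimes>\<^sub>M (borel :: real measure)"
  proof -
    have "fst \<in> (M \<Otimes>\<^sub>M X) \<Otimes>\<^sub>M borel \<rightarrow>\<^sub>M (\<F> T \<Otimes>\<^sub>M X)"
      using measurable_compose[OF measurable_fst sub_pair[OF T_nonneg measurable_ident]] by (simp add: id_def)
    from measurable_Pair[OF this measurable_snd] show ?thesis by simp
  qed
  from measurable_compose[OF this predX_progressive[OF K T_nonneg order_refl, of k]]
  have "(\<lambda>z. indicator {0<..T} (snd z) * K k (snd z) (fst (fst z)) (snd (fst z))) \<in> borel_measurable ((M \<Otimes>\<^sub>M X) \<Otimes>\<^sub>M borel)" .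
  moreover have "(\<lambda>z. indicator {0<..T} (snd z) * K k (snd z) (fst (fst z)) (snd (fst z))) = (\<lambda>z. K k (snd z) (fst (fst z)) (snd (fst z)))"
    by (intro ext) (auto simp: indicator_def intro!: zero)
  ultimately show ?thesis by simp
qed

lemma predX_fmeas:
  assumes K: "predX X K" and x: "x \<in> space X"
  shows "fmeas (\<lambda>k s \<omega>. K k s \<omega> x)"
  unfolding fmeas_def
proof
  fix k
  have "(\<lambda>z. ((fst z, x), snd z)) \<in> M \<Otimes>\<^sub>M borel \<rightarrow>\<^sub>M (M \<Otimes>\<^sub>M X) \<Otimes>\<^sub>M (borel :: real measure)"
    using x by measurable
  from measurable_compose[OF this predX_measurable[OF K, of k]]
  show "(\<lambda>(\<omega>, s). K k s \<omega> x) \<in> borel_measurable (M \<Otimes>\<^sub>M borel)" by (simp add: case_prod_beta')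
qed

lemma predX_qv:
  assumes K: "predX X K"
  shows "(\<lambda>z. qv r (\<lambda>k s. K k s (fst z) (snd z))) \<in> borel_measurable (M \<Otimes>\<^sub>M X)"
  using predX_measurable[OF K] by (intro qv_measurable) (simp add: case_prod_beta')

definition coef :: "nat \<Rightarrow> (nat \<Rightarrow> real \<Rightarrow> 'a \<Rightarrow> 'x \<Rightarrow> real) \<Rightarrow> nat \<Rightarrow> nat \<Rightarrow> 'a \<Rightarrow> 'x \<Rightarrow> real" where
  "coef n K k i \<omega> x = clamp n (avg T n (\<lambda>s. K k s \<omega> x) i)"

text \<open>The elementary integral of \<open>appr\<close>, written out as a finite sum so that its
  measurability in the parameter can be read off.\<close>

definition appx :: "nat \<Rightarrow> (nat \<Rightarrow> real \<Rightarrow> 'a \<Rightarrow> 'x \<Rightarrow> real) \<Rightarrow> real \<Rightarrow> 'a \<Rightarrow> 'x \<Rightarrow> real" where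
  "appx n K t \<omega> x = (\<Sum>k<n. \<Sum>i<n. coef n K k i \<omega> x *
     (W k (min t (T * real (Suc i) / real n)) \<omega> - W k (min t (T * real i / real n)) \<omega>))"

lemma grid_bounds: "0 < n \<Longrightarrow> i \<le> n \<Longrightarrow> 0 \<le> T * real i / real n \<and> T * real i / real n \<le> T"
proof -
  assume n: "0 < n" and i: "i \<le> n"
  have "T * real i / real n \<le> T * real n / real n"
    using T_nonneg i by (intro divide_right_mono mult_left_mono) simp_all
  then show ?thesis using T_nonneg n by simp
qed

text \<open>The coefficient of cell \<open>i\<close> averages over cell \<open>i - 1\<close>, which
  ends at the time where cell \<open>i\<close> starts. Progressive measurability up to that time
  therefore suffices, jointly with the parameter. For \<open>i = 0\<close> the coefficient is
  0.\<close>

lemma coef_adapted: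
  assumes K: "predX X K" and n: "0 < n" "i \<le> n"
  shows "(\<lambda>z. coef n K k i (fst z) (snd z)) \<in> borel_measurable (\<F> (T * real i / real n) \<Otimes>\<^sub>M X)"
proof (cases i)
  case 0
  then show ?thesis by (simp add: coef_def avg_def)
next
  case (Suc j)
  define r where "r = T * real i / real n"
  have r: "0 \<le> r" "r \<le> T" using grid_bounds[OF n] by (simp_all add: r_def)
  have sub: "gcell T n j \<subseteq> {0<..r}"
    using T_nonneg unfolding gcell_def r_def Suc
    by (intro subsetI) (auto intro: le_less_trans[rotated] divide_nonneg_nonneg)
  have [measurable]: "(\<lambda>z. indicator {0<..r} (snd z) * K k (snd z) (fst (fst z)) (snd (fst z))) \<in> borel_measurable ((\<F> r \<Otimes>\<^sub>M X) \<Otimes>\<^sub>M lborel)"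
    using predX_progressive[OF K r, of k] by (simp cong: measurable_cong_sets)
  have [measurable]: "gcell T n j \<in> sets borel" by (simp add: gcell_def)
  have "(\<lambda>z. LINT s|lborel. (indicator {0<..r} s * K k s (fst z) (snd z)) * indicator (gcell T n j) s) \<in> borel_measurable (\<F> r \<Otimes>\<^sub>M X)"
  proof (rule lborel.borel_measurable_lebesgue_integral)
    have "(\<lambda>z. (indicator {0<..r} (snd z) * K k (snd z) (fst (fst z)) (snd (fst z))) * indicator (gcell T n j) (snd z)) \<in> borel_measurable ((\<F> r \<Otimes>\<^sub>M X) \<Otimes>\<^sub>M lborel)"
      by measurable
    then show "(\<lambda>(z, s). (indicator {0<..r} s * K k s (fst z) (snd z)) * indicator (gcell T n j) s) \<in> borel_measurable ((\<F> r \<Otimes>\<^sub>M X) \<Otimes>\<^sub>M lborel)"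
      by (simp add: case_prod_beta')
  qed
  moreover have "(indicator {0<..r} s * K k s \<omega> x) * indicator (gcell T n j) s = K k s \<omega> x * indicator (gcell T n j) s" for s \<omega> x
    using sub by (auto simp: indicator_def)
  ultimately have "(\<lambda>z. LINT s|lborel. K k s (fst z) (snd z) * indicator (gcell T n j) s) \<in> borel_measurable (\<F> r \<Otimes>\<^sub>M X)"
    by simp
  then have "(\<lambda>z. clamp n ((real n / T) * (LINT s|lborel. K k s (fst z) (snd z) * indicator (gcell T n j) s))) \<in> borel_measurable (\<F> r \<Otimes>\<^sub>M X)"
    by measurable
  then show ?thesis unfolding r_def by (simp add: coef_def avg_def Suc)
qed

lemma coef_measurable:
  assumes "predX X K" "0 < n" "i \<le> n"
  shows "(\<lambda>z. coef n K k i (fst z) (snd z)) \<in> borel_measurable (M \<Otimes>\<^sub>M X)"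
  using sub_pair[OF _ coef_adapted[OF assms]] grid_bounds[OF assms(2,3)] by simp

lemma coef_section:
  assumes "predX X K" "0 < n" "i \<le> n" "x \<in> space X"
  shows "(\<lambda>\<omega>. coef n K k i \<omega> x) \<in> borel_measurable (\<F> (T * real i / real n))"
  using measurable_compose[OF measurable_Pair2'[OF assms(4)] coef_adapted[OF assms(1-3)]] by simp

lemma appr_coef:
  "appr T n (\<lambda>k s. K k s \<omega> x) k s =
    (\<Sum>(k', i)\<in>{..<n} \<times> {..<n}. if k = k' then coef n K k' i \<omega> x * indicator {T * real i / real n<..T * real (Suc i) / real n} s else 0)"
proof -
  have "(\<Sum>(k', i)\<in>{..<n} \<times> {..<n}. if k = k' then coef n K k' i \<omega> x * indicator {T * real i / real n<..T * real (Suc i) / real n} s else 0)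
    = (\<Sum>k'<n. if k = k' then (\<Sum>i<n. coef n K k' i \<omega> x * indicator {T * real i / real n<..T * real (Suc i) / real n} s) else 0)"
    unfolding sum.cartesian_product[symmetric] by (intro sum.cong) simp_all
  also have "\<dots> = appr T n (\<lambda>k s. K k s \<omega> x) k s"
    by (simp only: sum.delta'[OF finite_lessThan] lessThan_iff appr_def stepf_def coef_def gcell_def)
  finally show ?thesis by simp
qed

lemma appx_elem:
  assumes K: "predX X K" and n: "0 < n" and x: "x \<in> space X"
  shows "elem (\<lambda>k s \<omega>. appr T n (\<lambda>k s. K k s \<omega> x) k s) (\<lambda>t \<omega>. appx n K t \<omega> x)"
proof -
  let ?f = "\<lambda>p k s \<omega>. if k = fst p then coef n K (fst p) (snd p) \<omega> x * indicator {T * real (snd p) / real n<..T * real (Suc (snd p)) / real n} s else 0"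
  let ?I = "\<lambda>p t \<omega>. coef n K (fst p) (snd p) \<omega> x * (W (fst p) (min t (T * real (Suc (snd p)) / real n)) \<omega> - W (fst p) (min t (T * real (snd p) / real n)) \<omega>)"
  have "elem (\<lambda>k s \<omega>. \<Sum>p\<in>{..<n} \<times> {..<n}. ?f p k s \<omega>) (\<lambda>t \<omega>. \<Sum>p\<in>{..<n} \<times> {..<n}. ?I p t \<omega>)"
  proof (rule elem_sum)
    fix p assume "p \<in> {..<n} \<times> {..<n}"
    then have i: "snd p \<le> n" "Suc (snd p) \<le> n" by auto
    show "elem (?f p) (?I p)"
    proof (rule elem_single)
      show "0 \<le> T * real (snd p) / real n" "T * real (Suc (snd p)) / real n \<le> T"
        using grid_bounds[OF n i(1)] grid_bounds[OF n i(2)] by simp_all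
      show "T * real (snd p) / real n \<le> T * real (Suc (snd p)) / real n"
        using T_nonneg by (intro divide_right_mono mult_left_mono) simp_all
      show "(\<lambda>\<omega>. coef n K (fst p) (snd p) \<omega> x) \<in> borel_measurable (\<F> (T * real (snd p) / real n))"
        by (rule coef_section[OF K n i(1) x])
      show "\<bar>coef n K (fst p) (snd p) \<omega> x\<bar> \<le> real n" for \<omega> by (simp add: coef_def clamp_bdd)
    qed
  qed simp
  moreover have "(\<lambda>k s \<omega>. \<Sum>p\<in>{..<n} \<times> {..<n}. ?f p k s \<omega>) = (\<lambda>k s \<omega>. appr T n (\<lambda>k s. K k s \<omega> x) k s)"
    unfolding appr_coef by (simp add: case_prod_beta')
  moreover have "(\<lambda>t \<omega>. \<Sum>p\<in>{..<n} \<times> {..<n}. ?I p t \<omega>) = (\<lambda>t \<omega>. appx n K t \<omega> x)"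
    unfolding appx_def sum.cartesian_product by (simp add: case_prod_beta')
  ultimately show ?thesis by simp
qed

lemma appx_measurable:
  assumes K: "predX X K" and n: "0 < n" and t: "0 \<le> t"
  shows "(\<lambda>z. appx n K t (fst z) (snd z)) \<in> borel_measurable (M \<Otimes>\<^sub>M X)"
  unfolding appx_def
proof (intro borel_measurable_sum)
  fix k i assume i: "i \<in> {..<n}"
  have [measurable]: "(\<lambda>z. coef n K k i (fst z) (snd z)) \<in> borel_measurable (M \<Otimes>\<^sub>M X)"
    using i by (intro coef_measurable K n) simp
  have [measurable]: "W k (min t (T * real (Suc i) / real n)) \<in> borel_measurable M"
    "W k (min t (T * real i / real n)) \<in> borel_measurable M"
    using t grid_bounds[OF n, of i] grid_bounds[OF n, of "Suc i"] i by (auto intro!: W_measurable simp del: of_nat_Suc)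
  show "(\<lambda>z. coef n K k i (fst z) (snd z) * (W k (min t (T * real (Suc i) / real n)) (fst z) -
      W k (min t (T * real i / real n)) (fst z))) \<in> borel_measurable (M \<Otimes>\<^sub>M X)"
    by measurable
qed

lemma appr_pair_measurable:
  assumes K: "predX X K" and n: "0 < n"
  shows "(\<lambda>z. appr T n (\<lambda>k s. K k s (fst (fst z)) (snd (fst z))) k (snd z)) \<in> borel_measurable ((M \<Otimes>\<^sub>M X) \<Otimes>\<^sub>M borel)"
  unfolding appr_coef
proof (intro borel_measurable_sum)
  fix p assume "p \<in> {..<n} \<times> {..<n}"
  then have "snd p \<le> n" by auto
  then have [measurable]: "(\<lambda>z. coef n K (fst p) (snd p) (fst z) (snd z)) \<in> borel_measurable (M \<Otimes>\<^sub>M X)"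
    by (rule coef_measurable[OF K n])
  show "(\<lambda>z. case p of (k', i) \<Rightarrow> if k = k' then coef n K k' i (fst (fst z)) (snd (fst z)) *
      indicator {T * real i / real n<..T * real (Suc i) / real n} (snd z) else 0) \<in> borel_measurable ((M \<Otimes>\<^sub>M X) \<Otimes>\<^sub>M borel)"
    unfolding case_prod_beta' by measurable
qed

definition apperr :: "nat \<Rightarrow> (nat \<Rightarrow> real \<Rightarrow> 'a \<Rightarrow> 'x \<Rightarrow> real) \<Rightarrow> 'a \<Rightarrow> 'x \<Rightarrow> ennreal" where
  "apperr n K \<omega> x = qv T (\<lambda>k s. appr T n (\<lambda>k s. K k s \<omega> x) k s - K k s \<omega> x)"

lemma apperr_measurable:
  assumes K: "predX X K" and n: "0 < n"
  shows "(\<lambda>z. apperr n K (fst z) (snd z)) \<in> borel_measurable (M \<Otimes>\<^sub>M X)"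
  unfolding apperr_def
proof (rule qv_measurable)
  fix k
  note [measurable] = appr_pair_measurable[OF K n, of k] predX_measurable[OF K, of k]
  have "(\<lambda>z. appr T n (\<lambda>k s. K k s (fst (fst z)) (snd (fst z))) k (snd z) - K k (snd z) (fst (fst z)) (snd (fst z)))
      \<in> borel_measurable ((M \<Otimes>\<^sub>M X) \<Otimes>\<^sub>M borel)" by measurable
  then show "(\<lambda>(z, s). appr T n (\<lambda>k s. K k s (fst z) (snd z)) k s - K k s (fst z) (snd z)) \<in> borel_measurable ((M \<Otimes>\<^sub>M X) \<Otimes>\<^sub>M borel)"
    by (simp add: case_prod_beta')
qed

lemma predX_path:
  assumes "predX X K" "\<omega> \<in> space M" "x \<in> space X"
  shows "(\<lambda>s. K k s \<omega> x) \<in> borel_measurable borel"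
  using fmeas_path[OF predX_fmeas[OF assms(1,3)] assms(2)] .

lemma qv_T_zero: "T = 0 \<Longrightarrow> qv T p = 0"
  by (simp add: qv_def)

lemma apperr_le:
  assumes "predX X K" "0 < n" "\<omega> \<in> space M" "x \<in> space X"
  shows "apperr n K \<omega> x \<le> 4 * qv T (\<lambda>k s. K k s \<omega> x)"
proof (cases "T = 0")
  case True
  show ?thesis by (simp only: apperr_def qv_T_zero[OF True] zero_le)
next
  case False
  then show ?thesis unfolding apperr_def
    using T_nonneg assms by (intro qv_appr_le predX_path[OF assms(1)]) simp_all
qed

lemma apperr_tendsto:
  assumes "predX X K" "\<omega> \<in> space M" "x \<in> space X" "qv T (\<lambda>k s. K k s \<omega> x) < \<infinity>"
  shows "(\<lambda>n. apperr (Suc n) K \<omega> x) \<longlonglongrightarrow> 0"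
proof (cases "T = 0")
  case True
  show ?thesis by (simp only: apperr_def qv_T_zero[OF True] tendsto_const)
next
  case False
  then show ?thesis unfolding apperr_def
    using T_nonneg assms by (intro qv_appr_tendsto predX_path[OF assms(1)]) simp_all
qed

end

section \<open>Measurable versions of the integral\<close>

text \<open>Eventually geometric increments make the paths uniformly Cauchy. The limit is expressed
  by \<open>lim\<close>, an operation under which measurability in \<omega> and in the parameter
  survives in \<open>vito_exists\<close>.\<close>

lemma geometric_uniform_limit:
  fixes z :: "nat \<Rightarrow> real \<Rightarrow> real"
  assumes T: "0 \<le> T" and c: "\<And>l. continuous_on {0..T} (z l)"
    and ev: "\<forall>\<^sub>F l in sequentially. supn T (\<lambda>t. z (Suc l) t - z l t) \<le> ennreal ((1/2) ^ l)"
  shows "continuous_on {0..T} (\<lambda>t. lim (\<lambda>l. z l t))"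
    and "(\<lambda>l. supn T (\<lambda>t. z l t - lim (\<lambda>l. z l t))) \<longlonglongrightarrow> 0"
proof -
  obtain N where N: "\<And>l. N \<le> l \<Longrightarrow> supn T (\<lambda>t. z (Suc l) t - z l t) \<le> ennreal ((1/2) ^ l)"
    using ev by (auto simp: eventually_sequentially)
  have step: "\<bar>z (Suc l) t - z l t\<bar> \<le> (1/2) ^ l" if "N \<le> l" "0 \<le> t" "t \<le> T" for l t
  proof -
    have "ennreal \<bar>z (Suc l) t - z l t\<bar> \<le> ennreal ((1/2) ^ l)"
      using supn_upper[OF that(2,3), of "\<lambda>t. z (Suc l) t - z l t"] N[OF that(1)] by (rule order_trans)
    then show ?thesis by (simp add: ennreal_le_iff)
  qed
  \<comment> \<open>The difference on the right is the exact partial sum of the geometric series,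
    which lets the induction close.\<close>
  have tele: "\<bar>z (l + m) t - z l t\<bar> \<le> 2 * (1/2) ^ l - 2 * (1/2) ^ (l + m)" if "N \<le> l" "0 \<le> t" "t \<le> T" for l m t
  proof (induction m)
    case (Suc m)
    have "\<bar>z (Suc (l + m)) t - z (l + m) t\<bar> \<le> (1/2) ^ (l + m)" using that by (intro step) simp_all
    then have "\<bar>z (Suc (l + m)) t - z l t\<bar> \<le> 2 * (1/2) ^ l - 2 * (1/2) ^ (l + m) + (1/2) ^ (l + m)" using Suc by linarith
    then show ?case by simp
  qed simp
  have tele': "\<bar>z m t - z l t\<bar> \<le> 2 * (1/2) ^ l" if "N \<le> l" "l \<le> m" "0 \<le> t" "t \<le> T" for l m t
  proof -
    have "\<bar>z m t - z l t\<bar> \<le> 2 * (1/2) ^ l - 2 * (1/2) ^ m"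
      using tele[OF that(1,3,4), of "m - l"] that(2) by simp
    moreover have "0 \<le> (2::real) * (1/2) ^ m" by simp
    ultimately show ?thesis by linarith
  qed
  have pow: "(\<lambda>l. 2 * (1/2::real) ^ l) \<longlonglongrightarrow> 0" by real_asymp
  have conv: "convergent (\<lambda>l. z l t)" if "0 \<le> t" "t \<le> T" for t
  proof (rule Cauchy_convergent, rule CauchyI)
    fix e :: real assume e: "0 < e"
    then have "\<forall>\<^sub>F l in sequentially. 2 * (1/2::real) ^ l < e / 2" by (intro order_tendstoD(2)[OF pow]) simp
    then obtain L where L: "\<And>l. L \<le> l \<Longrightarrow> 2 * (1/2::real) ^ l < e / 2" by (auto simp: eventually_sequentially)
    define K where "K = max N L"
    show "\<exists>M. \<forall>m\<ge>M. \<forall>n\<ge>M. norm (z m t - z n t) < e"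
    proof (intro exI[of _ K] allI impI)
      fix m n assume "K \<le> m" "K \<le> n"
      then have "\<bar>z m t - z K t\<bar> \<le> 2 * (1/2) ^ K" "\<bar>z n t - z K t\<bar> \<le> 2 * (1/2) ^ K"
        using that by (auto intro!: tele' simp: K_def)
      moreover have "2 * (1/2::real) ^ K < e / 2" by (rule L) (simp add: K_def)
      ultimately show "norm (z m t - z n t) < e" by simp
    qed
  qed
  have lim: "(\<lambda>l. z l t) \<longlonglongrightarrow> lim (\<lambda>l. z l t)" if "0 \<le> t" "t \<le> T" for t
    using conv[OF that] by (simp add: convergent_LIMSEQ_iff)
  have dist: "\<bar>z l t - lim (\<lambda>l. z l t)\<bar> \<le> 2 * (1/2) ^ l" if "N \<le> l" "0 \<le> t" "t \<le> T" for l t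
  proof -
    have "(\<lambda>m. \<bar>z m t - z l t\<bar>) \<longlonglongrightarrow> \<bar>lim (\<lambda>l. z l t) - z l t\<bar>"
      by (intro tendsto_rabs tendsto_diff lim[OF that(2,3)] tendsto_const)
    then have "\<bar>lim (\<lambda>l. z l t) - z l t\<bar> \<le> 2 * (1/2) ^ l"
      by (rule LIMSEQ_le_const2) (use tele'[OF that(1) _ that(2,3)] in blast)
    then show ?thesis by (simp add: abs_minus_commute)
  qed
  have "uniform_limit {0..T} z (\<lambda>t. lim (\<lambda>l. z l t)) sequentially"
  proof (rule uniform_limitI)
    fix e :: real assume e: "0 < e"
    have "\<forall>\<^sub>F l in sequentially. 2 * (1/2::real) ^ l < e" by (rule order_tendstoD(2)[OF pow e])
    then show "\<forall>\<^sub>F l in sequentially. \<forall>t\<in>{0..T}. dist (z l t) (lim (\<lambda>l. z l t)) < e"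
      using eventually_ge_at_top[of N]
    proof eventually_elim
      case (elim l)
      then show ?case by (auto simp: dist_real_def intro!: le_less_trans[OF dist[OF elim(2)] elim(1)])
    qed
  qed
  then show "continuous_on {0..T} (\<lambda>t. lim (\<lambda>l. z l t))"
    by (rule uniform_limit_theorem[rotated]) (use c in simp_all)
  show "(\<lambda>l. supn T (\<lambda>t. z l t - lim (\<lambda>l. z l t))) \<longlonglongrightarrow> 0"
  proof (rule tendsto_sandwich[OF _ _ tendsto_const])
    show "\<forall>\<^sub>F l in sequentially. supn T (\<lambda>t. z l t - lim (\<lambda>l. z l t)) \<le> ennreal (2 * (1/2) ^ l)"
      using eventually_ge_at_top[of N]
    proof eventually_elim
      case (elim l)
      show ?case unfolding supn_def by (intro SUP_least ennreal_leI dist[OF elim]) simp_all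
    qed
    show "(\<lambda>l. ennreal (2 * (1/2) ^ l)) \<longlonglongrightarrow> 0" using tendsto_ennrealI[OF pow] by simp
  qed simp
qed

lemma qv_tail_tendsto:
  assumes fin: "qv T p < \<infinity>"
  shows "(\<lambda>n. qv T (\<lambda>k s. if k < n then 0 else p k s)) \<longlonglongrightarrow> 0"
proof -
  have "(\<lambda>n. \<integral>\<^sup>+k. sqn T (\<lambda>s. if k < n then 0 else p k s) \<partial>count_space UNIV) \<longlonglongrightarrow> (\<integral>\<^sup>+k. 0 \<partial>count_space (UNIV :: nat set))"
  proof (rule nn_integral_dominated_convergence[where w = "\<lambda>k. sqn T (p k)"])
    show "AE k in count_space UNIV. sqn T (\<lambda>s. if k < n then 0 else p k s) \<le> sqn T (p k)" for n
      by (intro AE_I2 sqn_mono) simp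
    show "(\<integral>\<^sup>+k. sqn T (p k) \<partial>count_space UNIV) < \<infinity>"
      using fin by (simp add: nn_integral_count_space_nat qv_sqn)
    show "AE k in count_space UNIV. (\<lambda>n. sqn T (\<lambda>s. if k < n then 0 else p k s)) \<longlonglongrightarrow> 0"
    proof (intro AE_I2 tendsto_eventually)
      fix k
      show "\<forall>\<^sub>F n in sequentially. sqn T (\<lambda>s. if k < n then 0 else p k s) = 0"
        by (rule eventually_sequentiallyI[of "Suc k"]) simp
    qed
  qed simp_all
  then show ?thesis by (simp add: nn_integral_count_space_nat qv_sqn)
qed

section \<open>Borel-Cantelli and a mesh that depends on the parameter\<close>

context wiener_system
begin

text \<open>Markov's inequality turns the bound (1/64)^l into probability at most (1/8)^l that the
  bracket error exceeds (1/8)^l. Off these events the bracket of an increment is at most 4 (1/8)^l,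
  and \<open>elem_maximal\<close> at level (1/2)^l gives probability at most 4 (1/8)^l / (1/4)^l = 4
  (1/2)^l. The sum is at most 6 (1/2)^l, so Borel-Cantelli applies.\<close>

lemma elem_fast_convergence:
  assumes g: "\<And>l. elem (g l) (Z l)" and f: "fmeas f"
    and q: "\<And>l. psize (\<lambda>\<omega>. qv T (\<lambda>k s. g l k s \<omega> - f k s \<omega>)) \<le> ennreal ((1/64) ^ l)"
  shows "AE \<omega> in M. \<forall>\<^sub>F l in sequentially. supn T (\<lambda>t. Z (Suc l) t \<omega> - Z l t \<omega>) \<le> ennreal ((1/2) ^ l)"
proof -
  define U where "U l \<omega> = supn T (\<lambda>t. Z (Suc l) t \<omega> - Z l t \<omega>)" for l \<omega>
  define R where "R l \<omega> = qv T (\<lambda>k s. g l k s \<omega> - f k s \<omega>)" for l \<omega>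
  define Q where "Q l \<omega> = qv T (\<lambda>k s. g (Suc l) k s \<omega> - g l k s \<omega>)" for l \<omega>
  note gf = fmeas_diff[OF elem_fmeas[OF g] f]
  have [measurable]: "U l \<in> borel_measurable M" "R l \<in> borel_measurable M" "Q l \<in> borel_measurable M" for l
    unfolding U_def[abs_def] R_def[abs_def] Q_def[abs_def]
    by (rule cadapted_supn[OF cadapted_diff[OF elem_cadapted[OF g] elem_cadapted[OF g]]],
        rule fmeas_qv[OF gf], rule fmeas_qv[OF fmeas_diff[OF elem_fmeas[OF g] elem_fmeas[OF g]]])
  define B where "B l = {\<omega> \<in> space M. ennreal ((1/8) ^ l) < R l \<omega>}" for l
  define D where "D l = {\<omega> \<in> space M. ennreal ((1/2) ^ l) < U l \<omega> \<and> Q l \<omega> \<le> ennreal (4 * (1/8) ^ l)}" for l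
  define A where "A l = {\<omega> \<in> space M. ennreal ((1/2) ^ l) < U l \<omega>}" for l
  have [measurable]: "B l \<in> sets M" "D l \<in> sets M" "A l \<in> sets M" for l
    unfolding B_def D_def A_def by measurable
  have QR: "Q l \<omega> \<le> 2 * R (Suc l) \<omega> + 2 * R l \<omega>" if "\<omega> \<in> space M" for l \<omega>
  proof -
    have "qv T (\<lambda>k s. (g (Suc l) k s \<omega> - f k s \<omega>) - (g l k s \<omega> - f k s \<omega>)) \<le> 2 * R (Suc l) \<omega> + 2 * R l \<omega>"
      unfolding R_def by (rule fmeas_diff_qv_le[OF gf gf that])
    then show ?thesis by (simp add: Q_def)
  qed
  have PB: "emeasure M (B l) \<le> ennreal ((1/8) ^ l)" for l
  proof -
    have "ennreal ((1/8) ^ l) * emeasure M (B l) \<le> psize (R l)"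
      unfolding B_def by (rule prob_le_psize) (simp_all add: power_le_one)
    also have "\<dots> \<le> ennreal ((1/64) ^ l)" using q[of l] by (simp add: R_def[abs_def])
    also have "\<dots> = ennreal ((1/8) ^ l) * ennreal ((1/8) ^ l)"
      by (simp add: ennreal_mult[symmetric] power_mult_distrib[symmetric])
    finally show ?thesis by (subst (asm) ennreal_mult_le_mult_iff) simp_all
  qed
  have PD: "emeasure M (D l) \<le> ennreal (4 * (1/2) ^ l)" for l
  proof -
    have "ennreal (((1/2) ^ l)\<^sup>2) * emeasure M (D l) \<le> (\<integral>\<^sup>+\<omega>. min (Q l \<omega>) (ennreal (4 * (1/8) ^ l)) \<partial>M)"
      unfolding D_def U_def Q_def by (intro elem_maximal elem_diff g) simp_all
    also have "\<dots> \<le> (\<integral>\<^sup>+\<omega>. ennreal (4 * (1/8) ^ l) \<partial>M)" by (intro nn_integral_mono) simp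
    also have "\<dots> = ennreal (4 * (1/8) ^ l)" by (simp add: emeasure_space_1)
    also have "4 * (1/8::real) ^ l = ((1/2) ^ l)\<^sup>2 * (4 * (1/2) ^ l)"
      by (simp add: power2_eq_square power_mult_distrib[symmetric])
    also have "ennreal (((1/2) ^ l)\<^sup>2 * (4 * (1/2) ^ l)) = ennreal (((1/2) ^ l)\<^sup>2) * ennreal (4 * (1/2) ^ l)"
      by (rule ennreal_mult) simp_all
    finally show ?thesis by (subst (asm) ennreal_mult_le_mult_iff) simp_all
  qed
  have sub: "A l \<subseteq> D l \<union> (B l \<union> B (Suc l))" for l
  proof
    fix \<omega> assume "\<omega> \<in> A l"
    then have \<omega>: "\<omega> \<in> space M" "ennreal ((1/2) ^ l) < U l \<omega>" by (simp_all add: A_def)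
    show "\<omega> \<in> D l \<union> (B l \<union> B (Suc l))"
    proof (rule ccontr)
      assume n: "\<omega> \<notin> D l \<union> (B l \<union> B (Suc l))"
      then have R: "R l \<omega> \<le> ennreal ((1/8) ^ l)" "R (Suc l) \<omega> \<le> ennreal ((1/8) ^ Suc l)"
        using \<omega> by (simp_all add: B_def not_less)
      have "Q l \<omega> \<le> 2 * ennreal ((1/8) ^ Suc l) + 2 * ennreal ((1/8) ^ l)"
        by (rule order_trans[OF QR[OF \<omega>(1)]]) (intro add_mono mult_left_mono R, simp_all)
      also have "\<dots> = ennreal (2 * (1/8) ^ Suc l + 2 * (1/8) ^ l)"
        unfolding numeral_mult_ennreal by (rule ennreal_plus[symmetric]) simp_all
      also have "\<dots> \<le> ennreal (4 * (1/8) ^ l)" by (intro ennreal_leI) simp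
      finally have "\<omega> \<in> D l" using \<omega> by (simp add: D_def)
      then show False using n by simp
    qed
  qed
  have PA: "measure M (A l) \<le> 6 * (1/2) ^ l" for l
  proof -
    have "emeasure M (A l) \<le> emeasure M (D l \<union> (B l \<union> B (Suc l)))" by (rule emeasure_mono[OF sub]) measurable
    also have "\<dots> \<le> emeasure M (D l) + emeasure M (B l \<union> B (Suc l))" by (rule emeasure_subadditive) measurable
    also have "\<dots> \<le> emeasure M (D l) + (emeasure M (B l) + emeasure M (B (Suc l)))"
      by (intro add_left_mono emeasure_subadditive) measurable
    also have "\<dots> \<le> ennreal (4 * (1/2) ^ l) + (ennreal ((1/8) ^ l) + ennreal ((1/8) ^ Suc l))"
      by (intro add_mono PD PB)
    also have "\<dots> = ennreal (4 * (1/2) ^ l + ((1/8) ^ l + (1/8) ^ Suc l))"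
      by (simp add: ennreal_plus[symmetric] del: ennreal_plus power_Suc)
    also have "\<dots> \<le> ennreal (6 * (1/2) ^ l)"
    proof (intro ennreal_leI)
      have "(1/8::real) ^ l \<le> (1/2) ^ l" by (intro power_mono) simp_all
      moreover have "(1/8::real) ^ Suc l \<le> (1/8) ^ l" by simp
      ultimately show "4 * (1/2) ^ l + ((1/8) ^ l + (1/8) ^ Suc l) \<le> 6 * (1/2::real) ^ l" by linarith
    qed
    finally show ?thesis by (simp add: emeasure_eq_measure ennreal_le_iff)
  qed
  have "AE \<omega> in M. \<forall>\<^sub>F l in sequentially. \<omega> \<in> space M - A l"
  proof (rule borel_cantelli_AE1)
    show "summable (\<lambda>l. measure M (A l))"
    proof (rule summable_comparison_test)
      show "\<exists>N. \<forall>l\<ge>N. norm (measure M (A l)) \<le> 6 * (1/2) ^ l" using PA by (intro exI[of _ 0]) simp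
      show "summable (\<lambda>l. 6 * (1/2::real) ^ l)" by (intro summable_mult summable_geometric) simp
    qed
  qed (simp_all add: emeasure_eq_measure)
  then show ?thesis
  proof eventually_elim
    case (elim \<omega>)
    then show ?case by (rule eventually_mono) (simp add: A_def U_def not_less)
  qed
qed

text \<open>At each x the grid integrals converge once the mesh is refined fast enough, but the
  speed needed varies with x. A mesh index that is a measurable function of x, with countably many
  values, gives almost sure convergence at every x and keeps joint measurability.\<close>

lemma vito_exists:
  assumes K: "predX X K"
    and fin: "\<And>\<omega> x. \<omega> \<in> space M \<Longrightarrow> x \<in> space X \<Longrightarrow> qv T (\<lambda>k s. K k s \<omega> x) < \<infinity>"
  obtains S where "\<And>t. 0 \<le> t \<Longrightarrow> t \<le> T \<Longrightarrow> (\<lambda>z. S t (fst z) (snd z)) \<in> borel_measurable (M \<Otimes>\<^sub>M X)"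
    and "\<And>x. x \<in> space X \<Longrightarrow> vito (\<lambda>k s \<omega>. K k s \<omega> x) (\<lambda>t \<omega>. S t \<omega> x)"
proof -
  define e where "e m x = psize (\<lambda>\<omega>. apperr (Suc m) K \<omega> x)" for m x
  \<comment> \<open>The least admissible index is measurable because the conditions are. One exists
    at each x in the space, since the \<open>psize\<close> of the error tends to 0; the bound is the
    one required by \<open>elem_fast_convergence\<close>.\<close>
  define j where "j l x = (LEAST m. e m x \<le> ennreal ((1/64) ^ l))" for l x
  define Z where "Z l t \<omega> x = appx (Suc (j l x)) K t \<omega> x" for l t \<omega> x
  define good where "good \<omega> x \<longleftrightarrow> (\<exists>N. \<forall>l. N \<le> l \<longrightarrow> supn T (\<lambda>t. Z (Suc l) t \<omega> x - Z l t \<omega> x) \<le> ennreal ((1/2) ^ l))" for \<omega> x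
  \<comment> \<open>Off the jointly measurable convergence set \<open>good\<close> the version is
    put equal to 0, so that all of its paths are continuous.\<close>
  define S where "S t \<omega> x = (if good \<omega> x then lim (\<lambda>l. Z l t \<omega> x) else 0)" for t \<omega> x
  have em [measurable]: "e m \<in> borel_measurable X" for m
  proof -
    have "(\<lambda>x. \<integral>\<^sup>+\<omega>. min 1 (apperr (Suc m) K \<omega> x) \<partial>M) \<in> borel_measurable X"
    proof (rule borel_measurable_nn_integral)
      have "(\<lambda>z. apperr (Suc m) K (snd z) (fst z)) \<in> borel_measurable (X \<Otimes>\<^sub>M M)"
        using measurable_compose[OF measurable_pair_swap'[of X M] apperr_measurable[OF K, of "Suc m"]]
        by (simp add: case_prod_beta')
      then have "(\<lambda>z. min 1 (apperr (Suc m) K (snd z) (fst z))) \<in> borel_measurable (X \<Otimes>\<^sub>M M)" by measurable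
      then show "(\<lambda>(x, \<omega>). min 1 (apperr (Suc m) K \<omega> x)) \<in> borel_measurable (X \<Otimes>\<^sub>M M)" by (simp add: case_prod_beta')
    qed
    then show ?thesis by (simp add: e_def[abs_def] psize_def)
  qed
  have apm: "(\<lambda>\<omega>. apperr n K \<omega> x) \<in> borel_measurable M" if "x \<in> space X" "0 < n" for n x
    using measurable_compose[OF measurable_Pair2'[OF that(1)] apperr_measurable[OF K that(2)]] by simp
  have jm [measurable]: "j l \<in> X \<rightarrow>\<^sub>M count_space UNIV" for l
    unfolding j_def[abs_def] by measurable
  have ej: "e (j l x) x \<le> ennreal ((1/64) ^ l)" if x: "x \<in> space X" for l x
  proof -
    have "(\<lambda>m. e m x) \<longlonglongrightarrow> 0"
      unfolding e_def using x K fin by (intro psize_tendsto_0_AE apm AE_I2 apperr_tendsto) simp_all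
    then have "\<forall>\<^sub>F m in sequentially. e m x \<le> ennreal ((1/64) ^ l)" by (simp add: ennreal_tendsto_0_iff)
    then obtain m where "e m x \<le> ennreal ((1/64) ^ l)" using eventually_happens by fastforce
    then show ?thesis unfolding j_def by (rule LeastI)
  qed
  have Zm: "(\<lambda>z. Z l t (fst z) (snd z)) \<in> borel_measurable (M \<Otimes>\<^sub>M X)" if t: "0 \<le> t" for l t
    unfolding Z_def
  proof (rule measurable_compose_countable[where f = "\<lambda>m z. appx (Suc m) K t (fst z) (snd z)" and g = "\<lambda>z. j l (snd z)"])
    show "(\<lambda>z. appx (Suc m) K t (fst z) (snd z)) \<in> borel_measurable (M \<Otimes>\<^sub>M X)" for m
      by (rule appx_measurable[OF K _ t]) simp
  qed measurable
  have Zelem: "elem (\<lambda>k s \<omega>. appr T (Suc (j l x)) (\<lambda>k s. K k s \<omega> x) k s) (\<lambda>t \<omega>. Z l t \<omega> x)" if "x \<in> space X" for l x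
    unfolding Z_def by (rule appx_elem[OF K _ that]) simp
  have Zc: "continuous_on {0..T} (\<lambda>t. Z l t \<omega> x)" if "\<omega> \<in> space M" "x \<in> space X" for l \<omega> x
    using cadaptedD(1)[OF elem_cadapted[OF Zelem[OF that(2)]] that(1)] .
  have goodm [measurable]: "Measurable.pred (M \<Otimes>\<^sub>M X) (\<lambda>z. good (fst z) (snd z))"
  proof -
    have [measurable]: "(\<lambda>z. supn T (\<lambda>t. Z (Suc l) t (fst z) (snd z) - Z l t (fst z) (snd z))) \<in> borel_measurable (M \<Otimes>\<^sub>M X)" for l
    proof (rule supn_measurable)
      fix z assume "z \<in> space (M \<Otimes>\<^sub>M X)"
      then have "fst z \<in> space M" "snd z \<in> space X" by (auto simp: space_pair_measure)
      then show "continuous_on {0..T} (\<lambda>t. Z (Suc l) t (fst z) (snd z) - Z l t (fst z) (snd z))"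
        by (intro continuous_on_diff Zc)
    next
      fix t assume "t \<in> {0..T}"
      then have t: "0 \<le> t" by simp
      note [measurable] = Zm[OF t]
      show "(\<lambda>z. Z (Suc l) t (fst z) (snd z) - Z l t (fst z) (snd z)) \<in> borel_measurable (M \<Otimes>\<^sub>M X)" by measurable
    qed
    show ?thesis unfolding good_def by measurable
  qed
  have Sm: "(\<lambda>z. S t (fst z) (snd z)) \<in> borel_measurable (M \<Otimes>\<^sub>M X)" if t: "0 \<le> t" for t
  proof -
    note [measurable] = Zm[OF t]
    show ?thesis unfolding S_def by measurable
  qed
  have "vito (\<lambda>k s \<omega>. K k s \<omega> x) (\<lambda>t \<omega>. S t \<omega> x)" if x: "x \<in> space X" for x
  proof -
    let ?g = "\<lambda>l k s \<omega>. appr T (Suc (j l x)) (\<lambda>k s. K k s \<omega> x) k s"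
    have gx: "good \<omega> x \<longleftrightarrow> (\<forall>\<^sub>F l in sequentially. supn T (\<lambda>t. Z (Suc l) t \<omega> x - Z l t \<omega> x) \<le> ennreal ((1/2) ^ l))" for \<omega>
      by (simp add: good_def eventually_sequentially)
    have q: "psize (\<lambda>\<omega>. qv T (\<lambda>k s. ?g l k s \<omega> - K k s \<omega> x)) \<le> ennreal ((1/64) ^ l)" for l
      using ej[OF x, of l] by (simp add: e_def apperr_def)
    have AEg: "AE \<omega> in M. good \<omega> x"
      unfolding gx by (rule elem_fast_convergence[OF Zelem[OF x] predX_fmeas[OF K x] q])
    have gM: "{\<omega> \<in> space M. good \<omega> x} \<in> sets M"
    proof -
      have "Measurable.pred M (\<lambda>\<omega>. good \<omega> x)"
        using measurable_compose[OF measurable_Pair2'[OF x] goodm] by simp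
      then show ?thesis by measurable
    qed
    \<comment> \<open>For fixed x the exceptional event is null and hence in every
      \<open>\<F> t\<close>: completeness of the filtration keeps \<open>S\<close> adapted, although
      \<open>good\<close> looks at whole paths.\<close>
    have gF: "Measurable.pred (\<F> t) (\<lambda>\<omega>. good \<omega> x)" if t: "0 \<le> t" for t
    proof -
      have "{\<omega> \<in> space M. \<not> good \<omega> x} \<in> null_sets M"
        using AEg gM by (subst AE_iff_null[symmetric]) auto
      then have "{\<omega> \<in> space M. \<not> good \<omega> x} \<in> sets (\<F> t)"
        using filtration t by (auto simp: complete_filtration_def)
      then have "Measurable.pred (\<F> t) (\<lambda>\<omega>. \<not> good \<omega> x)"
        using space_F[OF t] by (simp add: Measurable.pred_def)
      then have "Measurable.pred (\<F> t) (\<lambda>\<omega>. \<not> \<not> good \<omega> x)" by (rule pred_intros_logic)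
      then show ?thesis by simp
    qed
    have Sc: "cadapted (\<lambda>t \<omega>. S t \<omega> x)"
    proof (rule cadaptedI)
      fix \<omega> assume \<omega>: "\<omega> \<in> space M"
      show "continuous_on {0..T} (\<lambda>t. S t \<omega> x)"
      proof (cases "good \<omega> x")
        case True
        then show ?thesis unfolding S_def using geometric_uniform_limit(1)[of T "\<lambda>l t. Z l t \<omega> x"] T_nonneg Zc[OF \<omega> x]
          by (simp add: gx)
      qed (simp add: S_def)
    next
      fix t assume t: "0 \<le> t" "t \<le> T"
      have [measurable]: "(\<lambda>\<omega>. Z l t \<omega> x) \<in> borel_measurable (\<F> t)" for l
        by (rule cadaptedD(2)[OF elem_cadapted[OF Zelem[OF x]] t])
      note [measurable] = gF[OF t(1)]
      show "(\<lambda>\<omega>. S t \<omega> x) \<in> borel_measurable (\<F> t)" unfolding S_def by measurable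
    qed
    show ?thesis
    proof (rule vitoI[OF predX_fmeas[OF K x] Sc Zelem[OF x]])
      show "(\<lambda>l. psize (\<lambda>\<omega>. qv T (\<lambda>k s. ?g l k s \<omega> - K k s \<omega> x))) \<longlonglongrightarrow> 0"
      proof (rule tendsto_sandwich[OF _ _ tendsto_const])
        have "(\<lambda>l. (1/64::real) ^ l) \<longlonglongrightarrow> 0" by (rule LIMSEQ_power_zero) simp
        then show "(\<lambda>l. ennreal ((1/64) ^ l)) \<longlonglongrightarrow> 0" using tendsto_ennrealI by fastforce
      qed (use q in simp_all)
      show "(\<lambda>l. psize (\<lambda>\<omega>. supn T (\<lambda>t. Z l t \<omega> x - S t \<omega> x))) \<longlonglongrightarrow> 0"
      proof (rule psize_tendsto_0_AE)
        show "(\<lambda>\<omega>. supn T (\<lambda>t. Z l t \<omega> x - S t \<omega> x)) \<in> borel_measurable M" for l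
          by (rule cadapted_supn[OF cadapted_diff[OF elem_cadapted[OF Zelem[OF x]] Sc]])
        show "AE \<omega> in M. (\<lambda>l. supn T (\<lambda>t. Z l t \<omega> x - S t \<omega> x)) \<longlonglongrightarrow> 0"
          using AEg AE_space
        proof eventually_elim
          case (elim \<omega>)
          then show ?case using geometric_uniform_limit(2)[of T "\<lambda>l t. Z l t \<omega> x"] T_nonneg Zc[OF elim(2) x]
            by (simp add: gx S_def)
        qed
      qed
    qed
  qed
  with Sm show ?thesis by (intro that[of S]) simp_all
qed

section \<open>Cutting off at a full event\<close>

lemma event_predictable:
  assumes A: "A \<in> sets (\<F> 0)"
  shows "(\<lambda>z. indicator A (fst z) :: real) \<in> borel_measurable (\<P>)"
proof -
  let ?P = "\<P>"
  have gen: "{A \<times> {s<..t} | A s t. 0 \<le> s \<and> s \<le> t \<and> A \<in> sets (\<F> s)} \<subseteq> Pow (space M \<times> {0<..})"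
    using sets.sets_into_space space_F by fastforce
  have "A \<times> {0<..T} \<in> sets (predictable M \<F>)"
    unfolding predictable_def sets_measure_of[OF gen] using A T_nonneg by (intro sigma_sets.Basic) blast
  then have "(space M \<times> {0<..T}) \<inter> (A \<times> {0<..T}) \<in> sets ?P"
    unfolding predictable_upto_def sets_restrict_space by (rule imageI)
  moreover have "A \<subseteq> space M" using sets.sets_into_space[OF A] space_F[of 0] by simp
  ultimately have [measurable]: "A \<times> {0<..T} \<in> sets ?P" by (simp add: Times_Int_Times Int_absorb1)
  have "(\<lambda>z. indicator (A \<times> {0<..T}) z :: real) \<in> borel_measurable ?P" by measurable
  then show ?thesis
    by (rule measurable_cong[THEN iffD1, rotated]) (auto simp: space_predictable_upto indicator_def)
qed

text \<open>The complement is null, hence in \<open>\<F> 0\<close>. Thus multiplying a predictable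
  integrand by the indicator of a full event leaves it predictable.\<close>

lemma full_event_F0:
  assumes "A \<in> sets M" "AE \<omega> in M. \<omega> \<in> A"
  shows "A \<in> sets (\<F> 0)"
proof -
  have "{\<omega> \<in> space M. \<not> \<omega> \<in> A} \<in> null_sets M"
    using assms by (subst AE_iff_null[symmetric]) auto
  then have "space M - A \<in> sets (\<F> 0)"
    using filtration by (auto simp: complete_filtration_def set_diff_eq)
  then have "space M - (space M - A) \<in> sets (\<F> 0)" using space_F[of 0] by (metis order_refl sets.compl_sets)
  moreover have "A \<subseteq> space M" using assms(1) by (rule sets.sets_into_space)
  ultimately show ?thesis by (simp add: double_diff)
qed

definition pred1 :: "(nat \<Rightarrow> real \<Rightarrow> 'a \<Rightarrow> real) \<Rightarrow> bool" where
  "pred1 f \<longleftrightarrow> (\<forall>k. (\<lambda>(\<omega>, s). f k s \<omega>) \<in> borel_measurable (\<P>)) \<and>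
    (\<forall>k s \<omega>. s \<notin> {0<..T} \<longrightarrow> f k s \<omega> = 0)"

text \<open>A one-point parameter space lets everything proved with a parameter serve for plain
  integrands.\<close>

lemma pred1_predX:
  assumes "pred1 f"
  shows "predX (count_space (UNIV :: unit set)) (\<lambda>k s \<omega> x. f k s \<omega>)"
  unfolding predX_def
proof (intro conjI allI)
  fix k
  have "(\<lambda>z. f k (snd z) (fst z)) \<in> borel_measurable (\<P>)"
    using assms by (simp add: pred1_def case_prod_beta')
  from measurable_compose[OF measurable_fst this]
  show "(\<lambda>((\<omega>, s), x). f k s \<omega>) \<in> borel_measurable (\<P> \<Otimes>\<^sub>M count_space (UNIV :: unit set))"
    by (simp add: case_prod_beta')
qed (use assms in \<open>simp add: pred1_def\<close>)

lemma pred1_fmeas: "pred1 f \<Longrightarrow> fmeas f"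
  using predX_fmeas[OF pred1_predX, of f "()"] by simp

lemma AE_obtain_event:
  assumes "AE \<omega> in M. P \<omega>"
  obtains A where "A \<in> sets M" "AE \<omega> in M. \<omega> \<in> A" "\<And>\<omega>. \<omega> \<in> A \<Longrightarrow> P \<omega>"
proof -
  from assms obtain N where N: "N \<in> null_sets M" "{\<omega> \<in> space M. \<not> P \<omega>} \<subseteq> N" by (auto elim!: AE_E)
  show ?thesis
  proof (rule that[of "space M - N"])
    show "space M - N \<in> sets M" using N by auto
    show "AE \<omega> in M. \<omega> \<in> space M - N" using AE_not_in[OF N(1)] AE_space by eventually_elim simp
    show "P \<omega>" if "\<omega> \<in> space M - N" for \<omega> using that N(2) by blast
  qed
qed

text \<open>\<open>vito_exists\<close> asks for a finite bracket at every \<omega>. Cutting the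
  integrand off outside a full event achieves this, and \<open>vito_AE_cong\<close> restores the
  original integrand.\<close>

lemma vito_exists_AE:
  assumes f: "pred1 f" and fin: "AE \<omega> in M. qv T (\<lambda>k s. f k s \<omega>) < \<infinity>"
  obtains I where "vito f I"
proof -
  obtain A where A: "A \<in> sets M" "AE \<omega> in M. \<omega> \<in> A" "\<And>\<omega>. \<omega> \<in> A \<Longrightarrow> qv T (\<lambda>k s. f k s \<omega>) < \<infinity>"
    by (rule AE_obtain_event[OF fin]) (rule that; assumption)
  define g where "g k s \<omega> = indicator A \<omega> * f k s \<omega>" for k s \<omega>
  have g: "pred1 g"
    unfolding pred1_def
  proof (intro conjI allI)
    fix k
    have [measurable]: "(\<lambda>z. f k (snd z) (fst z)) \<in> borel_measurable (\<P>)"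
      using f by (simp add: pred1_def case_prod_beta')
    note [measurable] = event_predictable[OF full_event_F0[OF A(1,2)]]
    have "(\<lambda>z. indicator A (fst z) * f k (snd z) (fst z)) \<in> borel_measurable (\<P>)" by measurable
    then show "(\<lambda>(\<omega>, s). g k s \<omega>) \<in> borel_measurable (\<P>)" by (simp add: g_def case_prod_beta')
  qed (use f in \<open>simp add: g_def pred1_def\<close>)
  have gfin: "qv T (\<lambda>k s. g k s \<omega>) < \<infinity>" for \<omega>
    by (cases "\<omega> \<in> A") (simp_all add: g_def A(3)[unfolded infinity_ennreal_def])
  obtain S where S: "\<And>x. x \<in> space (count_space (UNIV :: unit set)) \<Longrightarrow> vito (\<lambda>k s \<omega>. g k s \<omega>) (\<lambda>t \<omega>. S t \<omega> x)"
    by (rule vito_exists[OF pred1_predX[OF g] gfin]) blast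
  have "vito f (\<lambda>t \<omega>. S t \<omega> ())"
  proof (rule vito_AE_cong[OF S pred1_fmeas[OF f]])
    show "AE \<omega> in M. qv T (\<lambda>k s. f k s \<omega> - g k s \<omega>) = 0"
      using A(2) by eventually_elim (simp add: g_def)
  qed simp
  then show ?thesis by (rule that)
qed

section \<open>Comparison with the integrals of the components\<close>

text \<open>Reconciles two conventions: \<open>has_ito_integral\<close> looks at (0, T] only, while
  \<open>pred1\<close> asks for the value 0 at all other times.\<close>

definition cut :: "(real \<Rightarrow> 'a \<Rightarrow> real) \<Rightarrow> real \<Rightarrow> 'a \<Rightarrow> real" where
  "cut h s \<omega> = (if 0 < s \<and> s \<le> T then h s \<omega> else 0)"

definition comp_at :: "nat \<Rightarrow> (real \<Rightarrow> 'a \<Rightarrow> real) \<Rightarrow> nat \<Rightarrow> real \<Rightarrow> 'a \<Rightarrow> real" where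
  "comp_at k0 h k s \<omega> = (if k = k0 then cut h s \<omega> else 0)"

lemma cut_predictable:
  assumes "(\<lambda>(\<omega>, s). h s \<omega>) \<in> borel_measurable (\<P>)"
  shows "(\<lambda>(\<omega>, s). cut h s \<omega>) \<in> borel_measurable (\<P>)"
  using assms by (rule measurable_cong[THEN iffD1, rotated]) (auto simp: space_predictable_upto cut_def)

lemma comp_at_pred1:
  assumes "(\<lambda>(\<omega>, s). h s \<omega>) \<in> borel_measurable (\<P>)"
  shows "pred1 (comp_at k0 h)"
  unfolding pred1_def
proof (intro conjI allI)
  fix k
  show "(\<lambda>(\<omega>, s). comp_at k0 h k s \<omega>) \<in> borel_measurable (\<P>)"
    using cut_predictable[OF assms] by (cases "k = k0") (simp_all add: comp_at_def)
qed (simp add: comp_at_def cut_def)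

lemma cut_pred1:
  assumes "\<And>k. (\<lambda>(\<omega>, s). h k s \<omega>) \<in> borel_measurable (\<P>)"
  shows "pred1 (\<lambda>k. cut (h k))"
  unfolding pred1_def by (intro conjI allI impI cut_predictable[OF assms]) (auto simp: cut_def)

lemma sqn_eq_set_integral: "sqn T p = (\<integral>\<^sup>+s\<in>{0<..T}. ennreal ((p s)\<^sup>2) \<partial>lborel)"
  by (simp add: sqn_def)

lemma qv_comp_at: "qv T (\<lambda>k s. comp_at k0 h k s \<omega>) = sqn T (\<lambda>s. h s \<omega>)"
  unfolding comp_at_def qv_single by (rule sqn_cong) (simp add: cut_def)

text \<open>Simple integrands are finite sums of single blocks placed at component
  \<open>k0\<close>, and both convergences in the definition are convergences of
  \<open>psize\<close> by \<open>tendsto_zero_in_prob_iff\<close>.\<close>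

lemma has_ito_vito:
  assumes h: "has_ito_integral M \<F> (W k0) T h I"
  shows "vito (comp_at k0 h) I"
proof -
  from h have hp: "(\<lambda>(\<omega>, s). h s \<omega>) \<in> borel_measurable (\<P>)"
    and I: "cadapted I" unfolding has_ito_integral_def cadapted_def by simp_all
  from h obtain n \<tau> \<xi> where si: "\<And>j. simple_integrand \<F> T (n j) (\<tau> j) (\<xi> j)"
    and t1: "tendsto_zero_in_prob M (\<lambda>j \<omega>. \<integral>\<^sup>+s\<in>{0<..T}. ennreal ((simple_process (n j) (\<tau> j) (\<xi> j) s \<omega> - h s \<omega>)\<^sup>2) \<partial>lborel)"
    and t2: "ucp_tendsto M T (\<lambda>j. simple_ito (W k0) (n j) (\<tau> j) (\<xi> j)) I"
    unfolding has_ito_integral_def by blast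
  let ?g = "\<lambda>j k s \<omega>. if k = k0 then simple_process (n j) (\<tau> j) (\<xi> j) s \<omega> else 0"
  show ?thesis
  proof (rule vitoI[OF pred1_fmeas[OF comp_at_pred1[OF hp]] I])
    show "elem (?g j) (simple_ito (W k0) (n j) (\<tau> j) (\<xi> j))" for j
    proof -
      let ?n = "n j" and ?\<tau> = "\<tau> j" and ?\<xi> = "\<xi> j"
      have s: "0 \<le> ?\<tau> 0" "\<And>i. i < ?n \<Longrightarrow> ?\<tau> i \<le> ?\<tau> (Suc i)" "?\<tau> ?n \<le> T"
        "\<And>i. i < ?n \<Longrightarrow> ?\<xi> i \<in> borel_measurable (\<F> (?\<tau> i))"
        "\<And>i. i < ?n \<Longrightarrow> \<exists>C. \<forall>\<omega>\<in>space (\<F> (?\<tau> i)). \<bar>?\<xi> i \<omega>\<bar> \<le> C"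
        using si[of j] by (simp_all add: simple_integrand_def)
      have mono: "?\<tau> a \<le> ?\<tau> b" if "a \<le> b" "b \<le> ?n" for a b
        using that
      proof (induction b)
        case (Suc b)
        show ?case
        proof (cases "a = Suc b")
          case False
          then have "?\<tau> a \<le> ?\<tau> b" "?\<tau> b \<le> ?\<tau> (Suc b)" using Suc s(2)[of b] by simp_all
          then show ?thesis by simp
        qed simp
      qed simp
      have "elem (\<lambda>k s \<omega>. \<Sum>i<?n. if k = k0 then ?\<xi> i \<omega> * indicator {?\<tau> i<..?\<tau> (Suc i)} s else 0)
          (\<lambda>t \<omega>. \<Sum>i<?n. ?\<xi> i \<omega> * (W k0 (min t (?\<tau> (Suc i))) \<omega> - W k0 (min t (?\<tau> i)) \<omega>))"
      proof (rule elem_sum)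
        fix i assume "i \<in> {..<?n}"
        then have i: "i < ?n" by simp
        have b: "0 \<le> ?\<tau> i" "?\<tau> (Suc i) \<le> T"
          using mono[of 0 i] mono[of "Suc i" ?n] s(1,3) i by simp_all
        obtain C where C: "\<forall>\<omega>\<in>space (\<F> (?\<tau> i)). \<bar>?\<xi> i \<omega>\<bar> \<le> C" using s(5)[OF i] by blast
        show "elem (\<lambda>k s \<omega>. if k = k0 then ?\<xi> i \<omega> * indicator {?\<tau> i<..?\<tau> (Suc i)} s else 0)
          (\<lambda>t \<omega>. ?\<xi> i \<omega> * (W k0 (min t (?\<tau> (Suc i))) \<omega> - W k0 (min t (?\<tau> i)) \<omega>))"
          using C space_F[OF b(1)] by (intro elem_single[where C = C] b s(2)[OF i] s(4)[OF i]) simp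
      qed simp
      moreover have "(\<lambda>k s \<omega>. \<Sum>i<?n. if k = k0 then ?\<xi> i \<omega> * indicator {?\<tau> i<..?\<tau> (Suc i)} s else 0) = ?g j"
        by (intro ext) (simp add: simple_process_def)
      ultimately show ?thesis by (simp add: simple_ito_def[abs_def])
    qed
    have "qv T (\<lambda>k s. ?g j k s \<omega> - comp_at k0 h k s \<omega>) =
      (\<integral>\<^sup>+s\<in>{0<..T}. ennreal ((simple_process (n j) (\<tau> j) (\<xi> j) s \<omega> - h s \<omega>)\<^sup>2) \<partial>lborel)" for j \<omega>
    proof -
      have "(\<lambda>k s. ?g j k s \<omega> - comp_at k0 h k s \<omega>) = (\<lambda>k s. if k = k0 then simple_process (n j) (\<tau> j) (\<xi> j) s \<omega> - cut h s \<omega> else 0)"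
        by (intro ext) (simp add: comp_at_def)
      then have "qv T (\<lambda>k s. ?g j k s \<omega> - comp_at k0 h k s \<omega>) = sqn T (\<lambda>s. simple_process (n j) (\<tau> j) (\<xi> j) s \<omega> - cut h s \<omega>)"
        by (simp only: qv_single)
      also have "\<dots> = sqn T (\<lambda>s. simple_process (n j) (\<tau> j) (\<xi> j) s \<omega> - h s \<omega>)"
        by (rule sqn_cong) (simp add: cut_def)
      finally show ?thesis by (simp only: sqn_eq_set_integral)
    qed
    then show "(\<lambda>j. psize (\<lambda>\<omega>. qv T (\<lambda>k s. ?g j k s \<omega> - comp_at k0 h k s \<omega>))) \<longlonglongrightarrow> 0"
      using t1 by (simp only: tendsto_zero_in_prob_iff)
    show "(\<lambda>j. psize (\<lambda>\<omega>. supn T (\<lambda>t. simple_ito (W k0) (n j) (\<tau> j) (\<xi> j) t \<omega> - I t \<omega>))) \<longlonglongrightarrow> 0"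
      using t2 by (simp only: tendsto_zero_in_prob_iff ucp_tendsto_def supn_def)
  qed
qed

text \<open>The approximants behind \<open>vito\<close> may have many components and an implicit
  partition, whereas the definition wants explicit simple integrands. The grid approximations have
  the required form; their integrals minus \<open>I\<close> are integrals of the approximation
  error, so \<open>vito_tendsto_0\<close> shows that they converge to the given
  \<open>I\<close>.\<close>

lemma vito_has_ito:
  assumes hp: "(\<lambda>(\<omega>, s). h s \<omega>) \<in> borel_measurable (\<P>)"
    and fin: "AE \<omega> in M. sqn T (\<lambda>s. h s \<omega>) < \<infinity>" and v: "vito (comp_at k0 h) I"
  shows "has_ito_integral M \<F> (W k0) T h I"
proof -
  define X where "X = count_space (UNIV :: unit set)"
  define K where "K k s \<omega> x = comp_at k0 h k s \<omega>" for k s \<omega> and x :: unit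
  have K: "predX X K" unfolding K_def[abs_def] X_def by (rule pred1_predX[OF comp_at_pred1[OF hp]])
  have u: "() \<in> space X" by (simp add: X_def)
  have K0: "K k s \<omega> x = 0" if "k \<noteq> k0" for k s \<omega> x using that by (simp add: K_def comp_at_def)
  have c0: "coef n K k i \<omega> x = 0" if "k \<noteq> k0" for n k i \<omega> x
    using K0[OF that] by (simp add: coef_def avg_def)
  define \<tau> where "\<tau> j i = T * real i / real (Suc j)" for j i :: nat
  \<comment> \<open>Zero until \<open>k0\<close> is among the first \<open>Suc j\<close> components,
    in accordance with \<open>appr\<close>.\<close>
  define \<xi> where "\<xi> j i \<omega> = (if k0 < Suc j then coef (Suc j) K k0 i \<omega> () else 0)" for j i \<omega>
  have proc: "simple_process (Suc j) (\<tau> j) (\<xi> j) s \<omega> = appr T (Suc j) (\<lambda>k s. K k s \<omega> ()) k0 s" for j s \<omega>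
    by (simp add: simple_process_def appr_def stepf_def \<xi>_def \<tau>_def coef_def gcell_def del: of_nat_Suc sum.lessThan_Suc)
  have appr0: "appr T n (\<lambda>k s. K k s \<omega> ()) k s = 0" if "k \<noteq> k0" for n k s \<omega>
  proof -
    have "avg T n (\<lambda>s. 0) i = 0" for i by (simp add: avg_def)
    then show ?thesis by (simp add: appr_def stepf_def K0[OF that])
  qed
  have err: "apperr (Suc j) K \<omega> () = (\<integral>\<^sup>+s\<in>{0<..T}. ennreal ((simple_process (Suc j) (\<tau> j) (\<xi> j) s \<omega> - h s \<omega>)\<^sup>2) \<partial>lborel)" for j \<omega>
  proof -
    have "(\<lambda>k s. appr T (Suc j) (\<lambda>k s. K k s \<omega> ()) k s - K k s \<omega> ()) =
        (\<lambda>k s. if k = k0 then simple_process (Suc j) (\<tau> j) (\<xi> j) s \<omega> - cut h s \<omega> else 0)"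
    proof (intro ext)
      fix k s
      show "appr T (Suc j) (\<lambda>k s. K k s \<omega> ()) k s - K k s \<omega> () =
        (if k = k0 then simple_process (Suc j) (\<tau> j) (\<xi> j) s \<omega> - cut h s \<omega> else 0)"
      proof (cases "k = k0")
        case True
        then show ?thesis by (simp only: proc if_True refl) (simp add: K_def comp_at_def)
      next
        case False
        then show ?thesis using appr0[OF False] K0[OF False] by simp
      qed
    qed
    then have "apperr (Suc j) K \<omega> () = sqn T (\<lambda>s. simple_process (Suc j) (\<tau> j) (\<xi> j) s \<omega> - cut h s \<omega>)"
      by (simp only: apperr_def qv_single)
    also have "\<dots> = sqn T (\<lambda>s. simple_process (Suc j) (\<tau> j) (\<xi> j) s \<omega> - h s \<omega>)"
      by (rule sqn_cong) (simp add: cut_def)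
    finally show ?thesis by (simp only: sqn_eq_set_integral)
  qed
  have ito: "simple_ito (W k0) (Suc j) (\<tau> j) (\<xi> j) t \<omega> = appx (Suc j) K t \<omega> ()" for j t \<omega>
  proof -
    let ?B = "\<lambda>k. \<Sum>i<Suc j. coef (Suc j) K k i \<omega> () * (W k (min t (T * real (Suc i) / real (Suc j))) \<omega> - W k (min t (T * real i / real (Suc j))) \<omega>)"
    have "appx (Suc j) K t \<omega> () = (\<Sum>k<Suc j. if k0 = k then ?B k0 else 0)"
      unfolding appx_def
    proof (rule sum.cong)
      fix k
      show "?B k = (if k0 = k then ?B k0 else 0)"
      proof (cases "k0 = k")
        case False
        show ?thesis by (simp only: False if_False c0[OF not_sym[OF False]] mult_zero_left sum.neutral_const)
      qed simp
    qed simp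
    also have "\<dots> = (if k0 < Suc j then ?B k0 else 0)" by (simp only: sum.delta'[OF finite_lessThan] lessThan_iff)
    also have "\<dots> = simple_ito (W k0) (Suc j) (\<tau> j) (\<xi> j) t \<omega>"
      by (simp only: simple_ito_def \<xi>_def \<tau>_def) (cases "k0 < Suc j"; simp only: if_True if_False mult_zero_left sum.neutral_const)
    finally show ?thesis by simp
  qed
  have apm: "(\<lambda>\<omega>. apperr (Suc j) K \<omega> ()) \<in> borel_measurable M" for j
    using measurable_compose[OF measurable_Pair2'[OF u] apperr_measurable[OF K, of "Suc j"]] by simp
  have lim: "(\<lambda>j. psize (\<lambda>\<omega>. apperr (Suc j) K \<omega> ())) \<longlonglongrightarrow> 0"
  proof (rule psize_tendsto_0_AE[OF apm])
    show "AE \<omega> in M. (\<lambda>j. apperr (Suc j) K \<omega> ()) \<longlonglongrightarrow> 0"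
      using fin AE_space
    proof eventually_elim
      case (elim \<omega>)
      then show ?case by (intro apperr_tendsto[OF K _ u]) (simp_all add: K_def qv_comp_at)
    qed
  qed
  have el: "elem (\<lambda>k s \<omega>. appr T (Suc j) (\<lambda>k s. K k s \<omega> ()) k s) (\<lambda>t \<omega>. appx (Suc j) K t \<omega> ())" for j
    by (rule appx_elem[OF K _ u]) simp
  have d: "vito (\<lambda>k s \<omega>. appr T (Suc j) (\<lambda>k s. K k s \<omega> ()) k s - comp_at k0 h k s \<omega>) (\<lambda>t \<omega>. appx (Suc j) K t \<omega> () - I t \<omega>)" for j
    by (rule vito_diff[OF elem_vito[OF el] v])
  have lim2: "(\<lambda>j. psize (\<lambda>\<omega>. supn T (\<lambda>t. appx (Suc j) K t \<omega> () - I t \<omega>))) \<longlonglongrightarrow> 0"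
    using lim by (intro vito_tendsto_0[OF d]) (simp add: apperr_def K_def)
  show ?thesis
    unfolding has_ito_integral_def
  proof (intro conjI exI[of _ Suc] exI[of _ \<tau>] exI[of _ \<xi>])
    show "AE \<omega> in M. (\<integral>\<^sup>+s\<in>{0<..T}. ennreal ((h s \<omega>)\<^sup>2) \<partial>lborel) < \<infinity>"
      using fin by (simp add: sqn_eq_set_integral)
    show "\<forall>t\<in>{0..T}. I t \<in> borel_measurable (\<F> t)" "\<forall>\<omega>\<in>space M. continuous_on {0..T} (\<lambda>t. I t \<omega>)"
      using vito_cadapted[OF v] by (simp_all add: cadapted_def)
    show "\<forall>j. simple_integrand \<F> T (Suc j) (\<tau> j) (\<xi> j)"
    proof
      fix j
      have 1: "\<tau> j i \<le> \<tau> j (Suc i)" for i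
        using T_nonneg unfolding \<tau>_def by (intro divide_right_mono mult_left_mono) simp_all
      have 2: "\<xi> j i \<in> borel_measurable (\<F> (\<tau> j i))" if "i < Suc j" for i
      proof (cases "k0 < Suc j")
        case True
        then show ?thesis unfolding \<xi>_def[abs_def] \<tau>_def using coef_section[OF K _ _ u, of "Suc j" i k0] that by simp
      qed (simp add: \<xi>_def[abs_def])
      have 3: "\<bar>\<xi> j i \<omega>\<bar> \<le> real (Suc j)" for i \<omega>
        using clamp_bdd[of "Suc j"] by (simp add: \<xi>_def coef_def)
      show "simple_integrand \<F> T (Suc j) (\<tau> j) (\<xi> j)"
        unfolding simple_integrand_def
      proof (intro conjI allI impI)
        show "\<exists>C. \<forall>\<omega>\<in>space (\<F> (\<tau> j i)). \<bar>\<xi> j i \<omega>\<bar> \<le> C" for i using 3 by blast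
        show "0 \<le> \<tau> j 0" "\<tau> j (Suc j) \<le> T" by (simp_all add: \<tau>_def del: of_nat_Suc)
      qed (rule 1, rule 2)
    qed
    show "tendsto_zero_in_prob M (\<lambda>j \<omega>. \<integral>\<^sup>+s\<in>{0<..T}. ennreal ((simple_process (Suc j) (\<tau> j) (\<xi> j) s \<omega> - h s \<omega>)\<^sup>2) \<partial>lborel)"
      unfolding err[symmetric] tendsto_zero_in_prob_iff using lim apm by simp
    show "ucp_tendsto M T (\<lambda>j. simple_ito (W k0) (Suc j) (\<tau> j) (\<xi> j)) I"
      unfolding ucp_tendsto_def ito tendsto_zero_in_prob_iff
      using lim2 cadapted_supn[OF vito_cadapted[OF d]] by (simp add: supn_def)
  qed (rule hp)
qed

text \<open>Nothing is known about the measurability of the two sums or of the supremum of their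
  difference. That supremum lies below the measurable infimum \<open>U\<close>, whose
  \<open>psize\<close> is 0.\<close>

lemma ucp_sums_unique:
  assumes "ucp_sums M T X S" "ucp_sums M T X S'"
  shows "AE \<omega> in M. \<forall>t\<in>{0..T}. S' t \<omega> = S t \<omega>"
proof -
  define Z where "Z n \<omega> = supn T (\<lambda>t. (\<Sum>k<n. X k t \<omega>) - S t \<omega>)" for n \<omega>
  define Z' where "Z' n \<omega> = supn T (\<lambda>t. (\<Sum>k<n. X k t \<omega>) - S' t \<omega>)" for n \<omega>
  have Z: "\<And>n. Z n \<in> borel_measurable M" "(\<lambda>n. psize (Z n)) \<longlonglongrightarrow> 0"
    and Z': "\<And>n. Z' n \<in> borel_measurable M" "(\<lambda>n. psize (Z' n)) \<longlonglongrightarrow> 0"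
    using assms unfolding ucp_sums_def ucp_tendsto_def tendsto_zero_in_prob_iff supn_def[symmetric]
    by (simp_all add: Z_def[abs_def] Z'_def[abs_def])
  note [measurable] = Z(1) Z'(1)
  define U where "U \<omega> = (INF n. Z n \<omega> + Z' n \<omega>)" for \<omega>
  have [measurable]: "U \<in> borel_measurable M" unfolding U_def[abs_def] by measurable
  have "psize U \<le> psize (Z n) + psize (Z' n)" for n
  proof -
    have "psize U \<le> psize (\<lambda>\<omega>. Z n \<omega> + Z' n \<omega>)"
      unfolding U_def by (intro psize_mono_AE AE_I2 INF_lower) simp
    also have "\<dots> \<le> psize (Z n) + psize (Z' n)" by (rule psize_add) measurable
    finally show ?thesis .
  qed
  moreover have "(\<lambda>n. psize (Z n) + psize (Z' n)) \<longlonglongrightarrow> 0 + 0" by (intro tendsto_add Z Z')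
  ultimately have "psize U \<le> 0 + 0" by (intro LIMSEQ_le_const) auto
  then have "AE \<omega> in M. U \<omega> = 0" by (simp add: psize_eq_0_iff)
  then show ?thesis
  proof eventually_elim
    case (elim \<omega>)
    have "supn T (\<lambda>t. S' t \<omega> - S t \<omega>) \<le> U \<omega>"
      unfolding U_def
    proof (rule INF_greatest)
      fix n
      have "supn T (\<lambda>t. ((\<Sum>k<n. X k t \<omega>) - S t \<omega>) - ((\<Sum>k<n. X k t \<omega>) - S' t \<omega>)) \<le> Z n \<omega> + Z' n \<omega>"
        unfolding Z_def Z'_def by (rule supn_diff_le)
      then show "supn T (\<lambda>t. S' t \<omega> - S t \<omega>) \<le> Z n \<omega> + Z' n \<omega>" by simp
    qed
    then have "supn T (\<lambda>t. S' t \<omega> - S t \<omega>) = 0" using elim by simp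
    then show ?case using T_nonneg by (simp add: supn_eq_0)
  qed
qed

text \<open>The partial sums of the chosen component integrals differ from \<open>S\<close> by the
  integral of the tail of the sequence, whose bracket tends to 0. By uniqueness the arbitrary
  choices in \<open>ito_integral\<close> and \<open>ucp_suminf\<close> affect the result only on a
  null event, common to all times.\<close>

lemma ito_series_eq:
  assumes hp: "\<And>k. (\<lambda>(\<omega>, s). h k s \<omega>) \<in> borel_measurable (\<P>)"
    and fin: "AE \<omega> in M. qv T (\<lambda>k s. h k s \<omega>) < \<infinity>" and S: "vito (\<lambda>k. cut (h k)) S"
  shows "ito_series_converges M \<F> W T h"
    and "AE \<omega> in M. \<forall>t\<in>{0..T}. ito_series M \<F> W T h t \<omega> = S t \<omega>"
proof -
  have fink: "AE \<omega> in M. sqn T (\<lambda>s. h k s \<omega>) < \<infinity>" for k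
    using fin
  proof eventually_elim
    case (elim \<omega>)
    have "sqn T (\<lambda>s. h k s \<omega>) = (\<Sum>i\<in>{k}. sqn T (\<lambda>s. h i s \<omega>))" by simp
    also have "\<dots> \<le> qv T (\<lambda>k s. h k s \<omega>)" unfolding qv_sqn by (rule sum_le_suminf) simp_all
    finally show ?case using elim by (rule le_less_trans)
  qed
  have integrable: "ito_integrable M \<F> (W k) T (h k)" for k
  proof -
    obtain I where "vito (comp_at k (h k)) I"
      by (rule vito_exists_AE[OF comp_at_pred1[OF hp[of k]], of k]) (use fink[of k] in \<open>simp_all add: qv_comp_at\<close>)
    then have "has_ito_integral M \<F> (W k) T (h k) I" by (rule vito_has_ito[OF hp fink])
    then show ?thesis by (auto simp: ito_integrable_def)
  qed
  define I where "I k = ito_integral M \<F> (W k) T (h k)" for k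
  have I: "vito (comp_at k (h k)) (I k)" for k
  proof (rule has_ito_vito)
    show "has_ito_integral M \<F> (W k) T (h k) (I k)"
      unfolding I_def ito_integral_def using integrable[of k] unfolding ito_integrable_def by (rule someI_ex)
  qed
  have d: "vito (\<lambda>k s \<omega>. (\<Sum>i<n. comp_at i (h i) k s \<omega>) - cut (h k) s \<omega>) (\<lambda>t \<omega>. (\<Sum>i<n. I i t \<omega>) - S t \<omega>)" for n
    by (intro vito_diff vito_sum I S) simp
  have qd: "qv T (\<lambda>k s. (\<Sum>i<n. comp_at i (h i) k s \<omega>) - cut (h k) s \<omega>) = qv T (\<lambda>k s. if k < n then 0 else h k s \<omega>)" for n \<omega>
  proof -
    have "(\<Sum>i<n. comp_at i (h i) k s \<omega>) - cut (h k) s \<omega> = - (if k < n then 0 else cut (h k) s \<omega>)" for k s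
      unfolding comp_at_def by (simp add: sum.delta')
    then have "qv T (\<lambda>k s. (\<Sum>i<n. comp_at i (h i) k s \<omega>) - cut (h k) s \<omega>) = qv T (\<lambda>k s. if k < n then 0 else cut (h k) s \<omega>)"
      by (simp only: qv_minus)
    also have "\<dots> = qv T (\<lambda>k s. if k < n then 0 else h k s \<omega>)" by (rule qv_cong) (simp add: cut_def)
    finally show ?thesis .
  qed
  have "(\<lambda>n. psize (\<lambda>\<omega>. supn T (\<lambda>t. (\<Sum>i<n. I i t \<omega>) - S t \<omega>))) \<longlonglongrightarrow> 0"
  proof (rule vito_tendsto_0[OF d], rule psize_tendsto_0_AE)
    show "(\<lambda>\<omega>. qv T (\<lambda>k s. (\<Sum>i<n. comp_at i (h i) k s \<omega>) - cut (h k) s \<omega>)) \<in> borel_measurable M" for n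
      by (rule fmeas_qv[OF vito_fmeas[OF d]])
    show "AE \<omega> in M. (\<lambda>n. qv T (\<lambda>k s. (\<Sum>i<n. comp_at i (h i) k s \<omega>) - cut (h k) s \<omega>)) \<longlonglongrightarrow> 0"
      using fin unfolding qd by eventually_elim (rule qv_tail_tendsto)
  qed
  then have sums: "ucp_sums M T I S"
    unfolding ucp_sums_def ucp_tendsto_def tendsto_zero_in_prob_iff supn_def[symmetric]
    using cadapted_supn[OF vito_cadapted[OF d]] by simp
  then show "ito_series_converges M \<F> W T h"
    using integrable by (auto simp: ito_series_converges_def ucp_summable_def I_def[abs_def])
  have "ucp_sums M T I (ucp_suminf M T I)"
    unfolding ucp_suminf_def by (rule someI[where P = "ucp_sums M T I", OF sums])
  from ucp_sums_unique[OF sums this]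
  show "AE \<omega> in M. \<forall>t\<in>{0..T}. ito_series M \<F> W T h t \<omega> = S t \<omega>"
    by (simp add: ito_series_def I_def[abs_def])
qed

end

section \<open>The supremum integrated over the parameter\<close>

lemma ennreal_power2_mono:
  fixes a b :: ennreal
  assumes le: "a\<^sup>2 \<le> b\<^sup>2"
  shows "a \<le> b"
proof (rule ccontr)
  assume "\<not> a \<le> b"
  then have lt: "b < a" by (simp only: not_le)
  then obtain y where b: "b = ennreal y" "0 \<le> y" by (cases b) auto
  obtain z where z: "b < z" "z < a" using dense[OF lt] by blast
  then obtain x where x: "z = ennreal x" "0 \<le> x" by (cases z) auto
  have yx: "y < x" using z(1) unfolding x(1) b(1) ennreal_less_iff[OF b(2)] .
  have "z\<^sup>2 \<le> a\<^sup>2" using z(2) by (intro power_mono) (simp_all only: less_imp_le zero_le)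
  also have "\<dots> \<le> b\<^sup>2" by (rule le)
  finally have "ennreal (x\<^sup>2) \<le> ennreal (y\<^sup>2)"
    unfolding x(1) b(1) ennreal_power[OF x(2)] ennreal_power[OF b(2)] .
  then have "x\<^sup>2 \<le> y\<^sup>2" by (subst (asm) ennreal_le_iff) simp_all
  then have "x \<le> y" using b(2) by (rule power2_le_imp_le)
  then show False using yx by simp
qed

text \<open>The square of the inner integral is a double integral over x and y; after exchanging the
  order, Cauchy-Schwarz in l bounds the product by \<open>n x * n y\<close>. A majorant
  \<open>n\<close> of the norm takes the place of a square root in \<open>ennreal\<close>.\<close>

lemma minkowski_nn_integral:
  assumes "sigma_finite_measure L" "sigma_finite_measure N"
    and [measurable]: "G \<in> borel_measurable (L \<Otimes>\<^sub>M N)" "n \<in> borel_measurable N"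
    and le: "\<And>x. x \<in> space N \<Longrightarrow> (\<integral>\<^sup>+l. (G (l, x))\<^sup>2 \<partial>L) \<le> (n x)\<^sup>2"
  shows "(\<integral>\<^sup>+l. (\<integral>\<^sup>+x. G (l, x) \<partial>N)\<^sup>2 \<partial>L) \<le> (\<integral>\<^sup>+x. n x \<partial>N)\<^sup>2"
proof -
  interpret L: sigma_finite_measure L by fact
  interpret N: sigma_finite_measure N by fact
  interpret LN: pair_sigma_finite L N ..
  interpret NL: pair_sigma_finite N L ..
  have "(\<integral>\<^sup>+l. (\<integral>\<^sup>+x. G (l, x) \<partial>N)\<^sup>2 \<partial>L) = (\<integral>\<^sup>+l. (\<integral>\<^sup>+x. (\<integral>\<^sup>+y. G (l, x) * G (l, y) \<partial>N) \<partial>N) \<partial>L)"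
    by (intro nn_integral_cong) (simp add: nn_integral_cmult nn_integral_multc power2_eq_square)
  also have "\<dots> = (\<integral>\<^sup>+x. (\<integral>\<^sup>+l. (\<integral>\<^sup>+y. G (l, x) * G (l, y) \<partial>N) \<partial>L) \<partial>N)"
    by (rule LN.Fubini'[symmetric]) measurable
  also have "\<dots> = (\<integral>\<^sup>+x. (\<integral>\<^sup>+y. (\<integral>\<^sup>+l. G (l, x) * G (l, y) \<partial>L) \<partial>N) \<partial>N)"
    by (intro nn_integral_cong LN.Fubini'[symmetric]) measurable
  also have "\<dots> \<le> (\<integral>\<^sup>+x. (\<integral>\<^sup>+y. n x * n y \<partial>N) \<partial>N)"
  proof (intro nn_integral_mono)
    fix x y assume xy: "x \<in> space N" "y \<in> space N"
    have "(\<integral>\<^sup>+l. G (l, x) * G (l, y) \<partial>L)\<^sup>2 \<le> (\<integral>\<^sup>+l. (G (l, x))\<^sup>2 \<partial>L) * (\<integral>\<^sup>+l. (G (l, y))\<^sup>2 \<partial>L)"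
      using xy by (intro Cauchy_Schwarz_nn_integral) measurable
    also have "\<dots> \<le> (n x)\<^sup>2 * (n y)\<^sup>2" by (intro mult_mono le xy) simp_all
    also have "\<dots> = (n x * n y)\<^sup>2" by (simp add: power_mult_distrib)
    finally show "(\<integral>\<^sup>+l. G (l, x) * G (l, y) \<partial>L) \<le> n x * n y" by (rule ennreal_power2_mono)
  qed
  also have "\<dots> = (\<integral>\<^sup>+x. n x \<partial>N)\<^sup>2"
    by (simp add: nn_integral_cmult nn_integral_multc power2_eq_square)
  finally show ?thesis .
qed

text \<open>Real valued, with an infinite bracket sent to 0; hence the finiteness assumptions in
  \<open>nrm_square\<close> and \<open>nrm_mono\<close>.\<close>

definition nrm :: "real \<Rightarrow> (nat \<Rightarrow> real \<Rightarrow> real) \<Rightarrow> real" where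
  "nrm r p = sqrt (enn2real (qv r p))"

lemma nrm_nonneg [simp]: "0 \<le> nrm r p"
  by (simp add: nrm_def)

lemma nrm_square: "qv r p < \<infinity> \<Longrightarrow> ennreal ((nrm r p)\<^sup>2) = qv r p"
  by (simp add: nrm_def less_top)

lemma nrm_mono: "qv r p \<le> qv r' q \<Longrightarrow> qv r' q < \<infinity> \<Longrightarrow> nrm r p \<le> nrm r' q"
  unfolding nrm_def by (simp add: enn2real_mono)

lemma sqrt_enn2real_square: "q < \<infinity> \<Longrightarrow> (ennreal (sqrt (enn2real q)))\<^sup>2 = q"
  by (simp add: ennreal_power less_top)

text \<open>Minkowski's inequality twice: in time for each component, then in the component index
  with counting measure. The absolute values stay inside the integral over x, so the bound also
  yields integrability of almost every section.\<close>

lemma minkowski_qv: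
  assumes N: "sigma_finite_measure N"
    and m: "\<And>k. (\<lambda>z. p k (fst z) (snd z)) \<in> borel_measurable (borel \<Otimes>\<^sub>M N)"
    and fin: "\<And>x. x \<in> space N \<Longrightarrow> qv T (\<lambda>k s. p k s x) < \<infinity>"
  shows "(\<Sum>k. \<integral>\<^sup>+s. (\<integral>\<^sup>+x. ennreal \<bar>p k s x\<bar> \<partial>N)\<^sup>2 * indicator {0<..T} s \<partial>lborel)
      \<le> (\<integral>\<^sup>+x. ennreal (nrm T (\<lambda>k s. p k s x)) \<partial>N)\<^sup>2"
proof -
  interpret N: sigma_finite_measure N by fact
  have m' [measurable]: "(\<lambda>z. p k (fst z) (snd z)) \<in> borel_measurable (lborel \<Otimes>\<^sub>M N)" for k
    using m[of k] by (simp cong: measurable_cong_sets)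
  have [measurable]: "(\<lambda>z. p k (snd z) (fst z)) \<in> borel_measurable (N \<Otimes>\<^sub>M lborel)" for k
    using measurable_compose[OF measurable_pair_swap'[of N lborel] m'[of k]] by (simp add: case_prod_beta')
  have [measurable]: "(\<lambda>x. sqn T (\<lambda>s. p k s x)) \<in> borel_measurable N" for k
    unfolding sqn_def by (rule lborel.borel_measurable_nn_integral) (simp add: case_prod_beta')
  have qvm [measurable]: "(\<lambda>x. qv T (\<lambda>k s. p k s x)) \<in> borel_measurable N"
    unfolding qv_sqn by measurable
  define a where "a k x = ennreal (sqrt (enn2real (sqn T (\<lambda>s. p k s x))))" for k x
  have [measurable]: "a k \<in> borel_measurable N" for k unfolding a_def[abs_def] by measurable
  have le_qv: "sqn T (\<lambda>s. p k s x) \<le> qv T (\<lambda>k s. p k s x)" for k x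
  proof -
    have "(\<Sum>i\<in>{k}. sqn T (\<lambda>s. p i s x)) \<le> qv T (\<lambda>k s. p k s x)" unfolding qv_sqn by (rule sum_le_suminf) simp_all
    then show ?thesis by simp
  qed
  have a2: "(a k x)\<^sup>2 = sqn T (\<lambda>s. p k s x)" if "x \<in> space N" for k x
    unfolding a_def by (rule sqrt_enn2real_square) (rule le_less_trans[OF le_qv fin[OF that]])
  have 1: "(\<integral>\<^sup>+s. (\<integral>\<^sup>+x. ennreal \<bar>p k s x\<bar> \<partial>N)\<^sup>2 * indicator {0<..T} s \<partial>lborel) \<le> (\<integral>\<^sup>+x. a k x \<partial>N)\<^sup>2" for k
  proof -
    let ?G = "\<lambda>z. ennreal \<bar>p k (fst z) (snd z)\<bar> * indicator {0<..T} (fst z)"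
    have "(\<integral>\<^sup>+s. (\<integral>\<^sup>+x. ennreal \<bar>p k s x\<bar> \<partial>N)\<^sup>2 * indicator {0<..T} s \<partial>lborel) = (\<integral>\<^sup>+s. (\<integral>\<^sup>+x. ?G (s, x) \<partial>N)\<^sup>2 \<partial>lborel)"
      by (intro nn_integral_cong) (simp add: indicator_def)
    also have "\<dots> \<le> (\<integral>\<^sup>+x. a k x \<partial>N)\<^sup>2"
    proof (rule minkowski_nn_integral[OF lborel.sigma_finite_measure_axioms N])
      fix x assume "x \<in> space N"
      have "(\<integral>\<^sup>+s. (?G (s, x))\<^sup>2 \<partial>lborel) = sqn T (\<lambda>s. p k s x)"
        unfolding sqn_def by (intro nn_integral_cong) (simp add: indicator_def ennreal_power)
      then show "(\<integral>\<^sup>+s. (?G (s, x))\<^sup>2 \<partial>lborel) \<le> (a k x)\<^sup>2" using a2[OF \<open>x \<in> space N\<close>] by simp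
    qed measurable
    finally show ?thesis .
  qed
  have "(\<Sum>k. \<integral>\<^sup>+s. (\<integral>\<^sup>+x. ennreal \<bar>p k s x\<bar> \<partial>N)\<^sup>2 * indicator {0<..T} s \<partial>lborel) \<le> (\<Sum>k. (\<integral>\<^sup>+x. a k x \<partial>N)\<^sup>2)"
    by (intro suminf_le 1) simp_all
  also have "\<dots> = (\<integral>\<^sup>+k. (\<integral>\<^sup>+x. (\<lambda>z. a (fst z) (snd z)) (k, x) \<partial>N)\<^sup>2 \<partial>count_space UNIV)"
    by (simp add: nn_integral_count_space_nat)
  also have "\<dots> \<le> (\<integral>\<^sup>+x. ennreal (nrm T (\<lambda>k s. p k s x)) \<partial>N)\<^sup>2"
  proof (rule minkowski_nn_integral[OF sigma_finite_measure_count_space N])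
    show "(\<lambda>z. a (fst z) (snd z)) \<in> borel_measurable (count_space UNIV \<Otimes>\<^sub>M N)"
      by (rule measurable_pair_measure_countable1) simp_all
    show "(\<lambda>x. ennreal (nrm T (\<lambda>k s. p k s x))) \<in> borel_measurable N"
      unfolding nrm_def by measurable
    fix x assume x: "x \<in> space N"
    have "(\<integral>\<^sup>+k. (a (fst (k, x)) (snd (k, x)))\<^sup>2 \<partial>count_space UNIV) = qv T (\<lambda>k s. p k s x)"
      by (simp add: nn_integral_count_space_nat a2[OF x] qv_sqn)
    then show "(\<integral>\<^sup>+k. (a (fst (k, x)) (snd (k, x)))\<^sup>2 \<partial>count_space UNIV) \<le> (ennreal (nrm T (\<lambda>k s. p k s x)))\<^sup>2"
      using nrm_square[OF fin[OF x]] by (simp add: ennreal_power)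
  qed
  finally show ?thesis .
qed

lemma qv_eq_integral:
  assumes [measurable]: "\<And>k. p k \<in> borel_measurable borel"
  shows "qv r p = (\<integral>\<^sup>+s. (\<Sum>k. ennreal ((p k s)\<^sup>2)) * indicator {0<..r} s \<partial>lborel)"
proof -
  have "qv r p = (\<integral>\<^sup>+s. (\<Sum>k. ennreal ((p k s)\<^sup>2) * indicator {0<..r} s) \<partial>lborel)"
    unfolding qv_def by (rule nn_integral_suminf[symmetric]) measurable
  then show ?thesis by simp
qed

lemma eventually_indicator_left:
  assumes "s \<noteq> t"
  shows "\<forall>\<^sub>F n in sequentially. indicator {0<..t - 1 / real (Suc n)} s = (indicator {0<..t} s :: ennreal)"
proof (cases "s < t")
  case True
  have "(\<lambda>n. 1 / real (Suc n)) \<longlonglongrightarrow> 0" by (rule LIMSEQ_Suc[OF lim_1_over_n])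
  moreover have "0 < t - s" using True by simp
  ultimately have "\<forall>\<^sub>F n in sequentially. 1 / real (Suc n) < t - s" by (rule order_tendstoD(2))
  then show ?thesis
  proof eventually_elim
    case (elim n)
    then have "s \<le> t - 1 / real (Suc n)" by linarith
    then have "s \<in> {0<..t - 1 / real (Suc n)} \<longleftrightarrow> s \<in> {0<..t}" using True by (simp only: greaterThanAtMost_iff less_imp_le)
    then show ?case by (simp only: indicator_def)
  qed
next
  case False
  have "s \<notin> {0<..t - 1 / real (Suc n)}" for n
  proof
    assume "s \<in> {0<..t - 1 / real (Suc n)}"
    then have "s \<le> t - 1 / real (Suc n)" by (simp only: greaterThanAtMost_iff)
    moreover have "0 < 1 / real (Suc n)" by simp
    ultimately show False using False by linarith
  qed
  moreover have "s \<notin> {0<..t}" using False assms by auto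
  ultimately show ?thesis by (simp only: indicator_simps always_eventually simp_thms)
qed

text \<open>The intervals of integration exhaust (0, t) and miss only the null set {t}; dominated
  convergence does the rest.\<close>

lemma qv_left_continuous:
  assumes m: "\<And>k. p k \<in> borel_measurable borel" and fin: "qv t p < \<infinity>"
  shows "(\<lambda>n. qv (t - 1 / real (Suc n)) p) \<longlonglongrightarrow> qv t p"
proof -
  define V where "V s = (\<Sum>k. ennreal ((p k s)\<^sup>2))" for s
  note [measurable] = m
  have [measurable]: "V \<in> borel_measurable borel" unfolding V_def[abs_def] by measurable
  have eq: "qv r p = (\<integral>\<^sup>+s. V s * indicator {0<..r} s \<partial>lborel)" for r
    unfolding V_def by (rule qv_eq_integral[OF m])
  have le: "indicator {0<..t - 1 / real (Suc n)} s \<le> (indicator {0<..t} s :: ennreal)" for n s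
  proof (rule indicator_leI)
    assume "s \<in> {0<..t - 1 / real (Suc n)}"
    then have s: "0 < s" "s \<le> t - 1 / real (Suc n)" by (simp_all only: greaterThanAtMost_iff)
    have "t - 1 / real (Suc n) \<le> t" by simp
    with s(2) have "s \<le> t" by (rule order_trans)
    with s(1) show "s \<in> {0<..t}" by simp
  qed
  have lim: "(\<lambda>n. V s * indicator {0<..t - 1 / real (Suc n)} s) \<longlonglongrightarrow> V s * indicator {0<..t} s" if "s \<noteq> t" for s
    by (rule tendsto_eventually, rule eventually_mono[OF eventually_indicator_left[OF that]]) simp
  have AE: "AE s in lborel. (\<lambda>n. V s * indicator {0<..t - 1 / real (Suc n)} s) \<longlonglongrightarrow> V s * indicator {0<..t} s"
    by (rule AE_mp[OF AE_lborel_singleton[of t] AE_I2]) (rule impI, rule lim)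
  show ?thesis
    unfolding eq
  proof (rule nn_integral_dominated_convergence[OF _ _ _ _ _ AE])
    show "(\<integral>\<^sup>+s. V s * indicator {0<..t} s \<partial>lborel) < \<infinity>" using fin by (simp only: eq)
    show "AE s in lborel. V s * indicator {0<..t - 1 / real (Suc n)} s \<le> V s * indicator {0<..t} s" for n
      by (intro AE_I2 mult_left_mono le) simp
  qed measurable
qed

section \<open>Predictable sets, the integrated root of the bracket and truncation\<close>

context wiener_system
begin

lemma predictable_gen_subset:
  "{A \<times> {s<..t} | A s t. 0 \<le> s \<and> s \<le> t \<and> A \<in> sets (\<F> s)} \<subseteq> Pow (space M \<times> {0<..})"
  using sets.sets_into_space space_F by fastforce

lemma predictable_rect:
  assumes a: "0 \<le> a" "a \<le> T" and A: "A \<in> sets (\<F> a)"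
  shows "A \<times> {a<..T} \<in> sets (\<P>)"
proof -
  have "A \<times> {a<..T} \<in> sets (predictable M \<F>)"
    unfolding predictable_def sets_measure_of[OF predictable_gen_subset] using A a by (intro sigma_sets.Basic) blast
  then have "(space M \<times> {0<..T}) \<inter> (A \<times> {a<..T}) \<in> sets (\<P>)"
    unfolding predictable_upto_def sets_restrict_space by (rule imageI)
  moreover have "A \<subseteq> space M" using sets.sets_into_space[OF A] space_F[OF a(1)] by simp
  then have "(space M \<times> {0<..T}) \<inter> (A \<times> {a<..T}) = A \<times> {a<..T}" using a(1) by auto
  ultimately show ?thesis by simp
qed

lemma predictable_time [measurable]: "snd \<in> \<P> \<rightarrow>\<^sub>M (borel :: real measure)"
proof (rule borel_measurableI_greater)
  fix y
  let ?a = "max 0 (min y T)"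
  have a: "0 \<le> ?a" "?a \<le> T" using T_nonneg by simp_all
  have "space M \<times> {?a<..T} \<in> sets (\<P>)"
    using predictable_rect[OF a sets.top] space_F[OF a(1)] by simp
  moreover have "space M \<times> {?a<..T} = {x \<in> space (\<P>). y < snd x}"
    by (auto simp: space_predictable_upto)
  ultimately show "{x \<in> space (\<P>). y < snd x} \<in> sets (\<P>)" by simp
qed

text \<open>The sets B \<times> (a, T] with B in \<open>\<F> a\<close> are predictable, so after
  time \<open>a\<close> the projection to \<omega> is measurable into \<open>\<F> a\<close>.\<close>

lemma adapted_step_predictable:
  assumes a: "0 \<le> a" "a \<le> T" and f: "(\<lambda>z. f (fst z) (snd z)) \<in> borel_measurable (\<F> a \<Otimes>\<^sub>M X)"
  shows "(\<lambda>z. f (fst (fst z)) (snd z) * indicator {a<..b} (snd (fst z)) :: real) \<in> borel_measurable (\<P> \<Otimes>\<^sub>M X)"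
proof -
  let ?P = "\<P>"
  let ?N = "?P \<Otimes>\<^sub>M X"
  note rect = predictable_rect[OF a]
  let ?A = "(space M \<times> {a<..T}) \<times> space X"
  have A: "?A \<inter> space ?N \<in> sets ?N"
  proof -
    have "space M \<times> {a<..T} \<in> sets ?P" using rect[OF sets.top] space_F[OF a(1)] by simp
    then have "?A \<in> sets ?N" by (rule pair_measureI) simp
    then show ?thesis by simp
  qed
  have 1: "(\<lambda>z. fst (fst z)) \<in> restrict_space ?N ?A \<rightarrow>\<^sub>M \<F> a"
  proof (rule measurableI)
    show "fst (fst z) \<in> space (\<F> a)" if "z \<in> space (restrict_space ?N ?A)" for z
    proof -
      from that have "z \<in> ?A" unfolding space_restrict_space by (rule IntD1)
      then show ?thesis unfolding space_F[OF a(1)] by (rule SigmaE) auto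
    qed
    fix B assume B: "B \<in> sets (\<F> a)"
    have "(B \<times> {a<..T}) \<times> space X \<in> sets ?N" using rect[OF B] by (rule pair_measureI) simp
    then have "?A \<inter> ((B \<times> {a<..T}) \<times> space X) \<in> sets (restrict_space ?N ?A)"
      unfolding sets_restrict_space by (rule imageI)
    moreover have "(\<lambda>z. fst (fst z)) -` B \<inter> space (restrict_space ?N ?A) = ?A \<inter> ((B \<times> {a<..T}) \<times> space X)"
      using a(1) by (auto simp: space_restrict_space space_pair_measure space_predictable_upto)
    ultimately show "(\<lambda>z. fst (fst z)) -` B \<inter> space (restrict_space ?N ?A) \<in> sets (restrict_space ?N ?A)" by simp
  qed
  have 2: "snd \<in> restrict_space ?N ?A \<rightarrow>\<^sub>M X"
    by (rule measurable_restrict_space1) measurable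
  have "(\<lambda>z. f (fst (fst z)) (snd z)) \<in> borel_measurable (restrict_space ?N ?A)"
    using measurable_compose[OF measurable_Pair[OF 1 2] f] by simp
  then have [measurable]: "(\<lambda>z. indicator ?A z *\<^sub>R f (fst (fst z)) (snd z)) \<in> borel_measurable ?N"
    by (subst (asm) borel_measurable_restrict_space_iff[OF A])
  have "(\<lambda>z. (indicator ?A z *\<^sub>R f (fst (fst z)) (snd z)) * indicator {a<..b} (snd (fst z))) \<in> borel_measurable ?N"
    by measurable
  then show ?thesis
    by (rule measurable_cong[THEN iffD1, rotated])
      (auto simp: space_pair_measure space_predictable_upto indicator_def)
qed

lemma predX_section:
  assumes K: "predX N K" and \<omega>: "\<omega> \<in> space M"
  shows "(\<lambda>z. K k (fst z) \<omega> (snd z)) \<in> borel_measurable (borel \<Otimes>\<^sub>M N)"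
proof -
  have "(\<lambda>z. ((\<omega>, snd z), fst z)) \<in> (borel :: real measure) \<Otimes>\<^sub>M N \<rightarrow>\<^sub>M (M \<Otimes>\<^sub>M N) \<Otimes>\<^sub>M borel"
    using \<omega> by measurable
  from measurable_compose[OF this predX_measurable[OF K, of k]] show ?thesis by simp
qed

text \<open>The approximation error must itself be a predictable integrand, because
  \<open>integral_supn_maximal\<close>, and with it the truncation, is applied to the error.\<close>

lemma predX_appr:
  assumes K: "predX X K" and n: "0 < n"
  shows "predX X (\<lambda>k s \<omega> x. appr T n (\<lambda>k s. K k s \<omega> x) k s)"
  unfolding predX_def
proof (intro conjI allI impI)
  fix k
  have "(\<lambda>z. appr T n (\<lambda>k s. K k s (fst (fst z)) (snd z)) k (snd (fst z))) \<in> borel_measurable (\<P> \<Otimes>\<^sub>M X)"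
    unfolding appr_coef
  proof (intro borel_measurable_sum)
    fix p assume "p \<in> {..<n} \<times> {..<n}"
    then have i: "snd p \<le> n" by auto
    show "(\<lambda>z. case p of (k', i) \<Rightarrow> if k = k' then coef n K k' i (fst (fst z)) (snd z) *
        indicator {T * real i / real n<..T * real (Suc i) / real n} (snd (fst z)) else 0) \<in> borel_measurable (\<P> \<Otimes>\<^sub>M X)"
    proof (cases "k = fst p")
      case True
      then show ?thesis
        using adapted_step_predictable[OF _ _ coef_adapted[OF K n i], of k "T * real (Suc (snd p)) / real n"] grid_bounds[OF n i]
        by (simp add: case_prod_beta' del: of_nat_Suc)
    qed (simp add: case_prod_beta')
  qed
  then show "(\<lambda>((\<omega>, s), x). appr T n (\<lambda>k s. K k s \<omega> x) k s) \<in> borel_measurable (\<P> \<Otimes>\<^sub>M X)"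
    by (simp add: case_prod_beta')
next
  fix k s \<omega> x assume s: "s \<notin> {0<..T}"
  have "indicator (gcell T n i) s = (0::real)" if "i < n" for i
  proof -
    have "0 \<le> T * real i / real n" "T * real (Suc i) / real n \<le> T"
      using grid_bounds[OF n, of i] grid_bounds[OF n, of "Suc i"] that by simp_all
    then show ?thesis using s unfolding gcell_def by (auto simp: indicator_def simp del: of_nat_Suc)
  qed
  then show "appr T n (\<lambda>k s. K k s \<omega> x) k s = 0" by (simp add: appr_def stepf_def)
qed

lemma predX_diff:
  assumes "predX X K" "predX X K'"
  shows "predX X (\<lambda>k s \<omega> x. K k s \<omega> x - K' k s \<omega> x)"
  unfolding predX_def
proof (intro conjI allI impI)
  fix k
  have [measurable]: "(\<lambda>z. K k (snd (fst z)) (fst (fst z)) (snd z)) \<in> borel_measurable (\<P> \<Otimes>\<^sub>M X)"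
    "(\<lambda>z. K' k (snd (fst z)) (fst (fst z)) (snd z)) \<in> borel_measurable (\<P> \<Otimes>\<^sub>M X)"
    using assms by (simp_all add: predX_def case_prod_beta')
  have "(\<lambda>z. K k (snd (fst z)) (fst (fst z)) (snd z) - K' k (snd (fst z)) (fst (fst z)) (snd z)) \<in> borel_measurable (\<P> \<Otimes>\<^sub>M X)"
    by measurable
  then show "(\<lambda>((\<omega>, s), x). K k s \<omega> x - K' k s \<omega> x) \<in> borel_measurable (\<P> \<Otimes>\<^sub>M X)"
    by (simp add: case_prod_beta')
qed (use assms in \<open>simp add: predX_def\<close>)

definition phi :: "'x measure \<Rightarrow> (nat \<Rightarrow> real \<Rightarrow> 'a \<Rightarrow> 'x \<Rightarrow> real) \<Rightarrow> real \<Rightarrow> 'a \<Rightarrow> ennreal" where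
  "phi N K r \<omega> = (\<integral>\<^sup>+x. ennreal (nrm r (\<lambda>k s. K k s \<omega> x)) \<partial>N)"

context
  fixes N :: "'x measure" and K :: "nat \<Rightarrow> real \<Rightarrow> 'a \<Rightarrow> 'x \<Rightarrow> real"
  assumes N: "sigma_finite_measure N" and K: "predX N K"
    and fin: "\<And>\<omega> x. \<omega> \<in> space M \<Longrightarrow> x \<in> space N \<Longrightarrow> qv T (\<lambda>k s. K k s \<omega> x) < \<infinity>"
    and phi_fin: "\<And>\<omega>. \<omega> \<in> space M \<Longrightarrow> phi N K T \<omega> < \<infinity>"
begin

lemma qv_fin: "\<omega> \<in> space M \<Longrightarrow> x \<in> space N \<Longrightarrow> t \<le> T \<Longrightarrow> qv t (\<lambda>k s. K k s \<omega> x) < \<infinity>"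
  using le_less_trans[OF qv_mono_r fin] .

lemma phi_mono: "\<omega> \<in> space M \<Longrightarrow> r \<le> t \<Longrightarrow> t \<le> T \<Longrightarrow> phi N K r \<omega> \<le> phi N K t \<omega>"
  unfolding phi_def
  by (intro nn_integral_mono ennreal_leI nrm_mono qv_mono_r qv_fin) simp_all

lemma nrm_measurable_F:
  assumes r: "0 \<le> r" "r \<le> T"
  shows "(\<lambda>z. nrm r (\<lambda>k s. K k s (fst z) (snd z))) \<in> borel_measurable (\<F> r \<Otimes>\<^sub>M N)"
proof -
  have "(\<lambda>z. qv r (\<lambda>k s. indicator {0<..r} s * K k s (fst z) (snd z))) \<in> borel_measurable (\<F> r \<Otimes>\<^sub>M N)"
    using predX_progressive[OF K r] by (intro qv_measurable) (simp add: case_prod_beta')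
  moreover have "qv r (\<lambda>k s. indicator {0<..r} s * K k s \<omega> x) = qv r (\<lambda>k s. K k s \<omega> x)" for \<omega> x
    by (rule qv_cong) simp
  ultimately have [measurable]: "(\<lambda>z. qv r (\<lambda>k s. K k s (fst z) (snd z))) \<in> borel_measurable (\<F> r \<Otimes>\<^sub>M N)" by simp
  show ?thesis unfolding nrm_def by measurable
qed

lemma phi_measurable:
  assumes r: "0 \<le> r" "r \<le> T"
  shows "phi N K r \<in> borel_measurable (\<F> r)"
proof -
  interpret N: sigma_finite_measure N by (rule N)
  note [measurable] = nrm_measurable_F[OF r]
  show ?thesis unfolding phi_def[abs_def] by measurable
qed

lemma nrm_section:
  assumes \<omega>: "\<omega> \<in> space M"
  shows "(\<lambda>x. nrm r (\<lambda>k s. K k s \<omega> x)) \<in> borel_measurable N"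
proof -
  have [measurable]: "(\<lambda>x. qv r (\<lambda>k s. K k s \<omega> x)) \<in> borel_measurable N"
  proof (rule qv_measurable)
    fix k
    show "(\<lambda>(x, s). K k s \<omega> x) \<in> borel_measurable (N \<Otimes>\<^sub>M borel)"
      using measurable_compose[OF measurable_pair_swap'[of N borel] predX_section[OF K \<omega>, of k]]
      by (simp add: case_prod_beta')
  qed
  show ?thesis unfolding nrm_def by measurable
qed

text \<open>Left continuity, from \<open>qv_left_continuous\<close> and dominated convergence over x
  with the value at T as majorant. The witness is rational so that the crossing of \<delta> becomes
  a countable union of predictable rectangles in \<open>phi_event_predictable\<close>.\<close>

lemma phi_left:
  assumes \<omega>: "\<omega> \<in> space M" and t: "0 < t" "t \<le> T" and d: "ennreal \<delta> < phi N K t \<omega>"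
  shows "\<exists>r\<in>\<rat>. 0 \<le> r \<and> r < t \<and> ennreal \<delta> < phi N K r \<omega>"
proof -
  define u where "u n = t - 1 / real (Suc n)" for n
  have u: "u n < t" for n by (simp add: u_def)
  have "(\<lambda>n. phi N K (u n) \<omega>) \<longlonglongrightarrow> phi N K t \<omega>"
    unfolding phi_def
  proof (rule nn_integral_dominated_convergence[where w = "\<lambda>x. ennreal (nrm T (\<lambda>k s. K k s \<omega> x))"])
    show "(\<integral>\<^sup>+x. ennreal (nrm T (\<lambda>k s. K k s \<omega> x)) \<partial>N) < \<infinity>" using phi_fin[OF \<omega>] by (simp add: phi_def)
    show "AE x in N. (\<lambda>n. ennreal (nrm (u n) (\<lambda>k s. K k s \<omega> x))) \<longlonglongrightarrow> ennreal (nrm t (\<lambda>k s. K k s \<omega> x))"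
    proof (rule AE_I2)
      fix x assume x: "x \<in> space N"
      have f: "qv t (\<lambda>k s. K k s \<omega> x) < \<infinity>" by (rule le_less_trans[OF qv_mono_r[OF t(2)] fin[OF \<omega> x]])
      have "(\<lambda>n. qv (u n) (\<lambda>k s. K k s \<omega> x)) \<longlonglongrightarrow> qv t (\<lambda>k s. K k s \<omega> x)"
        unfolding u_def by (rule qv_left_continuous[OF predX_path[OF K \<omega> x] f])
      then show "(\<lambda>n. ennreal (nrm (u n) (\<lambda>k s. K k s \<omega> x))) \<longlonglongrightarrow> ennreal (nrm t (\<lambda>k s. K k s \<omega> x))"
        unfolding nrm_def using f by (intro tendsto_ennrealI tendsto_real_sqrt tendsto_enn2real) (simp_all add: less_top)
    qed
    show "AE x in N. ennreal (nrm (u n) (\<lambda>k s. K k s \<omega> x)) \<le> ennreal (nrm T (\<lambda>k s. K k s \<omega> x))" for n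
      using u[of n] t by (intro AE_I2 ennreal_leI nrm_mono qv_mono_r fin \<omega>) simp_all
  qed (use nrm_section[OF \<omega>] in simp_all)
  then have "\<forall>\<^sub>F n in sequentially. ennreal \<delta> < phi N K (u n) \<omega>" using d by (rule order_tendstoD)
  then obtain n where n: "ennreal \<delta> < phi N K (u n) \<omega>" using eventually_happens by fastforce
  have "0 < u n"
  proof (rule ccontr)
    assume "\<not> 0 < u n"
    then have "qv (u n) p = 0" for p by (simp add: qv_def)
    then have "phi N K (u n) \<omega> = 0" by (simp add: phi_def nrm_def)
    then show False using n by simp
  qed
  obtain r where r: "r \<in> \<rat>" "u n < r" "r < t" using Rats_dense_in_real[OF u[of n]] by blast
  have "phi N K (u n) \<omega> \<le> phi N K r \<omega>" using r t by (intro phi_mono \<omega>) simp_all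
  then show ?thesis using r n \<open>0 < u n\<close> by (intro bexI[of _ r]) (auto intro: less_le_trans)
qed

lemma phi_event_predictable:
  "{z \<in> space (\<P>). phi N K (snd z) (fst z) \<le> ennreal \<delta>} \<in> sets (\<P>)"
proof -
  let ?P = "\<P>"
  \<comment> \<open>Since \<open>phi\<close> increases, \<delta> is exceeded at t exactly when it is
    already exceeded at some rational r < t.\<close>
  let ?U = "\<Union>r\<in>\<rat> \<inter> {0..T}. {\<omega> \<in> space M. ennreal \<delta> < phi N K r \<omega>} \<times> {r<..T}"
  have "countable (\<rat> \<inter> {0..T})" using countable_rat by (rule countable_subset[rotated]) simp
  then have "?U \<in> sets ?P"
  proof (rule sets.countable_UN'')
    fix r assume r: "r \<in> \<rat> \<inter> {0..T}"
    then have r': "0 \<le> r" "r \<le> T" by simp_all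
    note [measurable] = phi_measurable[OF r']
    have "{\<omega> \<in> space (\<F> r). ennreal \<delta> < phi N K r \<omega>} \<in> sets (\<F> r)" by measurable
    then show "{\<omega> \<in> space M. ennreal \<delta> < phi N K r \<omega>} \<times> {r<..T} \<in> sets ?P"
      unfolding space_F[OF r'(1)] by (rule predictable_rect[OF r'])
  qed
  then have "space ?P - ?U \<in> sets ?P" by (rule sets.compl_sets)
  moreover have "space ?P - ?U = {z \<in> space ?P. phi N K (snd z) (fst z) \<le> ennreal \<delta>}"
  proof (rule set_eqI)
    fix z :: "'a \<times> real"
    obtain \<omega> t where z: "z = (\<omega>, t)" by (cases z)
    show "z \<in> space ?P - ?U \<longleftrightarrow> z \<in> {z \<in> space ?P. phi N K (snd z) (fst z) \<le> ennreal \<delta>}"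
    proof (cases "\<omega> \<in> space M \<and> 0 < t \<and> t \<le> T")
      case True
      then have \<omega>: "\<omega> \<in> space M" and t: "0 < t" "t \<le> T" by simp_all
      have "z \<in> ?U \<longleftrightarrow> ennreal \<delta> < phi N K t \<omega>"
      proof
        assume "z \<in> ?U"
        then obtain r where "ennreal \<delta> < phi N K r \<omega>" "r < t" by (auto simp: z)
        then show "ennreal \<delta> < phi N K t \<omega>" using phi_mono[OF \<omega>, of r t] t by (auto intro: less_le_trans)
      next
        assume "ennreal \<delta> < phi N K t \<omega>"
        from phi_left[OF \<omega> t this] show "z \<in> ?U" using \<omega> t by (auto simp: z intro!: bexI)
      qed
      then show ?thesis using True by (simp add: z space_predictable_upto not_less)
    qed (auto simp: z space_predictable_upto)
  qed
  ultimately show ?thesis by simp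
qed

text \<open>
  Since \<open>phi N K\<close> is left continuous in time, the event \<open>phi N K s \<omega> \<le> \<delta>\<close> is predictable.
\<close>

definition trunc :: "real \<Rightarrow> nat \<Rightarrow> real \<Rightarrow> 'a \<Rightarrow> 'x \<Rightarrow> real" where
  "trunc \<delta> k s \<omega> x = (if phi N K s \<omega> \<le> ennreal \<delta> then K k s \<omega> x else 0)"

lemma trunc_predX: "predX N (trunc \<delta>)"
  unfolding predX_def
proof (intro conjI allI impI)
  fix k
  let ?P = "\<P>"
  have [measurable]: "(\<lambda>z. K k (snd (fst z)) (fst (fst z)) (snd z)) \<in> borel_measurable (?P \<Otimes>\<^sub>M N)"
    using K by (simp add: predX_def case_prod_beta')
  have "Measurable.pred ?P (\<lambda>z. phi N K (snd z) (fst z) \<le> ennreal \<delta>)"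
    using phi_event_predictable by (simp add: Measurable.pred_def)
  from measurable_compose[OF measurable_fst this]
  have [measurable]: "Measurable.pred (?P \<Otimes>\<^sub>M N) (\<lambda>z. phi N K (snd (fst z)) (fst (fst z)) \<le> ennreal \<delta>)" .
  have "(\<lambda>z. if phi N K (snd (fst z)) (fst (fst z)) \<le> ennreal \<delta> then K k (snd (fst z)) (fst (fst z)) (snd z) else 0) \<in> borel_measurable (?P \<Otimes>\<^sub>M N)"
    by measurable
  then show "(\<lambda>((\<omega>, s), x). trunc \<delta> k s \<omega> x) \<in> borel_measurable (?P \<Otimes>\<^sub>M N)"
    by (simp add: case_prod_beta' trunc_def)
qed (use K in \<open>simp add: trunc_def predX_def\<close>)

lemma trunc_qv_fin:
  assumes "\<omega> \<in> space M" "x \<in> space N"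
  shows "qv T (\<lambda>k s. trunc \<delta> k s \<omega> x) < \<infinity>"
proof -
  have "qv T (\<lambda>k s. trunc \<delta> k s \<omega> x) \<le> qv T (\<lambda>k s. K k s \<omega> x)"
    by (rule qv_mono) (simp add: trunc_def)
  then show ?thesis using fin[OF assms] by (rule le_less_trans)
qed

text \<open>Monotonicity and left continuity of \<open>phi\<close> make the times with
  \<open>phi \<le> \<delta>\<close> an interval that contains its right end \<sigma>. Truncation
  therefore amounts to stopping at \<sigma>, where the bound still holds.\<close>

lemma trunc_phi_le:
  assumes \<omega>: "\<omega> \<in> space M" and \<delta>: "0 \<le> \<delta>"
  shows "phi N (trunc \<delta>) T \<omega> \<le> ennreal \<delta>"
proof -
  define J where "J = {s. 0 < s \<and> s \<le> T \<and> phi N K s \<omega> \<le> ennreal \<delta>}"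
  show ?thesis
  proof (cases "J = {}")
    case True
    have "qv T (\<lambda>k s. trunc \<delta> k s \<omega> x) = qv T (\<lambda>k s. 0)" for x
      using True by (intro qv_cong) (auto simp: trunc_def J_def)
    then show ?thesis by (simp add: phi_def nrm_def)
  next
    case False
    have bdd: "bdd_above J" by (rule bdd_aboveI[of _ T]) (simp add: J_def)
    define \<sigma> where "\<sigma> = Sup J"
    obtain s0 where s0: "s0 \<in> J" using False by blast
    have \<sigma>: "0 < \<sigma>" "\<sigma> \<le> T"
      using cSup_upper[OF s0 bdd] s0 cSup_least[OF False, of T] by (auto simp: \<sigma>_def J_def intro: less_le_trans)
    have phis: "phi N K \<sigma> \<omega> \<le> ennreal \<delta>"
    proof (rule ccontr)
      assume "\<not> ?thesis"
      then obtain r where r: "r < \<sigma>" "ennreal \<delta> < phi N K r \<omega>"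
        using phi_left[OF \<omega> \<sigma>, of \<delta>] by (auto simp: not_le)
      obtain s where s: "s \<in> J" "r < s" using less_cSupD[OF False] r(1) unfolding \<sigma>_def by blast
      have "phi N K r \<omega> \<le> phi N K s \<omega>" using s by (intro phi_mono \<omega>) (simp_all add: J_def)
      also have "\<dots> \<le> ennreal \<delta>" using s by (simp add: J_def)
      finally show False using r(2) by simp
    qed
    have "phi N (trunc \<delta>) T \<omega> \<le> phi N K \<sigma> \<omega>"
      unfolding phi_def
    proof (intro nn_integral_mono ennreal_leI nrm_mono)
      fix x assume x: "x \<in> space N"
      have "qv T (\<lambda>k s. trunc \<delta> k s \<omega> x) \<le> qv T (\<lambda>k s. if s \<le> \<sigma> then K k s \<omega> x else 0)"
      proof (rule qv_mono)
        fix k s assume s: "0 < s" "s \<le> T"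
        show "\<bar>trunc \<delta> k s \<omega> x\<bar> \<le> \<bar>if s \<le> \<sigma> then K k s \<omega> x else 0\<bar>"
        proof (cases "phi N K s \<omega> \<le> ennreal \<delta>")
          case True
          then have "s \<le> \<sigma>" unfolding \<sigma>_def using s by (intro cSup_upper bdd) (simp add: J_def)
          then show ?thesis by (simp add: trunc_def)
        qed (simp add: trunc_def)
      qed
      also have "\<dots> \<le> qv \<sigma> (\<lambda>k s. K k s \<omega> x)"
        unfolding qv_def using \<sigma> by (intro suminf_le nn_integral_mono) (simp_all add: indicator_def)
      finally show "qv T (\<lambda>k s. trunc \<delta> k s \<omega> x) \<le> qv \<sigma> (\<lambda>k s. K k s \<omega> x)" .
      show "qv \<sigma> (\<lambda>k s. K k s \<omega> x) < \<infinity>" by (rule le_less_trans[OF qv_mono_r[OF \<sigma>(2)] fin[OF \<omega> x]])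
    qed
    then show ?thesis using phis by (rule order_trans)
  qed
qed

context
  fixes S :: "real \<Rightarrow> 'a \<Rightarrow> 'x \<Rightarrow> real"
  assumes S_meas: "\<And>t. 0 \<le> t \<Longrightarrow> t \<le> T \<Longrightarrow> (\<lambda>z. S t (fst z) (snd z)) \<in> borel_measurable (M \<Otimes>\<^sub>M N)"
    and S_vito: "\<And>x. x \<in> space N \<Longrightarrow> vito (\<lambda>k s \<omega>. K k s \<omega> x) (\<lambda>t \<omega>. S t \<omega> x)"
begin

lemma supn_S_measurable: "(\<lambda>z. supn T (\<lambda>t. S t (fst z) (snd z))) \<in> borel_measurable (M \<Otimes>\<^sub>M N)"
proof (rule supn_measurable)
  fix z assume "z \<in> space (M \<Otimes>\<^sub>M N)"
  then have "fst z \<in> space M" "snd z \<in> space N" by (auto simp: space_pair_measure)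
  then show "continuous_on {0..T} (\<lambda>t. S t (fst z) (snd z))"
    using cadaptedD(1)[OF vito_cadapted[OF S_vito]] by blast
qed (use S_meas in simp)

text \<open>For the truncated integrand the first moment bound of \<open>vito_L1\<close>, integrated
  over x, is at most 10 \<delta> by \<open>trunc_phi_le\<close>. On the event of small
  \<open>phi\<close> nothing has been truncated, so by locality \<open>S\<close> and the truncated
  version \<open>S'\<close> coincide there; Markov's inequality gives the claim.\<close>

lemma integral_supn_maximal:
  assumes e: "0 \<le> e" and \<delta>: "0 \<le> \<delta>"
  shows "ennreal e * emeasure M {\<omega> \<in> space M. ennreal e < (\<integral>\<^sup>+x. supn T (\<lambda>t. S t \<omega> x) \<partial>N) \<and> phi N K T \<omega> \<le> ennreal \<delta>} \<le> 10 * ennreal \<delta>"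
proof -
  interpret N: sigma_finite_measure N by (rule N)
  interpret MN: pair_sigma_finite M N ..
  obtain S' where S'm: "\<And>t. 0 \<le> t \<Longrightarrow> t \<le> T \<Longrightarrow> (\<lambda>z. S' t (fst z) (snd z)) \<in> borel_measurable (M \<Otimes>\<^sub>M N)"
    and S'v: "\<And>x. x \<in> space N \<Longrightarrow> vito (\<lambda>k s \<omega>. trunc \<delta> k s \<omega> x) (\<lambda>t \<omega>. S' t \<omega> x)"
    by (rule vito_exists[OF trunc_predX[of \<delta>] trunc_qv_fin[where \<delta> = \<delta>]]) (assumption, assumption, blast intro: that)
  have cont: "continuous_on {0..T} (\<lambda>t. S' t (fst z) (snd z))" "continuous_on {0..T} (\<lambda>t. S t (fst z) (snd z))"
    if "z \<in> space (M \<Otimes>\<^sub>M N)" for z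
  proof -
    have z: "fst z \<in> space M" "snd z \<in> space N" using that by (auto simp: space_pair_measure)
    show "continuous_on {0..T} (\<lambda>t. S' t (fst z) (snd z))" "continuous_on {0..T} (\<lambda>t. S t (fst z) (snd z))"
      using cadaptedD(1)[OF vito_cadapted[OF S'v]] cadaptedD(1)[OF vito_cadapted[OF S_vito]] z by blast+
  qed
  have [measurable]: "(\<lambda>z. supn T (\<lambda>t. S' t (fst z) (snd z))) \<in> borel_measurable (M \<Otimes>\<^sub>M N)"
    by (rule supn_measurable[OF cont(1)]) (use S'm in simp_all)
  have [measurable]: "(\<lambda>z. supn T (\<lambda>t. S t (fst z) (snd z) - S' t (fst z) (snd z))) \<in> borel_measurable (M \<Otimes>\<^sub>M N)"
  proof (rule supn_measurable)
    show "continuous_on {0..T} (\<lambda>t. S t (fst z) (snd z) - S' t (fst z) (snd z))" if "z \<in> space (M \<Otimes>\<^sub>M N)" for z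
      by (intro continuous_on_diff cont that)
    fix t assume t: "t \<in> {0..T}"
    note [measurable] = S_meas[of t] S'm[of t]
    show "(\<lambda>z. S t (fst z) (snd z) - S' t (fst z) (snd z)) \<in> borel_measurable (M \<Otimes>\<^sub>M N)"
      using t by (intro borel_measurable_diff S_meas S'm) simp_all
  qed
  note [measurable] = supn_S_measurable
  have trm [measurable]: "(\<lambda>z. qv T (\<lambda>k s. trunc \<delta> k s (fst z) (snd z))) \<in> borel_measurable (M \<Otimes>\<^sub>M N)"
    by (rule predX_qv[OF trunc_predX])
  have nrm [measurable]: "(\<lambda>z. nrm T (\<lambda>k s. trunc \<delta> k s (fst z) (snd z))) \<in> borel_measurable (M \<Otimes>\<^sub>M N)"
    unfolding nrm_def by measurable
  have [measurable]: "phi N K T \<in> borel_measurable M"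
    by (rule measurable_F_M[OF phi_measurable[OF T_nonneg order_refl] T_nonneg])
  have [measurable]: "(\<lambda>z. nrm T (\<lambda>k s. trunc \<delta> k s (snd z) (fst z))) \<in> borel_measurable (N \<Otimes>\<^sub>M M)"
    using measurable_compose[OF measurable_pair_swap'[of N M] nrm] by (simp add: case_prod_beta')
  have ES: "(\<integral>\<^sup>+\<omega>. (\<integral>\<^sup>+x. supn T (\<lambda>t. S' t \<omega> x) \<partial>N) \<partial>M) \<le> 10 * ennreal \<delta>"
  proof -
    have "(\<integral>\<^sup>+\<omega>. (\<integral>\<^sup>+x. supn T (\<lambda>t. S' t \<omega> x) \<partial>N) \<partial>M) = (\<integral>\<^sup>+x. (\<integral>\<^sup>+\<omega>. supn T (\<lambda>t. S' t \<omega> x) \<partial>M) \<partial>N)"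
      by (rule MN.Fubini'[symmetric]) measurable
    also have "\<dots> \<le> (\<integral>\<^sup>+x. 10 * (\<integral>\<^sup>+\<omega>. ennreal (nrm T (\<lambda>k s. trunc \<delta> k s \<omega> x)) \<partial>M) \<partial>N)"
    proof (intro nn_integral_mono vito_L1[OF S'v])
      fix x assume x: "x \<in> space N"
      show "(\<lambda>\<omega>. nrm T (\<lambda>k s. trunc \<delta> k s \<omega> x)) \<in> borel_measurable M"
        using measurable_compose[OF measurable_Pair2'[OF x] nrm] by simp
      show "qv T (\<lambda>k s. trunc \<delta> k s \<omega> x) = ennreal ((nrm T (\<lambda>k s. trunc \<delta> k s \<omega> x))\<^sup>2)" if "\<omega> \<in> space M" for \<omega>
        by (rule nrm_square[OF trunc_qv_fin[OF that x], symmetric])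
    qed simp_all
    also have "\<dots> = 10 * (\<integral>\<^sup>+x. (\<integral>\<^sup>+\<omega>. ennreal (nrm T (\<lambda>k s. trunc \<delta> k s \<omega> x)) \<partial>M) \<partial>N)"
      by (rule nn_integral_cmult) measurable
    also have "(\<integral>\<^sup>+x. (\<integral>\<^sup>+\<omega>. ennreal (nrm T (\<lambda>k s. trunc \<delta> k s \<omega> x)) \<partial>M) \<partial>N) = (\<integral>\<^sup>+\<omega>. phi N (trunc \<delta>) T \<omega> \<partial>M)"
      unfolding phi_def by (rule MN.Fubini') measurable
    also have "\<dots> \<le> (\<integral>\<^sup>+\<omega>. ennreal \<delta> \<partial>M)" by (intro nn_integral_mono trunc_phi_le \<delta>)
    finally show ?thesis by (simp add: emeasure_space_1 mult_left_mono)
  qed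
  \<comment> \<open>Locality gives a null event for each x separately. Joint measurability of the
    supremum of the difference permits the exchange of the two quantifiers, after which the
    integrals over x can be compared at fixed \<omega>.\<close>
  have "AE x in N. AE \<omega> in M. phi N K T \<omega> \<le> ennreal \<delta> \<longrightarrow> supn T (\<lambda>t. S t \<omega> x - S' t \<omega> x) = 0"
  proof (rule AE_I2)
    fix x assume x: "x \<in> space N"
    show "AE \<omega> in M. phi N K T \<omega> \<le> ennreal \<delta> \<longrightarrow> supn T (\<lambda>t. S t \<omega> x - S' t \<omega> x) = 0"
      using vito_local_diff[OF S_vito[OF x] S'v[OF x]] AE_space
    proof eventually_elim
      case (elim \<omega>)
      show ?case
      proof
        assume p: "phi N K T \<omega> \<le> ennreal \<delta>"
        have "qv T (\<lambda>k s. K k s \<omega> x - trunc \<delta> k s \<omega> x) = qv T (\<lambda>k s. 0)"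
        proof (rule qv_cong)
          fix k s assume "0 < s" "s \<le> T"
          then have "phi N K s \<omega> \<le> ennreal \<delta>" using phi_mono[OF elim(2), of s T] p by simp
          then show "K k s \<omega> x - trunc \<delta> k s \<omega> x = 0" by (simp add: trunc_def)
        qed
        then show "supn T (\<lambda>t. S t \<omega> x - S' t \<omega> x) = 0" using elim(1) by simp
      qed
    qed
  qed
  then have AE: "AE \<omega> in M. AE x in N. phi N K T \<omega> \<le> ennreal \<delta> \<longrightarrow> supn T (\<lambda>t. S t \<omega> x - S' t \<omega> x) = 0"
    by (subst MN.AE_commute) measurable
  have [measurable]: "(\<lambda>\<omega>. \<integral>\<^sup>+x. supn T (\<lambda>t. S t \<omega> x) \<partial>N) \<in> borel_measurable M"
    "(\<lambda>\<omega>. \<integral>\<^sup>+x. supn T (\<lambda>t. S' t \<omega> x) \<partial>N) \<in> borel_measurable M" by measurable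
  let ?B = "{\<omega> \<in> space M. ennreal e < (\<integral>\<^sup>+x. supn T (\<lambda>t. S t \<omega> x) \<partial>N) \<and> phi N K T \<omega> \<le> ennreal \<delta>}"
  have "ennreal e * emeasure M ?B = (\<integral>\<^sup>+\<omega>. ennreal e * indicator ?B \<omega> \<partial>M)"
    by (subst nn_integral_cmult) simp_all
  also have "\<dots> \<le> (\<integral>\<^sup>+\<omega>. (\<integral>\<^sup>+x. supn T (\<lambda>t. S' t \<omega> x) \<partial>N) \<partial>M)"
  proof (rule nn_integral_mono_AE)
    show "AE \<omega> in M. ennreal e * indicator ?B \<omega> \<le> (\<integral>\<^sup>+x. supn T (\<lambda>t. S' t \<omega> x) \<partial>N)"
      using AE
    proof eventually_elim
      case (elim \<omega>)
      show ?case
      proof (cases "\<omega> \<in> ?B")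
        case True
        then have p: "phi N K T \<omega> \<le> ennreal \<delta>" and l: "ennreal e < (\<integral>\<^sup>+x. supn T (\<lambda>t. S t \<omega> x) \<partial>N)" by simp_all
        have "(\<integral>\<^sup>+x. supn T (\<lambda>t. S t \<omega> x) \<partial>N) = (\<integral>\<^sup>+x. supn T (\<lambda>t. S' t \<omega> x) \<partial>N)"
        proof (rule nn_integral_cong_AE)
          show "AE x in N. supn T (\<lambda>t. S t \<omega> x) = supn T (\<lambda>t. S' t \<omega> x)"
            using elim
          proof eventually_elim
            case (elim x)
            then have "\<forall>t\<in>{0..T}. S t \<omega> x - S' t \<omega> x = 0" using p T_nonneg by (simp add: supn_eq_0)
            then show ?case by (intro supn_cong) simp
          qed
        qed
        then show ?thesis using True l by (simp add: less_imp_le)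
      qed simp
    qed
  qed
  also have "\<dots> \<le> 10 * ennreal \<delta>" by (rule ES)
  finally show ?thesis .
qed

text \<open>Fix \<delta> = n and let the level in \<open>integral_supn_maximal\<close> tend to
  infinity: an infinite integral has probability 0 on each event \<open>phi \<le> n\<close>, and
  these events cover the space because \<open>phi\<close> is finite.\<close>

lemma integral_supn_finite: "AE \<omega> in M. (\<integral>\<^sup>+x. supn T (\<lambda>t. S t \<omega> x) \<partial>N) < \<infinity>"
proof -
  interpret N: sigma_finite_measure N by (rule N)
  note [measurable] = supn_S_measurable
  have [measurable]: "(\<lambda>\<omega>. \<integral>\<^sup>+x. supn T (\<lambda>t. S t \<omega> x) \<partial>N) \<in> borel_measurable M" by measurable
  have [measurable]: "phi N K T \<in> borel_measurable M"
    by (rule measurable_F_M[OF phi_measurable[OF T_nonneg order_refl] T_nonneg])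
  have zero: "emeasure M {\<omega> \<in> space M. (\<integral>\<^sup>+x. supn T (\<lambda>t. S t \<omega> x) \<partial>N) = \<infinity> \<and> phi N K T \<omega> \<le> ennreal (real n)} = 0"
    (is "emeasure M ?B = 0") for n
  proof -
    have le: "ennreal (real m) * emeasure M ?B \<le> 10 * ennreal (real n)" for m
    proof -
      have "ennreal (real m) * emeasure M ?B \<le> ennreal (real m) * emeasure M {\<omega> \<in> space M. ennreal (real m) < (\<integral>\<^sup>+x. supn T (\<lambda>t. S t \<omega> x) \<partial>N) \<and> phi N K T \<omega> \<le> ennreal (real n)}"
        by (intro mult_left_mono emeasure_mono) auto
      also have "\<dots> \<le> 10 * ennreal (real n)" by (rule integral_supn_maximal) simp_all
      finally show ?thesis .
    qed
    have le': "real m * measure M ?B \<le> 10 * real n" for m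
      using le[of m] by (simp add: emeasure_eq_measure numeral_mult_ennreal ennreal_mult[symmetric] ennreal_le_iff)
    have "measure M ?B \<le> 0"
    proof (rule ccontr)
      assume "\<not> measure M ?B \<le> 0"
      then obtain m where "10 * real n < real m * measure M ?B"
        using ex_less_of_nat_mult[of "measure M ?B" "10 * real n"] by auto
      then show False using le'[of m] by simp
    qed
    then show ?thesis by (simp add: emeasure_eq_measure measure_le_0_iff)
  qed
  have "AE \<omega> in M. \<forall>n. \<not> ((\<integral>\<^sup>+x. supn T (\<lambda>t. S t \<omega> x) \<partial>N) = \<infinity> \<and> phi N K T \<omega> \<le> ennreal (real n))"
  proof (subst AE_all_countable, rule allI)
    fix n
    have "AE \<omega> in M. \<omega> \<notin> {\<omega> \<in> space M. (\<integral>\<^sup>+x. supn T (\<lambda>t. S t \<omega> x) \<partial>N) = \<infinity> \<and> phi N K T \<omega> \<le> ennreal (real n)}"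
      using zero[of n] by (intro AE_not_in) (simp add: null_sets_def)
    then show "AE \<omega> in M. \<not> ((\<integral>\<^sup>+x. supn T (\<lambda>t. S t \<omega> x) \<partial>N) = \<infinity> \<and> phi N K T \<omega> \<le> ennreal (real n))"
      using AE_space by eventually_elim simp
  qed
  then show ?thesis
    using AE_space
  proof eventually_elim
    case (elim \<omega>)
    obtain n where "phi N K T \<omega> < of_nat n" using ennreal_Ex_less_of_nat[of "phi N K T \<omega>"] phi_fin[OF elim(2)] by auto
    then have "phi N K T \<omega> \<le> ennreal (real n)" by (simp add: ennreal_of_nat_eq_real_of_nat less_imp_le)
    then show ?case using elim(1) by (auto simp: less_top)
  qed
qed

end

end

end

section \<open>Stochastic Fubini theorem\<close>

text \<open>Holds for every \<open>f\<close>: a nonintegrable function has Bochner integral 0. This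
  lets \<open>mean_qv_le\<close> include times at which the mean over x does not exist.\<close>

lemma ennreal_abs_integral_le:
  fixes f :: "'b \<Rightarrow> real"
  shows "ennreal \<bar>\<integral>x. f x \<partial>N\<bar> \<le> (\<integral>\<^sup>+x. ennreal \<bar>f x\<bar> \<partial>N)"
proof (cases "integrable N f")
  case True
  then show ?thesis using integral_norm_bound_ennreal[of N f] by simp
qed (simp add: not_integrable_integral_eq)

context
  fixes N :: "'x measure" and p :: "nat \<Rightarrow> real \<Rightarrow> 'x \<Rightarrow> real" and T :: real
  assumes N: "sigma_finite_measure N"
    and m: "\<And>k. (\<lambda>z. p k (fst z) (snd z)) \<in> borel_measurable (borel \<Otimes>\<^sub>M N)"
    and fin: "\<And>x. x \<in> space N \<Longrightarrow> qv T (\<lambda>k s. p k s x) < \<infinity>"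
begin

lemma nn_mean_measurable: "(\<lambda>s. \<integral>\<^sup>+x. ennreal \<bar>p k s x\<bar> \<partial>N) \<in> borel_measurable borel"
proof -
  interpret N: sigma_finite_measure N by (rule N)
  note [measurable] = m[of k]
  have "(\<lambda>s. \<integral>\<^sup>+x. (\<lambda>z. ennreal \<bar>p k (fst z) (snd z)\<bar>) (s, x) \<partial>N) \<in> borel_measurable borel" by measurable
  then show ?thesis by simp
qed

lemma mean_qv_le: "qv T (\<lambda>k s. \<integral>x. p k s x \<partial>N) \<le> (\<integral>\<^sup>+x. ennreal (nrm T (\<lambda>k s. p k s x)) \<partial>N)\<^sup>2"
proof -
  have "qv T (\<lambda>k s. \<integral>x. p k s x \<partial>N) \<le> (\<Sum>k. \<integral>\<^sup>+s. (\<integral>\<^sup>+x. ennreal \<bar>p k s x\<bar> \<partial>N)\<^sup>2 * indicator {0<..T} s \<partial>lborel)"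
    unfolding qv_def
  proof (intro suminf_le nn_integral_mono mult_right_mono)
    fix k s
    have "(ennreal \<bar>\<integral>x. p k s x \<partial>N\<bar>)\<^sup>2 \<le> (\<integral>\<^sup>+x. ennreal \<bar>p k s x\<bar> \<partial>N)\<^sup>2"
      by (intro power_mono ennreal_abs_integral_le) simp
    then show "ennreal ((\<integral>x. p k s x \<partial>N)\<^sup>2) \<le> (\<integral>\<^sup>+x. ennreal \<bar>p k s x\<bar> \<partial>N)\<^sup>2"
      by (simp add: ennreal_power)
  qed simp_all
  also have "\<dots> \<le> (\<integral>\<^sup>+x. ennreal (nrm T (\<lambda>k s. p k s x)) \<partial>N)\<^sup>2"
    by (rule minkowski_qv[OF N m fin])
  finally show ?thesis .
qed

text \<open>By \<open>minkowski_qv\<close> the square of the integral of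
  \<open>\<bar>p k s x\<bar>\<close> over x is integrable in time, hence finite for almost every
  s.\<close>

lemma mean_integrable_AE:
  assumes "(\<integral>\<^sup>+x. ennreal (nrm T (\<lambda>k s. p k s x)) \<partial>N) < \<infinity>"
  shows "AE s in lborel. s \<in> {0<..T} \<longrightarrow> integrable N (p k s)"
proof -
  have le: "(\<Sum>k. \<integral>\<^sup>+s. (\<integral>\<^sup>+x. ennreal \<bar>p k s x\<bar> \<partial>N)\<^sup>2 * indicator {0<..T} s \<partial>lborel) < \<infinity>"
    by (rule le_less_trans[OF minkowski_qv[OF N m fin]]) (use assms in \<open>simp_all add: less_top[symmetric] power_eq_top_ennreal\<close>)
  note [measurable] = nn_mean_measurable[of k]
  have "(\<integral>\<^sup>+s. (\<integral>\<^sup>+x. ennreal \<bar>p k s x\<bar> \<partial>N)\<^sup>2 * indicator {0<..T} s \<partial>lborel) < \<infinity>"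
    using sum_le_suminf[of "\<lambda>k. \<integral>\<^sup>+s. (\<integral>\<^sup>+x. ennreal \<bar>p k s x\<bar> \<partial>N)\<^sup>2 * indicator {0<..T} s \<partial>lborel" "{k}"] le
    by (simp add: le_less_trans)
  then have "AE s in lborel. (\<integral>\<^sup>+x. ennreal \<bar>p k s x\<bar> \<partial>N)\<^sup>2 * indicator {0<..T} s \<noteq> \<infinity>"
    by (intro nn_integral_PInf_AE) simp_all
  then show ?thesis
  proof eventually_elim
    case (elim s)
    have [measurable]: "p k s \<in> borel_measurable N"
      using measurable_compose[OF measurable_Pair1'[of s borel N] m[of k]] by simp
    show ?case
    proof
      assume "s \<in> {0<..T}"
      with elim have "(\<integral>\<^sup>+x. ennreal \<bar>p k s x\<bar> \<partial>N) < \<infinity>" by (simp add: less_top[symmetric] power_eq_top_ennreal)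
      then show "integrable N (p k s)" by (intro integrableI_bounded) simp_all
    qed
  qed
qed

end

section \<open>Means over the parameter and the exchange of integrals\<close>

context wiener_system
begin

lemma predX_mean:
  assumes N: "sigma_finite_measure N" and K: "predX N K"
  shows "pred1 (\<lambda>k s \<omega>. \<integral>x. K k s \<omega> x \<partial>N)"
proof -
  interpret N: sigma_finite_measure N by (rule N)
  show ?thesis
    unfolding pred1_def
  proof (intro conjI allI impI)
    fix k
    have "(\<lambda>z. \<integral>x. K k (snd z) (fst z) x \<partial>N) \<in> borel_measurable (\<P>)"
      using K unfolding predX_def by (intro N.borel_measurable_lebesgue_integral) (simp add: case_prod_beta')
    then show "(\<lambda>(\<omega>, s). \<integral>x. K k s \<omega> x \<partial>N) \<in> borel_measurable (\<P>)"
      by (simp add: case_prod_beta')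
  next
    fix k s \<omega> assume "s \<notin> {0<..T}"
    then have "K k s \<omega> = (\<lambda>x. 0)" using K unfolding predX_def by blast
    then show "(\<integral>x. K k s \<omega> x \<partial>N) = 0" by simp
  qed
qed

lemma coef_bdd: "\<bar>coef n K k i \<omega> x\<bar> \<le> real n"
  by (simp add: coef_def clamp_bdd)

context
  fixes N :: "'x measure" and K :: "nat \<Rightarrow> real \<Rightarrow> 'a \<Rightarrow> 'x \<Rightarrow> real"
  assumes N: "finite_measure N" and K: "predX N K"
    and fin: "\<And>\<omega> x. \<omega> \<in> space M \<Longrightarrow> x \<in> space N \<Longrightarrow> qv T (\<lambda>k s. K k s \<omega> x) < \<infinity>"
    and phi_fin: "\<And>\<omega>. \<omega> \<in> space M \<Longrightarrow> phi N K T \<omega> < \<infinity>"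
begin

lemma mean_qv_fin: "\<omega> \<in> space M \<Longrightarrow> qv T (\<lambda>k s. \<integral>x. K k s \<omega> x \<partial>N) < \<infinity>"
  by (rule le_less_trans[OF mean_qv_le[OF finite_measure.axioms(1)[OF N] predX_section[OF K] fin]])
    (use phi_fin[of \<omega>] in \<open>simp_all add: phi_def less_top[symmetric] power_eq_top_ennreal\<close>)

lemma coef_integrable:
  assumes "0 < n" "i \<le> n" "\<omega> \<in> space M"
  shows "integrable N (coef n K k i \<omega>)"
proof -
  interpret N: finite_measure N by (rule N)
  have "coef n K k i \<omega> \<in> borel_measurable N"
    using measurable_compose[OF measurable_Pair1'[OF assms(3)] coef_measurable[OF K assms(1,2)]] by simp
  then show ?thesis
    by (intro N.integrable_const_bound[where B = "real n"]) (simp_all add: coef_bdd)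
qed

lemma appr_integrable:
  assumes n: "0 < n" and \<omega>: "\<omega> \<in> space M"
  shows "integrable N (\<lambda>x. appr T n (\<lambda>k s. K k s \<omega> x) k s)"
    and "(\<integral>x. appr T n (\<lambda>k s. K k s \<omega> x) k s \<partial>N) = (\<Sum>(k', i)\<in>{..<n} \<times> {..<n}.
      if k = k' then (\<integral>x. coef n K k' i \<omega> x \<partial>N) * indicator {T * real i / real n<..T * real (Suc i) / real n} s else 0)" (is "?L = ?R")
proof -
  have 1: "integrable N (\<lambda>x. case p of (k', i) \<Rightarrow> if k = k' then coef n K k' i \<omega> x * indicator {T * real i / real n<..T * real (Suc i) / real n} s else 0)"
    if "p \<in> {..<n} \<times> {..<n}" for p
  proof -
    have "integrable N (coef n K (fst p) (snd p) \<omega>)" using that by (intro coef_integrable n \<omega>) auto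
    then show ?thesis by (cases "k = fst p") (simp_all add: case_prod_beta' del: of_nat_Suc)
  qed
  show "integrable N (\<lambda>x. appr T n (\<lambda>k s. K k s \<omega> x) k s)"
    unfolding appr_coef by (intro Bochner_Integration.integrable_sum 1)
  have "(\<integral>x. appr T n (\<lambda>k s. K k s \<omega> x) k s \<partial>N) = (\<Sum>p\<in>{..<n} \<times> {..<n}.
      \<integral>x. (case p of (k', i) \<Rightarrow> if k = k' then coef n K k' i \<omega> x * indicator {T * real i / real n<..T * real (Suc i) / real n} s else 0) \<partial>N)"
    unfolding appr_coef by (intro Bochner_Integration.integral_sum 1)
  also have "\<dots> = ?R"
    by (intro sum.cong) (auto simp del: of_nat_Suc)
  finally show "?L = ?R" .
qed

lemma appx_integrable:
  assumes n: "0 < n" and \<omega>: "\<omega> \<in> space M"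
  shows "integrable N (appx n K t \<omega>)"
    and "(\<integral>x. appx n K t \<omega> x \<partial>N) = (\<Sum>k<n. \<Sum>i<n. (\<integral>x. coef n K k i \<omega> x \<partial>N) *
      (W k (min t (T * real (Suc i) / real n)) \<omega> - W k (min t (T * real i / real n)) \<omega>))"
proof -
  have 1: "integrable N (\<lambda>x. coef n K k i \<omega> x * c)" if "i < n" for k i c
    using coef_integrable[OF n _ \<omega>, of i k] that by simp
  show "integrable N (appx n K t \<omega>)"
    unfolding appx_def by (intro Bochner_Integration.integrable_sum 1) simp
  show "(\<integral>x. appx n K t \<omega> x \<partial>N) = (\<Sum>k<n. \<Sum>i<n. (\<integral>x. coef n K k i \<omega> x \<partial>N) *
      (W k (min t (T * real (Suc i) / real n)) \<omega> - W k (min t (T * real i / real n)) \<omega>))"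
    unfolding appx_def
    by (subst Bochner_Integration.integral_sum, intro Bochner_Integration.integrable_sum 1, simp, rule sum.cong, simp,
        subst Bochner_Integration.integral_sum, rule 1, simp, simp)
qed

text \<open>The Fubini identity for step functions: the parameter occurs only in the coefficients of
  a finite sum. Their means are bounded since the measure is finite, and remain adapted because the
  coefficients are jointly measurable.\<close>

lemma mean_appx_elem:
  assumes n: "0 < n"
  shows "\<exists>f I. elem f I \<and> (\<forall>\<omega>\<in>space M. \<forall>k s. f k s \<omega> = (\<integral>x. appr T n (\<lambda>k s. K k s \<omega> x) k s \<partial>N)) \<and>
    (\<forall>\<omega>\<in>space M. \<forall>t. I t \<omega> = (\<integral>x. appx n K t \<omega> x \<partial>N))"
proof -
  interpret N: finite_measure N by (rule N)
  let ?c = "\<lambda>p \<omega>. \<integral>x. coef n K (fst p) (snd p) \<omega> x \<partial>N"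
  let ?f = "\<lambda>p k s \<omega>. if k = fst p then ?c p \<omega> * indicator {T * real (snd p) / real n<..T * real (Suc (snd p)) / real n} s else 0"
  let ?I = "\<lambda>p t \<omega>. ?c p \<omega> * (W (fst p) (min t (T * real (Suc (snd p)) / real n)) \<omega> - W (fst p) (min t (T * real (snd p) / real n)) \<omega>)"
  have "elem (\<lambda>k s \<omega>. \<Sum>p\<in>{..<n} \<times> {..<n}. ?f p k s \<omega>) (\<lambda>t \<omega>. \<Sum>p\<in>{..<n} \<times> {..<n}. ?I p t \<omega>)"
  proof (rule elem_sum)
    fix p assume "p \<in> {..<n} \<times> {..<n}"
    then have i: "snd p \<le> n" "Suc (snd p) \<le> n" by auto
    show "elem (?f p) (?I p)"
    proof (rule elem_single)
      show "0 \<le> T * real (snd p) / real n" "T * real (Suc (snd p)) / real n \<le> T"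
        using grid_bounds[OF n i(1)] grid_bounds[OF n i(2)] by simp_all
      show "T * real (snd p) / real n \<le> T * real (Suc (snd p)) / real n"
        using T_nonneg by (intro divide_right_mono mult_left_mono) simp_all
      show "?c p \<in> borel_measurable (\<F> (T * real (snd p) / real n))"
        using coef_adapted[OF K n i(1), of "fst p"]
        by (intro N.borel_measurable_lebesgue_integral) (simp add: case_prod_beta')
      show "\<bar>?c p \<omega>\<bar> \<le> real n * measure N (space N)" if "\<omega> \<in> space M" for \<omega>
      proof -
        have "\<bar>?c p \<omega>\<bar> \<le> (\<integral>x. \<bar>coef n K (fst p) (snd p) \<omega> x\<bar> \<partial>N)" by (rule integral_abs_bound)
        also have "\<dots> \<le> (\<integral>x. real n \<partial>N)"
          using coef_integrable[OF n i(1) that] by (intro integral_mono coef_bdd) simp_all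
        finally show ?thesis by (simp add: mult.commute)
      qed
    qed
  qed simp
  then show ?thesis
    by (intro exI conjI)
      (assumption, simp_all add: appr_integrable(2)[OF n] appx_integrable(2)[OF n] sum.cartesian_product case_prod_beta')
qed

definition err :: "nat \<Rightarrow> nat \<Rightarrow> real \<Rightarrow> 'a \<Rightarrow> 'x \<Rightarrow> real" where
  "err n k s \<omega> x = appr T (Suc n) (\<lambda>k s. K k s \<omega> x) k s - K k s \<omega> x"

lemma err_predX: "predX N (err n)"
  using predX_diff[OF predX_appr[OF K, of "Suc n"] K] by (simp add: err_def[abs_def])

lemma err_qv_le: "\<omega> \<in> space M \<Longrightarrow> x \<in> space N \<Longrightarrow> qv T (\<lambda>k s. err n k s \<omega> x) \<le> 4 * qv T (\<lambda>k s. K k s \<omega> x)"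
  using apperr_le[OF K, of "Suc n" \<omega> x] by (simp add: apperr_def err_def)

lemma err_qv_fin: "\<omega> \<in> space M \<Longrightarrow> x \<in> space N \<Longrightarrow> qv T (\<lambda>k s. err n k s \<omega> x) < \<infinity>"
  by (rule le_less_trans[OF err_qv_le]) (use fin[of \<omega> x] in \<open>simp_all add: ennreal_mult_less_top\<close>)

lemma err_nrm_le:
  assumes "\<omega> \<in> space M" "x \<in> space N"
  shows "nrm T (\<lambda>k s. err n k s \<omega> x) \<le> 2 * nrm T (\<lambda>k s. K k s \<omega> x)"
proof -
  have "enn2real (qv T (\<lambda>k s. err n k s \<omega> x)) \<le> enn2real (4 * qv T (\<lambda>k s. K k s \<omega> x))"
    using fin[OF assms] by (intro enn2real_mono err_qv_le assms) (simp add: ennreal_mult_less_top)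
  also have "\<dots> = 4 * enn2real (qv T (\<lambda>k s. K k s \<omega> x))" by (simp add: enn2real_mult)
  finally have "nrm T (\<lambda>k s. err n k s \<omega> x) \<le> sqrt (4 * enn2real (qv T (\<lambda>k s. K k s \<omega> x)))"
    unfolding nrm_def by simp
  then show ?thesis by (simp add: nrm_def real_sqrt_mult)
qed

lemma err_phi_fin:
  assumes \<omega>: "\<omega> \<in> space M"
  shows "phi N (err n) T \<omega> < \<infinity>"
proof -
  note [measurable] = nrm_section[OF finite_measure.axioms(1)[OF N] K fin phi_fin \<omega>, of T]
  have "phi N (err n) T \<omega> \<le> (\<integral>\<^sup>+x. 2 * ennreal (nrm T (\<lambda>k s. K k s \<omega> x)) \<partial>N)"
    unfolding phi_def by (intro nn_integral_mono) (simp add: numeral_mult_ennreal ennreal_leI err_nrm_le[OF \<omega>])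
  also have "\<dots> = 2 * phi N K T \<omega>" unfolding phi_def by (intro nn_integral_cmult) measurable
  also have "\<dots> < \<infinity>" using phi_fin[OF \<omega>] by (simp add: ennreal_mult_less_top)
  finally show ?thesis .
qed

lemma err_phi_tendsto:
  assumes \<omega>: "\<omega> \<in> space M"
  shows "(\<lambda>n. phi N (err n) T \<omega>) \<longlonglongrightarrow> 0"
proof -
  note [measurable] = nrm_section[OF finite_measure.axioms(1)[OF N] K fin phi_fin \<omega>, of T]
  have [measurable]: "(\<lambda>x. nrm T (\<lambda>k s. err n k s \<omega> x)) \<in> borel_measurable N" for n
    by (rule nrm_section[OF finite_measure.axioms(1)[OF N] err_predX err_qv_fin err_phi_fin \<omega>])
  have "(\<lambda>n. \<integral>\<^sup>+x. ennreal (nrm T (\<lambda>k s. err n k s \<omega> x)) \<partial>N) \<longlonglongrightarrow> (\<integral>\<^sup>+x. 0 \<partial>N)"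
  proof (rule nn_integral_dominated_convergence[where w = "\<lambda>x. 2 * ennreal (nrm T (\<lambda>k s. K k s \<omega> x))"])
    have "(\<integral>\<^sup>+x. 2 * ennreal (nrm T (\<lambda>k s. K k s \<omega> x)) \<partial>N) = 2 * phi N K T \<omega>"
      unfolding phi_def by (intro nn_integral_cmult) measurable
    then show "(\<integral>\<^sup>+x. 2 * ennreal (nrm T (\<lambda>k s. K k s \<omega> x)) \<partial>N) < \<infinity>"
      using phi_fin[OF \<omega>] by (simp add: ennreal_mult_less_top)
    show "AE x in N. (\<lambda>n. ennreal (nrm T (\<lambda>k s. err n k s \<omega> x))) \<longlonglongrightarrow> 0"
    proof (rule AE_I2)
      fix x assume x: "x \<in> space N"
      have "(\<lambda>n. qv T (\<lambda>k s. err n k s \<omega> x)) \<longlonglongrightarrow> ennreal 0"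
        using apperr_tendsto[OF K \<omega> x fin[OF \<omega> x]] by (simp add: apperr_def err_def)
      then have "(\<lambda>n. enn2real (qv T (\<lambda>k s. err n k s \<omega> x))) \<longlonglongrightarrow> 0" by (rule tendsto_enn2real) simp
      from tendsto_real_sqrt[OF this] have "(\<lambda>n. nrm T (\<lambda>k s. err n k s \<omega> x)) \<longlonglongrightarrow> 0" by (simp add: nrm_def)
      from tendsto_ennrealI[OF this] show "(\<lambda>n. ennreal (nrm T (\<lambda>k s. err n k s \<omega> x))) \<longlonglongrightarrow> 0" by simp
    qed
  qed (auto simp: numeral_mult_ennreal intro!: AE_I2 ennreal_leI err_nrm_le[OF \<omega>])
  then show ?thesis by (simp add: phi_def)
qed

lemma err_phi_measurable: "phi N (err n) T \<in> borel_measurable M"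
  by (rule measurable_F_M[OF phi_measurable[OF finite_measure.axioms(1)[OF N] err_predX err_qv_fin err_phi_fin T_nonneg order_refl] T_nonneg])

lemma err_phi_psize: "(\<lambda>n. psize (phi N (err n) T)) \<longlonglongrightarrow> 0"
  by (rule psize_tendsto_0_AE[OF err_phi_measurable AE_I2]) (rule err_phi_tendsto)

lemma err_mean_qv_le:
  assumes \<omega>: "\<omega> \<in> space M"
  shows "qv T (\<lambda>k s. (\<integral>x. appr T (Suc n) (\<lambda>k s. K k s \<omega> x) k s \<partial>N) - (\<integral>x. K k s \<omega> x \<partial>N)) \<le> (phi N (err n) T \<omega>)\<^sup>2"
proof -
  have "qv T (\<lambda>k s. (\<integral>x. appr T (Suc n) (\<lambda>k s. K k s \<omega> x) k s \<partial>N) - (\<integral>x. K k s \<omega> x \<partial>N))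
      = qv T (\<lambda>k s. \<integral>x. err n k s \<omega> x \<partial>N)"
    unfolding qv_def
  proof (intro arg_cong[where f = suminf] ext nn_integral_cong_AE)
    fix k
    \<comment> \<open>The difference of two means is the mean of the difference only if both
      functions are integrable. The approximant always is; \<open>K\<close> is for almost every
      time, which suffices under the time integral.\<close>
    have "AE s in lborel. s \<in> {0<..T} \<longrightarrow> integrable N (K k s \<omega>)"
      by (rule mean_integrable_AE[OF finite_measure.axioms(1)[OF N] predX_section[OF K \<omega>] fin[OF \<omega>]])
        (assumption, rule phi_fin[OF \<omega>, unfolded phi_def])
    then show "AE s in lborel. ennreal (((\<integral>x. appr T (Suc n) (\<lambda>k s. K k s \<omega> x) k s \<partial>N) - (\<integral>x. K k s \<omega> x \<partial>N))\<^sup>2) * indicator {0<..T} s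
      = ennreal ((\<integral>x. err n k s \<omega> x \<partial>N)\<^sup>2) * indicator {0<..T} s"
    proof eventually_elim
      case (elim s)
      then show ?case
        by (cases "s \<in> {0<..T}") (simp_all add: err_def Bochner_Integration.integral_diff[OF appr_integrable(1)[OF _ \<omega>]])
    qed
  qed
  also have "\<dots> \<le> (phi N (err n) T \<omega>)\<^sup>2"
    unfolding phi_def by (rule mean_qv_le[OF finite_measure.axioms(1)[OF N] predX_section[OF err_predX \<omega>] err_qv_fin[OF \<omega>]])
  finally show ?thesis .
qed

context
  fixes S :: "real \<Rightarrow> 'a \<Rightarrow> 'x \<Rightarrow> real"
  assumes S_meas: "\<And>t. 0 \<le> t \<Longrightarrow> t \<le> T \<Longrightarrow> (\<lambda>z. S t (fst z) (snd z)) \<in> borel_measurable (M \<Otimes>\<^sub>M N)"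
    and S_vito: "\<And>x. x \<in> space N \<Longrightarrow> vito (\<lambda>k s \<omega>. K k s \<omega> x) (\<lambda>t \<omega>. S t \<omega> x)"
begin

definition serr :: "nat \<Rightarrow> real \<Rightarrow> 'a \<Rightarrow> 'x \<Rightarrow> real" where
  "serr n t \<omega> x = appx (Suc n) K t \<omega> x - S t \<omega> x"

lemma serr_vito: "x \<in> space N \<Longrightarrow> vito (\<lambda>k s \<omega>. err n k s \<omega> x) (\<lambda>t \<omega>. serr n t \<omega> x)"
  using vito_diff[OF elem_vito[OF appx_elem[OF K zero_less_Suc]] S_vito, of x x n]
  by (simp add: err_def[abs_def] serr_def[abs_def])

lemma serr_meas:
  assumes "0 \<le> t" "t \<le> T"
  shows "(\<lambda>z. serr n t (fst z) (snd z)) \<in> borel_measurable (M \<Otimes>\<^sub>M N)"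
proof -
  note [measurable] = appx_measurable[OF K zero_less_Suc assms(1), of n] S_meas[OF assms]
  show ?thesis unfolding serr_def by measurable
qed

lemma serr_supn_measurable: "(\<lambda>\<omega>. \<integral>\<^sup>+x. supn T (\<lambda>t. serr n t \<omega> x) \<partial>N) \<in> borel_measurable M"
proof -
  interpret N: finite_measure N by (rule N)
  note [measurable] = supn_S_measurable[OF finite_measure.axioms(1)[OF N] err_predX err_qv_fin err_phi_fin serr_meas serr_vito, of n]
  show ?thesis by measurable
qed

lemma serr_supn_psize: "(\<lambda>n. psize (\<lambda>\<omega>. \<integral>\<^sup>+x. supn T (\<lambda>t. serr n t \<omega> x) \<partial>N)) \<longlonglongrightarrow> 0"
proof -
  define Y where "Y n \<omega> = (\<integral>\<^sup>+x. supn T (\<lambda>t. serr n t \<omega> x) \<partial>N)" for n \<omega>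
  have [measurable]: "Y n \<in> borel_measurable M" for n
    unfolding Y_def[abs_def] by (rule serr_supn_measurable)
  note [measurable] = err_phi_measurable
  have "(\<lambda>n. psize (Y n)) \<longlonglongrightarrow> 0"
    unfolding ennreal_tendsto_0_iff
  proof (intro allI impI)
    fix e :: real assume "0 < e"
    define d where "d = e / 3"
    \<comment> \<open>With this choice the bound \<open>10 * c / d\<close> equals \<open>d\<close>.
      Three shares \<open>d\<close> make up \<open>e\<close>: the level, the event of a large
      supremum and the event of a large \<open>phi\<close>.\<close>
    define c where "c = d * d / 10"
    have d: "0 < d" and c: "0 < c" using \<open>0 < e\<close> by (simp_all add: d_def c_def)
    have "psize (Y n) \<le> ennreal (2 * d) + emeasure M {\<omega> \<in> space M. ennreal c < phi N (err n) T \<omega>}" for n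
    proof -
      let ?A = "{\<omega> \<in> space M. ennreal d < Y n \<omega> \<and> phi N (err n) T \<omega> \<le> ennreal c}"
      let ?B = "{\<omega> \<in> space M. ennreal c < phi N (err n) T \<omega>}"
      have "ennreal d * emeasure M ?A \<le> 10 * ennreal c"
        unfolding Y_def
        by (rule integral_supn_maximal[OF finite_measure.axioms(1)[OF N] err_predX err_qv_fin err_phi_fin serr_meas serr_vito]) (use d c in simp_all)
      then have "d * measure M ?A \<le> d * d"
        using d by (simp add: emeasure_eq_measure numeral_mult_ennreal ennreal_mult[symmetric] ennreal_le_iff c_def)
      then have A: "emeasure M ?A \<le> ennreal d"
        using d by (simp add: emeasure_eq_measure ennreal_le_iff)
      have "psize (Y n) \<le> ennreal d + emeasure M {\<omega> \<in> space M. ennreal d < Y n \<omega>}"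
        by (rule psize_le_prob) simp_all
      also have "emeasure M {\<omega> \<in> space M. ennreal d < Y n \<omega>} \<le> emeasure M (?A \<union> ?B)"
        by (intro emeasure_mono) (auto simp: not_le[symmetric])
      also have "\<dots> \<le> emeasure M ?A + emeasure M ?B" by (intro emeasure_subadditive) measurable
      also have "\<dots> \<le> ennreal d + emeasure M ?B" by (intro add_right_mono A)
      finally have "psize (Y n) \<le> ennreal d + (ennreal d + emeasure M ?B)" by (simp add: add_left_mono)
      also have "\<dots> = ennreal (2 * d) + emeasure M ?B" using d by (simp add: add.assoc[symmetric] ennreal_plus[symmetric] del: ennreal_plus)
      finally show ?thesis .
    qed
    moreover have "\<forall>\<^sub>F n in sequentially. emeasure M {\<omega> \<in> space M. ennreal c < phi N (err n) T \<omega>} \<le> ennreal d"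
      using psize_tendsto_prob[OF err_phi_measurable err_phi_psize c] d unfolding ennreal_tendsto_0_iff by blast
    ultimately show "\<forall>\<^sub>F n in sequentially. psize (Y n) \<le> ennreal e"
    proof (elim eventually_mono)
      fix n assume 1: "\<And>n. psize (Y n) \<le> ennreal (2 * d) + emeasure M {\<omega> \<in> space M. ennreal c < phi N (err n) T \<omega>}"
        and 2: "emeasure M {\<omega> \<in> space M. ennreal c < phi N (err n) T \<omega>} \<le> ennreal d"
      have "psize (Y n) \<le> ennreal (2 * d) + ennreal d" using 1[of n] add_left_mono[OF 2] by (rule order_trans)
      then show "psize (Y n) \<le> ennreal e" using d by (simp add: ennreal_plus[symmetric] d_def del: ennreal_plus)
    qed
  qed
  then show ?thesis by (simp add: Y_def[abs_def])
qed

text \<open>Squaring decreases numbers below 1, and larger ones are cut off at 1. It absorbs the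
  square that Minkowski's inequality leaves in \<open>err_mean_qv_le\<close>.\<close>

lemma psize_square_le: "psize (\<lambda>\<omega>. (Z \<omega>)\<^sup>2) \<le> psize Z"
  unfolding psize_def
proof (rule nn_integral_mono)
  fix \<omega>
  show "min 1 ((Z \<omega>)\<^sup>2) \<le> min 1 (Z \<omega>)"
  proof (cases "Z \<omega> \<le> 1")
    case True
    then have "Z \<omega> * Z \<omega> \<le> 1 * Z \<omega>" by (intro mult_right_mono) simp_all
    then show ?thesis by (auto simp: min_def power2_eq_square)
  qed (simp add: min_def)
qed

text \<open>\<open>J\<close> and the mean of \<open>S\<close> are both compared with
  \<open>I n\<close>, the mean of the n-th elementary integral: \<open>Z n\<close> bounds the first
  distance and \<open>Y n\<close> the second. Both are suprema over time, so the exceptional event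
  is the same for all \<open>t\<close>.\<close>

lemma stochastic_fubini:
  assumes J: "vito (\<lambda>k s \<omega>. \<integral>x. K k s \<omega> x \<partial>N) J"
  shows "AE \<omega> in M. \<forall>t\<in>{0..T}. integrable N (S t \<omega>) \<and> J t \<omega> = (\<integral>x. S t \<omega> x \<partial>N)"
proof -
  interpret N: finite_measure N by (rule N)
  define Y where "Y n \<omega> = (\<integral>\<^sup>+x. supn T (\<lambda>t. serr n t \<omega> x) \<partial>N)" for n \<omega>
  have Ym [measurable]: "Y n \<in> borel_measurable M" for n
    unfolding Y_def[abs_def] by (rule serr_supn_measurable)
  have Y: "(\<lambda>n. psize (Y n)) \<longlonglongrightarrow> 0" using serr_supn_psize by (simp add: Y_def[abs_def])
  have "\<forall>n. \<exists>f I. elem f I \<and> (\<forall>\<omega>\<in>space M. \<forall>k s. f k s \<omega> = (\<integral>x. appr T (Suc n) (\<lambda>k s. K k s \<omega> x) k s \<partial>N)) \<and>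
    (\<forall>\<omega>\<in>space M. \<forall>t. I t \<omega> = (\<integral>x. appx (Suc n) K t \<omega> x \<partial>N))"
    by (intro allI mean_appx_elem) simp
  then obtain f I where "\<forall>n. elem (f n) (I n) \<and> (\<forall>\<omega>\<in>space M. \<forall>k s. f n k s \<omega> = (\<integral>x. appr T (Suc n) (\<lambda>k s. K k s \<omega> x) k s \<partial>N)) \<and>
    (\<forall>\<omega>\<in>space M. \<forall>t. I n t \<omega> = (\<integral>x. appx (Suc n) K t \<omega> x \<partial>N))"
    by (elim choice[THEN exE] choice[THEN exE, rotated])
  then have fI: "\<And>n. elem (f n) (I n)" and f: "\<And>n \<omega> k s. \<omega> \<in> space M \<Longrightarrow> f n k s \<omega> = (\<integral>x. appr T (Suc n) (\<lambda>k s. K k s \<omega> x) k s \<partial>N)"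
    and I: "\<And>n \<omega> t. \<omega> \<in> space M \<Longrightarrow> I n t \<omega> = (\<integral>x. appx (Suc n) K t \<omega> x \<partial>N)"
    by blast+
  have v: "vito (\<lambda>k s \<omega>. f n k s \<omega> - (\<integral>x. K k s \<omega> x \<partial>N)) (\<lambda>t \<omega>. I n t \<omega> - J t \<omega>)" for n
    by (rule vito_diff[OF elem_vito[OF fI] J])
  define Z where "Z n \<omega> = supn T (\<lambda>t. I n t \<omega> - J t \<omega>)" for n \<omega>
  have [measurable]: "Z n \<in> borel_measurable M" for n
    unfolding Z_def[abs_def] by (rule cadapted_supn[OF vito_cadapted[OF v]])
  have Z: "(\<lambda>n. psize (Z n)) \<longlonglongrightarrow> 0"
    unfolding Z_def[abs_def]
  proof (rule vito_tendsto_0[OF v])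
    show "(\<lambda>n. psize (\<lambda>\<omega>. qv T (\<lambda>k s. f n k s \<omega> - (\<integral>x. K k s \<omega> x \<partial>N)))) \<longlonglongrightarrow> 0"
    proof (rule tendsto_sandwich[OF _ _ tendsto_const err_phi_psize])
      show "\<forall>\<^sub>F n in sequentially. psize (\<lambda>\<omega>. qv T (\<lambda>k s. f n k s \<omega> - (\<integral>x. K k s \<omega> x \<partial>N))) \<le> psize (phi N (err n) T)"
      proof (intro always_eventually allI)
        fix n
        have "psize (\<lambda>\<omega>. qv T (\<lambda>k s. f n k s \<omega> - (\<integral>x. K k s \<omega> x \<partial>N))) \<le> psize (\<lambda>\<omega>. (phi N (err n) T \<omega>)\<^sup>2)"
          by (intro psize_mono_AE AE_I2) (simp only: f err_mean_qv_le)
        also have "\<dots> \<le> psize (phi N (err n) T)" by (rule psize_square_le)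
        finally show "psize (\<lambda>\<omega>. qv T (\<lambda>k s. f n k s \<omega> - (\<integral>x. K k s \<omega> x \<partial>N))) \<le> psize (phi N (err n) T)" .
      qed
    qed simp
  qed
  \<comment> \<open>Convergence of \<open>psize\<close> alone yields an infimum that is almost
    surely 0; the infimum bounds the discrepancy at every time.\<close>
  define U where "U \<omega> = (INF n. Z n \<omega> + Y n \<omega>)" for \<omega>
  have [measurable]: "U \<in> borel_measurable M" unfolding U_def[abs_def] by measurable
  have "psize U \<le> psize (Z n) + psize (Y n)" for n
  proof -
    have "psize U \<le> psize (\<lambda>\<omega>. Z n \<omega> + Y n \<omega>)"
      unfolding U_def by (intro psize_mono_AE AE_I2 INF_lower) simp
    also have "\<dots> \<le> psize (Z n) + psize (Y n)" by (rule psize_add) measurable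
    finally show ?thesis .
  qed
  moreover have "(\<lambda>n. psize (Z n) + psize (Y n)) \<longlonglongrightarrow> 0 + 0" by (intro tendsto_add Z Y)
  ultimately have "psize U \<le> 0 + 0" by (intro LIMSEQ_le_const) auto
  then have "AE \<omega> in M. U \<omega> = 0" by (simp add: psize_eq_0_iff)
  moreover have "AE \<omega> in M. (\<integral>\<^sup>+x. supn T (\<lambda>t. S t \<omega> x) \<partial>N) < \<infinity>"
    by (rule integral_supn_finite[OF finite_measure.axioms(1)[OF N] K fin phi_fin S_meas S_vito])
  ultimately show ?thesis
    using AE_space
  proof eventually_elim
    case (elim \<omega>)
    show ?case
    proof (rule ballI)
      fix t assume "t \<in> {0..T}"
      then have t: "0 \<le> t" "t \<le> T" by simp_all
      have [measurable]: "S t \<omega> \<in> borel_measurable N"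
        using measurable_compose[OF measurable_Pair1'[OF elim(3)] S_meas[OF t]] by simp
      have int: "integrable N (S t \<omega>)"
      proof (rule integrableI_bounded)
        have "(\<integral>\<^sup>+x. ennreal (norm (S t \<omega> x)) \<partial>N) \<le> (\<integral>\<^sup>+x. supn T (\<lambda>t. S t \<omega> x) \<partial>N)"
          by (intro nn_integral_mono) (simp add: supn_upper[OF t, of "\<lambda>t. S t \<omega> _"])
        then show "(\<integral>\<^sup>+x. ennreal (norm (S t \<omega> x)) \<partial>N) < \<infinity>" using elim(2) by (rule le_less_trans)
      qed measurable
      have "ennreal \<bar>J t \<omega> - (\<integral>x. S t \<omega> x \<partial>N)\<bar> \<le> Z n \<omega> + Y n \<omega>" for n
      proof -
        have "(\<integral>x. appx (Suc n) K t \<omega> x \<partial>N) - (\<integral>x. S t \<omega> x \<partial>N) = (\<integral>x. serr n t \<omega> x \<partial>N)"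
          unfolding serr_def using int appx_integrable(1)[OF zero_less_Suc elim(3)] by simp
        then have eq: "I n t \<omega> - (\<integral>x. S t \<omega> x \<partial>N) = (\<integral>x. serr n t \<omega> x \<partial>N)" by (simp only: I[OF elim(3)])
        have "ennreal \<bar>I n t \<omega> - (\<integral>x. S t \<omega> x \<partial>N)\<bar> \<le> (\<integral>\<^sup>+x. ennreal \<bar>serr n t \<omega> x\<bar> \<partial>N)"
          unfolding eq by (rule ennreal_abs_integral_le)
        also have "\<dots> \<le> Y n \<omega>"
          unfolding Y_def by (intro nn_integral_mono) (simp add: supn_upper[OF t, of "\<lambda>t. serr n t \<omega> _"])
        finally have 1: "ennreal \<bar>I n t \<omega> - (\<integral>x. S t \<omega> x \<partial>N)\<bar> \<le> Y n \<omega>" .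
        have 2: "ennreal \<bar>I n t \<omega> - J t \<omega>\<bar> \<le> Z n \<omega>"
          unfolding Z_def by (rule supn_upper[OF t])
        have "ennreal \<bar>J t \<omega> - (\<integral>x. S t \<omega> x \<partial>N)\<bar> \<le> ennreal (\<bar>I n t \<omega> - J t \<omega>\<bar> + \<bar>I n t \<omega> - (\<integral>x. S t \<omega> x \<partial>N)\<bar>)"
          by (intro ennreal_leI) linarith
        also have "\<dots> \<le> Z n \<omega> + Y n \<omega>" using add_mono[OF 2 1] by simp
        finally show ?thesis .
      qed
      then have "ennreal \<bar>J t \<omega> - (\<integral>x. S t \<omega> x \<partial>N)\<bar> \<le> U \<omega>" unfolding U_def by (rule INF_greatest)
      then have "J t \<omega> = (\<integral>x. S t \<omega> x \<partial>N)" using elim(1) by simp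
      with int show "integrable N (S t \<omega>) \<and> J t \<omega> = (\<integral>x. S t \<omega> x \<partial>N)" by simp
    qed
  qed
qed

end

end

end

section \<open>Wiener processes\<close>

locale raw_wiener = filtered_space M \<F> for M :: "'a measure" and \<F> :: "real \<Rightarrow> 'a measure" +
  fixes w :: "nat \<Rightarrow> real \<Rightarrow> 'a \<Rightarrow> real"
  assumes wiener: "\<And>k. wiener_process M \<F> (w k)"
    and independent: "independent_processes M w"
begin

lemma w_adapted: "0 \<le> t \<Longrightarrow> w k t \<in> borel_measurable (\<F> t)"
  using wiener[of k] unfolding wiener_process_def by blast

lemma w_measurable [measurable]: "0 \<le> t \<Longrightarrow> w k t \<in> borel_measurable M"
  by (rule measurable_F_M[OF w_adapted])

lemma increment_normal:
  "0 \<le> s \<Longrightarrow> s < t \<Longrightarrow> distributed M lborel (\<lambda>\<omega>. w k t \<omega> - w k s \<omega>) (normal_density 0 (sqrt (t - s)))"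
  using wiener[of k] unfolding wiener_process_def by blast

text \<open>\<open>indep_var\<close> concerns generated \<sigma>-fields: that of \<open>X\<close> is
  contained in \<open>\<F> s\<close>, and the preimages under the increment already form a
  \<sigma>-field.\<close>

lemma increment_indep:
  assumes s: "0 \<le> s" "s < t" and X: "X \<in> borel_measurable (\<F> s)"
  shows "indep_var borel X borel (\<lambda>\<omega>. w k t \<omega> - w k s \<omega>)"
proof -
  let ?D = "\<lambda>\<omega>. w k t \<omega> - w k s \<omega>"
  have [measurable]: "w k t \<in> borel_measurable M" "w k s \<in> borel_measurable M" using s by simp_all
  have D: "?D \<in> borel_measurable M" by measurable
  have ind: "indep_set (sets (\<F> s)) {?D -` B \<inter> space M | B. B \<in> sets borel}"
    using wiener[of k] s unfolding wiener_process_def by blast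
  have 1: "sigma_sets (space M) {X -` A \<inter> space M |A. A \<in> sets borel} \<subseteq> sets (\<F> s)"
  proof -
    have "space (\<F> s) = space M" using subalg[OF s(1)] by (simp add: subalgebra_def)
    then have "{X -` A \<inter> space M |A. A \<in> sets borel} \<subseteq> sets (\<F> s)" using measurable_sets[OF X] by auto
    from sets.sigma_sets_subset[OF this] show ?thesis using \<open>space (\<F> s) = space M\<close> by simp
  qed
  have 2: "sigma_sets (space M) {?D -` A \<inter> space M |A. A \<in> sets borel} = {?D -` A \<inter> space M |A. A \<in> sets borel}"
    using sets_vimage_algebra[of "space M" ?D borel] sets_vimage_algebra2[of ?D "space M" borel] by simp
  have "indep_set (sigma_sets (space M) {X -` A \<inter> space M |A. A \<in> sets borel})
      (sigma_sets (space M) {?D -` A \<inter> space M |A. A \<in> sets borel})"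
    using ind 1 unfolding 2 indep_sets2_eq by blast
  then show ?thesis unfolding indep_var_eq using D measurable_F_M[OF X s(1)] by blast
qed

lemma increment_integrable:
  assumes s: "0 \<le> s" "s \<le> t"
  shows "integrable M (\<lambda>\<omega>. w k t \<omega> - w k s \<omega>)" "integrable M (\<lambda>\<omega>. (w k t \<omega> - w k s \<omega>)\<^sup>2)"
    and "expectation (\<lambda>\<omega>. w k t \<omega> - w k s \<omega>) = 0" "expectation (\<lambda>\<omega>. (w k t \<omega> - w k s \<omega>)\<^sup>2) = t - s"
proof -
  let ?D = "\<lambda>\<omega>. w k t \<omega> - w k s \<omega>"
  have "integrable M ?D \<and> integrable M (\<lambda>\<omega>. (?D \<omega>)\<^sup>2) \<and> expectation ?D = 0 \<and> expectation (\<lambda>\<omega>. (?D \<omega>)\<^sup>2) = t - s"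
  proof (cases "s < t")
    case True
    note D = increment_normal[OF s(1) True, of k]
    have sg: "0 < sqrt (t - s)" using True by simp
    have m: "expectation ?D = 0" by (rule normal_distributed_expectation[OF sg D])
    have "expectation (\<lambda>\<omega>. (?D \<omega>)\<^sup>2) = t - s"
      using normal_distributed_variance[OF sg D] True by (simp add: m)
    moreover have "integrable M ?D"
      using distributed_integrable[OF D, of "\<lambda>x. x"] integrable_normal_moment[OF sg, of 0 1] by simp
    moreover have "integrable M (\<lambda>\<omega>. (?D \<omega>)\<^sup>2)"
      using distributed_integrable[OF D, of "\<lambda>x. x\<^sup>2"] integrable_normal_moment[OF sg, of 0 2] by simp
    ultimately show ?thesis using m by simp
  next
    case False
    then have "s = t" using s by simp
    then show ?thesis by simp
  qed
  then show "integrable M ?D" "integrable M (\<lambda>\<omega>. (?D \<omega>)\<^sup>2)" "expectation ?D = 0" "expectation (\<lambda>\<omega>. (?D \<omega>)\<^sup>2) = t - s"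
    by simp_all
qed

lemma w_mean:
  assumes s: "0 \<le> s" "s \<le> t" and X: "X \<in> borel_measurable (\<F> s)" "integrable M X"
  shows "has_bochner_integral M (\<lambda>\<omega>. X \<omega> * (w k t \<omega> - w k s \<omega>)) 0"
proof (cases "s < t")
  case True
  note ind = increment_indep[OF s(1) True X(1), of k] and D = increment_integrable[OF s, of k]
  from indep_var_lebesgue_integral[OF ind X(2) D(1)] indep_var_integrable[OF ind X(2) D(1)] show ?thesis
    by (simp add: has_bochner_integral_iff D)
next
  case False
  then have "s = t" using s by simp
  then show ?thesis by (simp add: has_bochner_integral_zero)
qed

lemma w_var:
  assumes s: "0 \<le> s" "s \<le> t" and X: "X \<in> borel_measurable (\<F> s)" "integrable M X"
  shows "has_bochner_integral M (\<lambda>\<omega>. X \<omega> * (w k t \<omega> - w k s \<omega>)\<^sup>2) (expectation X * (t - s))"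
proof (cases "s < t")
  case True
  note D = increment_integrable[OF s, of k]
  have ind: "indep_var borel X borel (\<lambda>\<omega>. (w k t \<omega> - w k s \<omega>)\<^sup>2)"
    using indep_var_compose[OF increment_indep[OF s(1) True X(1), of k], of "\<lambda>x. x" borel "\<lambda>x. x\<^sup>2" borel]
    by (simp add: comp_def)
  from indep_var_lebesgue_integral[OF ind X(2) D(2)] indep_var_integrable[OF ind X(2) D(2)] show ?thesis
    by (simp add: has_bochner_integral_iff D)
next
  case False
  then have "s = t" using s by simp
  then show ?thesis by (simp add: has_bochner_integral_zero)
qed

lemma paths_indep:
  assumes kl: "k \<noteq> l"
  shows "indep_var (\<Pi>\<^sub>M t\<in>{0..}. borel) (\<lambda>\<omega>. \<lambda>t\<in>{0..}. w k t \<omega>) (\<Pi>\<^sub>M t\<in>{0..}. borel) (\<lambda>\<omega>. \<lambda>t\<in>{0..}. w l t \<omega>)"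
proof -
  let ?X = "\<lambda>k \<omega>. \<lambda>t\<in>{0..}. w k t \<omega>" and ?P = "(\<Pi>\<^sub>M t\<in>{0..}. borel) :: (real \<Rightarrow> real) measure"
  let ?F = "\<lambda>i. {?X i -` A \<inter> space M |A. A \<in> sets ?P}"
  have rv: "\<And>i. random_variable ?P (?X i)" and ind: "indep_sets (\<lambda>i. sigma_sets (space M) (?F i)) UNIV"
    using independent unfolding independent_processes_def indep_vars_def by auto
  have "indep_set (sigma_sets (space M) (?F k)) (sigma_sets (space M) (?F l))"
    unfolding indep_sets2_eq
  proof (intro conjI ballI)
    show "sigma_sets (space M) (?F k) \<subseteq> events" "sigma_sets (space M) (?F l) \<subseteq> events"
      using ind unfolding indep_sets_def by blast+
    fix a b assume ab: "a \<in> sigma_sets (space M) (?F k)" "b \<in> sigma_sets (space M) (?F l)"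
    have "prob (\<Inter>j\<in>{k, l}. if j = k then a else b) = (\<Prod>j\<in>{k, l}. prob (if j = k then a else b))"
      by (rule indep_setsD[OF ind]) (use ab kl in auto)
    then show "prob (a \<inter> b) = prob a * prob b" using kl by (simp add: Int_commute)
  qed
  with rv show ?thesis unfolding indep_var_eq by blast
qed

text \<open>Each variable is a measurable functional of one whole path. This factors the mixed
  fourth moments in \<open>dcov_square\<close>, where increments from several times occur
  together.\<close>

lemma products_indep:
  assumes kl: "k \<noteq> l" and t: "0 \<le> a" "0 \<le> b" "0 \<le> c" "0 \<le> d"
  shows "indep_var borel (\<lambda>\<omega>. (w k a \<omega> - w k b \<omega>) * (w k c \<omega> - w k d \<omega>)) borel (\<lambda>\<omega>. (w l a \<omega> - w l b \<omega>) * (w l c \<omega> - w l d \<omega>))"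
proof -
  let ?g = "\<lambda>x. (x a - x b) * (x c - x d)"
  have [measurable]: "(\<lambda>x. x t) \<in> (\<Pi>\<^sub>M t\<in>{0..}. borel) \<rightarrow>\<^sub>M borel" if "0 \<le> t" for t :: real
    using that by (intro measurable_component_singleton) simp
  have "?g \<in> (\<Pi>\<^sub>M t\<in>{0..}. borel) \<rightarrow>\<^sub>M (borel :: real measure)" using t by measurable
  from indep_var_compose[OF paths_indep[OF kl] this this] show ?thesis
    using t by (simp add: comp_def)
qed

section \<open>Covariation of two independent Wiener paths on a grid\<close>

context
  fixes s t :: real and n :: nat
  assumes s: "0 \<le> s" "s \<le> t" and n: "0 < n"
begin

definition grid :: "nat \<Rightarrow> real" where
  "grid i = s + real i * (t - s) / real n"

definition dw :: "nat \<Rightarrow> nat \<Rightarrow> 'a \<Rightarrow> real" where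
  "dw k i \<omega> = w k (grid (Suc i)) \<omega> - w k (grid i) \<omega>"

lemma grid_mono: "i \<le> j \<Longrightarrow> grid i \<le> grid j"
  unfolding grid_def using s by (intro add_left_mono divide_right_mono mult_right_mono) simp_all

lemma grid_0: "grid 0 = s" and grid_n: "grid n = t"
  using n by (simp_all add: grid_def)

lemma grid_nonneg: "0 \<le> grid i"
  using grid_mono[of 0 i] s by (simp add: grid_0)

lemma grid_step: "grid (Suc i) - grid i = (t - s) / real n"
  by (simp add: grid_def diff_divide_distrib[symmetric] algebra_simps)

lemma dw_adapted: "dw k i \<in> borel_measurable (\<F> (grid (Suc i)))"
proof -
  have [measurable]: "w k (grid (Suc i)) \<in> borel_measurable (\<F> (grid (Suc i)))" by (rule w_adapted[OF grid_nonneg])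
  have [measurable]: "w k (grid i) \<in> borel_measurable (\<F> (grid (Suc i)))"
    by (rule measurable_F_mono[OF w_adapted[OF grid_nonneg] grid_nonneg grid_mono]) simp
  show ?thesis unfolding dw_def[abs_def] by measurable
qed

lemma dw_measurable [measurable]: "dw k i \<in> borel_measurable M"
  by (rule measurable_F_M[OF dw_adapted grid_nonneg])

lemma dw_square: "integrable M (\<lambda>\<omega>. (dw k i \<omega>)\<^sup>2)" "expectation (\<lambda>\<omega>. (dw k i \<omega>)\<^sup>2) = (t - s) / real n"
  and dw_int: "integrable M (dw k i)"
  unfolding dw_def[abs_def] using increment_integrable[OF grid_nonneg grid_mono[of i "Suc i"], of k]
  by (simp_all add: grid_step)

lemma square_products_integrable:
  assumes [measurable]: "f \<in> borel_measurable M" "g \<in> borel_measurable M"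
    and "integrable M (\<lambda>\<omega>. (f \<omega>)\<^sup>2)" "integrable M (\<lambda>\<omega>. (g \<omega>)\<^sup>2)"
  shows "integrable M (\<lambda>\<omega>. f \<omega> * g \<omega> :: real)"
proof (rule Bochner_Integration.integrable_bound)
  show "integrable M (\<lambda>\<omega>. (f \<omega>)\<^sup>2 + (g \<omega>)\<^sup>2)" using assms by simp
  show "AE \<omega> in M. norm (f \<omega> * g \<omega>) \<le> norm ((f \<omega>)\<^sup>2 + (g \<omega>)\<^sup>2)"
  proof (rule AE_I2)
    fix \<omega>
    have "2 * (\<bar>f \<omega>\<bar> * \<bar>g \<omega>\<bar>) \<le> \<bar>f \<omega>\<bar>\<^sup>2 + \<bar>g \<omega>\<bar>\<^sup>2" using sum_squares_bound[of "\<bar>f \<omega>\<bar>" "\<bar>g \<omega>\<bar>"] by (simp add: mult.assoc)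
    moreover have "0 \<le> \<bar>f \<omega>\<bar> * \<bar>g \<omega>\<bar>" by (intro mult_nonneg_nonneg) simp_all
    ultimately have "\<bar>f \<omega>\<bar> * \<bar>g \<omega>\<bar> \<le> \<bar>f \<omega>\<bar>\<^sup>2 + \<bar>g \<omega>\<bar>\<^sup>2" by linarith
    then have "\<bar>f \<omega>\<bar> * \<bar>g \<omega>\<bar> \<le> (f \<omega>)\<^sup>2 + (g \<omega>)\<^sup>2" by (simp only: power2_abs)
    then show "norm (f \<omega> * g \<omega>) \<le> norm ((f \<omega>)\<^sup>2 + (g \<omega>)\<^sup>2)" by (simp add: abs_mult)
  qed
qed measurable

lemma dw_product_integrable: "integrable M (\<lambda>\<omega>. dw k i \<omega> * dw l j \<omega>)"
  by (rule square_products_integrable) (simp_all add: dw_square)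

text \<open>At the start of the later cell \<open>j\<close> both \<open>X\<close> and the earlier
  increment are known, so the later one has mean 0 given everything else. The indices
  \<open>k\<close> and \<open>l\<close> are arbitrary, equal ones included.\<close>

lemma weighted_orthogonal:
  assumes X: "X \<in> borel_measurable (\<F> s)" and C: "\<And>\<omega>. \<omega> \<in> space M \<Longrightarrow> \<bar>X \<omega>\<bar> \<le> C" and ij: "i < j"
  shows "has_bochner_integral M (\<lambda>\<omega>. X \<omega> * dw k i \<omega> * dw l j \<omega>) 0"
  unfolding dw_def[of l j]
proof (rule w_mean[OF grid_nonneg grid_mono])
  have [measurable]: "X \<in> borel_measurable (\<F> (grid j))"
    using grid_mono[of 0 j] by (intro measurable_F_mono[OF X s(1)]) (simp add: grid_0)
  have [measurable]: "dw k i \<in> borel_measurable (\<F> (grid j))"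
    using ij by (intro measurable_F_mono[OF dw_adapted grid_nonneg] grid_mono) simp
  show "(\<lambda>\<omega>. X \<omega> * dw k i \<omega>) \<in> borel_measurable (\<F> (grid j))" by measurable
  have [measurable]: "X \<in> borel_measurable M" by (rule measurable_F_M[OF X s(1)])
  have "integrable M (\<lambda>\<omega>. dw k i \<omega> * X \<omega>)"
  proof (rule Bochner_Integration.integrable_bound)
    show "integrable M (\<lambda>\<omega>. C * dw k i \<omega>)" using dw_int by simp
    show "AE \<omega> in M. norm (dw k i \<omega> * X \<omega>) \<le> norm (C * dw k i \<omega>)"
    proof (rule AE_I2)
      fix \<omega> assume "\<omega> \<in> space M"
      then have "\<bar>X \<omega>\<bar> \<le> \<bar>C\<bar>" using C[of \<omega>] by simp
      then show "norm (dw k i \<omega> * X \<omega>) \<le> norm (C * dw k i \<omega>)"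
        by (simp add: abs_mult mult.commute mult_right_mono)
    qed
  qed measurable
  then show "integrable M (\<lambda>\<omega>. X \<omega> * dw k i \<omega>)" by (simp add: mult.commute)
qed simp

lemma increment_sum: "w k t \<omega> - w k s \<omega> = (\<Sum>i<n. dw k i \<omega>)"
  using sum_lessThan_telescope[of "\<lambda>i. w k (grid i) \<omega>" n] by (simp add: dw_def grid_0 grid_n)

text \<open>The discrete quadratic covariation of \<open>w k\<close> and \<open>w l\<close> along
  the grid.\<close>

definition dcov :: "nat \<Rightarrow> nat \<Rightarrow> 'a \<Rightarrow> real" where
  "dcov k l \<omega> = (\<Sum>i<n. dw k i \<omega> * dw l i \<omega>)"

lemma one_bdd: "(\<lambda>_. 1 :: real) \<in> borel_measurable (\<F> s)" by simp

lemma dw_orthogonal: "i \<noteq> j \<Longrightarrow> expectation (\<lambda>\<omega>. dw k i \<omega> * dw k j \<omega>) = 0"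
proof (induction i j rule: linorder_wlog)
  case (le i j)
  then show ?case using weighted_orthogonal[OF one_bdd, of 1 i j k k] by (simp add: has_bochner_integral_iff)
next
  case (sym i j)
  then show ?case by (simp add: mult.commute)
qed

text \<open>Independence of the two paths splits each mixed moment into a product of second moments.
  Those with \<open>i \<noteq> j\<close> vanish by orthogonality, and n diagonal terms of size ((t -
  s) / n)^2 remain.\<close>

lemma dcov_square:
  assumes kl: "k \<noteq> l"
  shows "has_bochner_integral M (\<lambda>\<omega>. (dcov k l \<omega>)\<^sup>2) ((t - s)\<^sup>2 / real n)"
proof -
  let ?p = "\<lambda>k i j \<omega>. dw k i \<omega> * dw k j \<omega>"
  have 1: "has_bochner_integral M (\<lambda>\<omega>. ?p k i j \<omega> * ?p l i j \<omega>) (if i = j then ((t - s) / real n)\<^sup>2 else 0)" for i j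
  proof -
    have ind: "indep_var borel (?p k i j) borel (?p l i j)"
      unfolding dw_def by (rule products_indep[OF kl]) (rule grid_nonneg)+
    have "expectation (\<lambda>\<omega>. ?p k i j \<omega> * ?p l i j \<omega>) = expectation (?p k i j) * expectation (?p l i j)"
      by (rule indep_var_lebesgue_integral[OF ind dw_product_integrable dw_product_integrable])
    also have "\<dots> = (if i = j then ((t - s) / real n)\<^sup>2 else 0)"
    proof (cases "i = j")
      case True
      then show ?thesis using dw_square(2)[of k j] dw_square(2)[of l j] by (simp add: power2_eq_square)
    qed (simp add: dw_orthogonal)
    finally show ?thesis
      using indep_var_integrable[OF ind dw_product_integrable dw_product_integrable] by (simp only: has_bochner_integral_iff)
  qed
  have eq: "(dcov k l \<omega>)\<^sup>2 = (\<Sum>i<n. \<Sum>j<n. ?p k i j \<omega> * ?p l i j \<omega>)" for \<omega>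
    unfolding dcov_def power2_eq_square sum_product by (intro sum.cong refl) simp
  have "has_bochner_integral M (\<lambda>\<omega>. (dcov k l \<omega>)\<^sup>2) (\<Sum>i<n. \<Sum>j<n. if i = j then ((t - s) / real n)\<^sup>2 else 0)"
    unfolding eq by (intro has_bochner_integral_sum 1)
  also have "(\<Sum>i<n. \<Sum>j<n. if i = j then ((t - s) / real n)\<^sup>2 else 0) = (t - s)\<^sup>2 / real n"
    using n by (simp add: sum.delta power2_eq_square field_simps)
  finally show ?thesis .
qed

text \<open>
  The cross terms over a subdivision vanish by adaptedness, and the diagonal \<open>dcov k l\<close> is small in
  mean square because the paths of \<open>w k\<close> and \<open>w l\<close> are independent.
\<close>

lemma w_cov_bound:
  assumes kl: "k \<noteq> l" and X: "X \<in> borel_measurable (\<F> s)" and C: "\<And>\<omega>. \<omega> \<in> space M \<Longrightarrow> \<bar>X \<omega>\<bar> \<le> C" and a: "0 < a"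
  shows "integrable M (\<lambda>\<omega>. X \<omega> * (w k t \<omega> - w k s \<omega>) * (w l t \<omega> - w l s \<omega>))"
    and "\<bar>expectation (\<lambda>\<omega>. X \<omega> * (w k t \<omega> - w k s \<omega>) * (w l t \<omega> - w l s \<omega>))\<bar> \<le> C * (a + (t - s)\<^sup>2 / real n / a)"
proof -
  have [measurable]: "X \<in> borel_measurable M" by (rule measurable_F_M[OF X s(1)])
  have C0: "0 \<le> C" using C not_empty by (meson abs_ge_zero all_not_in_conv order_trans)
  have bdd: "integrable M (\<lambda>\<omega>. X \<omega> * f \<omega>)" if [measurable]: "integrable M f" for f :: "'a \<Rightarrow> real"
  proof (rule Bochner_Integration.integrable_bound)
    show "integrable M (\<lambda>\<omega>. C * f \<omega>)" using that by simp
    show "AE \<omega> in M. norm (X \<omega> * f \<omega>) \<le> norm (C * f \<omega>)"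
      using C C0 by (intro AE_I2) (simp add: abs_mult mult_right_mono)
  qed measurable
  have i1: "integrable M (\<lambda>\<omega>. X \<omega> * dw k i \<omega> * dw l j \<omega>)" for i j
    using bdd[OF dw_product_integrable[of k i l j]] by (simp add: mult.assoc)
  have eq: "X \<omega> * (w k t \<omega> - w k s \<omega>) * (w l t \<omega> - w l s \<omega>) = (\<Sum>i<n. \<Sum>j<n. X \<omega> * dw k i \<omega> * dw l j \<omega>)" for \<omega>
    unfolding increment_sum mult.assoc sum_product by (simp only: sum_distrib_left)
  show "integrable M (\<lambda>\<omega>. X \<omega> * (w k t \<omega> - w k s \<omega>) * (w l t \<omega> - w l s \<omega>))"
    unfolding eq by (intro Bochner_Integration.integrable_sum i1)
  have off: "expectation (\<lambda>\<omega>. X \<omega> * dw k i \<omega> * dw l j \<omega>) = 0" if "i \<noteq> j" for i j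
  proof (cases "i < j")
    case True
    from weighted_orthogonal[OF X C this, of k l] show ?thesis by (simp add: has_bochner_integral_iff)
  next
    case False
    then have "j < i" using that by simp
    from weighted_orthogonal[OF X C this, of l k] show ?thesis by (simp add: has_bochner_integral_iff mult.assoc mult.commute[of "dw k i _"])
  qed
  have dint: "integrable M (dcov k l)"
    unfolding dcov_def[abs_def] by (intro Bochner_Integration.integrable_sum dw_product_integrable)
  have "expectation (\<lambda>\<omega>. X \<omega> * (w k t \<omega> - w k s \<omega>) * (w l t \<omega> - w l s \<omega>)) = (\<Sum>i<n. \<Sum>j<n. expectation (\<lambda>\<omega>. X \<omega> * dw k i \<omega> * dw l j \<omega>))"
    unfolding eq by (simp add: Bochner_Integration.integral_sum i1)
  also have "\<dots> = (\<Sum>i<n. \<Sum>j<n. if j = i then expectation (\<lambda>\<omega>. X \<omega> * dw k i \<omega> * dw l i \<omega>) else 0)"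
    by (intro sum.cong refl) (simp add: off)
  also have "\<dots> = expectation (\<lambda>\<omega>. X \<omega> * dcov k l \<omega>)"
    unfolding dcov_def by (simp add: sum.delta' sum_distrib_left mult.assoc[symmetric] Bochner_Integration.integral_sum i1)
  finally have e1: "expectation (\<lambda>\<omega>. X \<omega> * (w k t \<omega> - w k s \<omega>) * (w l t \<omega> - w l s \<omega>)) = expectation (\<lambda>\<omega>. X \<omega> * dcov k l \<omega>)" .
  have "\<bar>expectation (\<lambda>\<omega>. X \<omega> * dcov k l \<omega>)\<bar> \<le> expectation (\<lambda>\<omega>. \<bar>X \<omega> * dcov k l \<omega>\<bar>)" by (rule integral_abs_bound)
  also have "\<dots> \<le> expectation (\<lambda>\<omega>. C * (a + (dcov k l \<omega>)\<^sup>2 / a))"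
  proof (rule integral_mono)
    show "integrable M (\<lambda>\<omega>. \<bar>X \<omega> * dcov k l \<omega>\<bar>)" using bdd[OF dint] by simp
    show "integrable M (\<lambda>\<omega>. C * (a + (dcov k l \<omega>)\<^sup>2 / a))"
      using dcov_square[OF kl] by (simp add: has_bochner_integral_iff)
    fix \<omega> assume \<omega>: "\<omega> \<in> space M"
    \<comment> \<open>From the square of \<open>a - \<bar>dcov k l \<omega>\<bar>\<close> being
      nonnegative; the free parameter \<open>a\<close> is balanced against the number of cells in
      \<open>w_cov\<close>.\<close>
    have "\<bar>dcov k l \<omega>\<bar> \<le> a + (dcov k l \<omega>)\<^sup>2 / a"
    proof -
      have "0 \<le> (a - \<bar>dcov k l \<omega>\<bar>)\<^sup>2" by simp
      then have "2 * a * \<bar>dcov k l \<omega>\<bar> \<le> a * a + (dcov k l \<omega>)\<^sup>2" unfolding power2_diff power2_abs by (simp add: power2_eq_square)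
      moreover have "0 \<le> a * \<bar>dcov k l \<omega>\<bar>" using a by simp
      ultimately have "a * \<bar>dcov k l \<omega>\<bar> \<le> a * a + (dcov k l \<omega>)\<^sup>2" by simp
      then show ?thesis using a by (simp add: field_simps power2_eq_square)
    qed
    then show "\<bar>X \<omega> * dcov k l \<omega>\<bar> \<le> C * (a + (dcov k l \<omega>)\<^sup>2 / a)"
      unfolding abs_mult using C[OF \<omega>] C0 by (intro mult_mono) simp_all
  qed
  also have "\<dots> = C * (a + (t - s)\<^sup>2 / real n / a)"
    using dcov_square[OF kl] by (simp add: has_bochner_integral_iff prob_space)
  finally show "\<bar>expectation (\<lambda>\<omega>. X \<omega> * (w k t \<omega> - w k s \<omega>) * (w l t \<omega> - w l s \<omega>))\<bar> \<le> C * (a + (t - s)\<^sup>2 / real n / a)"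
    unfolding e1 .
qed

end

text \<open>\<open>X\<close> times the increment of \<open>w k\<close> is not known at time s, so
  independence of the increment of \<open>w l\<close> from \<open>\<F> s\<close> gives nothing
  directly. The expectation does not depend on the subdivision, while its bound in
  \<open>w_cov_bound\<close> can be made arbitrarily small.\<close>

lemma w_cov:
  assumes kl: "k \<noteq> l" and s: "0 \<le> s" "s \<le> t" and X: "X \<in> borel_measurable (\<F> s)"
    and C: "\<And>\<omega>. \<omega> \<in> space M \<Longrightarrow> \<bar>X \<omega>\<bar> \<le> C"
  shows "has_bochner_integral M (\<lambda>\<omega>. X \<omega> * (w k t \<omega> - w k s \<omega>) * (w l t \<omega> - w l s \<omega>)) 0"
proof -
  let ?E = "expectation (\<lambda>\<omega>. X \<omega> * (w k t \<omega> - w k s \<omega>) * (w l t \<omega> - w l s \<omega>))"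
  have int: "integrable M (\<lambda>\<omega>. X \<omega> * (w k t \<omega> - w k s \<omega>) * (w l t \<omega> - w l s \<omega>))"
    by (rule w_cov_bound(1)[OF s zero_less_one kl X C zero_less_one])
  have b: "\<bar>?E\<bar> \<le> C * (1 / real (Suc m) + (t - s)\<^sup>2 / real (Suc m))" for m
  proof -
    \<comment> \<open>(m + 1)^2 cells together with a = 1 / (m + 1) make both terms of the bound of
      order 1 / (m + 1).\<close>
    have "\<bar>?E\<bar> \<le> C * (1 / real (Suc m) + (t - s)\<^sup>2 / real (Suc m * Suc m) / (1 / real (Suc m)))"
      by (rule w_cov_bound(2)[OF s _ kl X C]) simp_all
    also have "(t - s)\<^sup>2 / real (Suc m * Suc m) / (1 / real (Suc m)) = (t - s)\<^sup>2 / real (Suc m)"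
      by (simp only: of_nat_mult) (simp add: field_simps del: of_nat_Suc)
    finally show ?thesis .
  qed
  have "(\<lambda>m. C * (1 / real (Suc m) + (t - s)\<^sup>2 / real (Suc m))) \<longlonglongrightarrow> C * (0 + 0)"
    by (intro tendsto_intros LIMSEQ_inverse_real_of_nat[unfolded inverse_eq_divide] LIMSEQ_Suc[OF lim_const_over_n])
  then have "\<bar>?E\<bar> \<le> C * (0 + 0)" by (rule LIMSEQ_le_const) (use b in blast)
  then show ?thesis using int by (simp add: has_bochner_integral_iff)
qed

text \<open>All paths are set to 0 on one null event containing every discontinuity. The event lies
  in every \<open>\<F> t\<close>, so adaptedness survives, and the moment identities change only on
  a null event.\<close>

lemma modification:
  assumes T: "0 \<le> T"
  obtains W where "wiener_system M \<F> W T" "AE \<omega> in M. \<forall>k t. W k t \<omega> = w k t \<omega>"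
proof -
  have "AE \<omega> in M. \<forall>k. continuous_on {0..} (\<lambda>t. w k t \<omega>)"
    unfolding AE_all_countable using wiener unfolding wiener_process_def by blast
  then obtain N where N: "{\<omega> \<in> space M. \<not> (\<forall>k. continuous_on {0..} (\<lambda>t. w k t \<omega>))} \<subseteq> N" "emeasure M N = 0" "N \<in> sets M"
    by (rule AE_E)
  define W where "W k t \<omega> = (if \<omega> \<in> N then 0 else w k t \<omega>)" for k t \<omega>
  have NF: "N \<in> sets (\<F> t)" if "0 \<le> t" for t
    using filtration that N(2,3) by (auto simp: complete_filtration_def null_sets_def)
  have "AE \<omega> in M. \<omega> \<notin> N" using N(2,3) by (intro AE_not_in) (simp add: null_sets_def)
  then have eq: "AE \<omega> in M. \<forall>k t. W k t \<omega> = w k t \<omega>" by eventually_elim (simp add: W_def)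
  have ad: "W k t \<in> borel_measurable (\<F> t)" if t: "0 \<le> t" for k t
  proof -
    note [measurable] = NF[OF t] w_adapted[OF t, of k]
    show ?thesis unfolding W_def[abs_def] by measurable
  qed
  have cong: "has_bochner_integral M f c" if "has_bochner_integral M g c" "f \<in> borel_measurable M"
      "AE \<omega> in M. f \<omega> = g \<omega>" for f g :: "'a \<Rightarrow> real" and c
    using that has_bochner_integral_cong_AE[of f M g c] borel_measurable_has_bochner_integral[OF that(1)] by blast
  have Wm: "0 \<le> t \<Longrightarrow> W k t \<in> borel_measurable M" for k t by (rule measurable_F_M[OF ad])
  have "wiener_system M \<F> W T"
  proof (unfold_locales)
    show "continuous_on {0..} (\<lambda>t. W k t \<omega>)" if "\<omega> \<in> space M" for k \<omega>
      unfolding W_def using N(1) that by (cases "\<omega> \<in> N") auto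
    show "W k t \<in> borel_measurable (\<F> t)" if "0 \<le> t" for k t by (rule ad[OF that])
    fix k s t and X :: "'a \<Rightarrow> real" assume s: "0 \<le> s" "s \<le> t" and X: "X \<in> borel_measurable (\<F> s)" "integrable M X"
    have [measurable]: "X \<in> borel_measurable M" using X(2) by (rule borel_measurable_integrable)
    have [measurable]: "W k s \<in> borel_measurable M" "W k t \<in> borel_measurable M" using s by (simp_all add: Wm)
    show "has_bochner_integral M (\<lambda>\<omega>. X \<omega> * (W k t \<omega> - W k s \<omega>)) 0"
      by (rule cong[OF w_mean[OF s X, of k]], measurable) (use eq in \<open>eventually_elim, simp\<close>)
    show "has_bochner_integral M (\<lambda>\<omega>. X \<omega> * (W k t \<omega> - W k s \<omega>)\<^sup>2) (expectation X * (t - s))"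
      by (rule cong[OF w_var[OF s X, of k]], measurable) (use eq in \<open>eventually_elim, simp\<close>)
  next
    fix k l :: nat and s t C and X :: "'a \<Rightarrow> real" assume kl: "k \<noteq> l" and s: "0 \<le> s" "s \<le> t" and X: "X \<in> borel_measurable (\<F> s)"
      and C: "\<And>\<omega>. \<omega> \<in> space M \<Longrightarrow> \<bar>X \<omega>\<bar> \<le> C"
    have [measurable]: "X \<in> borel_measurable M" by (rule measurable_F_M[OF X s(1)])
    have [measurable]: "W k s \<in> borel_measurable M" "W k t \<in> borel_measurable M" "W l s \<in> borel_measurable M" "W l t \<in> borel_measurable M"
      using s by (simp_all add: Wm)
    show "has_bochner_integral M (\<lambda>\<omega>. X \<omega> * (W k t \<omega> - W k s \<omega>) * (W l t \<omega> - W l s \<omega>)) 0"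
      by (rule cong[OF w_cov[OF kl s X C]], assumption, measurable) (use eq in \<open>eventually_elim, simp\<close>)
  qed (use T filtration in \<open>auto dest: complete_measure.complete[OF complete_M]\<close>)
  from that[OF this eq] show thesis .
qed

end

section \<open>Invariance of the Ito integral under modification of the Wiener paths\<close>

context wiener_system
begin

lemma ucp_tendsto_AE_cong:
  assumes u: "ucp_tendsto M T X Y" and eq: "AE \<omega> in M. \<forall>n t. X' n t \<omega> = X n t \<omega>"
  shows "ucp_tendsto M T X' Y"
proof -
  let ?Z = "\<lambda>X n \<omega>. \<Squnion>t\<in>{0..T}. ennreal \<bar>X n t \<omega> - Y t \<omega>\<bar>"
  have Z: "\<And>n. ?Z X n \<in> borel_measurable M" "(\<lambda>n. psize (?Z X n)) \<longlonglongrightarrow> 0"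
    using u unfolding ucp_tendsto_def tendsto_zero_in_prob_iff by blast+
  have e: "AE \<omega> in M. ?Z X' n \<omega> = ?Z X n \<omega>" for n
    using eq by eventually_elim simp
  have "?Z X' n \<in> borel_measurable M" for n
    by (rule complete_measure.borel_measurable_AE_cong[OF complete_M Z(1) e])
  moreover have "psize (?Z X' n) = psize (?Z X n)" for n
    unfolding psize_def by (rule nn_integral_cong_AE) (use e[of n] in \<open>eventually_elim, simp\<close>)
  ultimately show ?thesis using Z(2) unfolding ucp_tendsto_def tendsto_zero_in_prob_iff by simp
qed

lemma has_ito_modification:
  assumes eq: "AE \<omega> in M. \<forall>k t. W k t \<omega> = w k t \<omega>"
  shows "has_ito_integral M \<F> (w k) T h I \<longleftrightarrow> has_ito_integral M \<F> (W k) T h I"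
proof -
  have 1: "AE \<omega> in M. \<forall>j t. simple_ito (W k) (n j) (\<tau> j) (\<xi> j) t \<omega> = simple_ito (w k) (n j) (\<tau> j) (\<xi> j) t \<omega>" for n \<tau> \<xi>
    using eq by eventually_elim (simp add: simple_ito_def)
  have 2: "AE \<omega> in M. \<forall>j t. simple_ito (w k) (n j) (\<tau> j) (\<xi> j) t \<omega> = simple_ito (W k) (n j) (\<tau> j) (\<xi> j) t \<omega>" for n \<tau> \<xi>
    using eq by eventually_elim (simp add: simple_ito_def)
  have "ucp_tendsto M T (\<lambda>j. simple_ito (w k) (n j) (\<tau> j) (\<xi> j)) I \<longleftrightarrow> ucp_tendsto M T (\<lambda>j. simple_ito (W k) (n j) (\<tau> j) (\<xi> j)) I" for n \<tau> \<xi>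
    by (intro iffI) (erule ucp_tendsto_AE_cong, rule 1 2)+
  then show ?thesis unfolding has_ito_integral_def by simp
qed

text \<open>\<open>w\<close> and \<open>W\<close> have the same pairs of integrand and integral, so
  the choice operators are applied to identical predicates. The chosen integrals and series are
  therefore equal as functions, not merely almost surely.\<close>

lemma ito_modification:
  assumes eq: "AE \<omega> in M. \<forall>k t. W k t \<omega> = w k t \<omega>"
  shows "ito_integrable M \<F> (w k) T h \<longleftrightarrow> ito_integrable M \<F> (W k) T h"
    and "ito_series_converges M \<F> w T g \<longleftrightarrow> ito_series_converges M \<F> W T g"
    and "ito_series M \<F> w T g = ito_series M \<F> W T g"
proof -
  note * = has_ito_modification[OF eq]
  have 1: "ito_integrable M \<F> (w k) T h \<longleftrightarrow> ito_integrable M \<F> (W k) T h" for k h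
    unfolding ito_integrable_def * ..
  have 2: "ito_integral M \<F> (w k) T h = ito_integral M \<F> (W k) T h" for k h
    unfolding ito_integral_def * ..
  show "ito_integrable M \<F> (w k) T h \<longleftrightarrow> ito_integrable M \<F> (W k) T h" by (rule 1)
  show "ito_series_converges M \<F> w T g \<longleftrightarrow> ito_series_converges M \<F> W T g"
    unfolding ito_series_converges_def 1 2 ..
  show "ito_series M \<F> w T g = ito_series M \<F> W T g"
    unfolding ito_series_def 2 ..
qed

end

section \<open>Equations depending on a parameter\<close>

lemma continuous_on_integral_upto:
  fixes p :: "real \<Rightarrow> real"
  assumes p: "integrable lborel p"
  shows "continuous_on {0..T} (\<lambda>t. LINT s:{0<..t}|lborel. p s)"
  unfolding continuous_on_sequentially
proof (intro allI ballI impI)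
  fix u a assume "(\<forall>n. u n \<in> {0..T}) \<and> u \<longlonglongrightarrow> a"
  then have u: "u \<longlonglongrightarrow> a" by simp
  have [measurable]: "p \<in> borel_measurable lborel" using p by (rule borel_measurable_integrable)
  show "((\<lambda>t. LINT s:{0<..t}|lborel. p s) \<circ> u) \<longlonglongrightarrow> (LINT s:{0<..a}|lborel. p s)"
    unfolding set_lebesgue_integral_def comp_def
  proof (rule integral_dominated_convergence[where w = "\<lambda>s. \<bar>p s\<bar>"])
    have "AE s in lborel. s \<noteq> a" by (rule AE_lborel_singleton)
    then show "AE s in lborel. (\<lambda>n. indicat_real {0<..u n} s *\<^sub>R p s) \<longlonglongrightarrow> indicat_real {0<..a} s *\<^sub>R p s"
    proof eventually_elim
      case (elim s)
      have "\<forall>\<^sub>F n in sequentially. indicat_real {0<..u n} s *\<^sub>R p s = indicat_real {0<..a} s *\<^sub>R p s"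
      proof (cases "s < a")
        case True
        from order_tendstoD(1)[OF u this] show ?thesis by eventually_elim (use True in \<open>simp add: indicator_def\<close>)
      next
        case False
        with elim have "a < s" by simp
        from order_tendstoD(2)[OF u this] show ?thesis by eventually_elim (use \<open>a < s\<close> in \<open>simp add: indicator_def\<close>)
      qed
      then show ?case by (rule tendsto_eventually)
    qed
    show "integrable lborel (\<lambda>s. \<bar>p s\<bar>)" using p by simp
  qed (auto simp: indicator_def)
qed

section \<open>Drift, noise and their means over the parameter\<close>

context wiener_system
begin

lemma restricted_predX:
  assumes f: "\<And>k. (\<lambda>((\<omega>, s), x). f k s \<omega> x) \<in> borel_measurable (\<P> \<Otimes>\<^sub>M N)"
    and A: "A \<in> sets (\<F> 0)"
  shows "predX N (\<lambda>k s \<omega> x. if \<omega> \<in> A \<and> 0 < s \<and> s \<le> T then f k s \<omega> x else 0)"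
  unfolding predX_def
proof (intro conjI allI impI)
  fix k
  note [measurable] = f[of k, unfolded case_prod_beta']
  note [measurable] = event_predictable[OF A]
  have "(\<lambda>z. indicator A (fst (fst z)) * f k (snd (fst z)) (fst (fst z)) (snd z)) \<in> borel_measurable (\<P> \<Otimes>\<^sub>M N)"
    by measurable
  then show "(\<lambda>((\<omega>, s), x). if \<omega> \<in> A \<and> 0 < s \<and> s \<le> T then f k s \<omega> x else 0) \<in> borel_measurable (\<P> \<Otimes>\<^sub>M N)"
    by (rule measurable_cong[THEN iffD1, rotated])
      (auto simp: space_pair_measure space_predictable_upto indicator_def)
qed auto

text \<open>\<open>g\<close> and \<open>h\<close> stand for the means in the theorem, which are
  formed with Lebesgue measure on \<Gamma>. They are tied to integrals over \<open>N\<close> only at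
  times in (0, T], where the sections of the integrands are known to be measurable.\<close>

context
  fixes N :: "'x measure" and G :: "real \<Rightarrow> 'a \<Rightarrow> 'x \<Rightarrow> real" and H :: "nat \<Rightarrow> real \<Rightarrow> 'a \<Rightarrow> 'x \<Rightarrow> real" and A :: "'a set"
    and g :: "real \<Rightarrow> 'a \<Rightarrow> real" and h :: "nat \<Rightarrow> real \<Rightarrow> 'a \<Rightarrow> real"
  assumes N: "finite_measure N"
    and G_pred: "(\<lambda>((\<omega>, s), x). G s \<omega> x) \<in> borel_measurable (\<P> \<Otimes>\<^sub>M N)"
    and H_pred: "\<And>k. (\<lambda>((\<omega>, s), x). H k s \<omega> x) \<in> borel_measurable (\<P> \<Otimes>\<^sub>M N)"
    and A: "A \<in> sets M" "AE \<omega> in M. \<omega> \<in> A"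
    and G_path: "\<And>\<omega> x. \<omega> \<in> A \<Longrightarrow> x \<in> space N \<Longrightarrow> (\<integral>\<^sup>+s\<in>{0<..T}. ennreal \<bar>G s \<omega> x\<bar> \<partial>lborel) < \<infinity>"
    and H_path: "\<And>\<omega> x. \<omega> \<in> A \<Longrightarrow> x \<in> space N \<Longrightarrow> qv T (\<lambda>k s. H k s \<omega> x) < \<infinity>"
    and G_int: "\<And>\<omega>. \<omega> \<in> A \<Longrightarrow> (\<integral>\<^sup>+s\<in>{0<..T}. (\<integral>\<^sup>+x. ennreal \<bar>G s \<omega> x\<bar> \<partial>N) \<partial>lborel) < \<infinity>"
    and H_int: "\<And>\<omega>. \<omega> \<in> A \<Longrightarrow> phi N H T \<omega> < \<infinity>"
    and g: "\<And>s \<omega>. \<omega> \<in> space M \<Longrightarrow> 0 < s \<Longrightarrow> s \<le> T \<Longrightarrow> g s \<omega> = (\<integral>x. G s \<omega> x \<partial>N)"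
    and h: "\<And>k s \<omega>. \<omega> \<in> space M \<Longrightarrow> 0 < s \<Longrightarrow> s \<le> T \<Longrightarrow> h k s \<omega> = (\<integral>x. H k s \<omega> x \<partial>N)"
begin

text \<open>
  The integrands are set to 0 off the full event \<open>A\<close>, which makes all bounds hold for every \<open>\<omega>\<close>.
\<close>

definition G0 :: "real \<Rightarrow> 'a \<Rightarrow> 'x \<Rightarrow> real" where
  "G0 s \<omega> x = (if \<omega> \<in> A \<and> 0 < s \<and> s \<le> T then G s \<omega> x else 0)"

definition H0 :: "nat \<Rightarrow> real \<Rightarrow> 'a \<Rightarrow> 'x \<Rightarrow> real" where
  "H0 k s \<omega> x = (if \<omega> \<in> A \<and> 0 < s \<and> s \<le> T then H k s \<omega> x else 0)"

definition drift :: "real \<Rightarrow> 'a \<Rightarrow> 'x \<Rightarrow> real" where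
  "drift t \<omega> x = (LINT s:{0<..t}|lborel. G0 s \<omega> x)"

lemma A_F0: "A \<in> sets (\<F> 0)"
  by (rule full_event_F0[OF A])

lemma H0_predX: "predX N H0"
  unfolding H0_def by (rule restricted_predX[OF H_pred A_F0])

lemma G0_predX: "predX N (\<lambda>_. G0)"
  unfolding G0_def by (rule restricted_predX[OF G_pred A_F0])

lemma H0_qv: "x \<in> space N \<Longrightarrow> qv T (\<lambda>k s. H0 k s \<omega> x) < \<infinity>"
proof (cases "\<omega> \<in> A")
  case True
  assume x: "x \<in> space N"
  have "qv T (\<lambda>k s. H0 k s \<omega> x) = qv T (\<lambda>k s. H k s \<omega> x)"
    by (rule qv_cong) (simp add: H0_def True)
  then show ?thesis using H_path[OF True x] by simp
qed (simp add: H0_def)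

lemma H0_phi: "phi N H0 T \<omega> < \<infinity>"
proof (cases "\<omega> \<in> A")
  case True
  have "qv T (\<lambda>k s. H0 k s \<omega> x) = qv T (\<lambda>k s. H k s \<omega> x)" for x
    by (rule qv_cong) (simp add: H0_def True)
  then have "phi N H0 T \<omega> = phi N H T \<omega>" by (simp add: phi_def nrm_def)
  then show ?thesis using H_int[OF True] by simp
qed (simp add: H0_def phi_def nrm_def)

lemma G0_section:
  assumes \<omega>: "\<omega> \<in> space M"
  shows "(\<lambda>z. G0 (fst z) \<omega> (snd z)) \<in> borel_measurable (lborel \<Otimes>\<^sub>M N)"
  using predX_section[OF G0_predX \<omega>] by (simp cong: measurable_cong_sets)

lemma G0_path_integrable:
  assumes "\<omega> \<in> space M" "x \<in> space N"
  shows "integrable lborel (\<lambda>s. G0 s \<omega> x)"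
proof (cases "\<omega> \<in> A")
  case True
  show ?thesis
  proof (rule integrableI_bounded)
    show "(\<lambda>s. G0 s \<omega> x) \<in> borel_measurable lborel" using predX_path[OF G0_predX assms] by simp
    have "(\<integral>\<^sup>+s. ennreal (norm (G0 s \<omega> x)) \<partial>lborel) = (\<integral>\<^sup>+s\<in>{0<..T}. ennreal \<bar>G s \<omega> x\<bar> \<partial>lborel)"
      by (intro nn_integral_cong) (simp add: G0_def True indicator_def)
    then show "(\<integral>\<^sup>+s. ennreal (norm (G0 s \<omega> x)) \<partial>lborel) < \<infinity>" using G_path[OF True assms(2)] by simp
  qed
qed (simp add: G0_def)

lemma G0_pair_integrable:
  assumes \<omega>: "\<omega> \<in> space M"
  shows "integrable (lborel \<Otimes>\<^sub>M N) (\<lambda>z. G0 (fst z) \<omega> (snd z))"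
proof (cases "\<omega> \<in> A")
  case True
  interpret N: finite_measure N by (rule N)
  note [measurable] = G0_section[OF \<omega>]
  show ?thesis
  proof (rule integrableI_bounded)
    have "(\<integral>\<^sup>+z. ennreal (norm (G0 (fst z) \<omega> (snd z))) \<partial>(lborel \<Otimes>\<^sub>M N))
        = (\<integral>\<^sup>+s. \<integral>\<^sup>+x. ennreal \<bar>G0 s \<omega> x\<bar> \<partial>N \<partial>lborel)"
      by (subst N.nn_integral_fst[symmetric]) simp_all
    also have "\<dots> = (\<integral>\<^sup>+s\<in>{0<..T}. (\<integral>\<^sup>+x. ennreal \<bar>G s \<omega> x\<bar> \<partial>N) \<partial>lborel)"
    proof (intro nn_integral_cong)
      fix s
      show "(\<integral>\<^sup>+x. ennreal \<bar>G0 s \<omega> x\<bar> \<partial>N) = (\<integral>\<^sup>+x. ennreal \<bar>G s \<omega> x\<bar> \<partial>N) * indicator {0<..T} s"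
        by (cases "s \<in> {0<..T}", simp add: G0_def True, subst G0_def, subst if_not_P) simp_all
    qed
    finally show "(\<integral>\<^sup>+z. ennreal (norm (G0 (fst z) \<omega> (snd z))) \<partial>(lborel \<Otimes>\<^sub>M N)) < \<infinity>"
      using G_int[OF True] by simp
  qed measurable
qed (simp add: G0_def)

lemma drift_measurable: "(\<lambda>z. drift t (fst z) (snd z)) \<in> borel_measurable (M \<Otimes>\<^sub>M N)"
proof -
  have [measurable]: "(\<lambda>z. G0 (snd z) (fst (fst z)) (snd (fst z))) \<in> borel_measurable ((M \<Otimes>\<^sub>M N) \<Otimes>\<^sub>M lborel)"
    using predX_measurable[OF G0_predX] by (simp cong: measurable_cong_sets)
  show ?thesis
    unfolding drift_def set_lebesgue_integral_def
    by (rule lborel.borel_measurable_lebesgue_integral) (simp add: case_prod_beta')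
qed

lemma drift_continuous: "\<omega> \<in> space M \<Longrightarrow> x \<in> space N \<Longrightarrow> continuous_on {0..T} (\<lambda>t. drift t \<omega> x)"
  unfolding drift_def by (rule continuous_on_integral_upto[OF G0_path_integrable])

text \<open>The supremum of the drift over time is dominated by the time integral of
  \<open>\<bar>G0\<bar>\<close>, so Tonelli's theorem reduces the claim to
  \<open>G0_pair_integrable\<close>.\<close>

lemma drift_supn_finite:
  assumes \<omega>: "\<omega> \<in> space M"
  shows "(\<integral>\<^sup>+x. supn T (\<lambda>t. drift t \<omega> x) \<partial>N) < \<infinity>"
proof -
  interpret N: finite_measure N by (rule N)
  interpret LN: pair_sigma_finite lborel N ..
  note [measurable] = G0_section[OF \<omega>]
  have "(\<integral>\<^sup>+x. supn T (\<lambda>t. drift t \<omega> x) \<partial>N) \<le> (\<integral>\<^sup>+x. \<integral>\<^sup>+s. ennreal \<bar>G0 s \<omega> x\<bar> \<partial>lborel \<partial>N)"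
  proof (rule nn_integral_mono)
    fix x
    show "supn T (\<lambda>t. drift t \<omega> x) \<le> (\<integral>\<^sup>+s. ennreal \<bar>G0 s \<omega> x\<bar> \<partial>lborel)"
      unfolding supn_def
    proof (rule SUP_least)
      fix t
      have "ennreal \<bar>drift t \<omega> x\<bar> \<le> (\<integral>\<^sup>+s. ennreal \<bar>indicator {0<..t} s *\<^sub>R G0 s \<omega> x\<bar> \<partial>lborel)"
        unfolding drift_def set_lebesgue_integral_def by (rule ennreal_abs_integral_le)
      also have "\<dots> \<le> (\<integral>\<^sup>+s. ennreal \<bar>G0 s \<omega> x\<bar> \<partial>lborel)"
        by (intro nn_integral_mono ennreal_leI) (simp add: indicator_def)
      finally show "ennreal \<bar>drift t \<omega> x\<bar> \<le> (\<integral>\<^sup>+s. ennreal \<bar>G0 s \<omega> x\<bar> \<partial>lborel)" .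
    qed
  qed
  also have "\<dots> = (\<integral>\<^sup>+z. ennreal \<bar>G0 (fst z) \<omega> (snd z)\<bar> \<partial>(lborel \<Otimes>\<^sub>M N))"
    by (subst LN.nn_integral_snd[symmetric]) simp_all
  also have "\<dots> < \<infinity>"
    using G0_pair_integrable[OF \<omega>] by (simp add: integrable_iff_bounded)
  finally show ?thesis .
qed

lemma drift_mean:
  assumes \<omega>: "\<omega> \<in> A"
    and t: "0 \<le> t" "t \<le> T"
  shows "integrable N (drift t \<omega>)" and "(\<integral>x. drift t \<omega> x \<partial>N) = (LINT s:{0<..t}|lborel. g s \<omega>)"
proof -
  have \<omega>': "\<omega> \<in> space M" using \<omega> sets.sets_into_space[OF A(1)] by blast
  interpret N: finite_measure N by (rule N)
  interpret LN: pair_sigma_finite lborel N ..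
  have int: "integrable (lborel \<Otimes>\<^sub>M N) (\<lambda>(s, x). indicator {0<..t} s *\<^sub>R G0 s \<omega> x)"
  proof (rule Bochner_Integration.integrable_bound[OF G0_pair_integrable[OF \<omega>']])
    note [measurable] = G0_section[OF \<omega>']
    show "(\<lambda>(s, x). indicator {0<..t} s *\<^sub>R G0 s \<omega> x) \<in> borel_measurable (lborel \<Otimes>\<^sub>M N)"
      unfolding case_prod_beta' by measurable
  qed (auto simp: indicator_def)
  show "integrable N (drift t \<omega>)"
    unfolding drift_def[abs_def] set_lebesgue_integral_def using LN.integrable_snd[OF int] .
  have "(\<integral>x. drift t \<omega> x \<partial>N) = (\<integral>s. \<integral>x. indicator {0<..t} s *\<^sub>R G0 s \<omega> x \<partial>N \<partial>lborel)"
    unfolding drift_def set_lebesgue_integral_def by (rule LN.Fubini_integral[OF int])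
  also have "\<dots> = (LINT s:{0<..t}|lborel. g s \<omega>)"
    unfolding set_lebesgue_integral_def
    by (intro Bochner_Integration.integral_cong refl) (use t \<omega> g[OF \<omega>'] in \<open>simp add: indicator_def G0_def\<close>)
  finally show "(\<integral>x. drift t \<omega> x \<partial>N) = (LINT s:{0<..t}|lborel. g s \<omega>)" .
qed

lemma H_component_predictable:
  assumes x: "x \<in> space N"
  shows "(\<lambda>(\<omega>, s). H k s \<omega> x) \<in> borel_measurable (\<P>)"
proof -
  have "(\<lambda>z. (z, x)) \<in> \<P> \<rightarrow>\<^sub>M \<P> \<Otimes>\<^sub>M N" using x by measurable
  from measurable_compose[OF this H_pred[of k]] show ?thesis by (simp add: case_prod_beta')
qed

lemma H_mean_predictable: "(\<lambda>(\<omega>, s). h k s \<omega>) \<in> borel_measurable (\<P>)"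
proof -
  interpret N: finite_measure N by (rule N)
  have "(\<lambda>z. \<integral>x. H k (snd z) (fst z) x \<partial>N) \<in> borel_measurable (\<P>)"
    using H_pred[of k] by (intro N.borel_measurable_lebesgue_integral) (simp add: case_prod_beta')
  then show ?thesis
    by (rule measurable_cong[THEN iffD1, rotated]) (auto simp: space_predictable_upto h)
qed

lemma H_mean_integrable:
  assumes \<omega>: "\<omega> \<in> A"
  shows "AE s in lborel. s \<in> {0<..T} \<longrightarrow> integrable N (H k s \<omega>)"
proof -
  have \<omega>': "\<omega> \<in> space M" using \<omega> sets.sets_into_space[OF A(1)] by blast
  have "AE s in lborel. s \<in> {0<..T} \<longrightarrow> integrable N (H0 k s \<omega>)"
    by (rule mean_integrable_AE[OF finite_measure.axioms(1)[OF N] predX_section[OF H0_predX \<omega>'] H0_qv])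
      (assumption, rule H0_phi[unfolded phi_def])
  then show ?thesis
  proof eventually_elim
    case (elim s)
    show ?case
    proof
      assume "s \<in> {0<..T}"
      then have "H0 k s \<omega> = H k s \<omega>" using \<omega> by (auto simp: H0_def)
      then show "integrable N (H k s \<omega>)" using elim \<open>s \<in> {0<..T}\<close> by simp
    qed
  qed
qed

text \<open>The constructed solution is the drift plus the version \<open>S\<close> of the integral
  of \<open>H0\<close>. On the full event \<open>A\<close> the integrands \<open>H0\<close> and
  \<open>H\<close> agree on (0, T], so \<open>ito_series_eq\<close> identifies \<open>S\<close> with
  the series of \<open>H\<close> at each x, and the integral \<open>J\<close> of the mean of
  \<open>H0\<close> with the series of \<open>h\<close>. \<open>stochastic_fubini\<close> links
  \<open>J\<close> and \<open>S\<close>.\<close>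

lemma fubini_solution:
  obtains F where
    "\<And>t. 0 \<le> t \<Longrightarrow> t \<le> T \<Longrightarrow> (\<lambda>z. F t (fst z) (snd z)) \<in> borel_measurable (M \<Otimes>\<^sub>M N)"
    "\<And>\<omega> x. \<omega> \<in> space M \<Longrightarrow> x \<in> space N \<Longrightarrow> continuous_on {0..T} (\<lambda>t. F t \<omega> x)"
    "\<And>x. x \<in> space N \<Longrightarrow> ito_series_converges M \<F> W T (\<lambda>k s \<omega>. H k s \<omega> x)"
    "\<And>x. x \<in> space N \<Longrightarrow> AE \<omega> in M. \<forall>t\<in>{0..T}.
      F t \<omega> x = (LINT s:{0<..t}|lborel. G s \<omega> x) + ito_series M \<F> W T (\<lambda>k s \<omega>. H k s \<omega> x) t \<omega>"
    "ito_series_converges M \<F> W T h"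
    "AE \<omega> in M. (\<integral>\<^sup>+x. supn T (\<lambda>t. F t \<omega> x) \<partial>N) < \<infinity>"
    "AE \<omega> in M. \<forall>t\<in>{0..T}. integrable N (F t \<omega>) \<and> (\<integral>x. F t \<omega> x \<partial>N) =
      (LINT s:{0<..t}|lborel. g s \<omega>) + ito_series M \<F> W T h t \<omega>"
proof -
  obtain S where S: "\<And>t. 0 \<le> t \<Longrightarrow> t \<le> T \<Longrightarrow> (\<lambda>z. S t (fst z) (snd z)) \<in> borel_measurable (M \<Otimes>\<^sub>M N)"
    and Sv: "\<And>x. x \<in> space N \<Longrightarrow> vito (\<lambda>k s \<omega>. H0 k s \<omega> x) (\<lambda>t \<omega>. S t \<omega> x)"
    by (rule vito_exists[OF H0_predX H0_qv]) (assumption, blast intro: that)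
  have Sc: "continuous_on {0..T} (\<lambda>t. S t \<omega> x)" if "\<omega> \<in> space M" "x \<in> space N" for \<omega> x
    by (rule cadaptedD(1)[OF vito_cadapted[OF Sv[OF that(2)]] that(1)])
  define F where "F t \<omega> x = drift t \<omega> x + S t \<omega> x" for t \<omega> x
  note * = finite_measure.axioms(1)[OF N] H0_predX H0_qv H0_phi S Sv
  have 1: "(\<lambda>z. F t (fst z) (snd z)) \<in> borel_measurable (M \<Otimes>\<^sub>M N)" if "0 \<le> t" "t \<le> T" for t
  proof -
    note [measurable] = drift_measurable[of t] S[OF that]
    show ?thesis unfolding F_def by measurable
  qed
  have 2: "continuous_on {0..T} (\<lambda>t. F t \<omega> x)" if "\<omega> \<in> space M" "x \<in> space N" for \<omega> x
    unfolding F_def by (intro continuous_on_add drift_continuous Sc that)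
  have x_qv: "AE \<omega> in M. qv T (\<lambda>k s. H k s \<omega> x) < \<infinity>" if "x \<in> space N" for x
    using A(2) by eventually_elim (rule H_path[OF _ that])
  have x_vito: "vito (\<lambda>k. cut (\<lambda>s \<omega>. H k s \<omega> x)) (\<lambda>t \<omega>. S t \<omega> x)" if x: "x \<in> space N" for x
  proof (rule vito_AE_cong[OF Sv[OF x] pred1_fmeas[OF cut_pred1[OF H_component_predictable[OF x]]]])
    show "AE \<omega> in M. qv T (\<lambda>k s. cut (\<lambda>s \<omega>. H k s \<omega> x) s \<omega> - H0 k s \<omega> x) = 0"
      using A(2)
    proof eventually_elim
      case (elim \<omega>)
      have "(\<lambda>k s. cut (\<lambda>s \<omega>. H k s \<omega> x) s \<omega> - H0 k s \<omega> x) = (\<lambda>k s. 0)"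
        using elim by (intro ext) (simp add: cut_def H0_def)
      then show ?case by simp
    qed
  qed
  have 3: "ito_series_converges M \<F> W T (\<lambda>k s \<omega>. H k s \<omega> x)" if x: "x \<in> space N" for x
    by (rule ito_series_eq(1)[OF H_component_predictable[OF x] x_qv[OF x] x_vito[OF x]])
  have 4: "AE \<omega> in M. \<forall>t\<in>{0..T}.
      F t \<omega> x = (LINT s:{0<..t}|lborel. G s \<omega> x) + ito_series M \<F> W T (\<lambda>k s \<omega>. H k s \<omega> x) t \<omega>" if x: "x \<in> space N" for x
    using ito_series_eq(2)[OF H_component_predictable[OF x] x_qv[OF x] x_vito[OF x]] A(2)
  proof eventually_elim
    case (elim \<omega>)
    show ?case
    proof
      fix t assume t: "t \<in> {0..T}"
      have "drift t \<omega> x = (LINT s:{0<..t}|lborel. G s \<omega> x)"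
        unfolding drift_def set_lebesgue_integral_def
        by (intro Bochner_Integration.integral_cong refl) (use t elim(2) in \<open>simp add: indicator_def G0_def\<close>)
      with elim(1) t show "F t \<omega> x = (LINT s:{0<..t}|lborel. G s \<omega> x) + ito_series M \<F> W T (\<lambda>k s \<omega>. H k s \<omega> x) t \<omega>"
        by (simp add: F_def)
    qed
  qed
  have H0_eq: "H0 k s \<omega> = H k s \<omega>" if "\<omega> \<in> A" "0 < s" "s \<le> T" for k s \<omega>
    using that by (intro ext) (simp add: H0_def)
  have mean_qv: "AE \<omega> in M. qv T (\<lambda>k s. \<integral>x. H0 k s \<omega> x \<partial>N) < \<infinity>"
    by (rule AE_I2) (rule mean_qv_fin[OF N H0_predX H0_qv H0_phi])
  obtain J where J: "vito (\<lambda>k s \<omega>. \<integral>x. H0 k s \<omega> x \<partial>N) J"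
    by (rule vito_exists_AE[OF predX_mean[OF finite_measure.axioms(1)[OF N] H0_predX] mean_qv])
  have m_qv: "AE \<omega> in M. qv T (\<lambda>k s. h k s \<omega>) < \<infinity>"
    using A(2) mean_qv AE_space
  proof eventually_elim
    case (elim \<omega>)
    have "qv T (\<lambda>k s. h k s \<omega>) = qv T (\<lambda>k s. \<integral>x. H0 k s \<omega> x \<partial>N)"
      by (rule qv_cong) (simp add: H0_eq[OF elim(1)] h[OF elim(3)])
    then show ?case using elim(2) by simp
  qed
  have m_vito: "vito (\<lambda>k. cut (h k)) J"
  proof (rule vito_AE_cong[OF J pred1_fmeas[OF cut_pred1[OF H_mean_predictable]]])
    show "AE \<omega> in M. qv T (\<lambda>k s. cut (h k) s \<omega> - (\<integral>x. H0 k s \<omega> x \<partial>N)) = 0"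
      using A(2) AE_space
    proof eventually_elim
      case (elim \<omega>)
      have "qv T (\<lambda>k s. cut (h k) s \<omega> - (\<integral>x. H0 k s \<omega> x \<partial>N)) = qv T (\<lambda>k s. 0)"
        by (rule qv_cong) (simp add: cut_def H0_eq[OF elim(1)] h[OF elim(2)])
      then show ?case by simp
    qed
  qed
  have 5: "ito_series_converges M \<F> W T h"
    by (rule ito_series_eq(1)[OF H_mean_predictable m_qv m_vito])
  have 6: "AE \<omega> in M. (\<integral>\<^sup>+x. supn T (\<lambda>t. F t \<omega> x) \<partial>N) < \<infinity>"
  proof -
    have "AE \<omega> in M. (\<integral>\<^sup>+x. supn T (\<lambda>t. S t \<omega> x) \<partial>N) < \<infinity>"
      by (rule integral_supn_finite[OF *])
    then show ?thesis using AE_space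
    proof eventually_elim
      case (elim \<omega>)
      have [measurable]: "(\<lambda>x. supn T (\<lambda>t. drift t \<omega> x)) \<in> borel_measurable N" "(\<lambda>x. supn T (\<lambda>t. S t \<omega> x)) \<in> borel_measurable N"
      proof -
        have d: "(\<lambda>x. drift t \<omega> x) \<in> borel_measurable N" for t
          using measurable_compose[OF measurable_Pair1'[OF elim(2)] drift_measurable[of t]] by simp
        have s: "(\<lambda>x. S t \<omega> x) \<in> borel_measurable N" if "t \<in> {0..T}" for t
          using measurable_compose[OF measurable_Pair1'[OF elim(2)] S[of t]] that by simp
        show "(\<lambda>x. supn T (\<lambda>t. drift t \<omega> x)) \<in> borel_measurable N" by (rule supn_measurable[OF drift_continuous[OF elim(2)] d])
        show "(\<lambda>x. supn T (\<lambda>t. S t \<omega> x)) \<in> borel_measurable N" by (rule supn_measurable[OF Sc[OF elim(2)] s])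
      qed
      have "(\<integral>\<^sup>+x. supn T (\<lambda>t. F t \<omega> x) \<partial>N) \<le> (\<integral>\<^sup>+x. supn T (\<lambda>t. drift t \<omega> x) + supn T (\<lambda>t. S t \<omega> x) \<partial>N)"
        unfolding F_def by (intro nn_integral_mono supn_add_le)
      also have "\<dots> = (\<integral>\<^sup>+x. supn T (\<lambda>t. drift t \<omega> x) \<partial>N) + (\<integral>\<^sup>+x. supn T (\<lambda>t. S t \<omega> x) \<partial>N)"
        by (rule nn_integral_add) measurable
      also have "\<dots> < \<infinity>" using elim(1) drift_supn_finite[OF elim(2)] by simp
      finally show ?case .
    qed
  qed
  have 7: "AE \<omega> in M. \<forall>t\<in>{0..T}. integrable N (F t \<omega>) \<and> (\<integral>x. F t \<omega> x \<partial>N) =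
      (LINT s:{0<..t}|lborel. g s \<omega>) + ito_series M \<F> W T h t \<omega>"
  proof -
    have "AE \<omega> in M. \<forall>t\<in>{0..T}. integrable N (S t \<omega>) \<and> J t \<omega> = (\<integral>x. S t \<omega> x \<partial>N)"
      by (rule stochastic_fubini[OF N H0_predX H0_qv H0_phi S Sv J])
    then show ?thesis using ito_series_eq(2)[OF H_mean_predictable m_qv m_vito] A(2)
    proof eventually_elim
      case (elim \<omega>)
      show ?case
      proof
        fix t assume t: "t \<in> {0..T}"
        note d = drift_mean[OF elim(3), of t]
        have s: "integrable N (S t \<omega>)" "J t \<omega> = (\<integral>x. S t \<omega> x \<partial>N)"
          and j: "ito_series M \<F> W T h t \<omega> = J t \<omega>"
          using elim(1,2) t by blast+
        have "F t \<omega> = (\<lambda>x. drift t \<omega> x + S t \<omega> x)" by (intro ext) (simp add: F_def)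
        then show "integrable N (F t \<omega>) \<and> (\<integral>x. F t \<omega> x \<partial>N) =
            (LINT s:{0<..t}|lborel. g s \<omega>) + ito_series M \<F> W T h t \<omega>"
          using d s t by (simp add: j)
      qed
    qed
  qed
  show thesis
    by (rule that[of F]) (rule 1 2 3 4 5 6 7; assumption?)+
qed

end

end

section \<open>Lebesgue measure on a Borel set and the space \<open>\<ell>\<^sub>2\<close>\<close>

lemma complete_restrict_space:
  assumes "complete_measure M" and \<Omega>: "\<Omega> \<in> sets M"
  shows "complete_measure (restrict_space M \<Omega>)"
proof
  interpret complete_measure M by fact
  fix A B assume "B \<subseteq> A" "A \<in> null_sets (restrict_space M \<Omega>)"
  then have "B \<subseteq> \<Omega>" "B \<in> sets M"
    using complete[of B A] by (auto simp: null_sets_restrict_space[OF \<Omega>])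
  then show "B \<in> sets (restrict_space M \<Omega>)" using \<Omega> by (simp add: sets_restrict_space_iff)
qed

context
  fixes \<Gamma> :: "'b :: euclidean_space set"
  assumes \<Gamma>: "\<Gamma> \<in> sets borel"
begin

lemma complete_lebesgue_on: "complete_measure (lebesgue_on \<Gamma>)"
proof (rule complete_restrict_space)
  show "complete_measure lebesgue" ..
  show "\<Gamma> \<in> sets lebesgue" using \<Gamma> by simp
qed

lemma AE_lebesgue_on: "(AE x in restrict_space lborel \<Gamma>. P x) \<Longrightarrow> (AE x in lebesgue_on \<Gamma>. P x)"
  using \<Gamma> by (simp add: AE_restrict_space_iff AE_completion)

lemma sub_lebesgue_on:
  shows "sets (restrict_space lborel \<Gamma>) \<subseteq> sets (lebesgue_on \<Gamma>)"
    and "space (restrict_space lborel \<Gamma>) = space (lebesgue_on \<Gamma>)"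
    and "\<And>A. A \<in> sets (restrict_space lborel \<Gamma>) \<Longrightarrow> emeasure (restrict_space lborel \<Gamma>) A = emeasure (lebesgue_on \<Gamma>) A"
  using \<Gamma> by (auto simp: sets_restrict_space space_restrict_space emeasure_restrict_space)

lemma measurable_lebesgue_on: "f \<in> borel_measurable (restrict_space lborel \<Gamma>) \<Longrightarrow> f \<in> borel_measurable (lebesgue_on \<Gamma>)"
  using sub_lebesgue_on(1,2) by (auto simp: measurable_def)

lemma nn_integral_lebesgue_on: "(\<integral>\<^sup>+x\<in>\<Gamma>. f x \<partial>lebesgue) = (\<integral>\<^sup>+x. f x \<partial>restrict_space lborel \<Gamma>)"
  using \<Gamma> by (simp add: nn_integral_completion nn_integral_restrict_space)

lemma set_lebesgue_on:
  fixes f :: "'b \<Rightarrow> real"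
  shows "set_integrable lebesgue \<Gamma> f \<longleftrightarrow> integrable (lebesgue_on \<Gamma>) f"
    and "(LINT x:\<Gamma>|lebesgue. f x) = (\<integral>x. f x \<partial>lebesgue_on \<Gamma>)"
  using \<Gamma> by (simp_all add: set_integrable_def set_lebesgue_integral_def integrable_restrict_space integral_restrict_space)

lemma set_integral_lborel_on:
  fixes f :: "'b \<Rightarrow> real"
  assumes f: "f \<in> borel_measurable (restrict_space lborel \<Gamma>)"
  shows "set_integrable lebesgue \<Gamma> f \<longleftrightarrow> integrable (restrict_space lborel \<Gamma>) f"
    and "(LINT x:\<Gamma>|lebesgue. f x) = (\<integral>x. f x \<partial>restrict_space lborel \<Gamma>)"
  unfolding set_lebesgue_on
  using integrable_subalgebra[OF f sub_lebesgue_on] integral_subalgebra[OF f sub_lebesgue_on]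
  by simp_all

text \<open>For an arbitrary solution only almost everywhere equality with a Borel section is
  available. Completeness of Lebesgue measure on \<Gamma> then supplies measurability, integrability
  and the value of the integral.\<close>

lemma set_integral_AE_lborel_on:
  fixes f g :: "'b \<Rightarrow> real"
  assumes g: "integrable (restrict_space lborel \<Gamma>) g" and eq: "AE x in restrict_space lborel \<Gamma>. f x = g x"
  shows "set_integrable lebesgue \<Gamma> f \<and> (LINT x:\<Gamma>|lebesgue. f x) = (\<integral>x. g x \<partial>restrict_space lborel \<Gamma>)"
proof -
  have gm: "g \<in> borel_measurable (restrict_space lborel \<Gamma>)" using g by (rule borel_measurable_integrable)
  note eq' = AE_lebesgue_on[OF eq]
  have f: "f \<in> borel_measurable (lebesgue_on \<Gamma>)"
    by (rule complete_measure.borel_measurable_AE_cong[OF complete_lebesgue_on measurable_lebesgue_on[OF gm] eq'])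
  have gi: "integrable (lebesgue_on \<Gamma>) g" using g set_integral_lborel_on(1)[OF gm] by (simp add: set_lebesgue_on)
  have "integrable (lebesgue_on \<Gamma>) f"
    using integrable_cong_AE[OF f measurable_lebesgue_on[OF gm] eq'] gi by simp
  moreover have "(\<integral>x. f x \<partial>lebesgue_on \<Gamma>) = (\<integral>x. g x \<partial>lebesgue_on \<Gamma>)"
    by (rule integral_cong_AE[OF f measurable_lebesgue_on[OF gm] eq'])
  ultimately show ?thesis
    using set_integral_lborel_on(2)[OF gm] by (simp add: set_lebesgue_on)
qed

end

section \<open>Components and norms of square summable sequences\<close>

lemma ell2_diff:
  assumes "a \<in> ell2" "b \<in> ell2"
  shows "(\<lambda>k. a k - b k) \<in> ell2"
proof -
  have "summable (\<lambda>k. 2 * (a k)\<^sup>2 + 2 * (b k)\<^sup>2)"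
    using assms unfolding ell2_def by (intro summable_add summable_mult) simp_all
  then have "summable (\<lambda>k. (a k - b k)\<^sup>2)"
  proof (rule summable_comparison_test_ev[rotated], intro always_eventually allI)
    fix k show "norm ((a k - b k)\<^sup>2) \<le> 2 * (a k)\<^sup>2 + 2 * (b k)\<^sup>2"
      using sum_square_le[of "a k" "- b k"] by simp
  qed
  then show ?thesis by (simp add: ell2_def)
qed

lemma abs_le_ell2_norm:
  assumes "a \<in> ell2"
  shows "\<bar>a k\<bar> \<le> ell2_norm a"
proof -
  have "(\<Sum>i\<in>{k}. (a i)\<^sup>2) \<le> (\<Sum>i. (a i)\<^sup>2)"
    using assms unfolding ell2_def by (intro sum_le_suminf) simp_all
  then have "sqrt ((a k)\<^sup>2) \<le> ell2_norm a" unfolding ell2_norm_def by (intro real_sqrt_le_mono) simp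
  then show ?thesis by simp
qed

lemma space_ell2_borel: "space ell2_borel = ell2"
  unfolding ell2_borel_def by (rule space_measure_of) (auto simp: ell2_open_def)

text \<open>Coordinates are 1-Lipschitz for the norm, so preimages of open sets are open.
  Measurability of the sequence-valued integrand thereby passes to each component.\<close>

lemma ell2_component: "(\<lambda>a. a k) \<in> borel_measurable ell2_borel"
proof (rule borel_measurableI)
  fix U :: "real set" assume U: "open U"
  have "ell2_open {a \<in> ell2. a k \<in> U}"
    unfolding ell2_open_def
  proof (intro conjI ballI)
    fix a assume a: "a \<in> {a \<in> ell2. a k \<in> U}"
    then obtain e where e: "0 < e" "ball (a k) e \<subseteq> U" using U unfolding open_contains_ball by blast
    have "b k \<in> U" if "b \<in> ell2" "ell2_norm (\<lambda>k. b k - a k) < e" for b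
    proof -
      have "\<bar>b k - a k\<bar> < e" using abs_le_ell2_norm[OF ell2_diff[OF that(1)], of a k] a that(2) by simp
      then show ?thesis using e(2) by (auto simp: dist_real_def abs_minus_commute)
    qed
    then show "\<exists>e>0. \<forall>b\<in>ell2. ell2_norm (\<lambda>k. b k - a k) < e \<longrightarrow> b \<in> {a \<in> ell2. a k \<in> U}"
      using e(1) by blast
  qed blast
  then have "{a \<in> ell2. a k \<in> U} \<in> sets ell2_borel"
    unfolding ell2_borel_def by (subst sets_measure_of) (auto simp: ell2_open_def)
  moreover have "(\<lambda>a. a k) -` U \<inter> space ell2_borel = {a \<in> ell2. a k \<in> U}"
    by (auto simp: space_ell2_borel)
  ultimately show "(\<lambda>a. a k) -` U \<inter> space ell2_borel \<in> sets ell2_borel" by simp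
qed

lemma ell2_norm_square: "a \<in> ell2 \<Longrightarrow> (\<Sum>k. ennreal ((a k)\<^sup>2)) = ennreal ((ell2_norm a)\<^sup>2)"
  by (simp add: ell2_def ell2_norm_def suminf_nonneg suminf_ennreal2)

text \<open>Connects the bracket with hypotheses (ii) and (iii). The second identity holds for an
  infinite bracket as well: the Bochner integral and \<open>enn2real\<close> then both give
  0.\<close>

lemma qv_ell2:
  assumes m: "\<And>k. (\<lambda>s. if 0 < s \<and> s \<le> T then p k s else 0) \<in> borel_measurable borel"
    and p: "\<And>s. 0 < s \<Longrightarrow> s \<le> T \<Longrightarrow> (\<lambda>k. p k s) \<in> ell2"
  shows "qv T p = (\<integral>\<^sup>+s\<in>{0<..T}. ennreal ((ell2_norm (\<lambda>k. p k s))\<^sup>2) \<partial>lborel)"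
    and "nrm T p = sqrt (LINT s:{0<..T}|lborel. (ell2_norm (\<lambda>k. p k s))\<^sup>2)"
proof -
  define q where "q k s = (if 0 < s \<and> s \<le> T then p k s else 0)" for k s
  have qm [measurable]: "q k \<in> borel_measurable borel" for k unfolding q_def[abs_def] by (rule m)
  have sq: "(\<Sum>k. ennreal ((q k s)\<^sup>2)) * indicator {0<..T} s = ennreal ((ell2_norm (\<lambda>k. p k s))\<^sup>2) * indicator {0<..T} s" for s
  proof (cases "0 < s \<and> s \<le> T")
    case True
    then have qp: "q k s = p k s" for k by (simp add: q_def)
    have "(\<lambda>k. p k s) \<in> ell2" by (rule p) (rule True[THEN conjunct1] True[THEN conjunct2])+
    then show ?thesis unfolding qp by (simp only: ell2_norm_square)
  next
    case False
    then have "s \<notin> {0<..T}" by simp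
    then show ?thesis by simp
  qed
  have "qv T p = qv T q" by (rule qv_cong) (simp add: q_def)
  also have "\<dots> = (\<integral>\<^sup>+s. (\<Sum>k. ennreal ((q k s)\<^sup>2)) * indicator {0<..T} s \<partial>lborel)" by (rule qv_eq_integral[OF qm])
  finally show qv: "qv T p = (\<integral>\<^sup>+s\<in>{0<..T}. ennreal ((ell2_norm (\<lambda>k. p k s))\<^sup>2) \<partial>lborel)" by (simp only: sq)
  have eq: "indicator {0<..T} s *\<^sub>R (ell2_norm (\<lambda>k. p k s))\<^sup>2 = (\<Sum>k. (q k s)\<^sup>2)" for s
  proof (cases "0 < s \<and> s \<le> T")
    case True
    then have qp: "q k s = p k s" for k by (simp add: q_def)
    have "(\<lambda>k. p k s) \<in> ell2" by (rule p) (rule True[THEN conjunct1] True[THEN conjunct2])+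
    then have "0 \<le> (\<Sum>k. (p k s)\<^sup>2)" unfolding ell2_def by (intro suminf_nonneg) simp_all
    moreover have "indicator {0<..T} s = (1::real)" using True by simp
    ultimately show ?thesis unfolding qp ell2_norm_def by simp
  next
    case False
    then have "q k s = 0" for k by (auto simp: q_def)
    moreover from False have "s \<notin> {0<..T}" by simp
    ultimately show ?thesis by simp
  qed
  have 1: "(\<lambda>s. indicator {0<..T} s *\<^sub>R (ell2_norm (\<lambda>k. p k s))\<^sup>2) \<in> borel_measurable lborel"
    unfolding eq by measurable
  have "(LINT s:{0<..T}|lborel. (ell2_norm (\<lambda>k. p k s))\<^sup>2)
      = enn2real (\<integral>\<^sup>+s. ennreal (indicator {0<..T} s *\<^sub>R (ell2_norm (\<lambda>k. p k s))\<^sup>2) \<partial>lborel)"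
    unfolding set_lebesgue_integral_def by (rule integral_eq_nn_integral[OF 1 AE_I2]) simp
  also have "(\<integral>\<^sup>+s. ennreal (indicator {0<..T} s *\<^sub>R (ell2_norm (\<lambda>k. p k s))\<^sup>2) \<partial>lborel) = qv T p"
    unfolding qv by (intro nn_integral_cong) (simp split: split_indicator)
  finally show "nrm T p = sqrt (LINT s:{0<..T}|lborel. (ell2_norm (\<lambda>k. p k s))\<^sup>2)" by (simp add: nrm_def)
qed

text \<open>\<open>f\<close> is measurable only for the completed product, so it is replaced by a
  product-measurable \<open>f'\<close> equal to it off a null set \<open>Z\<close>. Almost all
  sections of \<open>Z\<close> are null in either direction, which moves the equation from
  \<open>f\<close> to \<open>f'\<close>, through the exchange of quantifiers, and back.\<close>

lemma (in pair_sigma_finite) AE_eq_commute: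
  fixes f :: "'a \<Rightarrow> 'b \<Rightarrow> real"
  assumes f: "(\<lambda>(x, y). f x y) \<in> borel_measurable (completion (M1 \<Otimes>\<^sub>M M2))"
    and g [measurable]: "(\<lambda>z. g (fst z) (snd z)) \<in> borel_measurable (M1 \<Otimes>\<^sub>M M2)"
    and eq: "\<And>y. y \<in> space M2 \<Longrightarrow> AE x in M1. f x y = g x y"
  shows "AE x in M1. AE y in M2. f x y = g x y"
proof -
  obtain f' where f' [measurable]: "f' \<in> borel_measurable (M1 \<Otimes>\<^sub>M M2)" and ff: "AE z in M1 \<Otimes>\<^sub>M M2. (case z of (x, y) \<Rightarrow> f x y) = f' z"
    using completion_ex_borel_measurable_real[OF f] by blast
  from ff obtain Z where Z: "{z \<in> space (M1 \<Otimes>\<^sub>M M2). (case z of (x, y) \<Rightarrow> f x y) \<noteq> f' z} \<subseteq> Z"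
    "emeasure (M1 \<Otimes>\<^sub>M M2) Z = 0" "Z \<in> sets (M1 \<Otimes>\<^sub>M M2)" by (rule AE_E)
  have "AE z in M1 \<Otimes>\<^sub>M M2. z \<notin> Z" using Z(2,3) by (intro AE_not_in) (simp add: null_sets_def)
  from AE_pair[OF this] have 1: "AE x in M1. AE y in M2. (x, y) \<notin> Z" .
  have "{z \<in> space (M1 \<Otimes>\<^sub>M M2). (fst z, snd z) \<notin> Z} \<in> sets (M1 \<Otimes>\<^sub>M M2)" using Z(3) by measurable
  from AE_commute[OF this] 1 have 2: "AE y in M2. AE x in M1. (x, y) \<notin> Z" by simp
  have out: "f x y = f' (x, y)" if "x \<in> space M1" "y \<in> space M2" "(x, y) \<notin> Z" for x y
    using that Z(1) by (auto simp: space_pair_measure)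
  have "AE y in M2. AE x in M1. f' (x, y) = g x y"
    using 2 AE_space
  proof eventually_elim
    case (elim y)
    show ?case using elim(1) eq[OF elim(2)] AE_space
      by eventually_elim (use out elim(2) in simp)
  qed
  moreover have "{z \<in> space (M1 \<Otimes>\<^sub>M M2). f' (fst z, snd z) = g (fst z) (snd z)} \<in> sets (M1 \<Otimes>\<^sub>M M2)" by measurable
  ultimately have "AE x in M1. AE y in M2. f' (x, y) = g x y" using AE_commute by fastforce
  then show ?thesis using 1 AE_space
  proof eventually_elim
    case (elim x)
    show ?case using elim(1,2) AE_space by eventually_elim (use out elim(3) in simp)
  qed
qed

theorem lemma2p6:
  fixes M :: "'a measure"
    and \<F> :: "real \<Rightarrow> 'a measure"
    and w :: "nat \<Rightarrow> real \<Rightarrow> 'a \<Rightarrow> real"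
    and \<Gamma> :: "(real ^ 'd) set"
    and T :: real
    and G :: "real \<Rightarrow> 'a \<Rightarrow> real ^ 'd \<Rightarrow> real"
    and H :: "nat \<Rightarrow> real \<Rightarrow> 'a \<Rightarrow> real ^ 'd \<Rightarrow> real"
  assumes "prob_space M" and "complete_measure M"
    and "complete_filtration M \<F>"
    and "\<And>k. wiener_process M \<F> (w k)" and "independent_processes M w"
    and "\<Gamma> \<in> sets borel" and "0 < emeasure lborel \<Gamma>" and "emeasure lborel \<Gamma> < \<infinity>"
    and "0 \<le> T"
    and i_G: "(\<lambda>((\<omega>, t), x). G t \<omega> x)
        \<in> borel_measurable (predictable_upto M \<F> T \<Otimes>\<^sub>M restrict_space borel \<Gamma>)"
    and i_H: "(\<lambda>((\<omega>, t), x) k. H k t \<omega> x)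
        \<in> measurable (predictable_upto M \<F> T \<Otimes>\<^sub>M restrict_space borel \<Gamma>) ell2_borel"
    and ii: "\<exists>\<Omega>'\<in>sets M. emeasure M \<Omega>' = 1 \<and> (\<forall>\<omega>\<in>\<Omega>'. \<forall>x\<in>\<Gamma>.
        (\<integral>\<^sup>+t\<in>{0<..T}. ennreal (\<bar>G t \<omega> x\<bar> + (ell2_norm (\<lambda>k. H k t \<omega> x))\<^sup>2) \<partial>lborel) < \<infinity>)"
    and iii: "AE \<omega> in M.
        (\<integral>\<^sup>+t\<in>{0<..T}. (\<integral>\<^sup>+x\<in>\<Gamma>. ennreal \<bar>G t \<omega> x\<bar> \<partial>lebesgue) \<partial>lborel)
        + (\<integral>\<^sup>+x\<in>\<Gamma>. ennreal (sqrt (LINT t:{0<..T}|lborel. (ell2_norm (\<lambda>k. H k t \<omega> x))\<^sup>2)) \<partial>lebesgue)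
        < \<infinity>"
  shows
    "(\<exists>F :: real \<Rightarrow> 'a \<Rightarrow> real ^ 'd \<Rightarrow> real.
        (\<lambda>((\<omega>, t), x). F t \<omega> x)
          \<in> borel_measurable ((M \<Otimes>\<^sub>M restrict_space borel {0..T}) \<Otimes>\<^sub>M restrict_space borel \<Gamma>) \<and>
        (\<forall>\<omega>\<in>space M. \<forall>x\<in>\<Gamma>. continuous_on {0..T} (\<lambda>t. F t \<omega> x)) \<and>
        (\<forall>x\<in>\<Gamma>.
          ito_series_converges M \<F> w T (\<lambda>k s \<omega>. H k s \<omega> x) \<and>
          (AE \<omega> in M. \<forall>t\<in>{0..T}.
            F t \<omega> x = (LINT s:{0<..t}|lborel. G s \<omega> x)
              + ito_series M \<F> w T (\<lambda>k s \<omega>. H k s \<omega> x) t \<omega>))) \<and>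
    (\<forall>k.
        (AE \<omega> in M. AE s in lborel. s \<in> {0<..T} \<longrightarrow> set_integrable lebesgue \<Gamma> (H k s \<omega>)) \<and>
        ito_integrable M \<F> (w k) T (\<lambda>s \<omega>. LINT x:\<Gamma>|lebesgue. H k s \<omega> x)) \<and>
    (\<forall>F. solves_pointwise M \<F> w T \<Gamma> G H F \<longrightarrow>
        (\<forall>\<rho>. countable \<rho> \<and> \<rho> \<subseteq> {0..T} \<longrightarrow>
          (AE \<omega> in M.
            (\<lambda>x. \<Squnion>t\<in>\<rho>. ennreal \<bar>F t \<omega> x\<bar>) \<in> borel_measurable (lebesgue_on \<Gamma>) \<and>
            (\<integral>\<^sup>+x\<in>\<Gamma>. (\<Squnion>t\<in>\<rho>. ennreal \<bar>F t \<omega> x\<bar>) \<partial>lebesgue) < \<infinity>)) \<and>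
        ito_series_converges M \<F> w T (\<lambda>k s \<omega>. LINT x:\<Gamma>|lebesgue. H k s \<omega> x) \<and>
        (\<forall>t\<in>{0..T}. AE \<omega> in M.
          set_integrable lebesgue \<Gamma> (F t \<omega>) \<and>
          (LINT x:\<Gamma>|lebesgue. F t \<omega> x) =
            (LINT s:{0<..t}|lborel. LINT x:\<Gamma>|lebesgue. G s \<omega> x)
            + ito_series M \<F> w T (\<lambda>k s \<omega>. LINT x:\<Gamma>|lebesgue. H k s \<omega> x) t \<omega>)) \<and>
    (\<forall>F. solves_pointwise M \<F> w T \<Gamma> G H F \<longrightarrow>
        (AE (\<omega>, x) in M \<Otimes>\<^sub>M restrict_space lborel \<Gamma>. continuous_on {0..T} (\<lambda>t. F t \<omega> x)) \<longrightarrow>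
        (AE \<omega> in M. \<forall>t\<in>{0..T}.
          set_integrable lebesgue \<Gamma> (F t \<omega>) \<and>
          (LINT x:\<Gamma>|lebesgue. F t \<omega> x) =
            (LINT s:{0<..t}|lborel. LINT x:\<Gamma>|lebesgue. G s \<omega> x)
            + ito_series M \<F> w T (\<lambda>k s \<omega>. LINT x:\<Gamma>|lebesgue. H k s \<omega> x) t \<omega>))"
proof -
  interpret prob_space M by fact
  interpret raw_wiener M \<F> w
    by (rule raw_wiener.intro[OF filtered_space.intro[OF _ filtered_space_axioms.intro] raw_wiener_axioms.intro]) fact+
  \<comment> \<open>The theory of the integral runs with paths continuous for every \<omega>, hence
    with the modification \<open>W\<close>; \<open>mod\<close> takes its conclusions back to
    \<open>w\<close>.\<close>
  obtain W where "wiener_system M \<F> W T" and Weq: "AE \<omega> in M. \<forall>k t. W k t \<omega> = w k t \<omega>"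
    by (rule modification[OF \<open>0 \<le> T\<close>])
  interpret wiener_system M \<F> W T by fact
  note mod = ito_modification[OF Weq]
  let ?N = "restrict_space lborel \<Gamma>" and ?P = "predictable_upto M \<F> T"
  have \<Gamma>: "\<Gamma> \<in> sets borel" by fact
  have N: "finite_measure ?N"
    using \<open>emeasure lborel \<Gamma> < \<infinity>\<close> \<Gamma> by (intro finite_measureI) (simp add: space_restrict_space emeasure_restrict_space)
  interpret N: finite_measure ?N by (rule N)
  interpret MN: pair_sigma_finite M ?N ..
  have spN: "space ?N = \<Gamma>" by (simp add: space_restrict_space)
  have setsN: "sets ?N = sets (restrict_space borel \<Gamma>)" by (simp add: sets_restrict_space)
  \<comment> \<open>The hypotheses restrict \<open>borel\<close>, integration needs
    \<open>lborel\<close>; the \<sigma>-fields are the same, so measurability carries over.\<close>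
  have PN: "sets (?P \<Otimes>\<^sub>M restrict_space borel \<Gamma>) = sets (?P \<Otimes>\<^sub>M ?N)"
    by (rule sets_pair_measure_cong[OF refl setsN[symmetric]])
  have G_pred: "(\<lambda>((\<omega>, s), x). G s \<omega> x) \<in> borel_measurable (?P \<Otimes>\<^sub>M ?N)"
    using i_G unfolding measurable_cong_sets[OF PN refl] .
  have HN: "(\<lambda>((\<omega>, s), x) k. H k s \<omega> x) \<in> ?P \<Otimes>\<^sub>M ?N \<rightarrow>\<^sub>M ell2_borel"
    using i_H unfolding measurable_cong_sets[OF PN refl] .
  have H_pred: "(\<lambda>((\<omega>, s), x). H k s \<omega> x) \<in> borel_measurable (?P \<Otimes>\<^sub>M ?N)" for k
    using measurable_compose[OF HN ell2_component[of k]] by (simp add: case_prod_beta')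
  have H_ell2: "(\<lambda>k. H k s \<omega> x) \<in> ell2" if "\<omega> \<in> space M" "x \<in> \<Gamma>" "0 < s" "s \<le> T" for \<omega> s x
    using measurable_space[OF HN, of "((\<omega>, s), x)"] that
    by (simp add: space_pair_measure space_predictable_upto spN space_ell2_borel)
  have H_cut: "(\<lambda>s. if 0 < s \<and> s \<le> T then H k s \<omega> x else 0) \<in> borel_measurable borel"
    if "\<omega> \<in> space M" "x \<in> \<Gamma>" for k \<omega> x
  proof -
    have "predX ?N (\<lambda>k s \<omega> x. if \<omega> \<in> space M \<and> 0 < s \<and> s \<le> T then H k s \<omega> x else 0)"
      by (rule restricted_predX[OF H_pred]) (use sets.top[of "\<F> 0"] in \<open>simp add: space_F\<close>)
    from predX_path[OF this that(1)] show ?thesis using that by (simp add: spN)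
  qed
  have sect: "f s \<omega> \<in> borel_measurable ?N"
    if f: "(\<lambda>((\<omega>, s), x). f s \<omega> x) \<in> borel_measurable (?P \<Otimes>\<^sub>M ?N)" and s: "\<omega> \<in> space M" "0 < s" "s \<le> T"
    for f :: "real \<Rightarrow> 'a \<Rightarrow> real ^ 'd \<Rightarrow> real" and s \<omega>
  proof -
    have "(\<omega>, s) \<in> space ?P" using s by (simp add: space_predictable_upto)
    from measurable_compose[OF measurable_Pair1'[OF this] f] show ?thesis by simp
  qed
  obtain \<Omega>' where \<Omega>': "\<Omega>' \<in> sets M" "emeasure M \<Omega>' = 1"
    and path: "\<And>\<omega> x. \<omega> \<in> \<Omega>' \<Longrightarrow> x \<in> \<Gamma> \<Longrightarrow>
      (\<integral>\<^sup>+t\<in>{0<..T}. ennreal (\<bar>G t \<omega> x\<bar> + (ell2_norm (\<lambda>k. H k t \<omega> x))\<^sup>2) \<partial>lborel) < \<infinity>"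
    using ii by blast
  have "AE \<omega> in M. \<omega> \<in> \<Omega>'" using \<Omega>' by (intro AE_prob_1) (simp add: measure_def)
  then have "AE \<omega> in M. \<omega> \<in> \<Omega>' \<and>
      (\<integral>\<^sup>+t\<in>{0<..T}. (\<integral>\<^sup>+x\<in>\<Gamma>. ennreal \<bar>G t \<omega> x\<bar> \<partial>lebesgue) \<partial>lborel)
        + (\<integral>\<^sup>+x\<in>\<Gamma>. ennreal (sqrt (LINT t:{0<..T}|lborel. (ell2_norm (\<lambda>k. H k t \<omega> x))\<^sup>2)) \<partial>lebesgue) < \<infinity>"
    using iii by eventually_elim blast
  \<comment> \<open>One measurable full event on which (ii) and (iii) hold together; the integrands
    will be cut off outside it.\<close>
  then obtain A where A: "A \<in> sets M" "AE \<omega> in M. \<omega> \<in> A" and A\<Omega>: "\<And>\<omega>. \<omega> \<in> A \<Longrightarrow> \<omega> \<in> \<Omega>' \<and>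
      (\<integral>\<^sup>+t\<in>{0<..T}. (\<integral>\<^sup>+x\<in>\<Gamma>. ennreal \<bar>G t \<omega> x\<bar> \<partial>lebesgue) \<partial>lborel)
        + (\<integral>\<^sup>+x\<in>\<Gamma>. ennreal (sqrt (LINT t:{0<..T}|lborel. (ell2_norm (\<lambda>k. H k t \<omega> x))\<^sup>2)) \<partial>lebesgue) < \<infinity>"
    by (rule AE_obtain_event) (rule that; assumption)
  have AM: "\<omega> \<in> space M" if "\<omega> \<in> A" for \<omega> using sets.sets_into_space[OF A(1)] that by blast
  have G_path: "(\<integral>\<^sup>+s\<in>{0<..T}. ennreal \<bar>G s \<omega> x\<bar> \<partial>lborel) < \<infinity>" if "\<omega> \<in> A" "x \<in> space ?N" for \<omega> x
  proof (rule le_less_trans[OF _ path[of \<omega> x]])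
    show "(\<integral>\<^sup>+s\<in>{0<..T}. ennreal \<bar>G s \<omega> x\<bar> \<partial>lborel)
        \<le> (\<integral>\<^sup>+t\<in>{0<..T}. ennreal (\<bar>G t \<omega> x\<bar> + (ell2_norm (\<lambda>k. H k t \<omega> x))\<^sup>2) \<partial>lborel)"
      by (intro nn_integral_mono mult_right_mono ennreal_leI) simp_all
  qed (use A\<Omega> that spN in simp_all)
  have H_path: "qv T (\<lambda>k s. H k s \<omega> x) < \<infinity>" if "\<omega> \<in> A" "x \<in> space ?N" for \<omega> x
  proof (rule le_less_trans[OF _ path[of \<omega> x]])
    have x: "x \<in> \<Gamma>" using that spN by simp
    have "qv T (\<lambda>k s. H k s \<omega> x) = (\<integral>\<^sup>+s\<in>{0<..T}. ennreal ((ell2_norm (\<lambda>k. H k s \<omega> x))\<^sup>2) \<partial>lborel)"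
      by (rule qv_ell2(1)[OF H_cut[OF AM[OF that(1)] x] H_ell2[OF AM[OF that(1)] x]])
    also have "\<dots> \<le> (\<integral>\<^sup>+t\<in>{0<..T}. ennreal (\<bar>G t \<omega> x\<bar> + (ell2_norm (\<lambda>k. H k t \<omega> x))\<^sup>2) \<partial>lborel)"
      by (intro nn_integral_mono mult_right_mono ennreal_leI) simp_all
    finally show "qv T (\<lambda>k s. H k s \<omega> x) \<le> (\<integral>\<^sup>+t\<in>{0<..T}. ennreal (\<bar>G t \<omega> x\<bar> + (ell2_norm (\<lambda>k. H k t \<omega> x))\<^sup>2) \<partial>lborel)" .
  qed (use A\<Omega> that spN in simp_all)
  have G_int: "(\<integral>\<^sup>+s\<in>{0<..T}. (\<integral>\<^sup>+x. ennreal \<bar>G s \<omega> x\<bar> \<partial>?N) \<partial>lborel) < \<infinity>" if "\<omega> \<in> A" for \<omega>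
    using A\<Omega>[OF that] by (simp add: nn_integral_lebesgue_on[OF \<Gamma>])
  have H_int: "phi ?N H T \<omega> < \<infinity>" if "\<omega> \<in> A" for \<omega>
  proof -
    have "phi ?N H T \<omega> = (\<integral>\<^sup>+x. ennreal (sqrt (LINT t:{0<..T}|lborel. (ell2_norm (\<lambda>k. H k t \<omega> x))\<^sup>2)) \<partial>?N)"
      unfolding phi_def
      by (intro nn_integral_cong arg_cong[where f = ennreal] qv_ell2(2) H_cut H_ell2 AM that) (simp_all add: spN)
    then show ?thesis using A\<Omega>[OF that] by (simp add: nn_integral_lebesgue_on[OF \<Gamma>])
  qed
  let ?g = "\<lambda>s \<omega>. LINT x:\<Gamma>|lebesgue. G s \<omega> x" and ?h = "\<lambda>k s \<omega>. LINT x:\<Gamma>|lebesgue. H k s \<omega> x"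
  have g: "?g s \<omega> = (\<integral>x. G s \<omega> x \<partial>?N)" if "\<omega> \<in> space M" "0 < s" "s \<le> T" for s \<omega>
    by (rule set_integral_lborel_on(2)[OF \<Gamma> sect[OF G_pred that]])
  have h: "?h k s \<omega> = (\<integral>x. H k s \<omega> x \<partial>?N)" if "\<omega> \<in> space M" "0 < s" "s \<le> T" for k s \<omega>
    by (rule set_integral_lborel_on(2)[OF \<Gamma> sect[OF H_pred that]])
  note facts = N G_pred H_pred A G_path H_path G_int H_int g h
  obtain Fa where
    Fm: "\<And>t. 0 \<le> t \<Longrightarrow> t \<le> T \<Longrightarrow> (\<lambda>z. Fa t (fst z) (snd z)) \<in> borel_measurable (M \<Otimes>\<^sub>M ?N)" and
    Fc: "\<And>\<omega> x. \<omega> \<in> space M \<Longrightarrow> x \<in> space ?N \<Longrightarrow> continuous_on {0..T} (\<lambda>t. Fa t \<omega> x)" and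
    Hser: "\<And>x. x \<in> space ?N \<Longrightarrow> ito_series_converges M \<F> W T (\<lambda>k s \<omega>. H k s \<omega> x)" and
    Fx: "\<And>x. x \<in> space ?N \<Longrightarrow> AE \<omega> in M. \<forall>t\<in>{0..T}.
      Fa t \<omega> x = (LINT s:{0<..t}|lborel. G s \<omega> x) + ito_series M \<F> W T (\<lambda>k s \<omega>. H k s \<omega> x) t \<omega>" and
    hser: "ito_series_converges M \<F> W T ?h" and
    Fsup: "AE \<omega> in M. (\<integral>\<^sup>+x. supn T (\<lambda>t. Fa t \<omega> x) \<partial>?N) < \<infinity>" and
    Fmean: "AE \<omega> in M. \<forall>t\<in>{0..T}. integrable ?N (Fa t \<omega>) \<and> (\<integral>x. Fa t \<omega> x \<partial>?N) =
      (LINT s:{0<..t}|lborel. ?g s \<omega>) + ito_series M \<F> W T ?h t \<omega>"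
    by (rule fubini_solution[OF facts]; (assumption | (rule that; assumption)))
  have a: "(\<lambda>((\<omega>, t), x). Fa t \<omega> x)
      \<in> borel_measurable ((M \<Otimes>\<^sub>M restrict_space borel {0..T}) \<Otimes>\<^sub>M restrict_space borel \<Gamma>)"
  proof -
    have jm: "(\<lambda>z. Fa (snd z) (fst (fst z)) (snd (fst z))) \<in> borel_measurable ((M \<Otimes>\<^sub>M ?N) \<Otimes>\<^sub>M restrict_space borel {0..T})"
    proof (rule continuous_jointly_measurable[OF \<open>0 \<le> T\<close> Fm])
      fix z assume "z \<in> space (M \<Otimes>\<^sub>M ?N)"
      then have "fst z \<in> space M" "snd z \<in> space ?N" by (auto simp: space_pair_measure)
      then show "continuous_on {0..T} (\<lambda>t. Fa t (fst z) (snd z))" by (rule Fc)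
    qed
    have "(\<lambda>z. ((fst (fst z), snd z), snd (fst z))) \<in>
        (M \<Otimes>\<^sub>M restrict_space borel {0..T}) \<Otimes>\<^sub>M ?N \<rightarrow>\<^sub>M (M \<Otimes>\<^sub>M ?N) \<Otimes>\<^sub>M restrict_space borel {0..T}"
      by measurable
    from measurable_compose[OF this jm]
    have "(\<lambda>((\<omega>, t), x). Fa t \<omega> x) \<in> borel_measurable ((M \<Otimes>\<^sub>M restrict_space borel {0..T}) \<Otimes>\<^sub>M ?N)"
      by (simp add: case_prod_beta')
    then show ?thesis
      unfolding measurable_cong_sets[OF sets_pair_measure_cong[OF refl setsN] refl] .
  qed
  \<comment> \<open>At fixed t and x both functions equal the same right hand side almost surely.
    \<open>AE_eq_commute\<close> makes this equality at almost all x for almost every \<omega>; the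
    exceptional event still depends on t, hence the countable unions that follow.\<close>
  have eqF: "AE \<omega> in M. AE x in ?N. F t \<omega> x = Fa t \<omega> x"
    if F: "solves_pointwise M \<F> w T \<Gamma> G H F" and t: "t \<in> {0..T}" for F t
  proof (rule MN.AE_eq_commute)
    show "(\<lambda>(\<omega>, x). F t \<omega> x) \<in> borel_measurable (completion (M \<Otimes>\<^sub>M ?N))"
      using F t unfolding solves_pointwise_def by blast
    show "(\<lambda>z. Fa t (fst z) (snd z)) \<in> borel_measurable (M \<Otimes>\<^sub>M ?N)" using t by (intro Fm) simp_all
    fix x assume x: "x \<in> space ?N"
    have "AE \<omega> in M. F t \<omega> x = (LINT s:{0<..t}|lborel. G s \<omega> x) + ito_series M \<F> W T (\<lambda>k s \<omega>. H k s \<omega> x) t \<omega>"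
      using F t x unfolding solves_pointwise_def mod(3) spN by blast
    then show "AE \<omega> in M. F t \<omega> x = Fa t \<omega> x"
      using Fx[OF x] by eventually_elim (use t in simp)
  qed
  have eqF_countable: "AE \<omega> in M. AE x in ?N. \<forall>t\<in>\<rho>. F t \<omega> x = Fa t \<omega> x"
    if F: "solves_pointwise M \<F> w T \<Gamma> G H F" and \<rho>: "countable \<rho>" "\<rho> \<subseteq> {0..T}" for F \<rho>
  proof -
    have "AE \<omega> in M. \<forall>t\<in>\<rho>. AE x in ?N. F t \<omega> x = Fa t \<omega> x"
      using \<rho> eqF[OF F] by (subst AE_ball_countable) auto
    then show ?thesis by eventually_elim (simp add: AE_ball_countable[OF \<rho>(1)])
  qed
  have csup: "AE \<omega> in M.
      (\<lambda>x. \<Squnion>t\<in>\<rho>. ennreal \<bar>F t \<omega> x\<bar>) \<in> borel_measurable (lebesgue_on \<Gamma>) \<and>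
      (\<integral>\<^sup>+x\<in>\<Gamma>. (\<Squnion>t\<in>\<rho>. ennreal \<bar>F t \<omega> x\<bar>) \<partial>lebesgue) < \<infinity>"
    if F: "solves_pointwise M \<F> w T \<Gamma> G H F" and \<rho>: "countable \<rho>" "\<rho> \<subseteq> {0..T}" for F \<rho>
    using eqF_countable[OF that] Fsup AE_space
  proof eventually_elim
    case (elim \<omega>)
    let ?s = "\<lambda>F x. \<Squnion>t\<in>\<rho>. ennreal \<bar>F t \<omega> x\<bar>"
    have eq: "AE x in ?N. ?s F x = ?s Fa x" using elim(1) by eventually_elim (auto intro: SUP_cong)
    have "(\<lambda>x. ennreal \<bar>Fa t \<omega> x\<bar>) \<in> borel_measurable ?N" if "t \<in> \<rho>" for t
    proof -
      have "0 \<le> t" "t \<le> T" using that \<rho>(2) by auto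
      note Fm[OF this, measurable]
      have [measurable]: "Fa t \<omega> \<in> borel_measurable ?N"
        using measurable_compose[OF measurable_Pair1'[OF elim(3)] Fm[OF \<open>0 \<le> t\<close> \<open>t \<le> T\<close>]] by simp
      show ?thesis by measurable
    qed
    then have m: "?s Fa \<in> borel_measurable ?N" by (intro borel_measurable_SUP \<rho>(1))
    have "(\<integral>\<^sup>+x. ?s F x \<partial>?N) = (\<integral>\<^sup>+x. ?s Fa x \<partial>?N)" by (rule nn_integral_cong_AE[OF eq])
    also have "\<dots> \<le> (\<integral>\<^sup>+x. supn T (\<lambda>t. Fa t \<omega> x) \<partial>?N)"
      unfolding supn_def by (intro nn_integral_mono SUP_subset_mono \<rho>(2)) simp
    also have "\<dots> < \<infinity>" by (rule elim(2))
    finally have "(\<integral>\<^sup>+x\<in>\<Gamma>. ?s F x \<partial>lebesgue) < \<infinity>" by (simp only: nn_integral_lebesgue_on[OF \<Gamma>])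
    moreover have "?s F \<in> borel_measurable (lebesgue_on \<Gamma>)"
      by (rule complete_measure.borel_measurable_AE_cong[OF complete_lebesgue_on[OF \<Gamma>]
            measurable_lebesgue_on[OF \<Gamma> m] AE_lebesgue_on[OF \<Gamma> eq]])
    ultimately show ?case by blast
  qed
  have ct: "AE \<omega> in M. set_integrable lebesgue \<Gamma> (F t \<omega>) \<and>
      (LINT x:\<Gamma>|lebesgue. F t \<omega> x) = (LINT s:{0<..t}|lborel. ?g s \<omega>) + ito_series M \<F> w T ?h t \<omega>"
    if F: "solves_pointwise M \<F> w T \<Gamma> G H F" and t: "t \<in> {0..T}" for F t
    using eqF[OF that] Fmean
  proof eventually_elim
    case (elim \<omega>)
    then have "integrable ?N (Fa t \<omega>)" "(\<integral>x. Fa t \<omega> x \<partial>?N) = (LINT s:{0<..t}|lborel. ?g s \<omega>) + ito_series M \<F> W T ?h t \<omega>"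
      using t by blast+
    with set_integral_AE_lborel_on[OF \<Gamma> this(1) elim(1)] show ?case unfolding mod(3) by simp
  qed
  have d: "AE \<omega> in M. \<forall>t\<in>{0..T}. set_integrable lebesgue \<Gamma> (F t \<omega>) \<and>
      (LINT x:\<Gamma>|lebesgue. F t \<omega> x) = (LINT s:{0<..t}|lborel. ?g s \<omega>) + ito_series M \<F> w T ?h t \<omega>"
    if F: "solves_pointwise M \<F> w T \<Gamma> G H F"
      and c: "AE (\<omega>, x) in M \<Otimes>\<^sub>M ?N. continuous_on {0..T} (\<lambda>t. F t \<omega> x)" for F
  proof -
    \<comment> \<open>On a countable dense set of times the exceptional events can be united.
      Continuity of both functions then extends the equality to [0, T], so that one null event
      serves all t.\<close>
    obtain D where D: "countable D" "D \<subseteq> {0..T}" "{0..T} \<subseteq> closure D" by (rule separable)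
    have "AE \<omega> in M. AE x in ?N. continuous_on {0..T} (\<lambda>t. F t \<omega> x)"
      using MN.AE_pair[OF c] by simp
    then show ?thesis using eqF_countable[OF F D(1,2)] Fmean AE_space
    proof eventually_elim
      case (elim \<omega>)
      have eq: "AE x in ?N. \<forall>t\<in>{0..T}. F t \<omega> x = Fa t \<omega> x"
        using elim(1,2) AE_space
      proof eventually_elim
        case (elim x)
        have "supn T (\<lambda>t. F t \<omega> x - Fa t \<omega> x) = (\<Squnion>t\<in>D. ennreal \<bar>F t \<omega> x - Fa t \<omega> x\<bar>)"
          by (rule supn_dense[OF continuous_on_diff[OF elim(1) Fc[OF \<open>\<omega> \<in> space M\<close> elim(3)]] D(2,3)])
        also have "\<dots> = (\<Squnion>t\<in>D. 0)" by (rule SUP_cong) (use elim(2) in auto)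
        also have "\<dots> \<le> 0" by (rule SUP_least) simp
        finally have "supn T (\<lambda>t. F t \<omega> x - Fa t \<omega> x) = 0" by simp
        then show ?case using \<open>0 \<le> T\<close> by (simp add: supn_eq_0)
      qed
      show ?case
      proof
        fix t assume t: "t \<in> {0..T}"
        then have "integrable ?N (Fa t \<omega>)" "(\<integral>x. Fa t \<omega> x \<partial>?N) = (LINT s:{0<..t}|lborel. ?g s \<omega>) + ito_series M \<F> W T ?h t \<omega>"
          using elim(3) by blast+
        moreover have "AE x in ?N. F t \<omega> x = Fa t \<omega> x" using eq by eventually_elim (use t in blast)
        ultimately show "set_integrable lebesgue \<Gamma> (F t \<omega>) \<and>
            (LINT x:\<Gamma>|lebesgue. F t \<omega> x) = (LINT s:{0<..t}|lborel. ?g s \<omega>) + ito_series M \<F> w T ?h t \<omega>"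
          using set_integral_AE_lborel_on[OF \<Gamma>] unfolding mod(3) by simp
      qed
    qed
  qed
  have b: "AE \<omega> in M. AE s in lborel. s \<in> {0<..T} \<longrightarrow> set_integrable lebesgue \<Gamma> (H k s \<omega>)" for k
    using A(2)
  proof eventually_elim
    case (elim \<omega>)
    have "AE s in lborel. s \<in> {0<..T} \<longrightarrow> integrable ?N (H k s \<omega>)"
      by (rule H_mean_integrable[OF facts elim])
    then show ?case
    proof eventually_elim
      case (elim s)
      then show ?case using set_integral_lborel_on(1)[OF \<Gamma> sect[OF H_pred AM[OF \<open>\<omega> \<in> A\<close>]], of s k] by simp
    qed
  qed
  have b': "ito_integrable M \<F> (w k) T (?h k)" for k
    using hser unfolding ito_series_converges_def mod(1) by blast
  have a': "\<forall>\<omega>\<in>space M. \<forall>x\<in>\<Gamma>. continuous_on {0..T} (\<lambda>t. Fa t \<omega> x)"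
    using Fc spN by simp
  have a'': "\<forall>x\<in>\<Gamma>. ito_series_converges M \<F> w T (\<lambda>k s \<omega>. H k s \<omega> x) \<and>
      (AE \<omega> in M. \<forall>t\<in>{0..T}. Fa t \<omega> x = (LINT s:{0<..t}|lborel. G s \<omega> x)
        + ito_series M \<F> w T (\<lambda>k s \<omega>. H k s \<omega> x) t \<omega>)"
    unfolding mod(2,3) using Hser Fx by (simp only: spN) blast
  have c': "ito_series_converges M \<F> w T ?h" using hser unfolding mod(2) .
  show ?thesis
    by (intro conjI exI[of _ Fa] allI impI ballI a a' a''[THEN bspec] a'[THEN bspec, THEN bspec] b b' csup ct c' d)
      (auto elim: conjE)
qed

end
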